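(* Let $d\le p$ be positive integers. Suppose $A\subset\mathbb{R}^p$ is a compact subset of a $d$-dimensional $C^1$ manifold with $\mathcal{H}_d(\partial A)=0$ (boundary relative to the manifold), and $w\in C(A\times A)$ is a nonnegative function with $w(x,x)>0$ for all $x\in A$. Then for every $s\ge d$, $$\lim_{N\to\infty}\frac{\mathcal{P}^w_s(A;N)}{\tau_{s,d}(N)}=\frac{\sigma_{s,d}}{[\mathcal{H}^{s,w}_d(A)]^{s/d}},$$ where for measurable $B\subset\mathbb{R}^p$, $\mathcal{H}^{s,w}_d(B):=\int_{B\cap A}w(x,x)^{-d/s}\,d\mathcal{H}_d(x)$. Moreover, if $\mathcal{H}_d(A)>0$, then for every asymptotically $(s,w)$-optimal sequence $\{\omega_N\}_{N\ge1}$ of $N$-point configurations in $A$, $$\nu(\omega_N)\xrightarrow{\ast}\frac{1}{\mathcal{H}^{s,w}_d(A)}\,\mathcal{H}^{s,w}_d\quad\text{as }N\to\infty.$$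
   Context: An $N$-point configuration $\omega_N=\{x_1,\dots,x_N\}\subset A$ is a multiset of $N$ points of $A$. For a weight $w:A\times A\to[0,\infty]$, $s>0$ and $B\subset A$: $U^w_s(y;\omega_N):=\sum_{j=1}^N w(y,x_j)|y-x_j|^{-s}$, $P^w_s(B;\omega_N):=\inf_{y\in B}U^w_s(y;\omega_N)$, and $\mathcal{P}^w_s(A;N):=\sup_{\omega_N\subset A}P^w_s(A;\omega_N)$. A sequence $\{\omega_N\}$ is asymptotically $(s,w)$-optimal if $\lim_{N\to\infty}P^w_s(A;\omega_N)/\mathcal{P}^w_s(A;N)=1$. $\tau_{s,d}(N):=N^{s/d}$ if $s>d$ and $\tau_{d,d}(N):=N\log N$. $\sigma_{s,d}$ for $s>d$ is $\lim_{N\to\infty}\mathcal{P}_s([0,1]^d;N)/N^{s/d}$ (with $w\equiv1$; this limit exists and is positive and finite), and $\sigma_{d,d}:=\mathrm{Vol}(\mathbb{B}^d)$, the volume of the unit ball in $\mathbb{R}^d$. $\mathcal{H}_d$ is $d$-dimensional Hausdorff measure normalized so that a $d$-dimensional unit cube has measure $1$. $\nu(\omega_N):=\frac1N\sum_{x\in\omega_N}\delta_x$. *)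

theory Defs
  imports "HOL-Analysis.Analysis" "HOL-Library.Multiset"
begin

text \<open>Normalisation constant: volume of a ball of diameter 1 in R^d, so that a
  d-dimensional unit cube has measure 1.\<close>
definition hausdorff_const :: "nat \<Rightarrow> real" where
  "hausdorff_const d = unit_ball_vol (real d) / 2 ^ d"

definition hausdorff_pre :: "nat \<Rightarrow> real \<Rightarrow> 'a::euclidean_space set \<Rightarrow> ennreal" where
  "hausdorff_pre d \<delta> E =
     (INF U \<in> {U :: nat \<Rightarrow> 'a set. E \<subseteq> \<Union>(range U) \<and>
                   (\<forall>i. bounded (U i) \<and> diameter (U i) \<le> \<delta>)}.
        (\<Sum>i. ennreal (hausdorff_const d * diameter (U i) ^ d)))"

definition hausdorff_outer :: "nat \<Rightarrow> 'a::euclidean_space set \<Rightarrow> ennreal" where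
  "hausdorff_outer d E = (SUP \<delta> \<in> {0<..}. hausdorff_pre d \<delta> E)"

text \<open>H_d as a measure on the Borel sets (where the Hausdorff outer measure is
  countably additive).\<close>
definition hausdorff_measure :: "nat \<Rightarrow> 'a::euclidean_space measure" where
  "hausdorff_measure d = measure_of UNIV (sets borel) (hausdorff_outer d)"

definition coord_dirs :: "nat \<Rightarrow> 'a::euclidean_space set" where
  "coord_dirs d = (SOME D. D \<subseteq> Basis \<and> card D = d)"

text \<open>The coordinate d-plane (a copy of R^d inside the ambient space).\<close>
definition coord_plane :: "nat \<Rightarrow> 'a::euclidean_space set" where
  "coord_plane d = {x. \<forall>b\<in>Basis - coord_dirs d. x \<bullet> b = 0}"

definition unit_cube :: "nat \<Rightarrow> 'a::euclidean_space set" where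
  "unit_cube d = {x \<in> coord_plane d. \<forall>b\<in>coord_dirs d. 0 \<le> x \<bullet> b \<and> x \<bullet> b \<le> 1}"

definition C1_submanifold :: "nat \<Rightarrow> 'a::euclidean_space set \<Rightarrow> bool" where
  "C1_submanifold d M \<longleftrightarrow>
     (\<forall>x\<in>M. \<exists>U V \<phi> \<psi> (\<phi>' :: 'a \<Rightarrow> 'a \<Rightarrow>\<^sub>L 'a).
        open U \<and> x \<in> U \<and> openin (top_of_set (coord_plane d)) V \<and>
        homeomorphism V (M \<inter> U) \<phi> \<psi> \<and>
        (\<forall>v\<in>V. (\<phi> has_derivative blinfun_apply (\<phi>' v)) (at v within V) \<and>
                inj_on (blinfun_apply (\<phi>' v)) (coord_plane d)) \<and>
        continuous_on V \<phi>')"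

definition riesz_pot :: "('a::euclidean_space \<Rightarrow> 'a \<Rightarrow> real) \<Rightarrow> real \<Rightarrow> 'a \<Rightarrow> 'a multiset \<Rightarrow> ennreal" where
  "riesz_pot w s y \<omega> =
     (\<Sum>x\<in>#\<omega>. ennreal (w y x) * (if y = x then \<infinity> else ennreal (dist y x powr (- s))))"

definition polar :: "'a::euclidean_space set \<Rightarrow> ('a \<Rightarrow> 'a \<Rightarrow> real) \<Rightarrow> real \<Rightarrow> 'a multiset \<Rightarrow> ennreal" where
  "polar B w s \<omega> = (INF y \<in> B. riesz_pot w s y \<omega>)"

definition configs :: "'a set \<Rightarrow> nat \<Rightarrow> 'a multiset set" where
  "configs A N = {\<omega>. size \<omega> = N \<and> set_mset \<omega> \<subseteq> A}"

definition polar_max :: "'a::euclidean_space set \<Rightarrow> ('a \<Rightarrow> 'a \<Rightarrow> real) \<Rightarrow> real \<Rightarrow> nat \<Rightarrow> ennreal" where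
  "polar_max A w s N = (SUP \<omega> \<in> configs A N. polar A w s \<omega>)"

definition asympt_optimal ::
  "'a::euclidean_space set \<Rightarrow> ('a \<Rightarrow> 'a \<Rightarrow> real) \<Rightarrow> real \<Rightarrow> (nat \<Rightarrow> 'a multiset) \<Rightarrow> bool" where
  "asympt_optimal A w s \<omega> \<longleftrightarrow>
     (\<forall>N\<ge>1. \<omega> N \<in> configs A N) \<and>
     ((\<lambda>N. polar A w s (\<omega> N) / polar_max A w s N) \<longlonglongrightarrow> 1)"

definition tau :: "real \<Rightarrow> nat \<Rightarrow> nat \<Rightarrow> real" where
  "tau s d N = (if s = real d then real N * ln (real N) else real N powr (s / real d))"

text \<open>sigma_{s,d}; the unit cube is realised isometrically inside the ambient type.\<close>
definition sigma_sd :: "real \<Rightarrow> nat \<Rightarrow> 'a::euclidean_space itself \<Rightarrow> ennreal" where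
  "sigma_sd s d _ = (if s = real d then ennreal (unit_ball_vol (real d))
     else lim (\<lambda>N. polar_max (unit_cube d :: 'a set) (\<lambda>_ _. 1) s N / ennreal (real N powr (s / real d))))"

definition Hsw :: "nat \<Rightarrow> real \<Rightarrow> ('a::euclidean_space \<Rightarrow> 'a \<Rightarrow> real) \<Rightarrow> 'a set \<Rightarrow> 'a set \<Rightarrow> ennreal" where
  "Hsw d s w A B = (\<integral>\<^sup>+ x \<in> B \<inter> A. ennreal (w x x powr (- real d / s)) \<partial>hausdorff_measure d)"

definition ennpow :: "ennreal \<Rightarrow> real \<Rightarrow> ennreal" where
  "ennpow x r = (if x = \<infinity> then \<infinity> else ennreal (enn2real x powr r))"

end

(* Every C^1 manifold is, at small scales, bi-Lipschitz to R^d with constant close to 1, so A splits up to small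
   measure into finitely many nearly isometric images of small cubes on which w is nearly constant.  Polarization
   adds up over such pieces: serving the pieces with separate point sets bounds the polarization from below, and
   for the upper bound the points outside a piece contribute only O(N) = o(tau(N)) at points well inside it.  Each
   piece is thus compared with the unweighted cube.  A set of measure m with weight c behaves like a cube of volume
   m c^(-d/s); the upper bound in fact bounds from below the number of points in each piece, which yields both the
   constant and the weak-star limit.  The cube itself is treated by self-similarity for s > d; for s = d an averaging
   argument and an explicit grid give the volume of the unit ball.  That the Hausdorff measure normalized by balls
   gives the unit cube measure 1 rests on the isodiametric inequality, here obtained from a Prekopa-Leindler
   argument. *)

theory Submission
  imports Defs "HOL-Real_Asymp.Real_Asymp"
begin

section \<open>Hausdorff measure\<close>

text \<open>Why volumes add: a piece that behaves like a flat cube of volume v and is served by n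
  points has potential about \<sigma> v powr (-\<gamma>) tau(n), where \<gamma> = s / d. Sharing N
  points among pieces in proportion to their volumes equalizes these potentials, and the common
  value is the one belonging to the total volume. The two bounds treat the part of A that escapes
  the patches differently. From below, the infimum runs over all of A, so even a remainder of tiny
  measure has to be served; a crude constant, uniform over compact subsets of A, shows that this
  costs a volume proportional to its measure. From above, the remainder may be ignored, since only
  points inside patches are counted; these counts are then tested against positive continuous
  functions. A further obstacle is that the number n of points in a patch is not known beforehand,
  so the cube estimate has to hold uniformly for all n \<le> N, with an error small against
  tau(N).\<close>

lemma hausdorff_const_nonneg [simp]: "0 \<le> hausdorff_const d"
  by (simp add: hausdorff_const_def)

lemma hausdorff_pre_le:
  assumes "E \<subseteq> \<Union>(range U)" "\<And>i. bounded (U i)" "\<And>i. diameter (U i) \<le> \<delta>"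
  shows "hausdorff_pre d \<delta> E \<le> (\<Sum>i. ennreal (hausdorff_const d * diameter (U i) ^ d))"
  unfolding hausdorff_pre_def using assms by (intro INF_lower) auto

lemma hausdorff_pre_greatest:
  assumes "\<And>U. E \<subseteq> \<Union>(range U) \<Longrightarrow> (\<And>i. bounded (U i)) \<Longrightarrow> (\<And>i. diameter (U i) \<le> \<delta>) \<Longrightarrow>
    c \<le> (\<Sum>i. ennreal (hausdorff_const d * diameter (U i) ^ d))"
  shows "c \<le> hausdorff_pre d \<delta> E"
  unfolding hausdorff_pre_def using assms by (intro INF_greatest) auto

lemma hausdorff_pre_close:
  assumes "hausdorff_pre d \<delta> E \<noteq> \<infinity>" "0 < e"
  shows "\<exists>U. E \<subseteq> \<Union>(range U) \<and> (\<forall>i. bounded (U i) \<and> diameter (U i) \<le> \<delta>) \<and>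
     (\<Sum>i. ennreal (hausdorff_const d * diameter (U i) ^ d)) \<le> hausdorff_pre d \<delta> E + e"
proof (rule ccontr)
  assume neg: "\<not> ?thesis"
  have "hausdorff_pre d \<delta> E + e \<le> hausdorff_pre d \<delta> E"
    by (rule hausdorff_pre_greatest) (use neg in \<open>metis linear\<close>)
  moreover have "hausdorff_pre d \<delta> E < hausdorff_pre d \<delta> E + e"
    using assms ennreal_add_left_cancel_less[of "hausdorff_pre d \<delta> E" 0 e] by simp
  ultimately show False by simp
qed

lemma hausdorff_pre_mono: "E \<subseteq> F \<Longrightarrow> hausdorff_pre d \<delta> E \<le> hausdorff_pre d \<delta> F"
  by (rule hausdorff_pre_greatest, rule hausdorff_pre_le) auto

lemma hausdorff_pre_antimono: "\<delta> \<le> \<delta>' \<Longrightarrow> hausdorff_pre d \<delta>' E \<le> hausdorff_pre d \<delta> E"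
  by (rule hausdorff_pre_greatest, rule hausdorff_pre_le) (auto intro: order_trans)

text \<open>With \<open>1 \<le> d\<close> an empty member of a cover costs \<open>0 ^ d = 0\<close>,
  so finite covers can be padded to sequences; for \<open>d = 0\<close> each one would cost
  \<open>hausdorff_const 0\<close>.\<close>

lemma hausdorff_pre_empty: "1 \<le> d \<Longrightarrow> 0 \<le> \<delta> \<Longrightarrow> hausdorff_pre d \<delta> {} = 0"
  using hausdorff_pre_le[of "{}" "\<lambda>_. {}" \<delta> d] by (simp add: power_0_left)

lemma hausdorff_pre_UN_le:
  "hausdorff_pre d \<delta> (\<Union>n::nat. E n) \<le> (\<Sum>n. hausdorff_pre d \<delta> (E n))"
proof (rule ennreal_le_epsilon)
  fix e :: real assume fin: "(\<Sum>n. hausdorff_pre d \<delta> (E n)) < top" and e: "0 < e"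
  have "hausdorff_pre d \<delta> (E n) \<noteq> \<infinity>" for n
    using fin by (metis ennreal_suminf_lessD infinity_ennreal_def less_irrefl)
  then have "\<exists>U. E n \<subseteq> \<Union>(range U) \<and> (\<forall>i. bounded (U i) \<and> diameter (U i) \<le> \<delta>) \<and>
     (\<Sum>i. ennreal (hausdorff_const d * diameter (U i) ^ d)) \<le> hausdorff_pre d \<delta> (E n) + ennreal (e * (1/2)^Suc n)" for n
    using e by (intro hausdorff_pre_close) auto
  then obtain U where U: "\<And>n. E n \<subseteq> \<Union>(range (U n))" "\<And>n i. bounded (U n i)" "\<And>n i. diameter (U n i) \<le> \<delta>"
     "\<And>n. (\<Sum>i. ennreal (hausdorff_const d * diameter (U n i) ^ d)) \<le> hausdorff_pre d \<delta> (E n) + ennreal (e * (1/2)^Suc n)"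
    by metis
  \<comment> \<open>The double sequence of covers is enumerated as one sequence; the tolerances
    \<open>e * (1/2)^Suc n\<close> add up to \<open>e\<close>.\<close>
  let ?V = "\<lambda>k. case_prod U (prod_decode k)"
  let ?f = "\<lambda>p. ennreal (hausdorff_const d * diameter (case_prod U p) ^ d)"
  have "(\<Union>n. E n) \<subseteq> \<Union>(range ?V)"
  proof
    fix x assume "x \<in> (\<Union>n. E n)"
    then obtain n i where "x \<in> U n i" using U(1) by blast
    then have "x \<in> ?V (prod_encode (n, i))" by simp
    then show "x \<in> \<Union>(range ?V)" by (rule UnionI[OF rangeI])
  qed
  then have "hausdorff_pre d \<delta> (\<Union>n. E n) \<le> (\<Sum>k. ?f (prod_decode k))"
    using U(2,3) by (intro hausdorff_pre_le) (auto split: prod.split)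
  also have "\<dots> = (\<Sum>n. \<Sum>i. ?f (n, i))"
    using suminf_ennreal_2dimen[of "\<lambda>n. \<Sum>i. ?f (n, i)" ?f] by (simp add: comp_def)
  also have "\<dots> \<le> (\<Sum>n. hausdorff_pre d \<delta> (E n) + ennreal (e * (1/2)^Suc n))"
    using U(4) by (intro suminf_le) auto
  also have "\<dots> = (\<Sum>n. hausdorff_pre d \<delta> (E n)) + (\<Sum>n. ennreal (e * (1/2)^Suc n))"
    by (intro suminf_add[symmetric]) auto
  also have "(\<Sum>n. ennreal (e * (1/2)^Suc n)) = ennreal e"
  proof -
    have "(\<lambda>n. e * (1/2)^Suc n) sums (e * 1)"
      by (intro sums_mult power_half_series)
    then have "(\<Sum>n. ennreal (e * (1/2)^Suc n)) = ennreal (e * 1)"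
      using e by (intro suminf_ennreal_eq) auto
    then show ?thesis by simp
  qed
  finally show "hausdorff_pre d \<delta> (\<Union>n. E n) \<le> (\<Sum>n. hausdorff_pre d \<delta> (E n)) + ennreal e" .
qed

lemma hausdorff_pre_le_outer: "0 < \<delta> \<Longrightarrow> hausdorff_pre d \<delta> E \<le> hausdorff_outer d E"
  unfolding hausdorff_outer_def by (intro SUP_upper) auto

lemma hausdorff_outer_least:
  "(\<And>\<delta>. 0 < \<delta> \<Longrightarrow> hausdorff_pre d \<delta> E \<le> c) \<Longrightarrow> hausdorff_outer d E \<le> c"
  unfolding hausdorff_outer_def by (intro SUP_least) auto

lemma hausdorff_outer_mono: "E \<subseteq> F \<Longrightarrow> hausdorff_outer d E \<le> hausdorff_outer d F"
  by (meson hausdorff_outer_least hausdorff_pre_le_outer hausdorff_pre_mono order_trans)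

lemma hausdorff_outer_empty:
  assumes "1 \<le> d" shows "hausdorff_outer d {} = 0"
proof -
  have "hausdorff_outer d {} \<le> 0"
    by (rule hausdorff_outer_least) (simp add: hausdorff_pre_empty[OF assms])
  then show ?thesis by simp
qed

lemma hausdorff_outer_UN_le:
  "hausdorff_outer d (\<Union>n::nat. E n) \<le> (\<Sum>n. hausdorff_outer d (E n))"
proof (rule hausdorff_outer_least)
  fix \<delta> :: real assume \<delta>: "0 < \<delta>"
  have "hausdorff_pre d \<delta> (\<Union>n. E n) \<le> (\<Sum>n. hausdorff_pre d \<delta> (E n))"
    by (rule hausdorff_pre_UN_le)
  also have "\<dots> \<le> (\<Sum>n. hausdorff_outer d (E n))"
    using \<delta> by (intro suminf_le hausdorff_pre_le_outer) auto
  finally show "hausdorff_pre d \<delta> (\<Union>n. E n) \<le> (\<Sum>n. hausdorff_outer d (E n))" .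
qed

section \<open>From the Hausdorff outer measure to a measure on Borel sets\<close>

lemma suminf_binary_ennreal:
  "f 0 = a \<Longrightarrow> f (Suc 0) = b \<Longrightarrow> (\<And>n. 2 \<le> n \<Longrightarrow> f n = 0) \<Longrightarrow> (\<Sum>n. f n) = (a + b :: ennreal)"
  using suminf_finite[of "{0, Suc 0}" f] by (auto simp: numeral_2_eq_2 not_less_eq_eq le_Suc_eq)

lemma outer_measure_space_hausdorff:
  assumes "1 \<le> d" shows "outer_measure_space (Pow UNIV) (hausdorff_outer d :: 'a::euclidean_space set \<Rightarrow> ennreal)"
  unfolding outer_measure_space_def positive_def increasing_def countably_subadditive_def
  using hausdorff_outer_empty[OF assms] hausdorff_outer_mono hausdorff_outer_UN_le by auto

lemma hausdorff_outer_Un_le: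
  assumes "1 \<le> d" shows "hausdorff_outer d (E \<union> F) \<le> hausdorff_outer d E + hausdorff_outer d F"
proof -
  let ?G = "\<lambda>n::nat. if n = 0 then E else if n = 1 then F else {}"
  have "(\<Union>n. ?G n) = E \<union> F" by (auto split: if_splits)
  then have "hausdorff_outer d (E \<union> F) \<le> (\<Sum>n. hausdorff_outer d (?G n))"
    using hausdorff_outer_UN_le[of d ?G] by simp
  also have "\<dots> = hausdorff_outer d E + hausdorff_outer d F"
    by (rule suminf_binary_ennreal) (auto simp: hausdorff_outer_empty[OF assms])
  finally show ?thesis .
qed

text \<open>A set of diameter at most \<open>\<delta> < \<rho>\<close> cannot meet both
  \<open>E\<close> and \<open>F\<close>, so every admissible cover of the union splits into a cover
  of each.\<close>

lemma hausdorff_pre_separated: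
  assumes d: "1 \<le> d" and sep: "\<And>x y. x \<in> E \<Longrightarrow> y \<in> F \<Longrightarrow> \<rho> \<le> dist x y" and \<delta>: "0 < \<delta>" "\<delta> < \<rho>"
  shows "hausdorff_pre d \<delta> E + hausdorff_pre d \<delta> F \<le> hausdorff_pre d \<delta> (E \<union> F)"
proof (rule hausdorff_pre_greatest)
  fix U :: "nat \<Rightarrow> 'a set"
  assume cov: "E \<union> F \<subseteq> \<Union>(range U)" and bd: "\<And>i. bounded (U i)" and dm: "\<And>i. diameter (U i) \<le> \<delta>"
  let ?c = "\<lambda>S. ennreal (hausdorff_const d * diameter S ^ d)"
  have mono: "?c (U i \<inter> S) \<le> ?c (U i)" for i S
    using bd by (intro ennreal_leI mult_left_mono power_mono diameter_subset diameter_ge_0)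
       (auto intro: bounded_subset)
  have one: "?c (U i \<inter> E) + ?c (U i \<inter> F) \<le> ?c (U i)" for i
  proof (cases "U i \<inter> E = {} \<or> U i \<inter> F = {}")
    case True
    then show ?thesis using mono[of i E] mono[of i F] d by (auto simp: power_0_left)
  next
    case False
    then obtain x y where "x \<in> U i" "x \<in> E" "y \<in> U i" "y \<in> F" by auto
    then have "\<rho> \<le> \<delta>" using sep dm[of i] diameter_bounded_bound[OF bd, of x i y] by force
    then show ?thesis using \<delta> by simp
  qed
  have "hausdorff_pre d \<delta> E + hausdorff_pre d \<delta> F \<le> (\<Sum>i. ?c (U i \<inter> E)) + (\<Sum>i. ?c (U i \<inter> F))"
    using cov bd order_trans[OF diameter_subset[OF Int_lower1 bd] dm]
    by (intro add_mono hausdorff_pre_le) (auto intro: bounded_subset)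
  also have "\<dots> = (\<Sum>i. ?c (U i \<inter> E) + ?c (U i \<inter> F))" by (intro suminf_add) auto
  also have "\<dots> \<le> (\<Sum>i. ?c (U i))" using one by (intro suminf_le) auto
  finally show "hausdorff_pre d \<delta> E + hausdorff_pre d \<delta> F \<le> (\<Sum>i. ?c (U i))" .
qed

text \<open>A scale below \<open>\<delta>1\<close>, \<open>\<delta>2\<close> and
  \<open>\<rho>\<close> serves both sets at once, so the two suprema over scales can be taken one
  after the other.\<close>

lemma hausdorff_outer_separated:
  assumes d: "1 \<le> d" and sep: "\<And>x y. x \<in> E \<Longrightarrow> y \<in> F \<Longrightarrow> \<rho> \<le> dist x y" and \<rho>: "0 < \<rho>"
  shows "hausdorff_outer d E + hausdorff_outer d F \<le> hausdorff_outer d (E \<union> F)"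
proof -
  have *: "hausdorff_pre d \<delta>1 E + hausdorff_pre d \<delta>2 F \<le> hausdorff_outer d (E \<union> F)"
    if "0 < \<delta>1" "0 < \<delta>2" for \<delta>1 \<delta>2
  proof -
    let ?\<delta> = "min (min \<delta>1 \<delta>2) (\<rho> / 2)"
    have "hausdorff_pre d \<delta>1 E + hausdorff_pre d \<delta>2 F \<le> hausdorff_pre d ?\<delta> E + hausdorff_pre d ?\<delta> F"
      by (intro add_mono hausdorff_pre_antimono) auto
    also have "\<dots> \<le> hausdorff_pre d ?\<delta> (E \<union> F)"
      using that \<rho> by (intro hausdorff_pre_separated[OF d sep]) auto
    also have "\<dots> \<le> hausdorff_outer d (E \<union> F)" using that \<rho> by (intro hausdorff_pre_le_outer) auto
    finally show ?thesis .
  qed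
  have **: "hausdorff_pre d \<delta>1 E + hausdorff_outer d F \<le> hausdorff_outer d (E \<union> F)" if "0 < \<delta>1" for \<delta>1
  proof -
    have "hausdorff_pre d \<delta>1 E + hausdorff_outer d F = (SUP \<delta>\<in>{0<..}. hausdorff_pre d \<delta>1 E + hausdorff_pre d \<delta> F)"
      unfolding hausdorff_outer_def by (intro ennreal_SUP_add_right) auto
    then show ?thesis using *[OF that] by (auto intro!: SUP_least)
  qed
  show ?thesis
  proof -
    have "hausdorff_outer d E + hausdorff_outer d F = (SUP \<delta>\<in>{0<..}. hausdorff_pre d \<delta> E + hausdorff_outer d F)"
      unfolding hausdorff_outer_def[of d E] by (intro ennreal_SUP_add_left[symmetric]) auto
    then show ?thesis using ** by (auto intro!: SUP_least)
  qed
qed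

text \<open>Caratheodory's criterion for metric outer measures: the layers \<open>D n\<close> between consecutive
  neighbourhoods of \<open>C\<close> have summable measure, because those of equal parity are separated.\<close>

lemma hausdorff_outer_closed:
  assumes d: "1 \<le> d" and C: "closed C"
  shows "hausdorff_outer d (E \<inter> C) + hausdorff_outer d (E - C) = hausdorff_outer d (E :: 'a::euclidean_space set)"
proof (rule antisym)
  let ?H = "hausdorff_outer d :: 'a set \<Rightarrow> ennreal"
  show "?H E \<le> ?H (E \<inter> C) + ?H (E - C)"
    using hausdorff_outer_Un_le[OF d, of "E \<inter> C" "E - C"] by (simp add: Int_Diff_Un)
  show "?H (E \<inter> C) + ?H (E - C) \<le> ?H E"
  proof (cases "C = {} \<or> ?H E = top")
    case True
    then show ?thesis by (auto simp: hausdorff_outer_empty[OF d])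
  next
    case False
    then have Cne: "C \<noteq> {}" and fin: "?H E < top" by (auto simp: less_top)
    define F where "F n = {x \<in> E. 1 / (real n + 1) \<le> infdist x C}" for n
    define D where "D n = {x \<in> E. 1 / (real n + 2) \<le> infdist x C \<and> infdist x C < 1 / (real n + 1)}" for n
    have inf_le: "infdist x C \<le> infdist y C + dist x y" for x y by (rule infdist_triangle)
    have sepD: "1 / (real j + 2) - 1 / (real j + 3) \<le> dist x y" if "x \<in> D j" "y \<in> D k" "j + 2 \<le> k" for j k x y
    proof -
      have "1 / (real k + 1) \<le> 1 / (real j + 3)" using that(3) by (intro divide_left_mono) auto
      then show ?thesis using that(1,2) inf_le[of x y] by (auto simp: D_def)
    qed
    \<comment> \<open>Two different layers of one parity have a full layer between them. The gaps
      shrink with the index, so by \<open>mm\<close> the gap at the newest layer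
      \<open>2 * n + p\<close> bounds its distance to all earlier ones from below.\<close>
    have par: "(\<Sum>k<n. ?H (D (2 * k + p))) \<le> ?H (\<Union>k<n. D (2 * k + p))" for n p
    proof (induction n)
      case (Suc n)
      let ?\<delta> = "1 / (real (2*n+p) + 2) - 1 / (real (2*n+p) + 3)"
      have mm: "?\<delta> \<le> 1 / (real (2*j+p) + 2) - 1 / (real (2*j+p) + 3)" if "j \<le> n" for j
      proof -
        have eq: "1 / (a + 2) - 1 / (a + 3) = 1 / ((a+2) * (a+3))" if "a \<ge> 0" for a :: real
          using that by (simp add: field_simps)
        show ?thesis using that by (subst (1 2) eq) (auto intro!: divide_left_mono mult_mono)
      qed
      have "(\<Sum>k<Suc n. ?H (D (2 * k + p))) \<le> ?H (\<Union>k<n. D (2 * k + p)) + ?H (D (2 * n + p))"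
        using Suc by (simp add: add_right_mono)
      also have "\<dots> \<le> ?H ((\<Union>k<n. D (2 * k + p)) \<union> D (2 * n + p))"
      proof (rule hausdorff_outer_separated[where \<rho> = "?\<delta>", OF d])
        fix x y assume "x \<in> (\<Union>k<n. D (2 * k + p))" "y \<in> D (2 * n + p)"
        then obtain j where "j < n" "x \<in> D (2*j+p)" by auto
        then show "?\<delta> \<le> dist x y" using sepD[OF _ \<open>y \<in> _\<close>, of x "2*j+p"] mm[of j] by auto
      qed (simp add: field_simps add_pos_nonneg)
      also have "(\<Union>k<n. D (2 * k + p)) \<union> D (2 * n + p) = (\<Union>k<Suc n. D (2 * k + p))"
        by (auto simp: lessThan_Suc)
      finally show ?case .
    qed simp
    have DE: "?H (\<Union>k\<in>K. D (h k)) \<le> ?H E" for K :: "nat set" and h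
      by (rule hausdorff_outer_mono) (auto simp: D_def)
    \<comment> \<open>The even and the odd layers each have total measure at most that of
      \<open>E\<close>; since this is finite, the tails of the series become small.\<close>
    have "(\<Sum>k<n. ?H (D k)) \<le> 2 * ?H E" for n
    proof -
      have "(\<Sum>k<n. ?H (D k)) \<le> (\<Sum>k<2*n. ?H (D k))" by (intro sum_mono2) auto
      also have "\<dots> = (\<Sum>k<n. ?H (D (2 * k + 0))) + (\<Sum>k<n. ?H (D (2 * k + 1)))"
        by (induction n) (auto simp: algebra_simps)
      also have "\<dots> \<le> ?H E + ?H E" by (intro add_mono order_trans[OF par DE])
      finally show ?thesis by (simp add: mult_2)
    qed
    then have S: "(\<Sum>k. ?H (D k)) \<le> 2 * ?H E" by (intro suminf_le_const) auto
    then have "(\<Sum>k. ?H (D k)) < top" using fin by (metis ennreal_mult_less_top ennreal_numeral ennreal_less_top order_le_less_trans)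
    moreover define g where "g k = enn2real (?H (D k))" for k
    ultimately have Hg: "?H (D k) = ennreal (g k)" and g0: "0 \<le> g k" for k
      using ennreal_suminf_lessD[of "\<lambda>k. ?H (D k)" top k] by (auto simp: g_def)
    have sg: "summable g"
      using \<open>(\<Sum>k. ?H (D k)) < top\<close> g0 unfolding Hg by (intro summable_suminf_not_top) auto
    show ?thesis
    proof (rule ennreal_le_epsilon)
      fix e :: real assume e: "0 < e"
      obtain N where N: "norm (\<Sum>i. g (i + N)) < e"
        using suminf_exist_split[OF e sg] by blast
      \<comment> \<open>A point off \<open>C\<close> that is not in \<open>F N\<close> has a
        positive distance to \<open>C\<close> below \<open>1 / (real N + 1)\<close>. If
        \<open>m\<close> is the first index with \<open>1 / (real m + 1)\<close> at most this
        distance, the point lies in the layer with index \<open>m - 1\<close>.\<close>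
      have EC: "E - C \<subseteq> F N \<union> (\<Union>i. D (i + N))"
      proof
        fix x assume x: "x \<in> E - C"
        then have pos: "0 < infdist x C"
          using C Cne by (metis DiffD2 in_closed_iff_infdist_zero infdist_nonneg less_eq_real_def)
        show "x \<in> F N \<union> (\<Union>i. D (i + N))"
        proof (cases "x \<in> F N")
          case False
          then have l: "infdist x C < 1 / (real N + 1)" using x by (auto simp: F_def)
          define m where "m = (LEAST m. 1 / (real m + 1) \<le> infdist x C)"
          have "\<exists>m. 1 / (real m + 1) \<le> infdist x C"
            using reals_Archimedean[OF pos] by (auto simp: inverse_eq_divide add.commute intro: less_imp_le)
          then have m: "1 / (real m + 1) \<le> infdist x C" unfolding m_def by (rule LeastI_ex)
          have "N < m"
          proof (rule ccontr)
            assume "\<not> N < m"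
            then have "1 / (real N + 1) \<le> 1 / (real m + 1)" by (intro divide_left_mono) auto
            then show False using m l by linarith
          qed
          then obtain i where i: "m = Suc (i + N)" by (metis add.commute less_imp_Suc_add)
          have "\<not> 1 / (real (i + N) + 1) \<le> infdist x C"
            using not_less_Least[of "i + N" "\<lambda>m. 1 / (real m + 1) \<le> infdist x C"] i unfolding m_def by auto
          then have "x \<in> D (i + N)" using x m i by (auto simp: D_def add.commute)
          then show ?thesis by auto
        qed simp
      qed
      have "?H (E - C) \<le> ?H (F N) + ?H (\<Union>i. D (i + N))"
        using hausdorff_outer_mono[OF EC] hausdorff_outer_Un_le[OF d] order_trans by blast
      also have "?H (\<Union>i. D (i + N)) \<le> (\<Sum>i. ?H (D (i + N)))" by (rule hausdorff_outer_UN_le)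
      also have "\<dots> = ennreal (\<Sum>i. g (i + N))"
        unfolding Hg using g0 sg by (intro suminf_ennreal2) auto
      also have "\<dots> \<le> ennreal e" using N by (intro ennreal_leI) auto
      finally have EF: "?H (E - C) \<le> ?H (F N) + ennreal e" by (simp add: add_left_mono)
      have "?H (E \<inter> C) + ?H (F N) \<le> ?H ((E \<inter> C) \<union> F N)"
      proof (rule hausdorff_outer_separated[where \<rho> = "1 / (real N + 1)", OF d])
        fix x y assume "x \<in> E \<inter> C" "y \<in> F N"
        then show "1 / (real N + 1) \<le> dist x y"
          using infdist_le[of x C y] by (auto simp: F_def dist_commute)
      qed auto
      moreover have "?H ((E \<inter> C) \<union> F N) \<le> ?H E" by (rule hausdorff_outer_mono) (auto simp: F_def)
      ultimately have le: "?H (E \<inter> C) + ?H (F N) \<le> ?H E" by (rule order_trans)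
      have "?H (E \<inter> C) + ?H (E - C) \<le> ?H (E \<inter> C) + (?H (F N) + ennreal e)"
        using EF by (rule add_left_mono)
      also have "?H (E \<inter> C) + (?H (F N) + ennreal e) \<le> ?H E + ennreal e"
        using add_right_mono[OF le, of "ennreal e"] by (simp only: add.assoc)
      finally show "?H (E \<inter> C) + ?H (E - C) \<le> ?H E + ennreal e" .
    qed
  qed
qed

text \<open>Closed sets split every set additively, so they lie in the Caratheodory system; being a
  sigma-algebra, it contains all Borel sets.\<close>

lemma measure_space_hausdorff:
  assumes d: "1 \<le> d"
  shows "measure_space UNIV (sets borel) (hausdorff_outer d :: 'a::euclidean_space set \<Rightarrow> ennreal)"
proof -
  let ?L = "lambda_system UNIV (Pow UNIV) (hausdorff_outer d :: 'a set \<Rightarrow> ennreal)"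
  interpret sigma_algebra UNIV "Pow (UNIV :: 'a set)" by (rule sigma_algebra_Pow)
  have ms: "measure_space UNIV ?L (hausdorff_outer d)"
    by (rule caratheodory_lemma[OF outer_measure_space_hausdorff[OF d]])
  have "C \<in> ?L" if "closed C" for C
    unfolding lambda_system_eq using hausdorff_outer_closed[OF d that] by auto
  moreover have "sigma_algebra UNIV ?L" using ms by (simp add: measure_space_def)
  ultimately have "sigma_sets UNIV (Collect closed) \<subseteq> ?L"
    by (intro sigma_algebra.sigma_sets_subset) auto
  then have "sets borel \<subseteq> ?L" by (simp add: borel_eq_closed)
  then show ?thesis using measure_down[OF ms] sets.sigma_algebra_axioms[of borel] by auto
qed

lemma sets_hausdorff_measure [simp, measurable_cong]: "sets (hausdorff_measure d) = sets borel"
  by (simp add: hausdorff_measure_def) (metis sets.sigma_sets_eq space_borel)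

lemma space_hausdorff_measure [simp]: "space (hausdorff_measure d) = UNIV"
  by (simp add: hausdorff_measure_def)

text \<open>\<open>measure_of\<close> returns the given set function only if that function is
  countably additive, so this identification is where Caratheodory's theorem enters all later uses
  of \<open>hausdorff_measure\<close>.\<close>

lemma emeasure_hausdorff_measure:
  assumes "1 \<le> d" "B \<in> sets borel"
  shows "emeasure (hausdorff_measure d) B = hausdorff_outer d B"
  unfolding hausdorff_measure_def
  using measure_space_hausdorff[OF assms(1)] assms(2) sets.sigma_algebra_axioms[of "borel :: 'a measure"]
  by (intro emeasure_measure_of_sigma) (auto simp: measure_space_def)

text \<open>A cover of \<open>E\<close> at scale \<open>\<delta> / K\<close> is cut down to
  \<open>E\<close>, where the Lipschitz bound is available, and then mapped; diameters grow by a
  factor of at most \<open>K\<close>, so each term grows by at most \<open>K ^ d\<close>.\<close>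

lemma hausdorff_outer_lipschitz:
  assumes K: "0 < K" and lip: "\<And>x y. x \<in> E \<Longrightarrow> y \<in> E \<Longrightarrow> dist (g x) (g y) \<le> K * dist x y"
  shows "hausdorff_outer d (g ` E) \<le> ennreal (K ^ d) * hausdorff_outer d E"
proof (rule hausdorff_outer_least)
  fix \<delta> :: real assume \<delta>: "0 < \<delta>"
  have "hausdorff_pre d \<delta> (g ` E) / ennreal (K ^ d) \<le> hausdorff_pre d (\<delta> / K) E"
  proof (rule hausdorff_pre_greatest)
    fix U :: "nat \<Rightarrow> 'a set"
    assume cov: "E \<subseteq> \<Union>(range U)" and bd: "\<And>i. bounded (U i)" and dm: "\<And>i. diameter (U i) \<le> \<delta> / K"
    have le: "dist (g x) (g y) \<le> K * diameter (U i)" if "x \<in> U i \<inter> E" "y \<in> U i \<inter> E" for x y i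
      using lip[of x y] that diameter_bounded_bound[OF bd, of x i y] K
      by (auto intro: order_trans mult_left_mono)
    have diam: "diameter (g ` (U i \<inter> E)) \<le> K * diameter (U i)" for i
      using le K diameter_ge_0[OF bd] by (intro diameter_le) (auto simp: dist_norm)
    have bdg: "bounded (g ` (U i \<inter> E))" for i
      using le by (force simp: bounded_two_points)
    have "hausdorff_pre d \<delta> (g ` E) \<le> (\<Sum>i. ennreal (hausdorff_const d * diameter (g ` (U i \<inter> E)) ^ d))"
    proof (rule hausdorff_pre_le)
      show "diameter (g ` (U i \<inter> E)) \<le> \<delta>" for i
        using diam[of i] dm[of i] K by (simp add: field_simps)
    qed (use cov bdg in blast)+
    also have "\<dots> \<le> (\<Sum>i. ennreal (K ^ d) * ennreal (hausdorff_const d * diameter (U i) ^ d))"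
    proof (rule suminf_le)
      fix i
      have "hausdorff_const d * diameter (g ` (U i \<inter> E)) ^ d \<le> hausdorff_const d * (K * diameter (U i)) ^ d"
        by (intro mult_left_mono power_mono diam diameter_ge_0 bdg) auto
      then show "ennreal (hausdorff_const d * diameter (g ` (U i \<inter> E)) ^ d)
          \<le> ennreal (K ^ d) * ennreal (hausdorff_const d * diameter (U i) ^ d)"
        using K diameter_ge_0[OF bd[of i]] by (simp add: ennreal_mult[symmetric] power_mult_distrib mult_ac ennreal_leI)
    qed auto
    also have "\<dots> = ennreal (K ^ d) * (\<Sum>i. ennreal (hausdorff_const d * diameter (U i) ^ d))" by simp
    finally show "hausdorff_pre d \<delta> (g ` E) / ennreal (K ^ d) \<le> (\<Sum>i. ennreal (hausdorff_const d * diameter (U i) ^ d))"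
      using K by (intro divide_le_posI_ennreal) auto
  qed
  also have "\<dots> \<le> hausdorff_outer d E" using K \<delta> by (intro hausdorff_pre_le_outer) auto
  finally have le: "hausdorff_pre d \<delta> (g ` E) / ennreal (K ^ d) \<le> hausdorff_outer d E" .
  show "hausdorff_pre d \<delta> (g ` E) \<le> ennreal (K ^ d) * hausdorff_outer d E"
  proof -
    have "hausdorff_pre d \<delta> (g ` E) = ennreal (K ^ d) * (hausdorff_pre d \<delta> (g ` E) / ennreal (K ^ d))"
      using K by (simp add: ennreal_times_divide mult.commute[of "ennreal (K^d)"] ennreal_mult_divide_eq)
    also have "\<dots> \<le> ennreal (K ^ d) * hausdorff_outer d E" using le by (rule mult_left_mono) simp
    finally show ?thesis .
  qed
qed

section \<open>The isodiametric inequality\<close>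

lemma emeasure_lborel_affine_real:
  fixes S :: "real set"
  assumes "compact S"
  shows "emeasure lborel ((\<lambda>x. m * x + t) ` S) = ennreal \<bar>m\<bar> * emeasure lborel S"
proof -
  have "compact ((\<lambda>x. m * x + t) ` S)"
    using assms by (intro compact_continuous_image continuous_intros)
  then have "emeasure lborel ((\<lambda>x. m * x + t) ` S) = emeasure lebesgue ((\<lambda>x. m *\<^sub>R x + t) ` S)"
    by (simp add: borel_compact)
  also have "\<dots> = ennreal (\<bar>m\<bar> ^ DIM(real)) * emeasure lebesgue S"
    by (rule emeasure_lebesgue_affine)
  finally show ?thesis using assms by (simp add: borel_compact)
qed

text \<open>With \<open>a\<close> and \<open>b\<close> the maxima of \<open>A\<close> and
  \<open>B\<close>, the copies \<open>(A - b) / 2\<close> and \<open>(a - B) / 2\<close> both lie in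
  \<open>C\<close> and meet only in \<open>(a - b) / 2\<close>, the greatest point of the first and
  the least of the second. Half differences take the place of the usual sums because the
  isodiametric inequality is about differences.\<close>

lemma brunn_minkowski_real_compact:
  fixes A B C :: "real set"
  assumes A: "compact A" "A \<noteq> {}" and B: "compact B" "B \<noteq> {}" and C: "C \<in> sets borel"
    and sub: "\<And>a b. a \<in> A \<Longrightarrow> b \<in> B \<Longrightarrow> (a - b) / 2 \<in> C"
  shows "emeasure lborel A + emeasure lborel B \<le> 2 * emeasure lborel C"
proof -
  obtain a where a: "a \<in> A" "\<And>x. x \<in> A \<Longrightarrow> x \<le> a" using compact_attains_sup[OF A] by blast
  obtain b where b: "b \<in> B" "\<And>x. x \<in> B \<Longrightarrow> x \<le> b" using compact_attains_sup[OF B] by blast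
  let ?A = "(\<lambda>x. (1/2) * x + (- b/2)) ` A" and ?B = "(\<lambda>x. (-1/2) * x + a/2) ` B"
  have cA: "compact ?A" and cB: "compact ?B"
    using A B by (intro compact_continuous_image continuous_intros; simp)+
  have eA: "emeasure lborel ?A = ennreal \<bar>1/2\<bar> * emeasure lborel A"
    by (rule emeasure_lborel_affine_real[OF A(1)])
  have eB: "emeasure lborel ?B = ennreal \<bar>-1/2\<bar> * emeasure lborel B"
    by (rule emeasure_lborel_affine_real[OF B(1)])
  have h2: "2 * (ennreal (1/2) * z) = z" for z
  proof -
    have "2 * ennreal (1/2) = 1" using ennreal_mult[of 2 "1/2"] by simp
    then show ?thesis by (simp add: mult.assoc[symmetric])
  qed
  have disj: "(?A - {(a-b)/2}) \<inter> ?B = {}"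
  proof -
    have False if "x \<in> A" "y \<in> B" "(1/2) * x + (- b/2) = (-1/2) * y + a/2" "(1/2) * x + (- b/2) \<noteq> (a-b)/2" for x y
      using a(2)[OF that(1)] b(2)[OF that(2)] that(3,4) by (simp add: field_simps)
    then show ?thesis by blast
  qed
  have "emeasure lborel ?A = emeasure lborel (?A - {(a-b)/2})"
  proof (rule emeasure_eq_AE)
    show "AE x in lborel. x \<in> ?A \<longleftrightarrow> x \<in> ?A - {(a-b)/2}"
      using AE_lborel_singleton[of "(a-b)/2"] by eventually_elim auto
  qed (use cA in \<open>auto intro: borel_compact\<close>)
  then have "emeasure lborel ?A + emeasure lborel ?B = emeasure lborel ((?A - {(a-b)/2}) \<union> ?B)"
    using plus_emeasure[OF _ _ disj, of lborel] borel_compact[OF cA] borel_compact[OF cB] by simp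
  also have "\<dots> \<le> emeasure lborel C"
  proof (rule emeasure_mono)
    show "?A - {(a-b)/2} \<union> ?B \<subseteq> C"
    proof -
      have eq: "(1/2) * x + (- b/2) = (x - b) / 2" "(-1/2) * x + a/2 = (a - x) / 2" for x
        by (simp_all add: field_simps)
      have "?A \<subseteq> C" unfolding eq using sub[OF _ b(1)] by blast
      moreover have "?B \<subseteq> C" unfolding eq using sub[OF a(1)] by blast
      ultimately show ?thesis by blast
    qed
  qed (use C in auto)
  finally have "2 * (emeasure lborel ?A + emeasure lborel ?B) \<le> 2 * emeasure lborel C"
    by (intro mult_left_mono) auto
  moreover have "2 * (emeasure lborel ?A + emeasure lborel ?B) = emeasure lborel A + emeasure lborel B"
    unfolding eA eB using h2 by (simp only: distrib_left abs_minus_cancel minus_divide_left[symmetric]) simp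
  ultimately show ?thesis by simp
qed

text \<open>Inner approximation by compact sets. A point of the set is inserted, because the compact
  case asks for nonempty sets and the closed approximating set may be empty.\<close>

lemma brunn_minkowski_real:
  fixes A B C :: "real set"
  assumes A: "A \<in> sets borel" "bounded A" "A \<noteq> {}" and B: "B \<in> sets borel" "bounded B" "B \<noteq> {}"
    and C: "C \<in> sets borel" and sub: "\<And>a b. a \<in> A \<Longrightarrow> b \<in> B \<Longrightarrow> (a - b) / 2 \<in> C"
  shows "emeasure lborel A + emeasure lborel B \<le> 2 * emeasure lborel C"
proof -
  have approx: "\<exists>K. compact K \<and> K \<noteq> {} \<and> K \<subseteq> S \<and> emeasure lborel S \<le> emeasure lborel K + ennreal e"
    if S: "S \<in> sets borel" "bounded S" "S \<noteq> {}" and e: "0 < e" for S :: "real set" and e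
  proof -
    have "S \<in> sets lebesgue" using S by auto
    then obtain T where T: "closed T" "T \<subseteq> S" "S - T \<in> lmeasurable" "emeasure lebesgue (S - T) < ennreal e"
      using sets_lebesgue_inner_closed[OF _ e] by metis
    then have T: "compact T" "T \<subseteq> S" "S - T \<in> lmeasurable" "emeasure lebesgue (S - T) < ennreal e"
      using S(2) bounded_subset compact_eq_bounded_closed by blast+
    obtain x where x: "x \<in> S" using S by auto
    have "S - T \<in> sets lborel" using S borel_compact[OF T(1)] by auto
    then have ST: "emeasure lborel (S - T) \<le> ennreal e" using T(4) by simp
    have "emeasure lborel S \<le> emeasure lborel (T \<union> (S - T))" using T(1) S by (intro emeasure_mono) (auto intro: borel_compact)
    also have "\<dots> \<le> emeasure lborel T + emeasure lborel (S - T)"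
      using S T by (intro emeasure_subadditive) (auto intro: borel_compact)
    also have "emeasure lborel (S - T) \<le> ennreal e" by (rule ST)
    also have "emeasure lborel T \<le> emeasure lborel (insert x T)"
      using T(1) by (intro emeasure_mono) (auto intro: borel_compact)
    finally show ?thesis using T x by (intro exI[of _ "insert x T"]) (auto simp: add_left_mono add_right_mono)
  qed
  show ?thesis
  proof (rule ennreal_le_epsilon)
    fix e :: real assume e: "0 < e"
    obtain K where K: "compact K" "K \<noteq> {}" "K \<subseteq> A" "emeasure lborel A \<le> emeasure lborel K + ennreal (e/2)"
      using approx[OF A, of "e/2"] e by auto
    obtain L where L: "compact L" "L \<noteq> {}" "L \<subseteq> B" "emeasure lborel B \<le> emeasure lborel L + ennreal (e/2)"
      using approx[OF B, of "e/2"] e by auto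
    have "emeasure lborel A + emeasure lborel B \<le> (emeasure lborel K + ennreal (e/2)) + (emeasure lborel L + ennreal (e/2))"
      by (intro add_mono K L)
    also have "\<dots> = (emeasure lborel K + emeasure lborel L) + ennreal e"
    proof -
      have "ennreal e = ennreal (e/2) + ennreal (e/2)" using e by (subst ennreal_plus[symmetric]) auto
      then show ?thesis by (simp add: algebra_simps)
    qed
    also have "emeasure lborel K + emeasure lborel L \<le> 2 * emeasure lborel C"
      using K L sub by (intro brunn_minkowski_real_compact C) auto
    finally show "emeasure lborel A + emeasure lborel B \<le> 2 * emeasure lborel C + ennreal e"
      by (simp add: add_right_mono)
  qed
qed

section \<open>The Prekopa-Leindler inequality\<close>

lemma nn_integral_layer_cake:
  assumes "sigma_finite_measure M" and [measurable]: "f \<in> borel_measurable M"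
  shows "(\<integral>\<^sup>+x. f x \<partial>M) = (\<integral>\<^sup>+t. emeasure M {x \<in> space M. ennreal t < f x} * indicator {0..} t \<partial>lborel)"
proof -
  interpret M: sigma_finite_measure M by fact
  interpret pair_sigma_finite M lborel ..
  \<comment> \<open>The segment from 0 to \<open>y\<close> has length \<open>y\<close>, also for
    infinite \<open>y\<close>; Fubini on the region below the graph then exchanges the two
    integrations.\<close>
  have seg: "emeasure lborel {t :: real. 0 \<le> t \<and> ennreal t < y} = y" for y
  proof (cases y)
    case (real r)
    then have "{t :: real. 0 \<le> t \<and> ennreal t < y} = {0..<r}" by (auto simp: ennreal_less_iff)
    then show ?thesis using real by simp
  next
    case top
    then have "{t :: real. 0 \<le> t \<and> ennreal t < y} = {0..}" by auto
    moreover have "emeasure lborel {0::real..} = top"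
    proof -
      have "ennreal (real n) \<le> emeasure lborel {0::real..}" for n
        using emeasure_mono[of "{0..real n}" "{0::real..}" lborel] by auto
      then show ?thesis
        using ennreal_Ex_less_of_nat[of "emeasure lborel {0::real..}"]
        by (metis ennreal_of_nat_eq_real_of_nat leD top.not_eq_extremum)
    qed
    ultimately show ?thesis using top by simp
  qed
  have "(\<integral>\<^sup>+x. f x \<partial>M) = (\<integral>\<^sup>+x. (\<integral>\<^sup>+t. indicator {t. 0 \<le> t \<and> ennreal t < f x} t \<partial>lborel) \<partial>M)"
  proof (rule nn_integral_cong)
    fix x
    have "{t :: real. 0 \<le> t \<and> ennreal t < f x} \<in> sets lborel" by measurable
    then show "f x = (\<integral>\<^sup>+t. indicator {t. 0 \<le> t \<and> ennreal t < f x} t \<partial>lborel)"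
      by (simp add: seg)
  qed
  also have "\<dots> = (\<integral>\<^sup>+x. (\<integral>\<^sup>+t. indicator {p \<in> space (M \<Otimes>\<^sub>M lborel). 0 \<le> snd p \<and> ennreal (snd p) < f (fst p)} (x, t) \<partial>lborel) \<partial>M)"
    by (intro nn_integral_cong) (auto simp: indicator_def space_pair_measure)
  also have "\<dots> = (\<integral>\<^sup>+t. (\<integral>\<^sup>+x. indicator {p \<in> space (M \<Otimes>\<^sub>M lborel). 0 \<le> snd p \<and> ennreal (snd p) < f (fst p)} (x, t) \<partial>M) \<partial>lborel)"
    by (rule Fubini[symmetric]) measurable
  also have "\<dots> = (\<integral>\<^sup>+t. (\<integral>\<^sup>+x. indicator {x \<in> space M. ennreal t < f x} x * indicator {0..} t \<partial>M) \<partial>lborel)"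
    by (intro nn_integral_cong) (auto simp: indicator_def space_pair_measure)
  also have "\<dots> = (\<integral>\<^sup>+t. emeasure M {x \<in> space M. ennreal t < f x} * indicator {0..} t \<partial>lborel)"
    by (intro nn_integral_cong) (simp add: nn_integral_multc)
  finally show ?thesis .
qed

lemma ennreal_mult_strict_mono:
  fixes a b c d :: ennreal
  shows "a < c \<Longrightarrow> b < d \<Longrightarrow> a * b < c * d"
  by (cases a; cases b; cases c; cases d)
    (auto simp: ennreal_mult[symmetric] ennreal_less_iff ennreal_mult_top ennreal_top_mult mult_strict_mono')

text \<open>Normalizing both suprema to 1 makes the superlevel sets of \<open>f\<close> and
  \<open>g\<close> nonempty for every \<open>t < 1\<close>, as Brunn-Minkowski demands, and half
  differences of points of these sets fall into the superlevel set of \<open>h\<close>. For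
  \<open>t \<ge> 1\<close> the left side vanishes. Integrating over the levels gives the additive
  form.\<close>

lemma prekopa_leindler_real_normalized:
  fixes f g h :: "real \<Rightarrow> ennreal"
  assumes [measurable]: "f \<in> borel_measurable borel" "g \<in> borel_measurable borel" "h \<in> borel_measurable borel"
    and supp: "\<And>x. R < \<bar>x\<bar> \<Longrightarrow> f x = 0 \<and> g x = 0"
    and sup: "(SUP x. f x) = 1" "(SUP x. g x) = 1"
    and le: "\<And>x y. f x * g y \<le> (h ((x - y) / 2))\<^sup>2"
  shows "(\<integral>\<^sup>+x. f x \<partial>lborel) + (\<integral>\<^sup>+x. g x \<partial>lborel) \<le> 2 * (\<integral>\<^sup>+x. h x \<partial>lborel)"
proof -
  have "sigma_finite_measure (lborel :: real measure)" ..
  note lc = nn_integral_layer_cake[OF this]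
  have main: "emeasure lborel {x. ennreal t < f x} + emeasure lborel {x. ennreal t < g x}
      \<le> 2 * emeasure lborel {x. ennreal t < h x}" if t: "0 \<le> t" for t
  proof (cases "t < 1")
    case True
    then have t1: "ennreal t < 1" using t by (simp add: ennreal_less_one_iff)
    have bdd: "bounded {x. ennreal t < f x}" "bounded {x. ennreal t < g x}"
      using supp by (intro boundedI[of _ R]; fastforce simp: not_less[symmetric])+
    have mS: "{x. ennreal t < f x} \<in> sets borel" "{x. ennreal t < g x} \<in> sets borel" "{x. ennreal t < h x} \<in> sets borel"
      by measurable
    show ?thesis
    proof (rule brunn_minkowski_real)
      show "{x. ennreal t < f x} \<noteq> {}" "{x. ennreal t < g x} \<noteq> {}"
        using t1 sup less_SUP_iff[of "ennreal t" f UNIV] less_SUP_iff[of "ennreal t" g UNIV] by auto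
      fix a b assume "a \<in> {x. ennreal t < f x}" "b \<in> {x. ennreal t < g x}"
      then have "ennreal t * ennreal t < f a * g b" by (auto intro: ennreal_mult_strict_mono)
      also have "\<dots> \<le> (h ((a - b) / 2))\<^sup>2" by (rule le)
      finally have lt: "ennreal t * ennreal t < h ((a - b) / 2) * h ((a - b) / 2)"
        by (simp add: power2_eq_square)
      have "\<not> h ((a - b) / 2) \<le> ennreal t"
      proof
        assume "h ((a - b) / 2) \<le> ennreal t"
        then have "h ((a - b) / 2) * h ((a - b) / 2) \<le> ennreal t * ennreal t" by (intro mult_mono) auto
        then show False using lt by simp
      qed
      then show "(a - b) / 2 \<in> {x. ennreal t < h x}" by (simp add: not_le)
    qed (fact bdd mS)+
  next
    case False
    have "f x \<le> 1" "g x \<le> 1" for x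
      using SUP_upper[of x UNIV f] SUP_upper[of x UNIV g] sup by simp_all
    then have "{x. ennreal t < f x} = {}" "{x. ennreal t < g x} = {}"
      using False by (auto simp: not_less intro: order_trans[of _ 1])
    then show ?thesis by simp
  qed
  have "(\<integral>\<^sup>+x. f x \<partial>lborel) + (\<integral>\<^sup>+x. g x \<partial>lborel) =
     (\<integral>\<^sup>+t. (emeasure lborel {x. ennreal t < f x} + emeasure lborel {x. ennreal t < g x}) * indicator {0..} t \<partial>lborel)"
    by (subst (1 2) lc) (auto simp: nn_integral_add[symmetric] distrib_right)
  also have "\<dots> \<le> (\<integral>\<^sup>+t. 2 * (emeasure lborel {x. ennreal t < h x} * indicator {0..} t) \<partial>lborel)"
    using main by (intro nn_integral_mono) (auto simp: indicator_def)
  also have "\<dots> = 2 * (\<integral>\<^sup>+x. h x \<partial>lborel)"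
    by (subst lc) (auto simp: nn_integral_cmult)
  finally show ?thesis .
qed

text \<open>Dividing \<open>f\<close> and \<open>g\<close> by their suprema \<open>a\<close> and
  \<open>b\<close>, and \<open>h\<close> by \<open>sqrt (a * b)\<close>, preserves the pointwise
  hypothesis and normalizes the suprema. The additive inequality then turns into the multiplicative
  one by the inequality between arithmetic and geometric mean. The multiplicative form is the one
  that can be iterated over coordinates.\<close>

lemma prekopa_leindler_real:
  fixes f g h :: "real \<Rightarrow> ennreal"
  assumes [measurable]: "f \<in> borel_measurable borel" "g \<in> borel_measurable borel" "h \<in> borel_measurable borel"
    and supp: "\<And>x. R < \<bar>x\<bar> \<Longrightarrow> f x = 0 \<and> g x = 0"
    and bdd: "\<And>x. f x \<le> ennreal c" "\<And>x. g x \<le> ennreal c"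
    and le: "\<And>x y. f x * g y \<le> (h ((x - y) / 2))\<^sup>2"
  shows "(\<integral>\<^sup>+x. f x \<partial>lborel) * (\<integral>\<^sup>+x. g x \<partial>lborel) \<le> (\<integral>\<^sup>+x. h x \<partial>lborel)\<^sup>2"
proof (cases "(SUP x. f x) = 0 \<or> (SUP x. g x) = 0")
  case True
  then have "(\<forall>x. f x = 0) \<or> (\<forall>x. g x = 0)" by (metis SUP_upper UNIV_I le_zero_eq)
  then show ?thesis by auto
next
  case False
  have "(SUP x. f x) \<le> ennreal c" "(SUP x. g x) \<le> ennreal c" using bdd by (auto intro!: SUP_least)
  then obtain a b where ab: "(SUP x. f x) = ennreal a" "(SUP x. g x) = ennreal b" "0 < a" "0 < b"
    using False by (metis ennreal_cases ennreal_0 ennreal_neq_top linorder_not_less neq_top_trans order_le_less top.extremum_uniqueI)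
  define m where "m = sqrt (a * b)"
  have m: "0 < m" "m * m = a * b" using ab by (auto simp: m_def)
  have sc: "ennreal (1/a) * ennreal a = 1" if "0 < a" for a using that by (simp add: ennreal_mult[symmetric])
  have "(\<integral>\<^sup>+x. ennreal (1/a) * f x \<partial>lborel) + (\<integral>\<^sup>+x. ennreal (1/b) * g x \<partial>lborel) \<le> 2 * (\<integral>\<^sup>+x. ennreal (1/m) * h x \<partial>lborel)"
  proof (rule prekopa_leindler_real_normalized)
    show "(SUP x. ennreal (1/a) * f x) = 1" "(SUP x. ennreal (1/b) * g x) = 1"
      using ab by (simp_all add: SUP_mult_left_ennreal[symmetric] sc)
    fix x y
    have "ennreal (1/a) * f x * (ennreal (1/b) * g y) = ennreal (1/a) * ennreal (1/b) * (f x * g y)" by (simp add: mult_ac)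
    also have "ennreal (1/a) * ennreal (1/b) = ennreal (1/m) * ennreal (1/m)"
      using ab m by (simp add: ennreal_mult[symmetric])
    also have "\<dots> * (f x * g y) \<le> ennreal (1/m) * ennreal (1/m) * (h ((x - y) / 2))\<^sup>2" by (intro mult_left_mono le) auto
    also have "\<dots> = (ennreal (1/m) * h ((x - y) / 2))\<^sup>2" by (simp add: power2_eq_square mult_ac)
    finally show "ennreal (1/a) * f x * (ennreal (1/b) * g y) \<le> (ennreal (1/m) * h ((x - y) / 2))\<^sup>2" .
  qed (use supp in auto)
  then have ineq: "ennreal (1/a) * (\<integral>\<^sup>+x. f x \<partial>lborel) + ennreal (1/b) * (\<integral>\<^sup>+x. g x \<partial>lborel) \<le> 2 * (ennreal (1/m) * (\<integral>\<^sup>+x. h x \<partial>lborel))"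
    by (simp add: nn_integral_cmult)
  have fin: "(\<integral>\<^sup>+x. u x \<partial>lborel) < top" if u: "\<And>x. R < \<bar>x\<bar> \<Longrightarrow> u x = 0" "\<And>x. u x \<le> ennreal c" for u :: "real \<Rightarrow> ennreal"
  proof -
    have "u x \<le> ennreal c * indicator {-R..R} x" for x
      using u(1)[of x] u(2)[of x] by (cases "R < \<bar>x\<bar>") (auto simp: indicator_def abs_le_iff)
    then have "(\<integral>\<^sup>+x. u x \<partial>lborel) \<le> (\<integral>\<^sup>+x. ennreal c * indicator {-R..R} x \<partial>lborel)" by (intro nn_integral_mono)
    also have "\<dots> = ennreal c * emeasure lborel {-R..R}" by (simp add: nn_integral_cmult_indicator)
    also have "\<dots> < top" by (simp add: ennreal_mult_less_top emeasure_lborel_Icc_eq)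
    finally show ?thesis .
  qed
  obtain F where F: "(\<integral>\<^sup>+x. f x \<partial>lborel) = ennreal F" "0 \<le> F"
    using fin[of f] supp bdd by (metis ennreal_cases less_irrefl)
  obtain G where G: "(\<integral>\<^sup>+x. g x \<partial>lborel) = ennreal G" "0 \<le> G"
    using fin[of g] supp bdd by (metis ennreal_cases less_irrefl)
  show ?thesis
  proof (cases "(\<integral>\<^sup>+x. h x \<partial>lborel)")
    case top
    then show ?thesis by (simp add: power2_eq_square ennreal_top_mult)
  next
    case (real X)
    have "F / a + G / b \<le> 2 * (X / m)"
    proof -
      have "ennreal (F / a + G / b) \<le> 2 * ennreal (X / m)"
        using ineq F G real ab m
        by (simp add: ennreal_mult[symmetric] ennreal_plus[symmetric] del: ennreal_plus ennreal_le_iff)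
      also have "2 * ennreal (X / m) = ennreal (2 * (X / m))"
        using ennreal_mult[of 2 "X / m"] real m by simp
      finally have "ennreal (F / a + G / b) \<le> ennreal (2 * (X / m))" .
      then show ?thesis using real m by simp
    qed
    moreover define P Q Y where "P = F / a" "Q = G / b" "Y = X / m"
    ultimately have "P + Q \<le> 2 * Y" and nn: "0 \<le> P" "0 \<le> Q" using F G ab by auto
    then have "((P + Q) / 2)\<^sup>2 \<le> Y\<^sup>2" by (intro power_mono) auto
    moreover have "P * Q \<le> ((P + Q) / 2)\<^sup>2"
      using zero_le_power2[of "P - Q"] by (simp add: power2_eq_square field_simps)
    ultimately have "F / a * (G / b) \<le> (X / m)\<^sup>2" unfolding P_Q_Y_def by linarith
    moreover have "(X / m)\<^sup>2 = X\<^sup>2 / (a * b)" by (simp add: power2_eq_square m)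
    moreover have "F / a * (G / b) = F * G / (a * b)" by simp
    ultimately have "F * G \<le> X\<^sup>2" using ab by (simp add: divide_le_cancel)
    then show ?thesis using F G real by (simp add: ennreal_mult[symmetric] power2_eq_square)
  qed
qed

lemma prekopa_leindler_PiM:
  assumes "finite I"
    and "f \<in> borel_measurable (Pi\<^sub>M I (\<lambda>_. lborel :: real measure))" "g \<in> borel_measurable (Pi\<^sub>M I (\<lambda>_. lborel))"
        "h \<in> borel_measurable (Pi\<^sub>M I (\<lambda>_. lborel))"
    and "\<And>x i. x \<in> extensional I \<Longrightarrow> i \<in> I \<Longrightarrow> R < \<bar>x i\<bar> \<Longrightarrow> f x = 0 \<and> g x = (0 :: ennreal)"
    and "\<And>x. x \<in> extensional I \<Longrightarrow> f x \<le> ennreal c \<and> g x \<le> ennreal c"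
    and "\<And>x y. x \<in> extensional I \<Longrightarrow> y \<in> extensional I \<Longrightarrow> f x * g y \<le> (h (\<lambda>i\<in>I. (x i - y i) / 2))\<^sup>2"
  shows "(\<integral>\<^sup>+x. f x \<partial>Pi\<^sub>M I (\<lambda>_. lborel)) * (\<integral>\<^sup>+x. g x \<partial>Pi\<^sub>M I (\<lambda>_. lborel)) \<le> (\<integral>\<^sup>+x. h x \<partial>Pi\<^sub>M I (\<lambda>_. lborel))\<^sup>2"
  using assms
proof (induction I arbitrary: f g h rule: finite_induct)
  case empty
  interpret product_sigma_finite "\<lambda>_. lborel :: real measure" ..
  have "(\<lambda>i\<in>{}. (undefined - undefined) / 2 :: real) = (\<lambda>_. undefined)" by auto
  then show ?case using empty(6)[of "\<lambda>_. undefined" "\<lambda>_. undefined"]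
    by (simp add: PiM_empty nn_integral_count_space_finite extensional_def)
next
  case (insert i I)
  interpret product_sigma_finite "\<lambda>_. lborel :: real measure" ..
  interpret P: sigma_finite_measure "Pi\<^sub>M I (\<lambda>_. lborel :: real measure)"
    using insert by (intro sigma_finite)
  let ?P = "Pi\<^sub>M I (\<lambda>_. lborel :: real measure)"
  have upd: "(\<lambda>p. (snd p)(i := fst p)) \<in> measurable (lborel \<Otimes>\<^sub>M ?P) (Pi\<^sub>M (insert i I) (\<lambda>_. lborel))"
    by (rule measurable_fun_upd[where J=I]) (auto simp: insert_Diff_if)
  have m2: "(\<lambda>p. u ((snd p)(i := fst p))) \<in> borel_measurable (lborel \<Otimes>\<^sub>M ?P)"
    if "u \<in> borel_measurable (Pi\<^sub>M (insert i I) (\<lambda>_. lborel))" for u :: "_ \<Rightarrow> ennreal"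
    by (rule measurable_compose[OF upd that])
  have m1: "(\<lambda>x. u (x(i := a))) \<in> borel_measurable ?P"
    if "u \<in> borel_measurable (Pi\<^sub>M (insert i I) (\<lambda>_. lborel))" for u :: "_ \<Rightarrow> ennreal" and a
    using measurable_compose[OF measurable_Pair1' m2[OF that], of a] by simp
  have mF: "(\<lambda>a. \<integral>\<^sup>+x. u (x(i := a)) \<partial>?P) \<in> borel_measurable borel"
    if "u \<in> borel_measurable (Pi\<^sub>M (insert i I) (\<lambda>_. lborel))" for u :: "_ \<Rightarrow> ennreal"
    using P.borel_measurable_nn_integral_fst[OF m2[OF that]] by simp
  have ext: "x(i := a) \<in> extensional (insert i I)" if "x \<in> extensional I" for x and a :: real
    using that by (auto simp: extensional_def)
  \<comment> \<open>Integrating out the other coordinates keeps a function bounded if it is bounded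
    and vanishes outside a box; the bound is multiplied by the volume of the box.\<close>
  have bound: "(\<integral>\<^sup>+x. u (x(i := a)) \<partial>?P) \<le> ennreal (c * (2 * \<bar>R\<bar>) ^ card I)"
    if c: "\<And>x. x \<in> extensional (insert i I) \<Longrightarrow> u x \<le> ennreal c"
      and s: "\<And>x j. x \<in> extensional (insert i I) \<Longrightarrow> j \<in> insert i I \<Longrightarrow> R < \<bar>x j\<bar> \<Longrightarrow> u x = 0" for u a
  proof -
    let ?B = "Pi\<^sub>E I (\<lambda>_. {- \<bar>R\<bar>..\<bar>R\<bar>})"
    have le: "u (x(i := a)) \<le> ennreal c * indicator ?B x" if "x \<in> space ?P" for x
    proof (cases "x \<in> ?B")
      case True
      then show ?thesis using c[OF ext, of x a] that by (auto simp: space_PiM PiE_def)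
    next
      case False
      then have "\<exists>j\<in>I. x j \<notin> {- \<bar>R\<bar>..\<bar>R\<bar>}" using that by (auto simp: space_PiM PiE_def)
      then obtain j where "j \<in> I" "R < \<bar>x j\<bar>" by force
      moreover have "j \<noteq> i" using \<open>j \<in> I\<close> insert.hyps by auto
      ultimately have "u (x(i := a)) = 0"
        using that s[OF ext, of x j a] insert.hyps by (auto simp: space_PiM PiE_def)
      then show ?thesis by simp
    qed
    have "(\<integral>\<^sup>+x. u (x(i := a)) \<partial>?P) \<le> (\<integral>\<^sup>+x. ennreal c * indicator ?B x \<partial>?P)"
      using le by (intro nn_integral_mono) auto
    also have "\<dots> = ennreal c * emeasure ?P ?B"
      using insert by (intro nn_integral_cmult_indicator) (auto intro!: sets_PiM_I_finite)
    also have "emeasure ?P ?B = ennreal ((2 * \<bar>R\<bar>) ^ card I)"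
      using insert by (subst emeasure_PiM) (auto simp: ennreal_power prod_constant)
    also have "ennreal c * ennreal ((2 * \<bar>R\<bar>) ^ card I) = ennreal (c * (2 * \<bar>R\<bar>) ^ card I)"
      by (rule ennreal_mult''[symmetric]) simp
    finally show ?thesis .
  qed
  have rev: "(\<integral>\<^sup>+x. u x \<partial>Pi\<^sub>M (insert i I) (\<lambda>_. lborel)) = (\<integral>\<^sup>+a. (\<integral>\<^sup>+x. u (x(i := a)) \<partial>?P) \<partial>lborel)"
    if "u \<in> borel_measurable (Pi\<^sub>M (insert i I) (\<lambda>_. lborel))" for u :: "_ \<Rightarrow> ennreal"
    using insert.hyps that by (rule product_nn_integral_insert_rev)
  have bf: "(\<integral>\<^sup>+x. f (x(i := a)) \<partial>?P) \<le> ennreal (c * (2 * \<bar>R\<bar>) ^ card I)" for a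
    by (rule bound) (use insert.prems(4,5) in blast)+
  have bg: "(\<integral>\<^sup>+x. g (x(i := a)) \<partial>?P) \<le> ennreal (c * (2 * \<bar>R\<bar>) ^ card I)" for a
    by (rule bound) (use insert.prems(4,5) in blast)+
  show ?case
    unfolding rev[OF insert.prems(1)] rev[OF insert.prems(2)] rev[OF insert.prems(3)]
  proof (rule prekopa_leindler_real[where R = "\<bar>R\<bar>" and c = "c * (2 * \<bar>R\<bar>) ^ card I"])
    fix a :: real assume a: "\<bar>R\<bar> < \<bar>a\<bar>"
    have "f (x(i := a)) = 0 \<and> g (x(i := a)) = 0" if "x \<in> space ?P" for x
    proof -
      have "x(i := a) \<in> extensional (insert i I)" using that by (intro ext) (auto simp: space_PiM PiE_def)
      then show ?thesis by (rule insert.prems(4)[where i = i]) (use a in auto)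
    qed
    then show "(\<integral>\<^sup>+x. f (x(i := a)) \<partial>?P) = 0 \<and> (\<integral>\<^sup>+x. g (x(i := a)) \<partial>?P) = 0"
      by (auto simp: nn_integral_0_iff_AE m1 insert.prems)
  next
    fix a b :: real
    show "(\<integral>\<^sup>+x. f (x(i := a)) \<partial>?P) * (\<integral>\<^sup>+x. g (x(i := b)) \<partial>?P) \<le> (\<integral>\<^sup>+x. h (x(i := (a - b) / 2)) \<partial>?P)\<^sup>2"
    proof (rule insert.IH)
      fix x y :: "'a \<Rightarrow> real" assume xy: "x \<in> extensional I" "y \<in> extensional I"
      have eq: "(\<lambda>j\<in>insert i I. ((x(i := a)) j - (y(i := b)) j) / 2) = (\<lambda>j\<in>I. (x j - y j) / 2)(i := (a - b) / 2)"
        using insert.hyps by (auto simp: fun_eq_iff)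
      show "f (x(i := a)) * g (y(i := b)) \<le> (h ((\<lambda>j\<in>I. (x j - y j) / 2)(i := (a - b) / 2)))\<^sup>2"
        using insert.prems(6)[OF ext[OF xy(1)] ext[OF xy(2)], of a b] unfolding eq .
    next
      fix x :: "'a \<Rightarrow> real" and j assume x: "x \<in> extensional I" "j \<in> I" "R < \<bar>x j\<bar>"
      then have "j \<noteq> i" using insert.hyps by auto
      then have "f (x(i := c)) = 0 \<and> g (x(i := c)) = 0" for c
        by (intro insert.prems(4)[where i = j] ext) (use x in auto)
      then show "f (x(i := a)) = 0 \<and> g (x(i := b)) = 0" by blast
    next
      fix x :: "'a \<Rightarrow> real" assume x: "x \<in> extensional I"
      show "f (x(i := a)) \<le> ennreal c \<and> g (x(i := b)) \<le> ennreal c"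
      proof -
        have "f (x(i := q)) \<le> ennreal c \<and> g (x(i := q)) \<le> ennreal c" for q
          by (intro insert.prems(5) ext x)
        then show ?thesis by blast
      qed
    qed (fact m1[OF insert.prems(1)] m1[OF insert.prems(2)] m1[OF insert.prems(3)])+
  qed (fact mF[OF insert.prems(1)] mF[OF insert.prems(2)] mF[OF insert.prems(3)] bf bg)+
qed

section \<open>Lebesgue measure on the coordinate plane and the isodiametric inequality\<close>

lemma coord_dirs:
  assumes "d \<le> DIM('a::euclidean_space)"
  shows "(coord_dirs d :: 'a set) \<subseteq> Basis" "card (coord_dirs d :: 'a set) = d"
proof -
  have "\<exists>D \<subseteq> (Basis :: 'a set). card D = d"
    using obtain_subset_with_card_n[OF assms] by metis
  then have "coord_dirs d \<subseteq> (Basis :: 'a set) \<and> card (coord_dirs d :: 'a set) = d"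
    unfolding coord_dirs_def by (rule someI_ex)
  then show "(coord_dirs d :: 'a set) \<subseteq> Basis" "card (coord_dirs d :: 'a set) = d" by auto
qed

definition coord_embed :: "nat \<Rightarrow> ('a \<Rightarrow> real) \<Rightarrow> 'a::euclidean_space" where
  "coord_embed d f = (\<Sum>b\<in>coord_dirs d. f b *\<^sub>R b)"

text \<open>Lebesgue measure of dimension d, carried to the coordinate plane but regarded as a Borel
  measure on the ambient space, so that it is defined on the same sets as the Hausdorff
  measure.\<close>

definition plane_lborel :: "nat \<Rightarrow> 'a::euclidean_space measure" where
  "plane_lborel d = distr (Pi\<^sub>M (coord_dirs d) (\<lambda>_. lborel)) borel (coord_embed d)"

lemma measurable_coord_embed [measurable]:
  "coord_embed d \<in> measurable (Pi\<^sub>M (coord_dirs d) (\<lambda>_. lborel)) (borel :: 'a::euclidean_space measure)"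
  unfolding coord_embed_def by measurable

context
  fixes d :: nat
  assumes d: "d \<le> DIM('a::euclidean_space)"
begin

lemma finite_coord_dirs: "finite (coord_dirs d :: 'a set)"
  using coord_dirs(1)[OF d] finite_Basis finite_subset by blast

lemma inner_coord_embed:
  assumes "b \<in> (Basis :: 'a set)"
  shows "coord_embed d f \<bullet> b = (if b \<in> coord_dirs d then f b else 0)"
proof -
  have "coord_embed d f \<bullet> b = (\<Sum>b'\<in>coord_dirs d. if b' = b then f b else 0)"
    unfolding coord_embed_def inner_sum_left using coord_dirs(1)[OF d] assms
    by (intro sum.cong) (auto simp: inner_Basis)
  then show ?thesis by (simp add: finite_coord_dirs)
qed

lemma norm_coord_embed: "norm (coord_embed d f :: 'a) = sqrt (\<Sum>b\<in>coord_dirs d. (f b)\<^sup>2)"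
proof -
  have "(\<Sum>b\<in>Basis. ((coord_embed d f :: 'a) \<bullet> b)\<^sup>2) = (\<Sum>b\<in>coord_dirs d. (f b)\<^sup>2)"
    using coord_dirs(1)[OF d] by (intro sum.mono_neutral_cong_right) (auto simp: inner_coord_embed subset_eq)
  then show ?thesis by (simp add: norm_eq_sqrt_inner euclidean_inner[of "coord_embed d f :: 'a" "coord_embed d f"] power2_eq_square)
qed

lemma emeasure_plane_lborel_cball:
  assumes "0 < r"
  shows "emeasure (plane_lborel d) (cball (0::'a) r) = ennreal (unit_ball_vol (real d) * r ^ d)"
proof -
  let ?P = "Pi\<^sub>M (coord_dirs d :: 'a set) (\<lambda>_. lborel :: real measure)"
  have "emeasure (plane_lborel d) (cball (0::'a) r) = emeasure ?P (coord_embed d -` cball 0 r \<inter> space ?P)"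
    unfolding plane_lborel_def by (subst emeasure_distr) auto
  also have "coord_embed d -` cball 0 r \<inter> space ?P = {f. sqrt (\<Sum>b\<in>coord_dirs d. (f b)\<^sup>2) \<le> r} \<inter> space ?P"
    by (auto simp: norm_coord_embed)
  also have "emeasure ?P \<dots> = ennreal (unit_ball_vol (real (card (coord_dirs d :: 'a set))) * r ^ card (coord_dirs d :: 'a set))"
    using assms by (intro emeasure_cball_aux finite_coord_dirs)
  finally show ?thesis by (simp add: coord_dirs(2)[OF d])
qed

text \<open>Prekopa-Leindler with \<open>f = g\<close> the indicator of \<open>K\<close> and
  \<open>h\<close> that of the ball of radius \<open>r\<close>: half the difference of two points of
  \<open>K\<close> has norm at most \<open>r\<close>. Taking differences plays the part of a
  symmetrization.\<close>

lemma isodiametric_inequality: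
  assumes K: "compact (K :: 'a set)" and r: "0 < r" "diameter K \<le> 2 * r"
  shows "emeasure (plane_lborel d) K \<le> ennreal (unit_ball_vol (real d) * r ^ d)"
proof -
  let ?P = "Pi\<^sub>M (coord_dirs d :: 'a set) (\<lambda>_. lborel :: real measure)"
  let ?e = "coord_embed d :: ('a \<Rightarrow> real) \<Rightarrow> 'a"
  have [measurable]: "K \<in> sets borel" using K by (rule borel_compact)
  have dist: "emeasure (plane_lborel d) S = (\<integral>\<^sup>+x. indicator S (?e x) \<partial>?P)" if [measurable]: "S \<in> sets borel" for S
    unfolding plane_lborel_def
    by (simp add: nn_integral_indicator[symmetric] nn_integral_distr del: nn_integral_indicator)
  obtain R where R: "\<And>x. x \<in> K \<Longrightarrow> norm x \<le> R" using K compact_imp_bounded bounded_iff by metis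
  have "(\<integral>\<^sup>+x. indicator K (?e x) \<partial>?P) * (\<integral>\<^sup>+x. indicator K (?e x) \<partial>?P) \<le> (\<integral>\<^sup>+x. indicator (cball 0 r) (?e x) \<partial>?P)\<^sup>2"
  proof (rule prekopa_leindler_PiM[where R = R and c = 1])
    fix x :: "'a \<Rightarrow> real" and b :: 'a assume x: "b \<in> coord_dirs d" "R < \<bar>x b\<bar>"
    have "\<bar>?e x \<bullet> b\<bar> \<le> norm (?e x)" using x coord_dirs(1)[OF d] by (intro Basis_le_norm) auto
    then have "R < norm (?e x)" using x coord_dirs(1)[OF d] inner_coord_embed[of b x] by auto
    then have "?e x \<notin> K" using R by force
    then show "indicator K (?e x) = 0 \<and> indicator K (?e x) = (0 :: ennreal)" by simp
  next
    fix x y :: "'a \<Rightarrow> real"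
    have eq: "?e (\<lambda>i\<in>coord_dirs d. (x i - y i) / 2) = (1/2) *\<^sub>R (?e x - ?e y)"
      unfolding coord_embed_def by (simp add: sum_subtractf[symmetric] scaleR_sum_right algebra_simps diff_divide_distrib)
    show "indicator K (?e x) * indicator K (?e y) \<le> (indicator (cball 0 r) (?e (\<lambda>i\<in>coord_dirs d. (x i - y i) / 2)) :: ennreal)\<^sup>2"
    proof (cases "?e x \<in> K \<and> ?e y \<in> K")
      case True
      then have "dist (?e x) (?e y) \<le> 2 * r"
        using diameter_bounded_bound[OF compact_imp_bounded[OF K], of "?e x" "?e y"] r by auto
      then have "norm (?e (\<lambda>i\<in>coord_dirs d. (x i - y i) / 2)) \<le> r" unfolding eq by (simp add: dist_norm)
      then show ?thesis using True by simp
    qed (auto simp: indicator_def)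
  qed (auto simp: finite_coord_dirs indicator_def)
  then have "(emeasure (plane_lborel d) K)\<^sup>2 \<le> (emeasure (plane_lborel d) (cball (0::'a) r))\<^sup>2"
    by (simp add: dist power2_eq_square)
  then have "emeasure (plane_lborel d) K \<le> emeasure (plane_lborel d) (cball (0::'a) r)"
    by (metis ennreal_mult_strict_mono not_le power2_eq_square)
  then show ?thesis by (simp add: emeasure_plane_lborel_cball r)
qed

end

section \<open>Hausdorff measure on the coordinate plane\<close>

lemma hausdorff_outer_similarity:
  assumes r: "0 < r" and sim: "\<And>x y. x \<in> E \<Longrightarrow> y \<in> E \<Longrightarrow> dist (g x) (g y) = r * dist x y"
  shows "hausdorff_outer d (g ` E) = ennreal (r ^ d) * hausdorff_outer d E"
proof (rule antisym)
  show "hausdorff_outer d (g ` E) \<le> ennreal (r ^ d) * hausdorff_outer d E"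
    using r sim by (intro hausdorff_outer_lipschitz) auto
  have inj: "inj_on g E" using r sim by (intro inj_onI) (metis dist_eq_0_iff mult_eq_0_iff less_irrefl)
  have "hausdorff_outer d (inv_into E g ` g ` E) \<le> ennreal ((1/r) ^ d) * hausdorff_outer d (g ` E)"
    using r sim by (intro hausdorff_outer_lipschitz) (auto simp: inv_into_f_f[OF inj])
  then have "ennreal (r ^ d) * hausdorff_outer d E \<le> ennreal (r ^ d) * (ennreal ((1/r) ^ d) * hausdorff_outer d (g ` E))"
    using inj by (intro mult_left_mono) auto
  also have "\<dots> = hausdorff_outer d (g ` E)"
    using r by (simp add: mult.assoc[symmetric] ennreal_mult[symmetric] power_one_over)
  finally show "ennreal (r ^ d) * hausdorff_outer d E \<le> hausdorff_outer d (g ` E)" .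
qed

lemma hausdorff_pre_Un_le:
  assumes "1 \<le> d" "0 \<le> \<delta>"
  shows "hausdorff_pre d \<delta> (E \<union> F) \<le> hausdorff_pre d \<delta> E + hausdorff_pre d \<delta> F"
proof -
  let ?G = "\<lambda>n::nat. if n = 0 then E else if n = 1 then F else {}"
  have "(\<Union>n. ?G n) = E \<union> F" by (auto split: if_splits)
  then have "hausdorff_pre d \<delta> (E \<union> F) \<le> (\<Sum>n. hausdorff_pre d \<delta> (?G n))"
    using hausdorff_pre_UN_le[of d \<delta> ?G] by simp
  also have "\<dots> = hausdorff_pre d \<delta> E + hausdorff_pre d \<delta> F"
    by (rule suminf_binary_ennreal) (auto simp: hausdorff_pre_empty[OF assms])
  finally show ?thesis .
qed

lemma hausdorff_pre_finite_UN_le: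
  assumes "1 \<le> d" "0 \<le> \<delta>" "finite I"
  shows "hausdorff_pre d \<delta> (\<Union>i\<in>I. E i) \<le> (\<Sum>i\<in>I. hausdorff_pre d \<delta> (E i))"
  using assms(3)
proof induction
  case (insert i I)
  have "hausdorff_pre d \<delta> (\<Union>i\<in>insert i I. E i) \<le> hausdorff_pre d \<delta> (E i) + hausdorff_pre d \<delta> (\<Union>i\<in>I. E i)"
    using hausdorff_pre_Un_le[OF assms(1,2)] by simp
  also have "\<dots> \<le> hausdorff_pre d \<delta> (E i) + (\<Sum>i\<in>I. hausdorff_pre d \<delta> (E i))"
    by (intro add_left_mono insert)
  finally show ?case using insert by simp
qed (simp add: hausdorff_pre_empty[OF assms(1,2)])

lemma hausdorff_outer_finite_UN_le:
  assumes "1 \<le> d" "finite I"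
  shows "hausdorff_outer d (\<Union>i\<in>I. E i) \<le> (\<Sum>i\<in>I. hausdorff_outer d (E i))"
  using assms(2)
proof induction
  case (insert i I)
  have "hausdorff_outer d (\<Union>i\<in>insert i I. E i) \<le> hausdorff_outer d (E i) + hausdorff_outer d (\<Union>i\<in>I. E i)"
    using hausdorff_outer_Un_le[OF assms(1)] by simp
  also have "\<dots> \<le> hausdorff_outer d (E i) + (\<Sum>i\<in>I. hausdorff_outer d (E i))"
    by (intro add_left_mono insert)
  finally show ?case using insert by simp
qed (simp add: hausdorff_outer_empty[OF assms(1)])

lemma hausdorff_pre_le_diameter:
  assumes "1 \<le> d" "bounded E" "diameter E \<le> \<delta>" "0 \<le> \<delta>"
  shows "hausdorff_pre d \<delta> E \<le> ennreal (hausdorff_const d * diameter E ^ d)"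
proof -
  let ?G = "\<lambda>n::nat. if n = 0 then E else {}"
  have "hausdorff_pre d \<delta> E \<le> (\<Sum>i. ennreal (hausdorff_const d * diameter (?G i) ^ d))"
    using assms by (intro hausdorff_pre_le) (auto split: if_splits)
  also have "\<dots> = ennreal (hausdorff_const d * diameter E ^ d)"
    using suminf_finite[of "{0}" "\<lambda>i. ennreal (hausdorff_const d * diameter (?G i) ^ d)"] assms(1)
    by (simp add: power_0_left)
  finally show ?thesis .
qed

text \<open>For estimates that are available only at sizes strictly above \<open>r\<close>: the
  isodiametric inequality asks for a positive radius, and a closed cube fits only into a strictly
  larger half-open one.\<close>

lemma ennreal_le_power_right:
  assumes "\<And>t. r < t \<Longrightarrow> x \<le> ennreal (C * t ^ d)"
  shows "x \<le> ennreal (C * r ^ d)"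
proof (rule tendsto_lowerbound)
  show "((\<lambda>t. ennreal (C * t ^ d)) \<longlongrightarrow> ennreal (C * r ^ d)) (at_right r)"
    by (intro tendsto_ennrealI tendsto_intros)
  show "\<forall>\<^sub>F t in at_right r. x \<le> ennreal (C * t ^ d)"
    using eventually_at_right_less[of r] by eventually_elim (rule assms)
qed simp

lemma ennreal_power_le_left:
  assumes "\<And>t. 0 < t \<Longrightarrow> t < r \<Longrightarrow> ennreal (C * t ^ d) \<le> x" "0 < r"
  shows "ennreal (C * r ^ d) \<le> x"
proof (rule tendsto_upperbound)
  show "((\<lambda>t. ennreal (C * t ^ d)) \<longlongrightarrow> ennreal (C * r ^ d)) (at_left r)"
    by (intro tendsto_ennrealI tendsto_intros)
  show "\<forall>\<^sub>F t in at_left r. ennreal (C * t ^ d) \<le> x"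
    using assms by (auto simp: eventually_at_left)
qed simp

section \<open>Grids of cubes in the coordinate plane\<close>

definition half_open_cube :: "nat \<Rightarrow> 'a::euclidean_space \<Rightarrow> real \<Rightarrow> 'a set" where
  "half_open_cube d a r = {x \<in> coord_plane d. \<forall>b\<in>coord_dirs d. a \<bullet> b \<le> x \<bullet> b \<and> x \<bullet> b < a \<bullet> b + r}"

definition closed_cube :: "nat \<Rightarrow> 'a::euclidean_space \<Rightarrow> real \<Rightarrow> 'a set" where
  "closed_cube d a r = {x \<in> coord_plane d. \<forall>b\<in>coord_dirs d. a \<bullet> b \<le> x \<bullet> b \<and> x \<bullet> b \<le> a \<bullet> b + r}"

definition open_cube :: "nat \<Rightarrow> 'a::euclidean_space \<Rightarrow> real \<Rightarrow> 'a set" where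
  "open_cube d a r = {x \<in> coord_plane d. \<forall>b\<in>coord_dirs d. a \<bullet> b < x \<bullet> b \<and> x \<bullet> b < a \<bullet> b + r}"

definition grid_point :: "nat \<Rightarrow> nat \<Rightarrow> ('a \<Rightarrow> int) \<Rightarrow> 'a::euclidean_space" where
  "grid_point d m z = coord_embed d (\<lambda>b. real_of_int (z b) / real m)"

text \<open>Restricting to \<open>coord_dirs d\<close> makes indices extensional, so that different
  indices name disjoint cells.\<close>

definition grid_index :: "nat \<Rightarrow> nat \<Rightarrow> 'a::euclidean_space \<Rightarrow> ('a \<Rightarrow> int)" where
  "grid_index d m x = (\<lambda>b\<in>coord_dirs d. \<lfloor>real m * (x \<bullet> b)\<rfloor>)"

abbreviation grid_cell :: "nat \<Rightarrow> nat \<Rightarrow> ('a \<Rightarrow> int) \<Rightarrow> 'a::euclidean_space set" where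
  "grid_cell d m z \<equiv> half_open_cube d (grid_point d m z) (1 / real m)"

text \<open>The closed cube, not just the half-open cell, has to fit into \<open>U\<close>: the
  cells give disjointness, while the closed cubes later become patches.\<close>

definition inner_cells :: "nat \<Rightarrow> nat \<Rightarrow> 'a::euclidean_space set \<Rightarrow> ('a \<Rightarrow> int) set" where
  "inner_cells d m U = {z \<in> extensional (coord_dirs d). closed_cube d (grid_point d m z) (1 / real m) \<subseteq> U}"

lemma open_cube_subset: "open_cube d a r \<subseteq> half_open_cube d a r"
  by (auto simp: open_cube_def half_open_cube_def less_imp_le)

lemma half_open_cube_subset: "half_open_cube d a r \<subseteq> closed_cube d a r"
  by (auto simp: closed_cube_def half_open_cube_def less_imp_le)

lemma subspace_coord_plane: "subspace (coord_plane d :: 'a::euclidean_space set)"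
  by (auto simp: subspace_def coord_plane_def inner_add_left)

lemma closed_coord_plane: "closed (coord_plane d :: 'a::euclidean_space set)"
  by (rule closed_subspace[OF subspace_coord_plane])

lemma borel_coord_plane [measurable, simp]: "coord_plane d \<in> sets (borel :: 'a::euclidean_space measure)"
  by (rule borel_closed[OF closed_coord_plane])

lemma closed_closed_cube: "closed (closed_cube d a r :: 'a::euclidean_space set)"
proof -
  have "closed_cube d a r = coord_plane d \<inter> (\<Inter>b\<in>coord_dirs d. {x. a \<bullet> b \<le> x \<bullet> b} \<inter> {x. x \<bullet> b \<le> a \<bullet> b + r})"
    by (auto simp: closed_cube_def)
  also have "closed \<dots>"
    by (intro closed_Int closed_coord_plane closed_INT ballI closed_Collect_le continuous_intros)
  finally show ?thesis .
qed

lemma unit_cube_eq: "unit_cube d = closed_cube d 0 1"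
  by (simp add: unit_cube_def closed_cube_def)

context
  fixes d :: nat
  assumes d: "d \<le> DIM('a::euclidean_space)" and d1: "1 \<le> d"
begin

private abbreviation "D \<equiv> coord_dirs d :: 'a set"
private abbreviation "plane \<equiv> coord_plane d :: 'a set"

lemmas dirs = coord_dirs[OF d] finite_coord_dirs[OF d]

lemma coord_embed_in_plane: "(coord_embed d f :: 'a) \<in> plane"
  by (auto simp: coord_plane_def inner_coord_embed[OF d])

lemma plane_lborel_plane: "S \<in> sets borel \<Longrightarrow> emeasure (plane_lborel d) S = emeasure (plane_lborel d) (S \<inter> plane)"
  using coord_embed_in_plane unfolding plane_lborel_def
  by (subst (1 2) emeasure_distr) (auto intro!: arg_cong2[where f = emeasure])

lemma sets_plane_lborel [simp]: "sets (plane_lborel d :: 'a measure) = sets borel"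
  by (simp add: plane_lborel_def)

text \<open>The l1 norm is used as a bound, which yields the factor \<open>d\<close> in place of its
  square root; cubes only have to become small, so the constant is harmless.\<close>

lemma dist_plane_le:
  assumes "x \<in> plane" "y \<in> plane" "\<And>b. b \<in> D \<Longrightarrow> \<bar>x \<bullet> b - y \<bullet> b\<bar> \<le> r"
  shows "dist x y \<le> real d * r"
proof -
  have "dist x y \<le> (\<Sum>b\<in>Basis. \<bar>(x - y) \<bullet> b\<bar>)" unfolding dist_norm by (rule norm_le_l1)
  also have "\<dots> = (\<Sum>b\<in>D. \<bar>(x - y) \<bullet> b\<bar>)"
    using dirs assms(1,2) by (intro sum.mono_neutral_right) (auto simp: coord_plane_def inner_diff_left)
  also have "\<dots> \<le> (\<Sum>b\<in>D. r)" using assms(3) by (intro sum_mono) (auto simp: inner_diff_left)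
  finally show ?thesis using dirs by simp
qed

lemma closed_cube_dist: "x \<in> closed_cube d a r \<Longrightarrow> y \<in> closed_cube d a r \<Longrightarrow> dist x y \<le> real d * r"
  for x :: 'a by (rule dist_plane_le) (force simp: closed_cube_def)+

lemma bounded_closed_cube: "bounded (closed_cube d a r :: 'a set)"
  using closed_cube_dist bounded_two_points by blast

lemma compact_closed_cube: "compact (closed_cube d a r :: 'a set)"
  using closed_closed_cube bounded_closed_cube compact_eq_bounded_closed by blast

lemma convex_closed_cube: "convex (closed_cube d a r :: 'a set)"
proof -
  have "closed_cube d a r = plane \<inter> (\<Inter>b\<in>D. {x. b \<bullet> x \<ge> a \<bullet> b} \<inter> {x. b \<bullet> x \<le> a \<bullet> b + r})"
    by (auto simp: closed_cube_def inner_commute)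
  also have "convex \<dots>"
    by (intro convex_Int subspace_imp_convex subspace_coord_plane convex_INT convex_halfspace_ge convex_halfspace_le)
  finally show ?thesis .
qed

lemma D_nonempty: "D \<noteq> {}"
  using dirs(2) d1 by auto

lemma sets_cubes [measurable, simp]:
  "(half_open_cube d a r :: 'a set) \<in> sets borel" "(open_cube d a r :: 'a set) \<in> sets borel" "(closed_cube d a r :: 'a set) \<in> sets borel"
proof -
  have "half_open_cube d a r = plane \<inter> (\<Inter>b\<in>D. {x. a \<bullet> b \<le> x \<bullet> b} \<inter> {x. x \<bullet> b < a \<bullet> b + r})"
    by (auto simp: half_open_cube_def)
  also have "\<dots> \<in> sets borel"
    using dirs D_nonempty by (intro sets.Int sets.finite_INT borel_coord_plane) auto
  finally show "half_open_cube d a r \<in> sets borel" .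
  have "open_cube d a r = plane \<inter> (\<Inter>b\<in>D. {x. a \<bullet> b < x \<bullet> b} \<inter> {x. x \<bullet> b < a \<bullet> b + r})"
    by (auto simp: open_cube_def)
  also have "\<dots> \<in> sets borel"
    using dirs D_nonempty by (intro sets.Int sets.finite_INT borel_coord_plane) auto
  finally show "open_cube d a r \<in> sets borel" .
qed (rule borel_closed[OF closed_closed_cube])

lemma openin_open_cube: "openin (top_of_set plane) (open_cube d a r)"
proof -
  have "open_cube d a r = plane \<inter> (\<Inter>b\<in>D. {x. a \<bullet> b < x \<bullet> b} \<inter> {x. x \<bullet> b < a \<bullet> b + r})"
    by (auto simp: open_cube_def)
  moreover have "open (\<Inter>b\<in>D. {x. a \<bullet> b < x \<bullet> b} \<inter> {x. x \<bullet> b < a \<bullet> b + r})"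
    using dirs by (intro open_INT open_Int open_Collect_less ballI continuous_intros) auto
  ultimately show ?thesis by auto
qed

lemma emeasure_plane_lborel_cube:
  assumes "0 \<le> r" shows "emeasure (plane_lborel d) (half_open_cube d a r :: 'a set) = ennreal (r ^ d)"
proof -
  interpret product_sigma_finite "\<lambda>_. lborel :: real measure" ..
  let ?P = "Pi\<^sub>M D (\<lambda>_. lborel :: real measure)"
  have "emeasure (plane_lborel d) (half_open_cube d a r) = emeasure ?P (coord_embed d -` half_open_cube d a r \<inter> space ?P)"
    unfolding plane_lborel_def by (subst emeasure_distr) auto
  also have "coord_embed d -` half_open_cube d a r \<inter> space ?P = Pi\<^sub>E D (\<lambda>b. {a \<bullet> b..<a \<bullet> b + r})"
    using dirs(1) by (auto simp: half_open_cube_def coord_embed_in_plane inner_coord_embed[OF d] space_PiM PiE_def Pi_def subset_eq)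
  also have "emeasure ?P \<dots> = (\<Prod>b\<in>D. ennreal r)"
    using dirs assms by (subst emeasure_PiM) auto
  finally show ?thesis using dirs assms by (simp add: ennreal_power)
qed

lemma affine_cube:
  assumes a: "a \<in> plane" and r: "0 < r"
  shows "(\<lambda>x. a + r *\<^sub>R x) ` half_open_cube d 0 1 = (half_open_cube d a r :: 'a set)"
    and "(\<lambda>x. a + r *\<^sub>R x) ` closed_cube d 0 1 = (closed_cube d a r :: 'a set)"
proof -
  have inv: "a + r *\<^sub>R ((1/r) *\<^sub>R (x - a)) = x" for x using r by simp
  have pl: "a + r *\<^sub>R x \<in> plane" if "x \<in> plane" for x
    using subspace_coord_plane a that by (intro subspace_add subspace_scale)
  have pl': "(1/r) *\<^sub>R (x - a) \<in> plane" if "x \<in> plane" for x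
    using subspace_coord_plane a that by (intro subspace_diff subspace_scale)
  have "(1/r) *\<^sub>R (x - a) \<in> half_open_cube d 0 1" if "x \<in> half_open_cube d a r" for x
    using that r pl' by (auto simp: half_open_cube_def inner_diff_left field_simps)
  then have "half_open_cube d a r \<subseteq> (\<lambda>x. a + r *\<^sub>R x) ` half_open_cube d 0 1"
    using inv by (metis (no_types, lifting) image_iff subsetI)
  moreover have "(\<lambda>x. a + r *\<^sub>R x) ` half_open_cube d 0 1 \<subseteq> half_open_cube d a r"
    using r pl by (auto simp: half_open_cube_def inner_add_left field_simps)
  ultimately show "(\<lambda>x. a + r *\<^sub>R x) ` half_open_cube d 0 1 = half_open_cube d a r" by auto
  have "(1/r) *\<^sub>R (x - a) \<in> closed_cube d 0 1" if "x \<in> closed_cube d a r" for x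
    using that r pl' by (auto simp: closed_cube_def inner_diff_left field_simps)
  then have "closed_cube d a r \<subseteq> (\<lambda>x. a + r *\<^sub>R x) ` closed_cube d 0 1"
    using inv by (metis (no_types, lifting) image_iff subsetI)
  moreover have "(\<lambda>x. a + r *\<^sub>R x) ` closed_cube d 0 1 \<subseteq> closed_cube d a r"
    using r pl by (auto simp: closed_cube_def inner_add_left field_simps)
  ultimately show "(\<lambda>x. a + r *\<^sub>R x) ` closed_cube d 0 1 = closed_cube d a r" by auto
qed

lemma hausdorff_cube_scale:
  assumes "a \<in> plane" "0 < r"
  shows "hausdorff_outer d (half_open_cube d a r :: 'a set) = ennreal (r ^ d) * hausdorff_outer d (half_open_cube d 0 1 :: 'a set)"
  unfolding affine_cube(1)[OF assms, symmetric]
  using assms by (intro hausdorff_outer_similarity) (auto simp: dist_norm scaleR_diff_right[symmetric])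

lemma grid_point_in_plane: "(grid_point d m z :: 'a) \<in> plane"
  by (simp add: grid_point_def coord_embed_in_plane)

lemma inner_grid_point: "b \<in> D \<Longrightarrow> grid_point d m z \<bullet> b = real_of_int (z b) / real m"
  using dirs(1) by (auto simp: grid_point_def inner_coord_embed[OF d])

lemma grid_cell_iff:
  assumes "0 < m" "z \<in> extensional D"
  shows "x \<in> grid_cell d m z \<longleftrightarrow> x \<in> plane \<and> grid_index d m x = z"
proof -
  have "(real_of_int (z b) / real m \<le> x \<bullet> b \<and> x \<bullet> b < real_of_int (z b) / real m + 1 / real m) \<longleftrightarrow> \<lfloor>real m * (x \<bullet> b)\<rfloor> = z b" for b
    using assms(1) by (auto simp: floor_eq_iff field_simps)
  then have "x \<in> grid_cell d m z \<longleftrightarrow> x \<in> plane \<and> (\<forall>b\<in>D. \<lfloor>real m * (x \<bullet> b)\<rfloor> = z b)"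
    by (auto simp: half_open_cube_def inner_grid_point)
  also have "\<dots> \<longleftrightarrow> x \<in> plane \<and> grid_index d m x = z"
    using assms(2) by (auto simp: grid_index_def fun_eq_iff extensional_def restrict_def)
  finally show ?thesis .
qed

lemma grid_index_extensional: "(grid_index d m (x::'a)) \<in> extensional D"
  by (simp add: grid_index_def)

lemma disjoint_grid_cells:
  assumes "0 < m" shows "disjoint_family_on (\<lambda>z. grid_cell d m z :: 'a set) (extensional D)"
  by (auto simp: disjoint_family_on_def grid_cell_iff[OF assms])

lemma half_open_cube_eq_grid:
  assumes "0 < m"
  shows "(half_open_cube d 0 1 :: 'a set) = (\<Union>z\<in>Pi\<^sub>E D (\<lambda>_. {0..<int m}). grid_cell d m z)" (is "?L = ?R")
proof -
  have iff: "(0 \<le> x \<bullet> b \<and> x \<bullet> b < 1) \<longleftrightarrow> \<lfloor>real m * (x \<bullet> b)\<rfloor> \<in> {0..<int m}" for x b :: 'a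
    using assms by (auto simp: le_floor_iff floor_less_iff zero_le_mult_iff)
  have "x \<in> ?L \<longleftrightarrow> x \<in> plane \<and> grid_index d m x \<in> Pi\<^sub>E D (\<lambda>_. {0..<int m})" for x
    using iff grid_index_extensional by (auto simp: half_open_cube_def PiE_def Pi_def grid_index_def)
  moreover have "x \<in> ?R \<longleftrightarrow> x \<in> plane \<and> grid_index d m x \<in> Pi\<^sub>E D (\<lambda>_. {0..<int m})" for x
    using grid_cell_iff[OF assms] by (auto simp: PiE_def)
  ultimately show ?thesis by (intro set_eqI) simp
qed

lemma card_grid: "card (Pi\<^sub>E D (\<lambda>_. {0..<int m})) = m ^ d" "finite (Pi\<^sub>E D (\<lambda>_. {0..<int m}))"
  using dirs by (simp_all add: card_PiE finite_PiE)

text \<open>\<open>m ^ d\<close> cells of diameter at most \<open>d / m\<close> cost at most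
  \<open>hausdorff_const d * real d ^ d\<close> altogether, whatever \<open>m\<close> is.\<close>

lemma hausdorff_cube_finite: "hausdorff_outer d (half_open_cube d 0 1 :: 'a set) < top"
proof -
  have "hausdorff_outer d (half_open_cube d 0 1 :: 'a set) \<le> ennreal (hausdorff_const d * real d ^ d)"
  proof (rule hausdorff_outer_least)
    fix \<delta> :: real assume \<delta>: "0 < \<delta>"
    obtain m :: nat where m: "real d / \<delta> < real m" using reals_Archimedean2 by blast
    then have m0: "0 < m" using \<delta> d1 by (intro gr0I) (auto simp: divide_less_0_iff)
    have m\<delta>: "real d * (1 / real m) \<le> \<delta>" using m m0 \<delta> by (simp add: field_simps)
    have "hausdorff_pre d \<delta> (grid_cell d m z :: 'a set) \<le> ennreal (hausdorff_const d * (real d * (1 / real m)) ^ d)" for z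
    proof -
      have diam: "diameter (grid_cell d m z :: 'a set) \<le> real d * (1 / real m)"
        using closed_cube_dist[OF subsetD[OF half_open_cube_subset] subsetD[OF half_open_cube_subset],
            of _ "grid_point d m z" "1 / real m"]
        by (intro diameter_le) (auto simp: dist_norm)
      have bd: "bounded (grid_cell d m z :: 'a set)"
        by (rule bounded_subset[OF bounded_closed_cube half_open_cube_subset])
      have "hausdorff_pre d \<delta> (grid_cell d m z :: 'a set) \<le> ennreal (hausdorff_const d * diameter (grid_cell d m z :: 'a set) ^ d)"
        using \<delta> diam m\<delta> by (intro hausdorff_pre_le_diameter d1 bd) auto
      also have "\<dots> \<le> ennreal (hausdorff_const d * (real d * (1 / real m)) ^ d)"
        using diam diameter_ge_0[OF bd] by (intro ennreal_leI mult_left_mono power_mono) auto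
      finally show ?thesis .
    qed
    then have "hausdorff_pre d \<delta> (half_open_cube d 0 1 :: 'a set) \<le> (\<Sum>z\<in>Pi\<^sub>E D (\<lambda>_. {0..<int m}). ennreal (hausdorff_const d * (real d * (1 / real m)) ^ d))"
      unfolding half_open_cube_eq_grid[OF m0] using \<delta> card_grid
      by (intro order_trans[OF hausdorff_pre_finite_UN_le] sum_mono d1) auto
    also have "\<dots> = ennreal (real (m ^ d) * (hausdorff_const d * (real d * (1 / real m)) ^ d))"
      by (simp add: card_grid ennreal_of_nat_eq_real_of_nat ennreal_mult'')
    also have "real (m ^ d) * (hausdorff_const d * (real d * (1 / real m)) ^ d) = hausdorff_const d * real d ^ d"
      using m0 by (simp add: power_mult_distrib power_one_over field_simps)
    finally show "hausdorff_pre d \<delta> (half_open_cube d 0 1 :: 'a set) \<le> ennreal (hausdorff_const d * real d ^ d)" .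
  qed
  then show ?thesis by (rule order_le_less_trans) simp
qed

lemma inner_cells_finite:
  assumes U: "bounded (U :: 'a set)" and m: "0 < m"
  shows "finite (inner_cells d m U)"
proof -
  obtain R where R: "\<And>x. x \<in> U \<Longrightarrow> norm x \<le> R" using U bounded_iff by metis
  have "inner_cells d m U \<subseteq> Pi\<^sub>E D (\<lambda>_. {- \<lceil>R * real m\<rceil>..\<lceil>R * real m\<rceil>})"
  proof
    fix z assume z: "z \<in> inner_cells d m U"
    have "grid_point d m z \<in> closed_cube d (grid_point d m z) (1 / real m)"
      by (simp add: closed_cube_def grid_point_in_plane)
    then have n: "norm (grid_point d m z) \<le> R" using z R by (auto simp: inner_cells_def)
    have "z b \<in> {- \<lceil>R * real m\<rceil>..\<lceil>R * real m\<rceil>}" if b: "b \<in> D" for b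
    proof -
      have "\<bar>real_of_int (z b) / real m\<bar> \<le> R"
        using Basis_le_norm[of b "grid_point d m z"] n b dirs(1) inner_grid_point[OF b, of m z] by auto
      then have "\<bar>real_of_int (z b)\<bar> \<le> R * real m" using m by (simp add: field_simps)
      then show ?thesis by (auto simp: abs_le_iff) linarith+
    qed
    then show "z \<in> Pi\<^sub>E D (\<lambda>_. {- \<lceil>R * real m\<rceil>..\<lceil>R * real m\<rceil>})"
      using z by (auto simp: inner_cells_def PiE_def)
  qed
  then show ?thesis using dirs by (auto intro: finite_subset finite_PiE)
qed

text \<open>By translation and scaling both measures of a cell are fixed multiples of
  \<open>(1 / m) ^ d\<close>, so on unions of cells they are proportional. The factor is the
  Hausdorff measure of the unit cube, at this stage known only to be finite.\<close>

lemma emeasure_inner_cells: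
  assumes m: "0 < m" and Z: "finite Z" "Z \<subseteq> extensional D"
  shows "emeasure (hausdorff_measure d) (\<Union>z\<in>Z. grid_cell d m z :: 'a set)
       = hausdorff_outer d (half_open_cube d 0 1 :: 'a set) * ennreal (real (card Z) * (1 / real m) ^ d)"
    and "emeasure (plane_lborel d) (\<Union>z\<in>Z. grid_cell d m z :: 'a set) = ennreal (real (card Z) * (1 / real m) ^ d)"
proof -
  have dj: "disjoint_family_on (\<lambda>z. grid_cell d m z :: 'a set) Z"
    using disjoint_grid_cells[OF m] Z(2) by (auto simp: disjoint_family_on_def)
  have "emeasure (hausdorff_measure d) (\<Union>z\<in>Z. grid_cell d m z :: 'a set) = (\<Sum>z\<in>Z. emeasure (hausdorff_measure d) (grid_cell d m z :: 'a set))"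
    using Z dj by (intro sum_emeasure[symmetric]) auto
  also have "\<dots> = (\<Sum>z\<in>Z. ennreal ((1 / real m) ^ d) * hausdorff_outer d (half_open_cube d 0 1 :: 'a set))"
    using m by (intro sum.cong refl) (simp add: emeasure_hausdorff_measure[OF d1] hausdorff_cube_scale grid_point_in_plane)
  also have "\<dots> = hausdorff_outer d (half_open_cube d 0 1 :: 'a set) * ennreal (real (card Z) * (1 / real m) ^ d)"
    by (simp add: ennreal_mult ennreal_of_nat_eq_real_of_nat mult_ac)
  finally show "emeasure (hausdorff_measure d) (\<Union>z\<in>Z. grid_cell d m z :: 'a set)
       = hausdorff_outer d (half_open_cube d 0 1 :: 'a set) * ennreal (real (card Z) * (1 / real m) ^ d)" .
  have "emeasure (plane_lborel d) (\<Union>z\<in>Z. grid_cell d m z :: 'a set) = (\<Sum>z\<in>Z. emeasure (plane_lborel d) (grid_cell d m z :: 'a set))"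
    using Z dj by (intro sum_emeasure[symmetric]) auto
  also have "\<dots> = (\<Sum>z\<in>Z. ennreal ((1 / real m) ^ d))"
    by (intro sum.cong refl emeasure_plane_lborel_cube) simp
  also have "\<dots> = ennreal (real (card Z) * (1 / real m) ^ d)"
    by (simp add: ennreal_mult ennreal_of_nat_eq_real_of_nat)
  finally show "emeasure (plane_lborel d) (\<Union>z\<in>Z. grid_cell d m z :: 'a set) = ennreal (real (card Z) * (1 / real m) ^ d)" .
qed

lemma inner_cells_cover:
  assumes m: "0 < m"
  shows "(\<Union>z\<in>inner_cells d m U. grid_cell d m z :: 'a set) =
    {x \<in> plane. closed_cube d (grid_point d m (grid_index d m x)) (1 / real m) \<subseteq> U}"
proof (intro set_eqI iffI)
  fix x :: 'a assume "x \<in> (\<Union>z\<in>inner_cells d m U. grid_cell d m z)"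
  then obtain z where z: "z \<in> inner_cells d m U" "x \<in> grid_cell d m z" by blast
  then have "x \<in> plane" "grid_index d m x = z"
    using grid_cell_iff[OF m, of z x] by (auto simp: inner_cells_def)
  then show "x \<in> {x \<in> plane. closed_cube d (grid_point d m (grid_index d m x)) (1 / real m) \<subseteq> U}"
    using z(1) by (auto simp: inner_cells_def)
next
  fix x :: 'a assume x: "x \<in> {x \<in> plane. closed_cube d (grid_point d m (grid_index d m x)) (1 / real m) \<subseteq> U}"
  then have "grid_index d m x \<in> inner_cells d m U"
    using grid_index_extensional by (simp add: inner_cells_def)
  moreover have "x \<in> grid_cell d m (grid_index d m x)"
    using x grid_cell_iff[OF m grid_index_extensional[of m x], of x] by simp
  ultimately show "x \<in> (\<Union>z\<in>inner_cells d m U. grid_cell d m z)" by blast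
qed

lemma grid_cell_self: "0 < m \<Longrightarrow> x \<in> plane \<Longrightarrow> x \<in> grid_cell d m (grid_index d m x)"
  by (simp add: grid_cell_iff grid_index_extensional)

text \<open>Dyadic scales are chosen because each dyadic grid refines the previous one, which makes
  the unions increase.\<close>

lemma inner_cells_exhaust:
  assumes U: "open (U :: 'a set)"
  shows "incseq (\<lambda>k. \<Union>z\<in>inner_cells d (2^k) U. grid_cell d (2^k) z :: 'a set)"
    and "(\<Union>k. \<Union>z\<in>inner_cells d (2^k) U. grid_cell d (2^k) z :: 'a set) = U \<inter> plane"
proof -
  define ccell where "ccell k x = closed_cube d (grid_point d (2^k) (grid_index d (2^k) x)) (1 / real (2^k))" for k and x :: 'a
  have cov: "(\<Union>z\<in>inner_cells d (2^k) U. grid_cell d (2^k) z :: 'a set) = {x \<in> plane. ccell k x \<subseteq> U}" for k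
    unfolding ccell_def by (rule inner_cells_cover) simp
  have self: "x \<in> ccell k x" if "x \<in> plane" for k x
    unfolding ccell_def using subsetD[OF half_open_cube_subset grid_cell_self[of "2^k" x]] that by simp
  have sub: "ccell (Suc k) x \<subseteq> ccell k x" for k x
  proof -
    \<comment> \<open>The floor at the finer scale is \<open>2 * ?n\<close> or
      \<open>2 * ?n + 1\<close>, so the finer closed interval lies in the coarser one.\<close>
    have fl: "real_of_int \<lfloor>2^k * t\<rfloor> / 2^k \<le> real_of_int \<lfloor>2^Suc k * t\<rfloor> / 2^Suc k \<and>
      real_of_int \<lfloor>2^Suc k * t\<rfloor> / 2^Suc k + 1 / 2^Suc k \<le> real_of_int \<lfloor>2^k * t\<rfloor> / 2^k + 1/2^k" for t :: real
    proof -
      let ?n = "\<lfloor>2^k * t\<rfloor>" and ?m = "\<lfloor>2^Suc k * t\<rfloor>"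
      have "2 * ?n \<le> ?m"
      proof -
        have "2 ^ Suc k * t = 2 * (2 ^ k * t)" by simp
        then have "real_of_int (2 * ?n) \<le> 2 ^ Suc k * t" using of_int_floor_le[of "2^k * t"] by simp
        then show ?thesis by (simp only: le_floor_iff)
      qed
      moreover have "?m < 2 * ?n + 2"
      proof -
        have "2 ^ Suc k * t < real_of_int (2 * ?n + 2)"
        proof -
          have eq: "2 ^ Suc k * t = 2 * (2 ^ k * t)" by simp
          show ?thesis unfolding eq using real_of_int_floor_add_one_gt[of "2^k * t"] by linarith
        qed
        then show ?thesis by (simp only: floor_less_iff)
      qed
      ultimately have "2 * real_of_int ?n \<le> real_of_int ?m" "real_of_int ?m + 1 \<le> 2 * real_of_int ?n + 2" by linarith+
      then have "2 * real_of_int ?n / 2^Suc k \<le> real_of_int ?m / 2^Suc k"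
        "(real_of_int ?m + 1) / 2^Suc k \<le> (2 * real_of_int ?n + 2) / 2^Suc k"
        by (intro divide_right_mono; simp)+
      then show ?thesis by (simp add: add_divide_distrib)
    qed
    show ?thesis
    proof
      fix y assume y: "y \<in> ccell (Suc k) x"
      have "real_of_int \<lfloor>2^k * (x \<bullet> b)\<rfloor> / 2^k \<le> y \<bullet> b \<and> y \<bullet> b \<le> real_of_int \<lfloor>2^k * (x \<bullet> b)\<rfloor> / 2^k + 1/2^k" if b: "b \<in> D" for b
      proof -
        have "real_of_int \<lfloor>2^Suc k * (x \<bullet> b)\<rfloor> / 2^Suc k \<le> y \<bullet> b \<and> y \<bullet> b \<le> real_of_int \<lfloor>2^Suc k * (x \<bullet> b)\<rfloor> / 2^Suc k + 1/2^Suc k"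
          using y b by (simp add: ccell_def closed_cube_def inner_grid_point grid_index_def)
        then show ?thesis using fl[of "x \<bullet> b"] by linarith
      qed
      then show "y \<in> ccell k x"
        using y by (simp add: ccell_def closed_cube_def inner_grid_point grid_index_def)
    qed
  qed
  show "incseq (\<lambda>k. \<Union>z\<in>inner_cells d (2^k) U. grid_cell d (2^k) z :: 'a set)"
    unfolding cov by (rule incseq_SucI) (use sub in blast)
  have "\<exists>k. ccell k x \<subseteq> U" if x: "x \<in> U" "x \<in> plane" for x
  proof -
    obtain e where e: "0 < e" "ball x e \<subseteq> U" using U x open_contains_ball by blast
    obtain k where k: "(1/2)^k < e / real d" using real_arch_pow_inv[of "e / real d" "1/2"] e d1 by auto
    have "ccell k x \<subseteq> ball x e"
    proof
      fix y assume y: "y \<in> ccell k x"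
      have "dist x y \<le> real d * (1 / real (2^k))"
        using y self[OF x(2), of k] unfolding ccell_def by (rule closed_cube_dist[rotated])
      also have "\<dots> < e" using k d1 by (simp add: field_simps power_one_over)
      finally show "y \<in> ball x e" by simp
    qed
    then show ?thesis using e by blast
  qed
  moreover have "x \<in> U" if "x \<in> plane" "ccell k x \<subseteq> U" for x k
    using self[OF that(1)] that(2) by blast
  ultimately show "(\<Union>k. \<Union>z\<in>inner_cells d (2^k) U. grid_cell d (2^k) z :: 'a set) = U \<inter> plane"
    unfolding cov by auto
qed

text \<open>Proportionality passes from unions of cells to open sets by monotone exhaustion. It is
  wanted for balls, which will determine the factor.\<close>

lemma hausdorff_open_eq:
  assumes U: "open (U :: 'a set)" "bounded U"
  shows "emeasure (hausdorff_measure d) (U \<inter> plane) = hausdorff_outer d (half_open_cube d 0 1 :: 'a set) * emeasure (plane_lborel d) U"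
proof -
  let ?c = "hausdorff_outer d (half_open_cube d 0 1 :: 'a set)"
  let ?F = "\<lambda>k. \<Union>z\<in>inner_cells d (2^k) U. grid_cell d (2^k) z :: 'a set"
  have fin: "finite (inner_cells d (2^k) U)" "inner_cells d (2^k) U \<subseteq> extensional D" for k
    by (rule inner_cells_finite[OF U(2)], simp) (auto simp: inner_cells_def)
  have meas: "?F k \<in> sets borel" for k using fin by (intro sets.finite_UN) auto
  have "emeasure (hausdorff_measure d) (\<Union>k. ?F k) = (SUP k. emeasure (hausdorff_measure d) (?F k))"
    using meas inner_cells_exhaust(1)[OF U(1)] by (intro SUP_emeasure_incseq[symmetric]) auto
  also have "\<dots> = (SUP k. ?c * emeasure (plane_lborel d) (?F k))"
  proof (rule SUP_cong)
    fix k
    have "0 < (2::nat)^k" by simp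
    from emeasure_inner_cells[OF this fin]
    show "emeasure (hausdorff_measure d) (?F k) = ?c * emeasure (plane_lborel d) (?F k)" by metis
  qed simp
  also have "\<dots> = ?c * (SUP k. emeasure (plane_lborel d) (?F k))" by (simp add: SUP_mult_left_ennreal)
  also have "(SUP k. emeasure (plane_lborel d) (?F k)) = emeasure (plane_lborel d) (\<Union>k. ?F k)"
    using meas inner_cells_exhaust(1)[OF U(1)] by (intro SUP_emeasure_incseq) auto
  finally show ?thesis
    unfolding inner_cells_exhaust(2)[OF U(1)] using plane_lborel_plane[of U] U by simp
qed

lemma emeasure_plane_lborel_ball:
  assumes "0 < r"
  shows "emeasure (plane_lborel d) (ball (0::'a) r) = ennreal (unit_ball_vol (real d) * r ^ d)"
proof (rule antisym)
  show "emeasure (plane_lborel d) (ball (0::'a) r) \<le> ennreal (unit_ball_vol (real d) * r ^ d)"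
    unfolding emeasure_plane_lborel_cball[OF d assms, symmetric] by (intro emeasure_mono) auto
  show "ennreal (unit_ball_vol (real d) * r ^ d) \<le> emeasure (plane_lborel d) (ball (0::'a) r)"
  proof (rule ennreal_power_le_left)
    fix t :: real assume "0 < t" "t < r"
    then show "ennreal (unit_ball_vol (real d) * t ^ d) \<le> emeasure (plane_lborel d) (ball (0::'a) r)"
      unfolding emeasure_plane_lborel_cball[OF d \<open>0 < t\<close>, symmetric] by (intro emeasure_mono) auto
  qed fact
qed

text \<open>By the isodiametric inequality each member of a cover has Lebesgue measure at most its
  cost, so the costs add up to at least the volume 1. Passing to closures gives compact sets of the
  same diameter.\<close>

lemma hausdorff_unit_cube_ge: "1 \<le> hausdorff_outer d (half_open_cube d 0 1 :: 'a set)"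
proof -
  have "1 \<le> hausdorff_pre d 1 (half_open_cube d 0 1 :: 'a set)"
  proof (rule hausdorff_pre_greatest)
    fix U :: "nat \<Rightarrow> 'a set"
    assume cov: "half_open_cube d 0 1 \<subseteq> \<Union>(range U)" and bd: "\<And>i. bounded (U i)"
    have "1 = emeasure (plane_lborel d) (half_open_cube d 0 1 :: 'a set)"
      by (subst emeasure_plane_lborel_cube) auto
    also have "\<dots> \<le> emeasure (plane_lborel d) (\<Union>i. closure (U i))"
      by (intro emeasure_mono order_trans[OF cov] UN_mono closure_subset subset_refl) auto
    also have "\<dots> \<le> (\<Sum>i. emeasure (plane_lborel d) (closure (U i)))"
      by (intro emeasure_subadditive_countably) auto
    also have "\<dots> \<le> (\<Sum>i. ennreal (hausdorff_const d * diameter (U i) ^ d))"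
    proof (intro suminf_le)
      fix i
      \<comment> \<open>The diameter may be 0, so the inequality is applied with a radius
        \<open>t\<close> above half the diameter and the limit is taken afterwards.\<close>
      have "emeasure (plane_lborel d) (closure (U i)) \<le> ennreal (unit_ball_vol (real d) * t ^ d)" if "diameter (U i) / 2 < t" for t
      proof (rule isodiametric_inequality[OF d])
        show "0 < t" using that diameter_ge_0[OF bd, of i] by linarith
        show "diameter (closure (U i)) \<le> 2 * t" using that diameter_closure[OF bd, of i] by simp
        show "compact (closure (U i))" using bd by simp
      qed
      then have "emeasure (plane_lborel d) (closure (U i)) \<le> ennreal (unit_ball_vol (real d) * (diameter (U i) / 2) ^ d)"
        by (rule ennreal_le_power_right)
      then show "emeasure (plane_lborel d) (closure (U i)) \<le> ennreal (hausdorff_const d * diameter (U i) ^ d)"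
        by (simp add: hausdorff_const_def power_divide)
    qed auto
    finally show "1 \<le> (\<Sum>i. ennreal (hausdorff_const d * diameter (U i) ^ d))" .
  qed
  also have "\<dots> \<le> hausdorff_outer d (half_open_cube d 0 1 :: 'a set)" by (intro hausdorff_pre_le_outer) simp
  finally show ?thesis .
qed

text \<open>The inscribed balls of a fine grid realise the optimal ratio of measure to diameter on a fixed
  fraction of the cube; by self-similarity this fraction cannot lose any measure.\<close>

lemma hausdorff_unit_cube_le: "hausdorff_outer d (half_open_cube d 0 1 :: 'a set) \<le> 1"
proof -
  define Q where "Q = (half_open_cube d 0 1 :: 'a set)"
  define p where "p = (coord_embed d (\<lambda>_. 1/2) :: 'a)"
  \<comment> \<open>\<open>\<beta>\<close> is both the volume of a ball of diameter 1 and, being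
    equal to \<open>hausdorff_const d\<close>, the cost of a covering set of diameter 1; the
    argument closes because the two agree.\<close>
  define \<beta> where "\<beta> = unit_ball_vol (real d) * (1/2) ^ d"
  have \<beta>: "0 < \<beta>" by (simp add: \<beta>_def)
  have p: "p \<in> plane" "\<And>b. b \<in> D \<Longrightarrow> p \<bullet> b = 1/2"
    using dirs by (auto simp: p_def coord_embed_in_plane inner_coord_embed[OF d])
  obtain c where c: "hausdorff_outer d Q = ennreal c" "0 \<le> c"
    using hausdorff_cube_finite unfolding Q_def by (metis ennreal_cases less_irrefl)
  define B where "B = cball p (1/2) \<inter> plane"
  have Qs: "Q \<in> sets (hausdorff_measure d)" "B \<in> sets (hausdorff_measure d)"
    by (auto simp: Q_def B_def)
  have ball_sub: "ball p (1/2) \<inter> plane \<subseteq> Q \<inter> B"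
  proof
    fix x assume x: "x \<in> ball p (1/2) \<inter> plane"
    have "\<bar>x \<bullet> b - 1/2\<bar> < 1/2" if "b \<in> D" for b
      using Basis_le_norm[of b "x - p"] x that dirs(1) p(2)[OF that] by (auto simp: dist_norm norm_minus_commute inner_diff_left)
    then have "0 \<le> x \<bullet> b \<and> x \<bullet> b < 1" if "b \<in> D" for b
      using \<open>\<And>b. b \<in> D \<Longrightarrow> \<bar>x \<bullet> b - 1/2\<bar> < 1/2\<close>[OF that] by linarith
    then show "x \<in> Q \<inter> B" using x by (auto simp: Q_def B_def half_open_cube_def)
  qed
  have "ennreal (c * \<beta>) \<le> emeasure (hausdorff_measure d) (Q \<inter> B)"
  proof -
    have "emeasure (hausdorff_measure d) (ball 0 (1/2) \<inter> plane) = ennreal c * ennreal \<beta>"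
      unfolding hausdorff_open_eq[OF open_ball bounded_ball] using c
      by (subst emeasure_plane_lborel_ball) (simp_all add: Q_def \<beta>_def)
    moreover have "(+) p ` (ball 0 (1/2) \<inter> plane) = ball p (1/2) \<inter> plane"
    proof -
      have "x \<in> (+) p ` (ball 0 (1/2) \<inter> plane)" if "x \<in> ball p (1/2) \<inter> plane" for x
        using that p(1) subspace_diff[OF subspace_coord_plane]
        by (intro image_eqI[of _ _ "x - p"]) (auto simp: dist_norm norm_minus_commute)
      then show ?thesis using p(1) subspace_add[OF subspace_coord_plane] by (auto simp: dist_norm)
    qed
    moreover have "hausdorff_outer d ((+) p ` (ball 0 (1/2) \<inter> plane)) = ennreal (1 ^ d) * hausdorff_outer d (ball 0 (1/2) \<inter> plane)"
      by (rule hausdorff_outer_similarity) auto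
    ultimately have "hausdorff_outer d (ball p (1/2) \<inter> plane) = ennreal (c * \<beta>)"
      using c(2) \<beta>
      by (simp add: emeasure_hausdorff_measure[OF d1] ennreal_mult)
    then show ?thesis
      using hausdorff_outer_mono[OF ball_sub, of d] Qs by (simp add: emeasure_hausdorff_measure[OF d1])
  qed
  then have rest: "hausdorff_outer d (Q - B) \<le> ennreal (c - c * \<beta>)"
  proof -
    assume le: "ennreal (c * \<beta>) \<le> emeasure (hausdorff_measure d) (Q \<inter> B)"
    have "emeasure (hausdorff_measure d) (Q \<inter> B) + emeasure (hausdorff_measure d) (Q - B) = emeasure (hausdorff_measure d) Q"
      using Qs by (subst plus_emeasure) (auto simp: Int_Diff_Un)
    then have eq: "emeasure (hausdorff_measure d) (Q \<inter> B) + hausdorff_outer d (Q - B) = ennreal c"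
      using Qs c by (simp add: emeasure_hausdorff_measure[OF d1])
    then have "ennreal (c * \<beta>) + hausdorff_outer d (Q - B) \<le> ennreal c" using le by (metis add_right_mono)
    then show ?thesis
      using c(2) \<beta> by (cases "hausdorff_outer d (Q - B)")
        (auto simp: ennreal_plus[symmetric] top_add top_unique simp del: ennreal_plus intro!: ennreal_leI)
  qed
  have diamB: "diameter B \<le> 1" 
  proof (rule diameter_le)
    fix x y assume "x \<in> B" "y \<in> B"
    then show "norm (x - y) \<le> 1" using dist_triangle3[of x y p] by (auto simp: B_def dist_norm[symmetric])
  qed simp
  have "hausdorff_outer d Q \<le> ennreal (\<beta> + (c - c * \<beta>))"
  proof (rule hausdorff_outer_least)
    fix \<delta> :: real assume \<delta>: "0 < \<delta>"
    obtain m :: nat where m: "1 / \<delta> < real m" using reals_Archimedean2 by blast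
    then have m0: "0 < m" using \<delta> by (intro gr0I) (auto simp: not_less)
    have m\<delta>: "1 / real m \<le> \<delta>" using m m0 \<delta> by (simp add: field_simps)
    let ?g = "\<lambda>z x. grid_point d m z + (1 / real m) *\<^sub>R x"
    have dg: "dist (?g z x) (?g z y) = 1 / real m * dist x y" for z x y
      using m0 by (simp add: dist_norm scaleR_diff_right[symmetric])
    \<comment> \<open>Up to scaling, the inscribed ball of a cell is covered at cost
      \<open>\<beta>\<close>, and the rest of the cell at its measure, at most
      \<open>c - c * \<beta>\<close>.\<close>
    have cell: "hausdorff_pre d \<delta> (grid_cell d m z :: 'a set) \<le> ennreal ((1 / real m) ^ d * (\<beta> + (c - c * \<beta>)))" for z
    proof -
      have diam: "diameter (?g z ` B) \<le> 1 / real m"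
      proof (rule diameter_le)
        fix x y assume "x \<in> ?g z ` B" "y \<in> ?g z ` B"
        then obtain x' y' where xy: "x' \<in> B" "y' \<in> B" "x = ?g z x'" "y = ?g z y'" by auto
        have "dist x' y' \<le> 1"
          using xy(1,2) dist_triangle3[of x' y' p] by (auto simp: B_def)
        then show "norm (x - y) \<le> 1 / real m"
          using m0 dg[of z x' y'] xy by (simp add: dist_norm[symmetric] field_simps)
      qed (use m0 in auto)
      have bdd: "bounded (?g z ` B)"
      proof -
        have "bounded B" by (simp add: B_def bounded_Int)
        then have "bounded ((+) (grid_point d m z) ` (*\<^sub>R) (1 / real m) ` B)"
          by (intro bounded_translation bounded_scaling)
        then show ?thesis by (simp add: image_image)
      qed
      have "grid_cell d m z = ?g z ` Q"
        unfolding Q_def using m0 by (intro affine_cube(1)[symmetric] grid_point_in_plane) auto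
      also have "\<dots> \<subseteq> ?g z ` B \<union> ?g z ` (Q - B)" by auto
      finally have "hausdorff_pre d \<delta> (grid_cell d m z :: 'a set) \<le> hausdorff_pre d \<delta> (?g z ` B) + hausdorff_pre d \<delta> (?g z ` (Q - B))"
        using \<delta> by (intro order_trans[OF hausdorff_pre_mono hausdorff_pre_Un_le] d1) auto
      also have "hausdorff_pre d \<delta> (?g z ` B) \<le> ennreal (hausdorff_const d * diameter (?g z ` B) ^ d)"
        using \<delta> diam m\<delta> by (intro hausdorff_pre_le_diameter d1 bdd) auto
      also have "\<dots> \<le> ennreal (hausdorff_const d * (1 / real m) ^ d)"
        using diam diameter_ge_0[OF bdd] by (intro ennreal_leI mult_left_mono power_mono) auto
      also have "hausdorff_const d * (1 / real m) ^ d = (1 / real m) ^ d * \<beta>"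
        by (simp add: \<beta>_def hausdorff_const_def power_one_over)
      also have "hausdorff_pre d \<delta> (?g z ` (Q - B)) \<le> hausdorff_outer d (?g z ` (Q - B))"
        using \<delta> by (rule hausdorff_pre_le_outer)
      also have "\<dots> = ennreal ((1 / real m) ^ d) * hausdorff_outer d (Q - B)"
        using m0 dg by (intro hausdorff_outer_similarity) auto
      also have "\<dots> \<le> ennreal ((1 / real m) ^ d) * ennreal (c - c * \<beta>)" by (intro mult_left_mono rest) simp
      also have "\<dots> = ennreal ((1 / real m) ^ d * (c - c * \<beta>))" by (simp add: ennreal_mult')
      also have "ennreal ((1 / real m) ^ d * \<beta>) + \<dots> = ennreal ((1 / real m) ^ d * (\<beta> + (c - c * \<beta>)))"
      proof -
        have "c * \<beta> \<le> c"
        proof -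
          have "ennreal (c * \<beta>) \<le> emeasure (hausdorff_measure d) (Q \<inter> B)" by fact
          also have "\<dots> \<le> emeasure (hausdorff_measure d) Q" using Qs by (intro emeasure_mono) auto
          also have "\<dots> = ennreal c" using Qs c by (simp add: emeasure_hausdorff_measure[OF d1])
          finally show ?thesis using c by simp
        qed
        then show ?thesis using \<beta> by (subst ennreal_plus[symmetric]) (auto simp: distrib_left)
      qed
      finally show ?thesis by (simp add: add_mono add_left_mono add_right_mono)
    qed
    have "hausdorff_pre d \<delta> Q \<le> (\<Sum>z\<in>Pi\<^sub>E D (\<lambda>_. {0..<int m}). ennreal ((1 / real m) ^ d * (\<beta> + (c - c * \<beta>))))"
      unfolding Q_def half_open_cube_eq_grid[OF m0] using \<delta> card_grid cell
      by (intro order_trans[OF hausdorff_pre_finite_UN_le] sum_mono d1) auto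
    also have "\<dots> = ennreal (real (m ^ d)) * ennreal ((1 / real m) ^ d * (\<beta> + (c - c * \<beta>)))"
      by (simp add: card_grid ennreal_of_nat_eq_real_of_nat)
    also have "\<dots> = ennreal (real (m ^ d) * ((1 / real m) ^ d * (\<beta> + (c - c * \<beta>))))"
      by (rule ennreal_mult'[symmetric]) simp
    also have "real (m ^ d) * ((1 / real m) ^ d * (\<beta> + (c - c * \<beta>))) = \<beta> + (c - c * \<beta>)"
      using m0 by (simp add: power_one_over)
    finally show "hausdorff_pre d \<delta> Q \<le> ennreal (\<beta> + (c - c * \<beta>))" .
  qed
  \<comment> \<open>The first alternative leaves \<open>c * \<beta> \<le> \<beta>\<close>; the
    second accounts for \<open>ennreal\<close> sending negative reals to 0.\<close>
  then have "c \<le> \<beta> + (c - c * \<beta>) \<or> c = 0" using c by (auto simp: ennreal_le_iff2)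
  then have "c \<le> 1" using \<beta> by auto
  then show ?thesis using c unfolding Q_def by simp
qed

lemma hausdorff_unit_cube: "hausdorff_outer d (half_open_cube d 0 1 :: 'a set) = 1"
  using hausdorff_unit_cube_le hausdorff_unit_cube_ge by (rule antisym)

lemma hausdorff_half_open_cube:
  assumes "a \<in> plane" "0 < r" shows "hausdorff_outer d (half_open_cube d a r) = ennreal (r ^ d)"
  using hausdorff_cube_scale[OF assms] by (simp add: hausdorff_unit_cube)

lemma hausdorff_closed_cube:
  assumes "a \<in> plane" "0 < r" shows "hausdorff_outer d (closed_cube d a r) = ennreal (r ^ d)"
proof (rule antisym)
  have "hausdorff_outer d (closed_cube d a r) \<le> ennreal (1 * r ^ d)"
  proof (rule ennreal_le_power_right)
    fix t assume t: "r < t"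
    have "closed_cube d a r \<subseteq> half_open_cube d a t" 
    proof
      fix x assume x: "x \<in> closed_cube d a r"
      have "a \<bullet> b \<le> x \<bullet> b \<and> x \<bullet> b < a \<bullet> b + t" if "b \<in> D" for b
      proof -
        have "a \<bullet> b \<le> x \<bullet> b" "x \<bullet> b \<le> a \<bullet> b + r" using x that by (simp_all add: closed_cube_def)
        then show ?thesis using t by simp
      qed
      then show "x \<in> half_open_cube d a t" using x by (simp add: closed_cube_def half_open_cube_def)
    qed
    from hausdorff_outer_mono[OF this, of d] show "hausdorff_outer d (closed_cube d a r) \<le> ennreal (1 * t ^ d)"
      using hausdorff_half_open_cube[of a t] assms t by simp
  qed
  then show "hausdorff_outer d (closed_cube d a r) \<le> ennreal (r ^ d)" by simp
  show "ennreal (r ^ d) \<le> hausdorff_outer d (closed_cube d a r)"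
    unfolding hausdorff_half_open_cube[OF assms, symmetric] by (rule hausdorff_outer_mono[OF half_open_cube_subset])
qed

lemma hausdorff_open_cube:
  assumes "a \<in> plane" "0 < r" shows "hausdorff_outer d (open_cube d a r) = ennreal (r ^ d)"
proof (rule antisym)
  show "hausdorff_outer d (open_cube d a r) \<le> ennreal (r ^ d)"
    unfolding hausdorff_half_open_cube[OF assms, symmetric] by (rule hausdorff_outer_mono[OF open_cube_subset])
  have "ennreal (1 * r ^ d) \<le> hausdorff_outer d (open_cube d a r)"
  proof (rule ennreal_power_le_left)
    fix t assume t: "0 < t" "t < r"
    let ?a = "a + coord_embed d (\<lambda>_. (r - t) / 2)"
    have a: "?a \<in> plane" using assms(1) by (intro subspace_add subspace_coord_plane coord_embed_in_plane)
    have "?a \<bullet> b = a \<bullet> b + (r - t) / 2" if "b \<in> D" for b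
      using that dirs(1) by (auto simp: inner_add_left inner_coord_embed[OF d])
    then have "hausdorff_outer d (half_open_cube d ?a t) \<le> hausdorff_outer d (open_cube d a r)"
    proof (intro hausdorff_outer_mono subsetI)
      fix x assume x: "x \<in> half_open_cube d ?a t"
      have "a \<bullet> b < x \<bullet> b \<and> x \<bullet> b < a \<bullet> b + r" if b: "b \<in> D" for b
      proof -
        have "?a \<bullet> b \<le> x \<bullet> b" "x \<bullet> b < ?a \<bullet> b + t" using x b by (auto simp: half_open_cube_def)
        moreover have "A \<le> X \<Longrightarrow> X < A + t \<Longrightarrow> A = \<alpha> + (r - t) / 2 \<Longrightarrow> \<alpha> < X \<and> X < \<alpha> + r" for A X \<alpha> :: real
          using t by argo
        ultimately show ?thesis using \<open>\<And>b. b \<in> D \<Longrightarrow> ?a \<bullet> b = a \<bullet> b + (r - t) / 2\<close>[OF b] by blast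
      qed
      then show "x \<in> open_cube d a r" using x by (auto simp: half_open_cube_def open_cube_def)
    qed
    then show "ennreal (1 * t ^ d) \<le> hausdorff_outer d (open_cube d a r)"
      using hausdorff_half_open_cube[OF a t(1)] by simp
  qed fact
  then show "ennreal (r ^ d) \<le> hausdorff_outer d (open_cube d a r)" by simp
qed

lemma hausdorff_cball:
  assumes a: "a \<in> plane" and r: "0 \<le> r"
  shows "hausdorff_outer d (cball a r \<inter> plane) = ennreal (unit_ball_vol (real d) * r ^ d)"
proof -
  have ball: "hausdorff_outer d (ball a t \<inter> plane) = ennreal (unit_ball_vol (real d) * t ^ d)" if t: "0 < t" for t
  proof -
    have "(+) a ` (ball 0 t \<inter> plane) = ball a t \<inter> plane"
    proof -
      have "x \<in> (+) a ` (ball 0 t \<inter> plane)" if "x \<in> ball a t \<inter> plane" for x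
        using that a subspace_diff[OF subspace_coord_plane]
        by (intro image_eqI[of _ _ "x - a"]) (auto simp: dist_norm norm_minus_commute)
      then show ?thesis using a subspace_add[OF subspace_coord_plane] by (auto simp: dist_norm)
    qed
    moreover have "hausdorff_outer d ((+) a ` (ball 0 t \<inter> plane)) = ennreal (1 ^ d) * hausdorff_outer d (ball 0 t \<inter> plane)"
      by (rule hausdorff_outer_similarity) auto
    moreover have "hausdorff_outer d (ball 0 t \<inter> plane) = ennreal (unit_ball_vol (real d) * t ^ d)"
      using hausdorff_open_eq[OF open_ball bounded_ball, of 0 t] t
      by (simp add: emeasure_plane_lborel_ball emeasure_hausdorff_measure[OF d1] hausdorff_unit_cube )
    ultimately show ?thesis by simp
  qed
  show ?thesis
  proof (rule antisym)
    show "hausdorff_outer d (cball a r \<inter> plane) \<le> ennreal (unit_ball_vol (real d) * r ^ d)"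
    proof (rule ennreal_le_power_right)
      fix t assume t: "r < t"
      have "hausdorff_outer d (cball a r \<inter> plane) \<le> hausdorff_outer d (ball a t \<inter> plane)"
        using t by (intro hausdorff_outer_mono) auto
      then show "hausdorff_outer d (cball a r \<inter> plane) \<le> ennreal (unit_ball_vol (real d) * t ^ d)"
        using ball[of t] t r by simp
    qed
    show "ennreal (unit_ball_vol (real d) * r ^ d) \<le> hausdorff_outer d (cball a r \<inter> plane)"
    proof (cases "r = 0")
      case False
      then have "hausdorff_outer d (ball a r \<inter> plane) \<le> hausdorff_outer d (cball a r \<inter> plane)"
        by (intro hausdorff_outer_mono) auto
      then show ?thesis using ball[of r] r False by simp
    qed (use d1 in \<open>simp add: power_0_left\<close>)
  qed
qed

text \<open>The unions of cells increase to the part of \<open>U\<close> in the plane, whose measure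
  is finite, so the measure of what they miss tends to 0.\<close>

lemma inner_cells_approx:
  assumes U: "open (U :: 'a set)" "bounded U" and e: "0 < e"
  shows "\<forall>\<^sub>F k in sequentially. emeasure (hausdorff_measure d) (U \<inter> plane - (\<Union>z\<in>inner_cells d (2^k) U. grid_cell d (2^k) z)) < ennreal e"
proof -
  let ?F = "\<lambda>k. \<Union>z\<in>inner_cells d (2^k) U. grid_cell d (2^k) z :: 'a set"
  let ?H = "emeasure (hausdorff_measure d)"
  have fin: "finite (inner_cells d (2^k) U)" "inner_cells d (2^k) U \<subseteq> extensional D" for k
    by (rule inner_cells_finite[OF U(2)], simp) (auto simp: inner_cells_def)
  have meas: "?F k \<in> sets borel" for k using fin by (intro sets.finite_UN) auto
  have UP: "U \<inter> plane \<in> sets borel" using U by auto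
  have finU: "?H (U \<inter> plane) < top"
  proof -
    obtain R where R: "0 < R" "\<forall>x\<in>U. norm x \<le> R" using U(2) unfolding bounded_pos by blast
    then have R: "0 < R" "U \<subseteq> cball 0 R" by auto
    then have "hausdorff_outer d (U \<inter> plane) \<le> hausdorff_outer d (cball 0 R \<inter> plane)"
      by (intro hausdorff_outer_mono) auto
    also have "\<dots> < top" using R subspace_0[OF subspace_coord_plane] by (subst hausdorff_cball) auto
    finally show ?thesis using UP by (simp add: emeasure_hausdorff_measure[OF d1])
  qed
  have lim: "(\<lambda>k. ?H (U \<inter> plane - ?F k)) \<longlonglongrightarrow> ?H (\<Inter>k. U \<inter> plane - ?F k)"
  proof (rule Lim_emeasure_decseq)
    show "decseq (\<lambda>k. U \<inter> plane - ?F k)"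
      using inner_cells_exhaust(1)[OF U(1)] by (auto simp: decseq_def incseq_def)
    fix k show "?H (U \<inter> plane - ?F k) \<noteq> \<infinity>"
    proof -
      have "?H (U \<inter> plane - ?F k) \<le> ?H (U \<inter> plane)" using UP by (intro emeasure_mono) auto
      then show ?thesis using finU by (auto simp: top_unique)
    qed
  qed (use UP meas in auto)
  have "(\<Inter>k. U \<inter> plane - ?F k) = {}"
    using inner_cells_exhaust(2)[OF U(1)] by blast
  then have "(\<lambda>k. ?H (U \<inter> plane - ?F k)) \<longlonglongrightarrow> 0" using lim by (simp only: emeasure_empty)
  from order_tendstoD(2)[OF this, of "ennreal e"] show ?thesis using e by simp
qed

text \<open>Polar coordinates without a surface measure: the image of the plane measure under
  \<open>dist a\<close> has distribution function \<open>unit_ball_vol (real d) * r ^ d\<close>,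
  hence its derivative as density. The two measures on the line are identified through their values
  on half-lines.\<close>

lemma nn_integral_plane_radial:
  assumes a: "a \<in> plane" and g [measurable]: "g \<in> borel_measurable borel"
  shows "(\<integral>\<^sup>+y. g (dist a y) * indicator plane y \<partial>hausdorff_measure d) =
    (\<integral>\<^sup>+\<rho>. g \<rho> * (ennreal (real d * unit_ball_vol (real d) * \<rho> ^ (d - 1)) * indicator {0..} \<rho>) \<partial>lborel)"
proof -
  let ?H = "hausdorff_measure d :: 'a measure"
  let ?\<beta> = "unit_ball_vol (real d)"
  define M1 where "M1 = distr (density ?H (indicator plane)) borel (dist a)"
  define M2 where "M2 = density lborel (\<lambda>\<rho>::real. ennreal (real d * ?\<beta> * \<rho> ^ (d - 1)) * indicator {0..} \<rho>)"
  have M1: "emeasure M1 {..r} = ennreal (?\<beta> * (max 0 r) ^ d)" for r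
  proof -
    have "emeasure M1 {..r} = emeasure (density ?H (indicator plane)) (dist a -` {..r})"
      unfolding M1_def by (subst emeasure_distr) auto
    also have "\<dots> = (\<integral>\<^sup>+y. indicator plane y * indicator (dist a -` {..r}) y \<partial>?H)"
    proof (rule emeasure_density)
      have "dist a -` {..r} = cball a r" by auto
      then show "dist a -` {..r} \<in> sets ?H" by simp
    qed measurable
    also have "\<dots> = (\<integral>\<^sup>+y. indicator (cball a r \<inter> plane) y \<partial>?H)"
      by (intro nn_integral_cong) (auto simp: indicator_def)
    also have "\<dots> = hausdorff_outer d (cball a r \<inter> plane)"
      by (simp add: emeasure_hausdorff_measure[OF d1])
    also have "\<dots> = ennreal (?\<beta> * (max 0 r) ^ d)"
    proof (cases "0 \<le> r")
      case True then show ?thesis by (simp add: hausdorff_cball[OF a])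
    next
      case False
      then have "cball a r = {}" by simp
      then show ?thesis using False d1 by (simp add: hausdorff_outer_empty[OF d1] max_def power_0_left)
    qed
    finally show ?thesis .
  qed
  have M2: "emeasure M2 {..r} = ennreal (?\<beta> * (max 0 r) ^ d)" for r
  proof -
    have "emeasure M2 {..r} = (\<integral>\<^sup>+\<rho>. ennreal (real d * ?\<beta> * \<rho> ^ (d - 1)) * indicator {0..max 0 r} \<rho> \<partial>lborel)"
    proof (cases "0 \<le> r")
      case True
      then show ?thesis unfolding M2_def
        by (subst emeasure_density) (auto intro!: nn_integral_cong simp: indicator_def)
    next
      case False
      have "emeasure M2 {..r} = (\<integral>\<^sup>+\<rho>. ennreal (real d * ?\<beta> * \<rho> ^ (d - 1)) * indicator {0..} \<rho> * indicator {..r} \<rho> \<partial>lborel)"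
        unfolding M2_def by (rule emeasure_density) auto
      also have "\<dots> = (\<integral>\<^sup>+(\<rho>::real). 0 \<partial>lborel)"
        using False by (intro nn_integral_cong) (auto simp: indicator_def)
      finally have "emeasure M2 {..r} = 0" by simp
      moreover have "(\<integral>\<^sup>+\<rho>. ennreal (real d * ?\<beta> * \<rho> ^ (d - 1)) * indicator {0..max 0 r} \<rho> \<partial>lborel) = 0"
        using False d1 AE_lborel_singleton[of "0::real"]
        by (subst nn_integral_0_iff_AE) (auto simp: max_def indicator_def elim!: eventually_mono)
      ultimately show ?thesis by simp
    qed
    also have "\<dots> = ennreal (?\<beta> * (max 0 r) ^ d - ?\<beta> * 0 ^ d)"
    proof (rule nn_integral_FTC_Icc[where F = "\<lambda>\<rho>. ?\<beta> * \<rho> ^ d"])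
      fix x :: real assume "x \<in> {0..max 0 r}"
      then have "0 \<le> x" by simp
      show "((\<lambda>\<rho>. ?\<beta> * \<rho> ^ d) has_real_derivative real d * ?\<beta> * x ^ (d - 1)) (at x)"
        by (auto intro!: derivative_eq_intros)
      show "0 \<le> real d * ?\<beta> * x ^ (d - 1)" using \<open>0 \<le> x\<close> by simp
    qed auto
    finally show ?thesis using d1 by (simp add: power_0_left)
  qed
  have "M1 = M2"
  proof (rule measure_eqI_generator_eq[where E = "range atMost" and \<Omega> = UNIV and A = "\<lambda>n. {..real n}"])
    show "Int_stable (range (atMost :: real \<Rightarrow> real set))" by (auto simp: Int_stable_def)
    show "sets M1 = sigma_sets UNIV (range atMost)" "sets M2 = sigma_sets UNIV (range atMost)"
      by (simp_all add: M1_def M2_def borel_eq_atMost)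
    show "(\<Union>n. {..real n}) = UNIV" by (auto intro: real_arch_simple)
    show "emeasure M1 {..real n} \<noteq> \<infinity>" for n by (simp add: M1)
  qed (auto simp: M1 M2)
  then have "(\<integral>\<^sup>+\<rho>. g \<rho> \<partial>M1) = (\<integral>\<^sup>+\<rho>. g \<rho> \<partial>M2)" by simp
  moreover have "(\<integral>\<^sup>+\<rho>. g \<rho> \<partial>M1) = (\<integral>\<^sup>+y. g (dist a y) * indicator plane y \<partial>?H)"
    unfolding M1_def by (subst nn_integral_distr, simp, simp, subst nn_integral_density) (auto simp: mult.commute)
  moreover have "(\<integral>\<^sup>+\<rho>. g \<rho> \<partial>M2) = (\<integral>\<^sup>+\<rho>. g \<rho> * (ennreal (real d * ?\<beta> * \<rho> ^ (d - 1)) * indicator {0..} \<rho>) \<partial>lborel)"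
    unfolding M2_def by (subst nn_integral_density) (auto simp: mult.commute)
  ultimately show ?thesis by simp
qed

end

section \<open>Riesz potentials and polarization of the cube\<close>

definition riesz_kernel :: "real \<Rightarrow> 'a::euclidean_space \<Rightarrow> 'a \<Rightarrow> ennreal" where
  "riesz_kernel s y x = (if y = x then \<infinity> else ennreal (dist y x powr (- s)))"

lemma riesz_pot_eq: "riesz_pot w s y \<omega> = (\<Sum>x\<in>#\<omega>. ennreal (w y x) * riesz_kernel s y x)"
  by (simp add: riesz_pot_def riesz_kernel_def)

abbreviation riesz :: "real \<Rightarrow> 'a::euclidean_space \<Rightarrow> 'a multiset \<Rightarrow> ennreal" where
  "riesz \<equiv> riesz_pot (\<lambda>_ _. 1)"

lemma riesz_eq: "riesz s y \<omega> = (\<Sum>x\<in>#\<omega>. riesz_kernel s y x)"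
  by (simp add: riesz_pot_eq)

lemma riesz_pot_union [simp]: "riesz_pot w s y (\<omega> + \<omega>') = riesz_pot w s y \<omega> + riesz_pot w s y \<omega>'"
  by (simp add: riesz_pot_def)

lemma riesz_pot_mono: "\<omega> \<subseteq># \<omega>' \<Longrightarrow> riesz_pot w s y \<omega> \<le> riesz_pot w s y \<omega>'"
  by (metis le_iff_add riesz_pot_union subset_mset.le_iff_add)

lemma riesz_kernel_ge:
  assumes "dist y x \<le> t" "0 < t" "0 \<le> s" shows "ennreal (t powr - s) \<le> riesz_kernel s y x"
proof (cases "y = x")
  case False
  then have "t powr - s \<le> dist y x powr - s" using assms by (intro powr_mono2') auto
  then show ?thesis using False by (simp add: riesz_kernel_def ennreal_leI)
qed (simp add: riesz_kernel_def)

lemma riesz_kernel_le: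
  assumes "t \<le> dist y x" "0 < t" "0 \<le> s" shows "riesz_kernel s y x \<le> ennreal (t powr - s)"
proof -
  have "dist y x powr - s \<le> t powr - s" using assms by (intro powr_mono2') auto
  then show ?thesis using assms by (auto simp: riesz_kernel_def ennreal_leI)
qed

lemma riesz_kernel_dist_le:
  assumes "dist y' x' \<le> L * dist y x" "0 < L" "0 \<le> s"
  shows "ennreal (L powr - s) * riesz_kernel s y x \<le> riesz_kernel s y' x'"
proof (cases "y' = x'")
  case False
  then have pos: "0 < dist y' x'" by simp
  then have ne: "y \<noteq> x" using assms(1) by auto
  have "ennreal (L powr - s) * riesz_kernel s y x = ennreal ((L * dist y x) powr - s)"
    using ne assms(2) by (simp add: riesz_kernel_def ennreal_mult[symmetric] powr_mult)
  also have "\<dots> \<le> riesz_kernel s y' x'"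
    using assms ne by (intro riesz_kernel_ge) auto
  finally show ?thesis .
qed (simp add: riesz_kernel_def)

lemma card_set_mset_le_size: "card (set_mset M) \<le> size M"
  by (induction M) (auto simp: card_insert_if)

lemma sum_mset_mono_ennreal:
  "(\<And>x. x \<in># M \<Longrightarrow> f x \<le> g x) \<Longrightarrow> (\<Sum>x\<in>#M. f x) \<le> (\<Sum>x\<in>#M. (g x :: ennreal))"
  by (induction M) (auto intro: add_mono)

lemma riesz_image_mset:
  assumes "\<And>x. x \<in># \<omega> \<Longrightarrow> dist y' (g x) \<le> L * dist y x" "0 < L" "0 \<le> s"
  shows "ennreal (L powr - s) * riesz s y \<omega> \<le> riesz s y' (image_mset g \<omega>)"
proof -
  have "ennreal (L powr - s) * riesz s y \<omega> = (\<Sum>x\<in>#\<omega>. ennreal (L powr - s) * riesz_kernel s y x)"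
    by (simp add: riesz_eq sum_mset_distrib_left)
  also have "\<dots> \<le> (\<Sum>x\<in>#\<omega>. riesz_kernel s y' (g x))"
    by (intro sum_mset_mono_ennreal riesz_kernel_dist_le assms)
  also have "\<dots> = riesz s y' (image_mset g \<omega>)" by (simp add: riesz_eq image_mset.compositionality comp_def)
  finally show ?thesis .
qed

lemma polar_le: "y \<in> B \<Longrightarrow> polar B w s \<omega> \<le> riesz_pot w s y \<omega>"
  unfolding polar_def by (rule INF_lower)

lemma polar_greatest: "(\<And>y. y \<in> B \<Longrightarrow> c \<le> riesz_pot w s y \<omega>) \<Longrightarrow> c \<le> polar B w s \<omega>"
  unfolding polar_def by (rule INF_greatest)

lemma polar_le_max: "\<omega> \<in> configs A N \<Longrightarrow> polar A w s \<omega> \<le> polar_max A w s N"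
  unfolding polar_max_def by (rule SUP_upper)

lemma configs_nonempty: "A \<noteq> {} \<Longrightarrow> configs A N \<noteq> {}"
proof -
  assume "A \<noteq> {}"
  then obtain x where "x \<in> A" by auto
  then have "replicate_mset N x \<in> configs A N" by (auto simp: configs_def set_mset_replicate_mset_subset)
  then show ?thesis by auto
qed

lemma configs_add: "\<omega> \<in> configs A m \<Longrightarrow> \<omega>' \<in> configs A n \<Longrightarrow> \<omega> + \<omega>' \<in> configs A (m + n)"
  by (auto simp: configs_def)

lemma polar_max_mono:
  assumes "A \<noteq> {}" "m \<le> n" shows "polar_max A w s m \<le> polar_max A w s n"
  unfolding polar_max_def[of A w s m]
proof (rule SUP_least)
  fix \<omega> assume \<omega>: "\<omega> \<in> configs A m"
  obtain \<omega>' where "\<omega>' \<in> configs A (n - m)" using configs_nonempty[OF assms(1)] by blast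
  then have c: "\<omega> + \<omega>' \<in> configs A n" using configs_add[OF \<omega>] assms(2) by fastforce
  have "polar A w s \<omega> \<le> polar A w s (\<omega> + \<omega>')"
    by (intro polar_greatest order_trans[OF polar_le riesz_pot_mono]) auto
  also have "\<dots> \<le> polar_max A w s n" by (rule polar_le_max[OF c])
  finally show "polar A w s \<omega> \<le> polar_max A w s n" .
qed

text \<open>Working at a level strictly below the supremum avoids asking for an optimal
  configuration.\<close>

lemma less_polar_maxD:
  assumes "c < polar_max A w s N"
  shows "\<exists>\<omega>\<in>configs A N. \<forall>y\<in>A. c \<le> riesz_pot w s y \<omega>"
proof -
  obtain \<omega> where \<omega>: "\<omega> \<in> configs A N" "c < polar A w s \<omega>"
    using assms unfolding polar_max_def less_SUP_iff by auto
  then have "c \<le> riesz_pot w s y \<omega>" if "y \<in> A" for y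
    using polar_le[OF that, of w s \<omega>] by simp
  then show ?thesis using \<omega>(1) by blast
qed

lemma measurable_riesz_kernel [measurable]: "(\<lambda>y. riesz_kernel s y x) \<in> borel_measurable borel"
  unfolding riesz_kernel_def by measurable

lemma measurable_riesz [measurable]: "(\<lambda>y. riesz s y \<omega>) \<in> borel_measurable borel"
  unfolding riesz_eq by (induction \<omega>) auto

lemma nn_integral_riesz_le:
  assumes "\<And>x. x \<in># \<omega> \<Longrightarrow> (\<integral>\<^sup>+y. riesz_kernel s y x * indicator G y \<partial>hausdorff_measure d) \<le> \<Phi>"
    and [measurable]: "G \<in> sets borel"
  shows "(\<integral>\<^sup>+y. riesz s y \<omega> * indicator G y \<partial>hausdorff_measure d) \<le> of_nat (size \<omega>) * \<Phi>"
  using assms(1)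
proof (induction \<omega>)
  case empty
  then show ?case by (simp add: riesz_eq)
next
  case (add x \<omega>)
  have "(\<integral>\<^sup>+y. riesz s y (add_mset x \<omega>) * indicator G y \<partial>hausdorff_measure d)
     = (\<integral>\<^sup>+y. riesz_kernel s y x * indicator G y + riesz s y \<omega> * indicator G y \<partial>hausdorff_measure d)"
    by (simp add: riesz_eq distrib_right)
  also have "\<dots> = (\<integral>\<^sup>+y. riesz_kernel s y x * indicator G y \<partial>hausdorff_measure d) + (\<integral>\<^sup>+y. riesz s y \<omega> * indicator G y \<partial>hausdorff_measure d)"
    by (intro nn_integral_add) auto
  also have "\<dots> \<le> \<Phi> + of_nat (size \<omega>) * \<Phi>" using add by (intro add_mono) auto
  finally show ?case by (simp add: distrib_right)
qed

lemma ennreal_le_divide_iff_mult_le: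
  fixes x y :: ennreal
  assumes "0 < c" shows "x \<le> y / ennreal c \<longleftrightarrow> x * ennreal c \<le> y"
proof (cases y)
  case top
  then show ?thesis using assms by (simp add: ennreal_top_divide)
next
  case (real r)
  then show ?thesis using assms
    by (cases x) (auto simp: divide_ennreal ennreal_mult[symmetric] field_simps top_unique ennreal_top_mult)
qed

section \<open>Scaling, subdivision and averaging for the cube\<close>

abbreviation cube_polar :: "'a::euclidean_space itself \<Rightarrow> nat \<Rightarrow> real \<Rightarrow> nat \<Rightarrow> ennreal" where
  "cube_polar (_ :: 'a itself) d s N \<equiv> polar_max (unit_cube d :: 'a set) (\<lambda>_ _. 1) s N"

context
  fixes d :: nat
  assumes d: "d \<le> DIM('a::euclidean_space)" and d1: "1 \<le> d"
begin

private abbreviation "unit \<equiv> unit_cube d :: 'a set"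

lemma zero_in_unit: "0 \<in> unit"
  by (simp add: unit_cube_eq closed_cube_def subspace_0[OF subspace_coord_plane])

lemma unit_nonempty: "unit \<noteq> {}" using zero_in_unit by auto

text \<open>Projection onto the convex cube is 1-Lipschitz and fixes its points, so it brings no
  point of \<open>\<omega>\<close> farther from any \<open>y\<close> in the cube and can only raise
  the potential there. Hence configurations with points outside the cube are covered as well;
  scaling to the unit cube contributes \<open>r powr s\<close>.\<close>

lemma polar_closed_cube_le:
  assumes a: "a \<in> (coord_plane d :: 'a set)" and r: "0 < r" and s: "0 \<le> s"
  shows "ennreal (r powr s) * polar (closed_cube d a r) (\<lambda>_ _. 1) s \<omega> \<le> cube_polar TYPE('a) d s (size \<omega>)"
proof -
  let ?Q = "closed_cube d a r"
  have im: "(\<lambda>x. a + r *\<^sub>R x) ` unit = ?Q" unfolding unit_cube_eq by (rule affine_cube[OF d d1 a r])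
  have ne: "?Q \<noteq> {}" using im unit_nonempty by auto
  define g where "g x = (1/r) *\<^sub>R (closest_point ?Q x - a)" for x
  have g_in: "g x \<in> unit" for x
  proof -
    have "closest_point ?Q x \<in> (\<lambda>x. a + r *\<^sub>R x) ` unit"
      unfolding im by (rule closest_point_in_set[OF closed_closed_cube ne])
    then obtain u where "u \<in> unit" "closest_point ?Q x = a + r *\<^sub>R u" by (auto elim!: imageE)
    then show ?thesis using r by (simp add: g_def)
  qed
  let ?\<omega> = "image_mset g \<omega>"
  have c: "?\<omega> \<in> configs unit (size \<omega>)" using g_in by (auto simp: configs_def)
  have "ennreal (r powr s) * polar ?Q (\<lambda>_ _. 1) s \<omega> \<le> riesz s u ?\<omega>" if u: "u \<in> unit" for u
  proof -
    let ?y = "a + r *\<^sub>R u"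
    have y: "?y \<in> ?Q" using im u by auto
    have "dist u (g x) \<le> (1/r) * dist ?y x" for x
    proof -
      have "u - g x = (1/r) *\<^sub>R (?y - closest_point ?Q x)"
        using r by (simp add: g_def algebra_simps)
      then have "dist u (g x) = (1/r) * dist ?y (closest_point ?Q x)"
        using r by (simp add: dist_norm)
      also have "dist ?y (closest_point ?Q x) = dist (closest_point ?Q ?y) (closest_point ?Q x)"
        using closest_point_self[OF y] by simp
      also have "\<dots> \<le> dist ?y x"
        by (rule closest_point_lipschitz[OF convex_closed_cube[OF d d1] closed_closed_cube ne])
      finally show ?thesis using r by (simp add: divide_right_mono)
    qed
    then have "ennreal ((1/r) powr - s) * riesz s ?y \<omega> \<le> riesz s u ?\<omega>"
      using r s by (intro riesz_image_mset) auto
    moreover have "(1/r) powr - s = r powr s" using r by (simp add: powr_minus powr_divide)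
    ultimately show ?thesis
      using mult_left_mono[OF polar_le[OF y, of "\<lambda>_ _. 1" s \<omega>], of "ennreal (r powr s)"] by simp
  qed
  then have "ennreal (r powr s) * polar ?Q (\<lambda>_ _. 1) s \<omega> \<le> polar unit (\<lambda>_ _. 1) s ?\<omega>"
    by (rule polar_greatest)
  also have "\<dots> \<le> cube_polar TYPE('a) d s (size \<omega>)" by (rule polar_le_max[OF c])
  finally show ?thesis .
qed

lemma unit_subset_grid:
  assumes m: "0 < m"
  shows "unit \<subseteq> (\<Union>z\<in>Pi\<^sub>E (coord_dirs d :: 'a set) (\<lambda>_. {0..<int m}). closed_cube d (grid_point d m z) (1 / real m))"
proof
  fix x assume x: "x \<in> unit"
  \<comment> \<open>The minimum with \<open>int m - 1\<close> puts coordinates equal to 1 into the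
    last cube.\<close>
  define z where "z = (\<lambda>b\<in>(coord_dirs d :: 'a set). min \<lfloor>real m * (x \<bullet> b)\<rfloor> (int m - 1))"
  have xb: "x \<in> (coord_plane d :: 'a set)" "\<And>b. b \<in> (coord_dirs d :: 'a set) \<Longrightarrow> 0 \<le> x \<bullet> b \<and> x \<bullet> b \<le> 1"
    using x by (auto simp: unit_cube_def)
  have z: "z \<in> Pi\<^sub>E (coord_dirs d :: 'a set) (\<lambda>_. {0..<int m})" using m xb(2) by (auto simp: z_def)
  have "real_of_int (z b) / real m \<le> x \<bullet> b \<and> x \<bullet> b \<le> real_of_int (z b) / real m + 1 / real m" if b: "b \<in> (coord_dirs d :: 'a set)" for b
  proof (cases "\<lfloor>real m * (x \<bullet> b)\<rfloor> \<le> int m - 1")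
    case True
    then have zb: "z b = \<lfloor>real m * (x \<bullet> b)\<rfloor>" using b by (simp add: z_def)
    have "real_of_int (z b) \<le> real m * (x \<bullet> b)" "real m * (x \<bullet> b) \<le> real_of_int (z b) + 1"
      unfolding zb by linarith+
    then show ?thesis using m by (simp add: field_simps)
  next
    case False
    then have zb: "z b = int m - 1" using b by (simp add: z_def)
    have "int m \<le> \<lfloor>real m * (x \<bullet> b)\<rfloor>" using False by linarith
    then have "real m \<le> real m * (x \<bullet> b)" by (simp add: le_floor_iff)
    moreover have "real m * (x \<bullet> b) \<le> real m * 1" using xb(2)[OF b] by (intro mult_left_mono) auto
    ultimately have "x \<bullet> b = 1" using m by simp
    moreover have "real_of_int (z b) / real m = 1 - 1 / real m" using m by (simp add: zb field_simps)
    ultimately show ?thesis by simp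
  qed
  then have "x \<in> closed_cube d (grid_point d m z) (1 / real m)"
    using xb(1) by (simp add: closed_cube_def inner_grid_point[OF d d1])
  then show "x \<in> (\<Union>z\<in>Pi\<^sub>E (coord_dirs d :: 'a set) (\<lambda>_. {0..<int m}). closed_cube d (grid_point d m z) (1 / real m))"
    using z by blast
qed

lemma grid_cube_subset_unit:
  assumes m: "0 < m" and z: "z \<in> Pi\<^sub>E (coord_dirs d :: 'a set) (\<lambda>_. {0..<int m})"
  shows "closed_cube d (grid_point d m z) (1 / real m) \<subseteq> unit"
proof
  fix x assume x: "x \<in> closed_cube d (grid_point d m z) (1 / real m)"
  have "0 \<le> x \<bullet> b \<and> x \<bullet> b \<le> 1" if b: "b \<in> (coord_dirs d :: 'a set)" for b
  proof -
    have 1: "real_of_int (z b) / real m \<le> x \<bullet> b" "x \<bullet> b \<le> real_of_int (z b) / real m + 1 / real m"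
      using x b by (auto simp: closed_cube_def inner_grid_point[OF d d1])
    have zb: "0 \<le> z b" "z b + 1 \<le> int m" using z b by (auto simp: PiE_def Pi_def)
    then have "0 \<le> real_of_int (z b) / real m" by simp
    moreover have "(real_of_int (z b) + 1) / real m \<le> 1" using zb m by (simp add: divide_le_eq_1)
    ultimately show ?thesis using 1 by (simp add: add_divide_distrib)
  qed
  then show "x \<in> unit" using x by (simp add: unit_cube_def closed_cube_def)
qed

lemma cp_mono: "m \<le> n \<Longrightarrow> cube_polar TYPE('a) d s m \<le> cube_polar TYPE('a) d s n"
  by (rule polar_max_mono[OF unit_nonempty])

lemma size_sum_multiset:
  fixes M :: "'i \<Rightarrow> 'b multiset"
  shows "size (\<Sum>i\<in>I. M i) = (\<Sum>i\<in>I. size (M i))"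
  by (induction I rule: infinite_finite_induct) auto

text \<open>Each of the \<open>m ^ d\<close> subcubes receives a copy of the configuration shrunk by
  \<open>m\<close>. A point of the cube sees at least the copy in its own subcube, and shrinking
  multiplies the kernel by \<open>real m powr s\<close>.\<close>

lemma cp_subdivide:
  assumes m: "0 < m" and s: "0 \<le> s"
  shows "ennreal (real m powr s) * cube_polar TYPE('a) d s n \<le> cube_polar TYPE('a) d s (m ^ d * n)"
proof -
  let ?Z = "Pi\<^sub>E (coord_dirs d :: 'a set) (\<lambda>_. {0..<int m})"
  let ?g = "\<lambda>z x. grid_point d m z + (1 / real m) *\<^sub>R x"
  have im: "?g z ` unit = closed_cube d (grid_point d m z) (1 / real m)" for z
    unfolding unit_cube_eq using m by (intro affine_cube[OF d d1] grid_point_in_plane[OF d d1]) auto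
  have le: "ennreal (real m powr s) * c \<le> cube_polar TYPE('a) d s (m ^ d * n)" if lt: "c < cube_polar TYPE('a) d s n" for c
  proof -
    obtain \<omega> where \<omega>: "\<omega> \<in> configs unit n" "\<And>y. y \<in> unit \<Longrightarrow> c \<le> riesz s y \<omega>"
      using less_polar_maxD[OF lt] by blast
    define \<Omega> where "\<Omega> = (\<Sum>z\<in>?Z. image_mset (?g z) \<omega>)"
    have "size \<Omega> = m ^ d * n"
      using \<omega>(1) by (simp add: \<Omega>_def size_sum_multiset card_grid[OF d d1] configs_def)
    moreover have "set_mset \<Omega> \<subseteq> unit"
    proof
      fix x assume "x \<in># \<Omega>"
      then obtain z where z: "z \<in> ?Z" "x \<in># image_mset (?g z) \<omega>"
        unfolding \<Omega>_def by (auto simp: set_mset_sum card_grid[OF d d1])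
      then have "x \<in> ?g z ` unit" using \<omega>(1) by (auto simp: configs_def)
      then show "x \<in> unit" unfolding im using grid_cube_subset_unit[OF m z(1)] by blast
    qed
    ultimately have \<Omega>: "\<Omega> \<in> configs unit (m ^ d * n)" by (simp add: configs_def)
    have "ennreal (real m powr s) * c \<le> riesz s y \<Omega>" if y: "y \<in> unit" for y
    proof -
      obtain z where z: "z \<in> ?Z" "y \<in> closed_cube d (grid_point d m z) (1 / real m)"
        using unit_subset_grid[OF m] y by blast
      then obtain u where u: "u \<in> unit" "y = ?g z u" using im[of z] by blast
      have "ennreal (real m powr s) * c \<le> ennreal ((1 / real m) powr - s) * riesz s u \<omega>"
        using m \<omega>(2)[OF u(1)] by (intro mult_mono) (auto simp: powr_minus powr_divide)
      also have "\<dots> \<le> riesz s y (image_mset (?g z) \<omega>)"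
        using m s by (intro riesz_image_mset) (auto simp: u(2) dist_norm scaleR_diff_right[symmetric])
      also have "\<dots> \<le> riesz s y \<Omega>"
        unfolding \<Omega>_def using z card_grid[OF d d1]
        by (intro riesz_pot_mono) (simp add: sum.remove[OF _ z(1)])
      finally show ?thesis .
    qed
    then have "ennreal (real m powr s) * c \<le> polar unit (\<lambda>_ _. 1) s \<Omega>" by (rule polar_greatest)
    also have "\<dots> \<le> cube_polar TYPE('a) d s (m ^ d * n)" by (rule polar_le_max[OF \<Omega>])
    finally show ?thesis .
  qed
  have "c \<le> cube_polar TYPE('a) d s (m ^ d * n) / ennreal (real m powr s)" if "c < cube_polar TYPE('a) d s n" for c
    using le[OF that] m by (subst ennreal_le_divide_iff_mult_le) (auto simp: mult.commute)
  then have "cube_polar TYPE('a) d s n \<le> cube_polar TYPE('a) d s (m ^ d * n) / ennreal (real m powr s)" by (rule dense_le)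
  then show ?thesis
    using m by (subst (asm) ennreal_le_divide_iff_mult_le) (auto simp: mult.commute)
qed

lemma cp_1_pos: "0 \<le> s \<Longrightarrow> ennreal (real d powr - s) \<le> cube_polar TYPE('a) d s 1"
proof -
  assume s: "0 \<le> s"
  have c: "{#0#} \<in> configs unit 1" using zero_in_unit by (simp add: configs_def)
  have "ennreal (real d powr - s) \<le> riesz s y {#0#}" if "y \<in> unit" for y
    using that zero_in_unit closed_cube_dist[OF d d1, of y 0 1 0] d1 s
    by (simp add: riesz_eq unit_cube_eq riesz_kernel_ge)
  then have "ennreal (real d powr - s) \<le> polar unit (\<lambda>_ _. 1) s {#0#}" by (rule polar_greatest)
  also have "\<dots> \<le> cube_polar TYPE('a) d s 1" by (rule polar_le_max[OF c])
  finally show ?thesis .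
qed

text \<open>Averaging over the cube with the balls of radius \<open>t\<close> around the points removed.\<close>

lemma cp_average:
  assumes t: "0 < t" and s: "0 \<le> s"
  shows "cube_polar TYPE('a) d s n * (1 - ennreal (real n * (unit_ball_vol (real d) * t ^ d)))
    \<le> of_nat n * (\<integral>\<^sup>+\<rho>. ennreal (real d * unit_ball_vol (real d) * (\<rho> powr (real d - 1 - s))) * indicator {t..real d} \<rho> \<partial>lborel)"
    (is "_ \<le> of_nat n * ?\<Phi>")
proof -
  let ?H = "hausdorff_measure d :: 'a measure"
  have bnd: "polar unit (\<lambda>_ _. 1) s \<omega> * (1 - ennreal (real n * (unit_ball_vol (real d) * t ^ d))) \<le> of_nat n * ?\<Phi>"
    if \<omega>: "\<omega> \<in> configs unit n" for \<omega>
  proof -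
    define G where "G = unit - (\<Union>x\<in>set_mset \<omega>. cball x t)"
    have G [measurable]: "G \<in> sets borel" unfolding G_def unit_cube_eq by (intro sets.Diff) (auto simp: sets_cubes[OF d d1])
    \<comment> \<open>Subadditivity leaves \<open>G\<close> with measure at least 1 minus that of
      the removed balls; subtraction in \<open>ennreal\<close> is truncated, so the estimate becomes
      void if the balls are too large.\<close>
    have "hausdorff_outer d unit \<le> hausdorff_outer d G + hausdorff_outer d (\<Union>x\<in>set_mset \<omega>. cball x t \<inter> (coord_plane d :: 'a set))"
      by (intro order_trans[OF hausdorff_outer_mono hausdorff_outer_Un_le] d1) (auto simp: G_def unit_cube_def)
    also have "hausdorff_outer d (\<Union>x\<in>set_mset \<omega>. cball x t \<inter> (coord_plane d :: 'a set)) \<le> (\<Sum>x\<in>set_mset \<omega>. hausdorff_outer d (cball x t \<inter> (coord_plane d :: 'a set)))"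
      by (intro hausdorff_outer_finite_UN_le d1) simp
    also have "\<dots> = (\<Sum>x\<in>set_mset \<omega>. ennreal (unit_ball_vol (real d) * t ^ d))"
      using \<omega> t by (intro sum.cong refl hausdorff_cball[OF d d1]) (auto simp: configs_def unit_cube_def)
    also have "\<dots> = ennreal (real (card (set_mset \<omega>)) * (unit_ball_vol (real d) * t ^ d))"
      using t by (simp add: ennreal_mult ennreal_of_nat_eq_real_of_nat)
    also have "\<dots> \<le> ennreal (real n * (unit_ball_vol (real d) * t ^ d))"
      using t \<omega> by (intro ennreal_leI mult_right_mono) (auto simp: configs_def card_set_mset_le_size)
    finally have "hausdorff_outer d unit \<le> hausdorff_outer d G + ennreal (real n * (unit_ball_vol (real d) * t ^ d))"
      by (simp add: add_left_mono)
    moreover have "hausdorff_outer d unit = 1"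
      unfolding unit_cube_eq by (subst hausdorff_closed_cube[OF d d1]) (auto simp: subspace_0[OF subspace_coord_plane])
    ultimately have HG: "1 - ennreal (real n * (unit_ball_vol (real d) * t ^ d)) \<le> emeasure ?H G"
      by (simp add: emeasure_hausdorff_measure[OF d1] ennreal_minus_le_iff add.commute)
    have "polar unit (\<lambda>_ _. 1) s \<omega> * (1 - ennreal (real n * (unit_ball_vol (real d) * t ^ d))) \<le> polar unit (\<lambda>_ _. 1) s \<omega> * emeasure ?H G"
      using HG by (rule mult_left_mono) simp
    also have "\<dots> = (\<integral>\<^sup>+y. polar unit (\<lambda>_ _. 1) s \<omega> * indicator G y \<partial>?H)"
      by (simp add: nn_integral_cmult_indicator)
    also have "\<dots> \<le> (\<integral>\<^sup>+y. riesz s y \<omega> * indicator G y \<partial>?H)"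
      by (intro nn_integral_mono) (auto simp: indicator_def G_def intro!: polar_le)
    also have "\<dots> \<le> of_nat (size \<omega>) * ?\<Phi>"
    proof (rule nn_integral_riesz_le[OF _ G])
      fix x assume x: "x \<in># \<omega>"
      then have xu: "x \<in> unit" "x \<in> (coord_plane d :: 'a set)" using \<omega> by (auto simp: configs_def unit_cube_def)
      have "(\<integral>\<^sup>+y. riesz_kernel s y x * indicator G y \<partial>?H)
         \<le> (\<integral>\<^sup>+y. (\<lambda>\<rho>. ennreal (\<rho> powr - s) * indicator {t..real d} \<rho>) (dist x y) * indicator (coord_plane d :: 'a set) y \<partial>?H)"
      proof (rule nn_integral_mono)
        fix y
        show "riesz_kernel s y x * indicator G y \<le> (\<lambda>\<rho>. ennreal (\<rho> powr - s) * indicator {t..real d} \<rho>) (dist x y) * indicator (coord_plane d :: 'a set) y"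
        proof (cases "y \<in> G")
          case True
          then have "t < dist x y" "y \<in> (coord_plane d :: 'a set)" using x by (auto simp: G_def unit_cube_def not_le)
          moreover have "dist x y \<le> real d"
            using xu(1) True closed_cube_dist[OF d d1, of x 0 1 y] by (auto simp: G_def unit_cube_eq)
          ultimately show ?thesis using t True by (auto simp: riesz_kernel_def dist_commute)
        qed simp
      qed
      also have "\<dots> = (\<integral>\<^sup>+\<rho>. ennreal (\<rho> powr - s) * indicator {t..real d} \<rho> * (ennreal (real d * unit_ball_vol (real d) * \<rho> ^ (d - 1)) * indicator {0..} \<rho>) \<partial>lborel)"
        by (rule nn_integral_plane_radial[OF d d1 xu(2)]) measurable
      also have "\<dots> = ?\<Phi>"
      proof (rule nn_integral_cong)
        fix \<rho> :: real
        show "ennreal (\<rho> powr - s) * indicator {t..real d} \<rho> * (ennreal (real d * unit_ball_vol (real d) * \<rho> ^ (d - 1)) * indicator {0..} \<rho>)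
           = ennreal (real d * unit_ball_vol (real d) * (\<rho> powr (real d - 1 - s))) * indicator {t..real d} \<rho>"
        proof (cases "\<rho> \<in> {t..real d}")
          case True
          then have "0 < \<rho>" using t by auto
          then have "\<rho> powr - s * (real d * unit_ball_vol (real d) * \<rho> ^ (d - 1)) = real d * unit_ball_vol (real d) * (\<rho> powr (real d - 1 - s))"
            using d1 by (simp add: powr_realpow[symmetric] of_nat_diff powr_add[symmetric])
          then show ?thesis using True \<open>0 < \<rho>\<close> by (simp add: ennreal_mult''[symmetric])
        qed simp
      qed
      finally show "(\<integral>\<^sup>+y. riesz_kernel s y x * indicator G y \<partial>?H) \<le> ?\<Phi>" .
    qed
    finally show ?thesis using \<omega> by (simp add: configs_def)
  qed
  have "cube_polar TYPE('a) d s n * (1 - ennreal (real n * (unit_ball_vol (real d) * t ^ d))) = (SUP \<omega>\<in>configs unit n. polar unit (\<lambda>_ _. 1) s \<omega> * (1 - ennreal (real n * (unit_ball_vol (real d) * t ^ d))))"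
    unfolding polar_max_def by (simp add: SUP_mult_right_ennreal)
  also have "\<dots> \<le> of_nat n * ?\<Phi>" using bnd by (rule SUP_least)
  finally show ?thesis .
qed

end

lemma ennreal_le_divide_one_minus:
  fixes x :: ennreal
  assumes "x * (1 - ennreal q) \<le> of_nat n * ennreal K" "0 \<le> q" "q < 1" "0 \<le> K"
  shows "x \<le> ennreal (real n * K / (1 - q))"
proof -
  have "1 - ennreal q = ennreal (1 - q)" using assms by (metis ennreal_1 ennreal_minus)
  then have "x * ennreal (1 - q) \<le> ennreal (real n * K)"
    using assms by (simp add: ennreal_mult ennreal_of_nat_eq_real_of_nat)
  then have "x \<le> ennreal (real n * K) / ennreal (1 - q)"
    using assms by (subst ennreal_le_divide_iff_mult_le) auto
  then show ?thesis using assms by (simp add: divide_ennreal)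
qed

text \<open>A sequence with \<open>a (k ^ d * n) \<ge> k powr s * a n\<close> is, after normalization, asymptotically at least each of its terms;
  so its limit is its supremum.\<close>

lemma supermultiplicative_convergent:
  fixes a :: "nat \<Rightarrow> real"
  assumes d: "1 \<le> d" and s: "0 < s" and mono: "\<And>m n. m \<le> n \<Longrightarrow> a m \<le> a n"
    and sub: "\<And>k n. 0 < k \<Longrightarrow> real k powr s * a n \<le> a (k ^ d * n)"
    and bdd: "\<And>n. 1 \<le> n \<Longrightarrow> a n \<le> C * real n powr (s / real d)" and pos: "0 < a 1"
  shows "\<exists>\<sigma>>0. (\<lambda>n. a n / real n powr (s / real d)) \<longlonglongrightarrow> \<sigma>"
proof -
  define b where "b n = a n / real n powr (s / real d)" for n
  have bC: "b n \<le> C" if "1 \<le> n" for n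
    using bdd[OF that] that by (simp add: b_def divide_le_eq)
  define \<sigma> where "\<sigma> = (SUP n\<in>{1..}. b n)"
  have bdd: "bdd_above (b ` {1..})" using bC by (intro bdd_aboveI2[of _ _ C]) auto
  have b\<sigma>: "b n \<le> \<sigma>" if "1 \<le> n" for n
    unfolding \<sigma>_def using that bdd by (intro cSUP_upper) auto
  have "0 < b 1" using pos by (simp add: b_def)
  then have \<sigma>: "0 < \<sigma>" using b\<sigma>[of 1] by simp
  have "b \<longlonglongrightarrow> \<sigma>"
  proof (rule order_tendstoI)
    fix y assume y: "y < \<sigma>"
    then obtain n where n: "1 \<le> n" "max y 0 < b n"
      using less_cSUP_iff[OF _ bdd, of "max y 0"] \<sigma> unfolding \<sigma>_def by auto
    \<comment> \<open>\<open>u N\<close> is the ideal subdivision number before rounding: its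
      integer part \<open>k\<close> satisfies \<open>k ^ d * n \<le> N\<close>, and
      \<open>k / u N\<close> tends to 1.\<close>
    define u where "u N = (real N / real n) powr (1 / real d)" for N
    have lim: "(\<lambda>N. b n * (1 - 1 / u N) powr s) \<longlonglongrightarrow> b n * (1 - 0) powr s"
    proof -
      have "filterlim u at_top sequentially"
        unfolding u_def using n d by real_asymp
      then have "(\<lambda>N. 1 / u N) \<longlonglongrightarrow> 0"
        by (intro tendsto_divide_0[OF tendsto_const] filterlim_at_top_imp_at_infinity)
      then show ?thesis by (intro tendsto_intros) auto
    qed
    then have "\<forall>\<^sub>F N in sequentially. y < b n * (1 - 1 / u N) powr s"
      using n by (intro order_tendstoD(1)[OF lim]) auto
    moreover have "\<forall>\<^sub>F N in sequentially. n \<le> N" by (rule eventually_ge_at_top)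
    ultimately show "\<forall>\<^sub>F N in sequentially. y < b N"
    proof eventually_elim
      fix N assume y: "y < b n * (1 - 1 / u N) powr s" and N: "n \<le> N"
      have u1: "1 \<le> u N" unfolding u_def using n N by (intro ge_one_powr_ge_zero) auto
      define k where "k = nat \<lfloor>u N\<rfloor>"
      have k: "0 < k" "real k \<le> u N" "u N - 1 \<le> real k" using u1 by (auto simp: k_def)
      have "real k ^ d \<le> u N ^ d" using k by (intro power_mono) auto
      also have "u N ^ d = real N / real n"
        using n N d by (simp add: u_def powr_realpow[symmetric] powr_powr)
      finally have "real (k ^ d * n) \<le> real N" using n by (simp add: field_simps)
      then have kN: "k ^ d * n \<le> N" by (simp only: of_nat_le_iff)
      have up: "u N powr s = (real N / real n) powr (s / real d)"
        by (simp add: u_def powr_powr)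
      have "b n * (1 - 1 / u N) powr s = b n * ((u N - 1) / u N) powr s" using u1 by (simp add: diff_divide_distrib)
      also have "\<dots> \<le> b n * (real k / u N) powr s"
        using n u1 k s by (intro mult_left_mono powr_mono2 divide_right_mono) auto
      also have "\<dots> = real k powr s * a n / real N powr (s / real d)"
        using n N u1 by (simp add: powr_divide up b_def)
      also have "\<dots> \<le> b N"
        unfolding b_def using order_trans[OF sub[OF k(1), of n] mono[OF kN]] by (intro divide_right_mono) auto
      finally show "y < b N" using y by simp
    qed
  next
    fix y assume y: "\<sigma> < y"
    show "\<forall>\<^sub>F N in sequentially. b N < y"
      using eventually_ge_at_top[of 1]
    proof eventually_elim
      fix N :: nat assume "1 \<le> N"
      then show "b N < y" using b\<sigma>[of N] y by simp
    qed
  qed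
  then show ?thesis using \<sigma> unfolding b_def by blast
qed

lemma le_enn2realI:
  assumes "ennreal r \<le> x" "x < top" shows "r \<le> enn2real x"
proof -
  have "r \<le> enn2real (ennreal r)" by (cases "0 \<le> r") (auto simp: ennreal_neg)
  also have "\<dots> \<le> enn2real x" by (rule enn2real_mono[OF assms])
  finally show ?thesis .
qed

section \<open>Growth of the normalizing sequence\<close>

lemma tau_pos: "1 \<le> d \<Longrightarrow> 2 \<le> N \<Longrightarrow> 0 < tau s d N"
  by (auto simp: tau_def)

lemma tau_nonneg: "0 \<le> tau s d N"
  by (cases "N = 0") (auto simp: tau_def)

lemma tau_at_top:
  assumes "1 \<le> d" "real d \<le> s" shows "filterlim (tau s d) at_top sequentially"
proof (cases "s = real d")
  case True
  have "filterlim (\<lambda>N. real N * ln (real N)) at_top sequentially" by real_asymp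
  then show ?thesis using True by (simp add: tau_def[abs_def])
next
  case False
  have "0 < s / real d" using assms by simp
  then have "filterlim (\<lambda>N. real N powr (s / real d)) at_top sequentially" by real_asymp
  then show ?thesis using False by (simp add: tau_def[abs_def])
qed

text \<open>Makes the contribution of points at a fixed positive distance, at most a constant times
  \<open>N\<close>, negligible; for \<open>s = d\<close> it is the logarithm that does this.\<close>

lemma tau_superlinear:
  assumes "1 \<le> d" "real d \<le> s" shows "(\<lambda>N. real N / tau s d N) \<longlonglongrightarrow> 0"
proof (cases "s = real d")
  case True
  have "(\<lambda>N. real N / (real N * ln (real N))) \<longlonglongrightarrow> 0" by real_asymp
  then show ?thesis using True by (simp add: tau_def[abs_def])
next
  case False
  then have "1 < s / real d" using assms by simp
  then have "(\<lambda>N. real N / real N powr (s / real d)) \<longlonglongrightarrow> 0" by real_asymp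
  then show ?thesis using False by (simp add: tau_def[abs_def])
qed

text \<open>For \<open>s = d\<close> the factor \<open>ln n \<le> ln N\<close> only helps. Unlike
  the limit of the ratio, this bound holds for every \<open>n \<le> N\<close>.\<close>

lemma tau_le_fraction:
  assumes "1 \<le> d" "real d \<le> s" "n \<le> N" shows "tau s d n \<le> (real n / real N) powr (s / real d) * tau s d N"
proof (cases "n = 0")
  case True
  then show ?thesis by (simp add: tau_def)
next
  case False
  then have "ln (real n) \<le> ln (real N)" using assms by simp
  then show ?thesis
    using False assms by (auto simp: tau_def powr_divide intro: mult_left_mono)
qed

text \<open>For \<open>s = d\<close> the quotient of the logarithms tends to 1, since
  \<open>ln (h N / N)\<close> converges while \<open>ln N\<close> grows; so both cases lead to the
  same exponent.\<close>

lemma tau_ratio_tendsto: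
  assumes "1 \<le> d" "real d \<le> s" and lim: "(\<lambda>N. real (h N) / real N) \<longlonglongrightarrow> \<theta>" and \<theta>: "0 < \<theta>"
  shows "(\<lambda>N. tau s d (h N) / tau s d N) \<longlonglongrightarrow> \<theta> powr (s / real d)"
proof (cases "s = real d")
  case False
  have "(\<lambda>N. (real (h N) / real N) powr (s / real d)) \<longlonglongrightarrow> \<theta> powr (s / real d)"
    using \<theta> by (intro tendsto_powr lim tendsto_const) auto
  then show ?thesis using False by (simp add: tau_def powr_divide)
next
  case True
  have "(\<lambda>N. (real (h N) / real N) * (1 + ln (real (h N) / real N) / ln (real N))) \<longlonglongrightarrow> \<theta> * (1 + 0)"
  proof (intro tendsto_intros lim)
    have ll: "(\<lambda>N. ln (real (h N) / real N)) \<longlonglongrightarrow> ln \<theta>" using \<theta> by (intro tendsto_ln lim) auto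
    have "filterlim (\<lambda>N. ln (real N)) at_top sequentially" by real_asymp
    then show "(\<lambda>N. ln (real (h N) / real N) / ln (real N)) \<longlonglongrightarrow> 0"
      by (intro tendsto_divide_0[OF ll] filterlim_at_top_imp_at_infinity)
  qed
  moreover have "\<forall>\<^sub>F N in sequentially. (real (h N) / real N) * (1 + ln (real (h N) / real N) / ln (real N)) = tau s d (h N) / tau s d N"
    using order_tendstoD(1)[OF lim, of 0, OF \<theta>] eventually_ge_at_top[of 2]
  proof eventually_elim
    case (elim N)
    then have "0 < real (h N)" "0 < ln (real N)" by (auto simp: zero_less_divide_iff)
    then show ?case using elim True by (simp add: tau_def ln_div field_simps)
  qed
  ultimately have "(\<lambda>N. tau s d (h N) / tau s d N) \<longlonglongrightarrow> \<theta> * (1 + 0)" by (rule Lim_transform_eventually)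
  then show ?thesis using True \<theta> assms(1) by simp
qed

section \<open>Asymptotics of the polarization of the cube\<close>

context
  fixes d :: nat
  assumes d: "d \<le> DIM('a::euclidean_space)" and d1: "1 \<le> d"
begin

private abbreviation "\<beta> \<equiv> unit_ball_vol (real d)"

text \<open>The choice \<open>t ^ d = 1 / (2 * n * \<beta>)\<close> limits the measure of the
  removed balls to 1/2. Outside radius \<open>t\<close> the kernel integrates to order
  \<open>t powr (d - s)\<close>, that is \<open>n powr (s / d - 1)\<close> for each point. Only the
  order matters, because for \<open>s > d\<close> the constant is defined as a limit.\<close>

lemma cp_bound_gt:
  assumes s: "real d < s" and n: "1 \<le> n"
  shows "cube_polar TYPE('a) d s n \<le> ennreal (2 * (real d * \<beta> / (s - real d)) * (2 * \<beta>) powr ((s - real d) / real d) * real n powr (s / real d))"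
proof -
  define t where "t = (1 / (2 * real n * \<beta>)) powr (1 / real d)"
  have \<beta>: "0 < \<beta>" by simp
  then have \<beta>0: "\<beta> \<noteq> 0" by linarith
  have t: "0 < t" using n by (simp add: t_def \<beta>0)
  have "t ^ d = 1 / (2 * real n * \<beta>)" using n \<beta> d1 by (simp add: t_def powr_realpow[symmetric] powr_powr \<beta>0)
  then have q: "real n * (\<beta> * t ^ d) = 1/2" using n by (simp add: \<beta>0)
  define K where "K = real d * \<beta> / (s - real d) * t powr (real d - s)"
  have "(\<integral>\<^sup>+\<rho>. ennreal (real d * \<beta> * (\<rho> powr (real d - 1 - s))) * indicator {t..real d} \<rho> \<partial>lborel) \<le> ennreal K"
  proof (cases "t \<le> real d")
    case True
    define F where "F \<rho> = - (real d * \<beta> / (s - real d)) * \<rho> powr (real d - s)" for \<rho>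
    have "(\<integral>\<^sup>+\<rho>. ennreal (real d * \<beta> * (\<rho> powr (real d - 1 - s))) * indicator {t..real d} \<rho> \<partial>lborel) = ennreal (F (real d) - F t)"
    proof (rule nn_integral_FTC_Icc)
      fix x assume "x \<in> {t..real d}"
      then have x: "0 < x" using t by auto
      show "DERIV F x :> real d * \<beta> * (x powr (real d - 1 - s))"
      proof -
        have "DERIV F x :> - (real d * \<beta> / (s - real d)) * ((real d - s) * x powr (real d - s - 1))"
          unfolding F_def by (intro DERIV_cmult has_real_derivative_powr x)
        moreover have "- (real d * \<beta> / (s - real d)) * ((real d - s) * z) = real d * \<beta> * z" for z
        proof -
          have "q \<noteq> 0 \<Longrightarrow> - (B / q) * (- q * z) = B * z" for B q :: real by simp
          from this[of "s - real d" "real d * \<beta>"] show ?thesis using s by simp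
        qed
        moreover have "real d - s - 1 = real d - 1 - s" by simp
        ultimately show ?thesis by simp
      qed
    qed (use True in auto)
    also have "\<dots> \<le> ennreal K"
      using s by (intro ennreal_leI) (simp add: F_def K_def)
    finally show ?thesis .
  next
    case False
    then have "{t..real d} = {}" by simp
    then show ?thesis by simp
  qed
  then have "cube_polar TYPE('a) d s n * (1 - ennreal (1/2)) \<le> of_nat n * ennreal K"
    using cp_average[OF d d1 t, of s n] s unfolding q by (meson d1 le_less_trans less_imp_le mult_left_mono of_nat_0_le_iff order_trans zero_le)
  then have "cube_polar TYPE('a) d s n \<le> ennreal (real n * K / (1 - 1/2))"
    using s by (intro ennreal_le_divide_one_minus) (auto simp: K_def)
  also have "real n * K / (1 - 1/2) = 2 * (real d * \<beta> / (s - real d)) * (2 * \<beta>) powr ((s - real d) / real d) * real n powr (s / real d)"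
  proof -
    have "t powr (real d - s) = (1 / (2 * real n * \<beta>)) powr ((real d - s) / real d)"
      by (simp add: t_def powr_powr)
    also have "\<dots> = (2 * real n * \<beta>) powr ((s - real d) / real d)"
    proof -
      have "(s - real d) / real d = - ((real d - s) / real d)" by (simp add: minus_divide_left)
      then show ?thesis using n \<beta>0 by (simp add: powr_divide powr_minus_divide)
    qed
    also have "\<dots> = (2 * \<beta>) powr ((s - real d) / real d) * real n powr (s / real d - 1)"
      using n \<beta> d1 by (simp add: powr_mult diff_divide_distrib mult_ac)
    finally have "real n * t powr (real d - s) = (2 * \<beta>) powr ((s - real d) / real d) * (real n powr 1 * real n powr (s / real d - 1))"
      using n by simp
    also have "real n powr 1 * real n powr (s / real d - 1) = real n powr (s / real d)"
      unfolding powr_add[symmetric] by simp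
    finally show ?thesis by (simp add: K_def)
  qed
  finally show ?thesis .
qed

text \<open>The leading term is \<open>\<beta> * n * ln n / (1 - \<theta>)\<close>, because
  \<open>d * ln (1 / t)\<close> equals \<open>ln n\<close> up to a constant. The removed fraction
  \<open>\<theta>\<close> stays a parameter so that it can tend to 0 for the sharp constant;
  \<open>small\<close> gives \<open>t \<le> 1\<close>, hence a nonempty range of radii.\<close>

lemma cp_bound_eq:
  assumes \<theta>: "0 < \<theta>" "\<theta> < 1" and n: "1 \<le> n" and small: "\<theta> / (real n * \<beta>) \<le> 1"
  shows "cube_polar TYPE('a) d (real d) n \<le> ennreal (real n * (\<beta> * (real d * ln (real d) + ln (real n) + ln (\<beta> / \<theta>))) / (1 - \<theta>))"
proof -
  define t where "t = (\<theta> / (real n * \<beta>)) powr (1 / real d)"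
  have \<beta>: "0 < \<beta>" by simp
  then have \<beta>0: "\<beta> \<noteq> 0" by linarith
  have t: "0 < t" using n \<theta> by (simp add: t_def \<beta>0)
  have "t \<le> 1" unfolding t_def using small \<theta> \<beta> n by (intro powr_le1) auto
  then have td: "t \<le> real d" using d1 by linarith
  have "t ^ d = \<theta> / (real n * \<beta>)" using n \<beta> \<theta> d1 by (simp add: t_def powr_realpow[symmetric] powr_powr \<beta>0)
  then have q: "real n * (\<beta> * t ^ d) = \<theta>" using n by (simp add: \<beta>0)
  have ln_t: "real d * ln t = ln \<theta> - ln (real n) - ln \<beta>"
    using n \<beta> \<theta> d1 by (simp add: t_def ln_powr ln_div ln_mult \<beta>0)
  have "(\<integral>\<^sup>+\<rho>. ennreal (real d * \<beta> * (\<rho> powr (real d - 1 - real d))) * indicator {t..real d} \<rho> \<partial>lborel)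
     = ennreal (real d * \<beta> * ln (real d) - real d * \<beta> * ln t)"
  proof (rule nn_integral_FTC_Icc[where F = "\<lambda>\<rho>. real d * \<beta> * ln \<rho>"])
    fix x assume "x \<in> {t..real d}"
    then have x: "0 < x" using t by auto
    show "DERIV (\<lambda>\<rho>. real d * \<beta> * ln \<rho>) x :> real d * \<beta> * (x powr (real d - 1 - real d))"
      using x by (auto intro!: derivative_eq_intros simp: powr_minus divide_simps)
  qed (use td in auto)
  then have "cube_polar TYPE('a) d (real d) n * (1 - ennreal \<theta>) \<le> of_nat n * ennreal (real d * \<beta> * ln (real d) - real d * \<beta> * ln t)"
    using cp_average[OF d d1 t, of "real d" n] unfolding q by simp
  moreover have eq: "real d * \<beta> * ln (real d) - real d * \<beta> * ln t = \<beta> * (real d * ln (real d) + ln (real n) + ln (\<beta> / \<theta>))"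
  proof -
    have A: "ln (\<beta> / \<theta>) = ln \<beta> - ln \<theta>" using \<theta> by (simp add: ln_div \<beta>0)
    have B: "real d * \<beta> * ln t = \<beta> * (ln \<theta> - ln (real n) - ln \<beta>)" by (simp add: ln_t[symmetric])
    show ?thesis unfolding A B by (simp add: algebra_simps)
  qed
  moreover have "0 \<le> real d * \<beta> * ln (real d) - real d * \<beta> * ln t"
    using td t \<beta> by (simp add: mult_left_mono)
  ultimately show ?thesis using \<theta> by (intro ennreal_le_divide_one_minus) auto
qed

text \<open>For \<open>s = d\<close> the averaging bound asks for sufficiently many points;
  monotonicity in the number of points reduces to that case.\<close>

lemma cp_finite:
  assumes s: "real d \<le> s" shows "cube_polar TYPE('a) d s n < top"
proof (cases "s = real d")
  case False
  then have "cube_polar TYPE('a) d s (max 1 n) < top" using s by (intro order_le_less_trans[OF cp_bound_gt]) auto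
  then show ?thesis using cp_mono[OF d d1 max.cobounded2[of n 1], of s] by (rule order_le_less_trans[rotated])
next
  case True
  define m where "m = max (max 1 n) (nat \<lceil>1 / \<beta>\<rceil>)"
  have "1 / \<beta> \<le> real m" by (simp add: m_def) linarith
  then have "(1/2) / (real m * \<beta>) \<le> 1" using unit_ball_vol_pos[of "real d"] by (simp add: field_simps m_def)
  then have "cube_polar TYPE('a) d (real d) m < top"
    by (intro order_le_less_trans[OF cp_bound_eq[of "1/2" m]]) (auto simp: m_def)
  then show ?thesis unfolding True using cp_mono[OF d d1, of n m "real d"] by (rule order_le_less_trans[rotated]) (simp add: m_def)
qed

text \<open>The grid is extended beyond the cube by \<open>\<eta>\<close>, so that every point of the cube sees a full ball of grid points;
  projecting the grid onto the cube only increases the potential.\<close>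

lemma cp_lower_eq:
  assumes \<eta>: "0 < \<eta>" and m: "0 < m" and small: "real d * (real d / real m) \<le> \<eta>"
  shows "ennreal (real m ^ d * (real d * \<beta> * (ln (\<eta> * real m / (real d)\<^sup>2) - 1))) \<le> cube_polar TYPE('a) d (real d) ((m + 2 * nat \<lceil>\<eta> * real m\<rceil> + 1) ^ d)"
proof -
  let ?H = "hausdorff_measure d :: 'a measure"
  define e where "e = nat \<lceil>\<eta> * real m\<rceil>"
  have e: "\<eta> * real m \<le> real e" unfolding e_def by linarith
  \<comment> \<open>\<open>c\<close> bounds the distance of a point of a cell to its grid point.
    Adding it to the distance makes the kernel on the whole cell at most its value at the grid
    point, so the sum over the grid dominates an integral.\<close>
  define c where "c = real d / real m"
  have c: "0 < c" using m d1 by (simp add: c_def)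
  define Z where "Z = Pi\<^sub>E (coord_dirs d :: 'a set) (\<lambda>_. {- int e..int m + int e})"
  have fin: "finite Z" unfolding Z_def using finite_coord_dirs[OF d] by (intro finite_PiE) auto
  have Zext: "Z \<subseteq> extensional (coord_dirs d :: 'a set)" by (auto simp: Z_def PiE_def)
  have card: "card Z = (m + 2 * e + 1) ^ d"
  proof -
    have "card {- int e..int m + int e} = m + 2 * e + 1"
      unfolding card_atLeastAtMost_int by linarith
    then show ?thesis unfolding Z_def using finite_coord_dirs[OF d] coord_dirs(2)[OF d] by (simp add: card_PiE)
  qed
  define \<omega> where "\<omega> = image_mset (grid_point d m) (mset_set Z)"
  have size: "size \<omega> = (m + 2 * e + 1) ^ d" by (simp add: \<omega>_def card)
  have "ennreal (real m ^ d * (real d * \<beta> * (ln (\<eta> * real m / (real d)\<^sup>2) - 1))) \<le> riesz (real d) y \<omega>" if y: "y \<in> (unit_cube d :: 'a set)" for y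
  proof -
    have yp: "y \<in> (coord_plane d :: 'a set)" "\<And>b. b \<in> (coord_dirs d :: 'a set) \<Longrightarrow> 0 \<le> y \<bullet> b \<and> y \<bullet> b \<le> 1" using y by (auto simp: unit_cube_def)
    let ?k = "\<lambda>x. ennreal ((dist y x + c) powr - real d)"
    let ?B = "ball y \<eta> \<inter> (coord_plane d :: 'a set)"
    have cover: "\<exists>z\<in>Z. x \<in> grid_cell d m z" if x: "x \<in> ?B" for x
    proof
      show "x \<in> grid_cell d m (grid_index d m x)" using x by (intro grid_cell_self[OF d d1] m) auto
      have "\<lfloor>real m * (x \<bullet> b)\<rfloor> \<in> {- int e..int m + int e}" if b: "b \<in> (coord_dirs d :: 'a set)" for b
      proof -
        have "\<bar>(x - y) \<bullet> b\<bar> \<le> norm (x - y)" using b coord_dirs(1)[OF d] by (intro Basis_le_norm) auto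
        then have "\<bar>x \<bullet> b - y \<bullet> b\<bar> < \<eta>" using x by (simp add: inner_diff_left dist_norm norm_minus_commute)
        then have "- \<eta> \<le> x \<bullet> b" "x \<bullet> b \<le> 1 + \<eta>" using yp(2)[OF b] by linarith+
        then have "real m * (- \<eta>) \<le> real m * (x \<bullet> b)" "real m * (x \<bullet> b) \<le> real m * (1 + \<eta>)"
          by (intro mult_left_mono; simp)+
        then have "- real e \<le> real m * (x \<bullet> b)" "real m * (x \<bullet> b) \<le> real m + real e"
          using e by (simp_all add: algebra_simps)
        then show ?thesis by (simp add: le_floor_iff floor_le_iff)
      qed
      then show "grid_index d m x \<in> Z" by (auto simp: grid_index_def Z_def)
    qed
    have term_le: "ennreal (real m ^ d) * (\<integral>\<^sup>+x. ?k x * indicator (grid_cell d m z) x \<partial>?H) \<le> riesz_kernel (real d) y (grid_point d m z)"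
      if z: "z \<in> Z" for z
    proof -
      have "?k x * indicator (grid_cell d m z) x \<le> riesz_kernel (real d) y (grid_point d m z) * indicator (grid_cell d m z) x" for x
      proof (cases "x \<in> grid_cell d m z")
        case True
        have "grid_point d m z \<in> closed_cube d (grid_point d m z) (1 / real m)"
          by (simp add: closed_cube_def grid_point_in_plane[OF d d1])
        then have "dist x (grid_point d m z) \<le> real d * (1 / real m)"
          using True half_open_cube_subset by (intro closed_cube_dist[OF d d1]) auto
        then have "dist y (grid_point d m z) \<le> dist y x + c"
          using dist_triangle[of y "grid_point d m z" x] by (simp add: c_def)
        then show ?thesis using True c by (auto intro!: riesz_kernel_ge add_nonneg_pos)
      qed simp
      then have "(\<integral>\<^sup>+x. ?k x * indicator (grid_cell d m z) x \<partial>?H) \<le> (\<integral>\<^sup>+x. riesz_kernel (real d) y (grid_point d m z) * indicator (grid_cell d m z) x \<partial>?H)"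
        by (rule nn_integral_mono)
      also have "\<dots> = riesz_kernel (real d) y (grid_point d m z) * ennreal ((1 / real m) ^ d)"
        using m by (simp add: nn_integral_cmult_indicator sets_cubes[OF d d1] emeasure_hausdorff_measure[OF d1]
           hausdorff_half_open_cube[OF d d1] grid_point_in_plane[OF d d1])
      finally have "ennreal (real m ^ d) * (\<integral>\<^sup>+x. ?k x * indicator (grid_cell d m z) x \<partial>?H)
        \<le> ennreal (real m ^ d) * (riesz_kernel (real d) y (grid_point d m z) * ennreal ((1 / real m) ^ d))"
        by (rule mult_left_mono) simp
      also have "\<dots> = riesz_kernel (real d) y (grid_point d m z) * (ennreal (real m ^ d) * ennreal ((1 / real m) ^ d))"
        by (simp only: mult_ac)
      also have "ennreal (real m ^ d) * ennreal ((1 / real m) ^ d) = 1"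
        using m by (simp add: ennreal_mult[symmetric] power_one_over)
      finally show ?thesis by simp
    qed
    \<comment> \<open>A lower bound of the radial integrand with an explicit antiderivative:
      Bernoulli's inequality replaces \<open>(\<rho> / (\<rho> + c)) ^ d\<close> by
      \<open>1 - d * c / \<rho>\<close>. The range of integration starts at \<open>d * c\<close>,
      where this becomes nonnegative.\<close>
    define f where "f \<rho> = real d * \<beta> * (1 / \<rho> - real d * c / \<rho>\<^sup>2)" for \<rho>
    have dc: "0 < real d * c" "real d * c \<le> \<eta>"
      using mult_pos_pos[OF _ c, of "real d"] d1 small by (auto simp: c_def)
    have "ennreal (real d * \<beta> * (ln (\<eta> * real m / (real d)\<^sup>2) - 1)) \<le> (\<integral>\<^sup>+\<rho>. ennreal (f \<rho>) * indicator {real d * c..\<eta>} \<rho> \<partial>lborel)"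
    proof -
      define F where "F \<rho> = real d * \<beta> * (ln \<rho> + real d * c / \<rho>)" for \<rho>
      have "(\<integral>\<^sup>+\<rho>. ennreal (f \<rho>) * indicator {real d * c..\<eta>} \<rho> \<partial>lborel) = ennreal (F \<eta> - F (real d * c))"
      proof (rule nn_integral_FTC_Icc)
        show "f \<in> borel_measurable borel" unfolding f_def by measurable
        fix x assume x: "x \<in> {real d * c..\<eta>}"
        then have x0: "0 < x" using dc by auto
        show "DERIV F x :> f x"
          unfolding F_def f_def using x0 by (auto intro!: derivative_eq_intros simp: power2_eq_square field_simps)
        have "real d * c / x\<^sup>2 \<le> 1 / x"
          using x x0 by (simp add: power2_eq_square field_simps)
        then show "0 \<le> f x" unfolding f_def by simp
      qed (use dc in auto)
      moreover have "real d * \<beta> * (ln (\<eta> * real m / (real d)\<^sup>2) - 1) \<le> F \<eta> - F (real d * c)"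
      proof -
        have "ln (\<eta> * real m / (real d)\<^sup>2) = ln (\<eta> / (real d * c))"
          using m d1 by (simp add: c_def power2_eq_square)
        also have "\<dots> = ln \<eta> - ln (real d * c)" using \<eta> c d1 by (simp add: ln_div)
        finally have "F \<eta> - F (real d * c) = real d * \<beta> * (ln (\<eta> * real m / (real d)\<^sup>2) - 1 + real d * c / \<eta>)"
          using c d1 by (simp add: F_def right_diff_distrib[symmetric])
        moreover have "0 \<le> real d * c / \<eta>" using dc \<eta> by simp
        ultimately show ?thesis using d1 by (auto intro!: mult_left_mono)
      qed
      ultimately show ?thesis by (simp add: ennreal_leI)
    qed
    also have "\<dots> \<le> (\<integral>\<^sup>+\<rho>. (ennreal ((\<rho> + c) powr - real d) * indicator {..<\<eta>} \<rho>) * (ennreal (real d * \<beta> * \<rho> ^ (d - 1)) * indicator {0..} \<rho>) \<partial>lborel)"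
    \<comment> \<open>The endpoint \<open>\<eta>\<close> belongs to the closed interval on the left
      but not to the open ball on the right; it is a null set.\<close>
    proof (rule nn_integral_mono_AE)
      show "AE \<rho> in lborel. ennreal (f \<rho>) * indicator {real d * c..\<eta>} \<rho> \<le> (ennreal ((\<rho> + c) powr - real d) * indicator {..<\<eta>} \<rho>) * (ennreal (real d * \<beta> * \<rho> ^ (d - 1)) * indicator {0..} \<rho>)"
        using AE_lborel_singleton[of \<eta>]
      proof eventually_elim
        fix \<rho> :: real assume ne: "\<rho> \<noteq> \<eta>"
        show "ennreal (f \<rho>) * indicator {real d * c..\<eta>} \<rho> \<le> (ennreal ((\<rho> + c) powr - real d) * indicator {..<\<eta>} \<rho>) * (ennreal (real d * \<beta> * \<rho> ^ (d - 1)) * indicator {0..} \<rho>)"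
        proof (cases "\<rho> \<in> {real d * c..\<eta>}")
          case True
          then have \<rho>: "real d * c \<le> \<rho>" "\<rho> < \<eta>" "0 < \<rho>" using ne dc by auto
          have c\<rho>: "c \<le> \<rho>" 
          proof -
            have "1 * c \<le> real d * c" using c d1 by (intro mult_right_mono) auto
            then show ?thesis using \<rho>(1) by linarith
          qed
          have "1 - real d * (c / \<rho>) \<le> (1 - c / \<rho>) ^ d"
            using Bernoulli_inequality[of "- (c / \<rho>)" d] c\<rho> \<rho> by simp
          also have "\<dots> \<le> (\<rho> / (\<rho> + c)) ^ d"
          proof (rule power_mono)
            show "1 - c / \<rho> \<le> \<rho> / (\<rho> + c)" using \<rho> c by (simp add: field_simps)
            show "0 \<le> 1 - c / \<rho>" using c\<rho> \<rho> by simp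
          qed
          finally have "1 / \<rho> * (1 - real d * (c / \<rho>)) \<le> 1 / \<rho> * (\<rho> / (\<rho> + c)) ^ d"
            using \<rho> by (intro mult_left_mono) auto
          also have "1 / \<rho> * (\<rho> / (\<rho> + c)) ^ d = (\<rho> + c) powr - real d * \<rho> ^ (d - 1)"
          proof -
            have "\<rho> ^ d = \<rho> * \<rho> ^ (d - 1)" using d1 by (metis Suc_le_eq One_nat_def power_minus_mult mult.commute)
            then show ?thesis using \<rho> c by (simp add: power_divide powr_minus powr_realpow field_simps)
          qed
          finally have "1 / \<rho> - real d * c / \<rho>\<^sup>2 \<le> (\<rho> + c) powr - real d * \<rho> ^ (d - 1)"
            by (simp add: right_diff_distrib power2_eq_square)
          then have "f \<rho> \<le> real d * \<beta> * ((\<rho> + c) powr - real d * \<rho> ^ (d - 1))"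
            unfolding f_def using d1 by (intro mult_left_mono) auto
          then have "ennreal (f \<rho>) \<le> ennreal ((\<rho> + c) powr - real d * (real d * \<beta> * \<rho> ^ (d - 1)))"
            by (intro ennreal_leI) (simp add: mult_ac)
          then show ?thesis using \<rho> True by (simp add: ennreal_mult)
        qed simp
      qed
    qed
    also have "\<dots> = (\<integral>\<^sup>+x. ennreal ((dist y x + c) powr - real d) * indicator {..<\<eta>} (dist y x) * indicator (coord_plane d :: 'a set) x \<partial>?H)"
      by (rule nn_integral_plane_radial[OF d d1 yp(1), symmetric]) measurable
    also have "\<dots> \<le> (\<integral>\<^sup>+x. (\<Sum>z\<in>Z. ?k x * indicator (grid_cell d m z) x) \<partial>?H)"
    proof (rule nn_integral_mono)
      fix x
      show "?k x * indicator {..<\<eta>} (dist y x) * indicator (coord_plane d :: 'a set) x \<le> (\<Sum>z\<in>Z. ?k x * indicator (grid_cell d m z) x)"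
      proof (cases "x \<in> ?B")
        case True
        then obtain z where z: "z \<in> Z" "x \<in> grid_cell d m z" using cover by blast
        have "?k x * indicator (grid_cell d m z) x \<le> (\<Sum>z\<in>Z. ?k x * indicator (grid_cell d m z) x)"
          using z fin by (intro member_le_sum) auto
        then show ?thesis using z True by simp
      qed (auto simp: indicator_def)
    qed
    also have "\<dots> = (\<Sum>z\<in>Z. \<integral>\<^sup>+x. ?k x * indicator (grid_cell d m z) x \<partial>?H)"
    proof (rule nn_integral_sum)
      note [measurable] = sets_cubes(1)[OF d d1]
      show "(\<lambda>x. ?k x * indicator (grid_cell d m z) x) \<in> borel_measurable ?H" for z by measurable
    qed
    finally have "ennreal (real m ^ d) * ennreal (real d * \<beta> * (ln (\<eta> * real m / (real d)\<^sup>2) - 1))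
       \<le> (\<Sum>z\<in>Z. ennreal (real m ^ d) * (\<integral>\<^sup>+x. ?k x * indicator (grid_cell d m z) x \<partial>?H))"
      unfolding sum_distrib_left[symmetric] by (rule mult_left_mono) simp
    also have "\<dots> \<le> (\<Sum>z\<in>Z. riesz_kernel (real d) y (grid_point d m z))"
      by (rule sum_mono[OF term_le])
    also have "\<dots> = riesz (real d) y \<omega>"
      by (simp add: riesz_eq \<omega>_def image_mset.compositionality comp_def sum_unfold_sum_mset)
    finally show ?thesis by (simp add: ennreal_mult')
  qed
  then have "ennreal (real m ^ d * (real d * \<beta> * (ln (\<eta> * real m / (real d)\<^sup>2) - 1))) \<le> polar (unit_cube d :: 'a set) (\<lambda>_ _. 1) (real d) \<omega>"
    by (rule polar_greatest)
  also have "\<dots> \<le> cube_polar TYPE('a) d (real d) (size \<omega>)"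
  proof -
    have "0 \<in> (coord_plane d :: 'a set)" by (rule subspace_0[OF subspace_coord_plane])
    then show ?thesis using polar_closed_cube_le[OF d d1, of 0 1 "real d" \<omega>] by (simp add: unit_cube_eq)
  qed
  finally show ?thesis by (simp add: size e_def)
qed

text \<open>Subdivision supplies the growth hypothesis and averaging an upper bound of the right
  order; the value of the limit stays implicit.\<close>

lemma cp_lim_gt:
  assumes s: "real d < s"
  shows "\<exists>\<sigma>>0. (\<lambda>n. enn2real (cube_polar TYPE('a) d s n) / real n powr (s / real d)) \<longlonglongrightarrow> \<sigma>"
proof (rule supermultiplicative_convergent)
  let ?a = "cube_polar TYPE('a) d s"
  have fin: "?a n < top" for n using s by (intro cp_finite) simp
  then have ar: "?a n = ennreal (enn2real (?a n))" for n by simp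
  show "1 \<le> d" "0 < s" using d1 s by auto
  show "enn2real (?a m) \<le> enn2real (?a n)" if "m \<le> n" for m n
    by (rule enn2real_mono[OF cp_mono[OF d d1 that] fin])
  show "real k powr s * enn2real (?a n) \<le> enn2real (?a (k ^ d * n))" if "0 < k" for k n
  proof -
    have "enn2real (ennreal (real k powr s) * ?a n) \<le> enn2real (?a (k ^ d * n))"
      using s by (intro enn2real_mono[OF cp_subdivide[OF d d1 that] fin]) simp
    then show ?thesis by (simp add: enn2real_mult)
  qed
  show "enn2real (?a n) \<le> 2 * (real d * \<beta> / (s - real d)) * (2 * \<beta>) powr ((s - real d) / real d) * real n powr (s / real d)"
    if "1 \<le> n" for n
    using cp_bound_gt[OF s that] s by (intro enn2real_leI) auto
  have "0 < ?a 1" using s d1 by (intro order_less_le_trans[OF _ cp_1_pos[OF d d1, of s]]) auto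
  then show "0 < enn2real (?a 1)" using fin[of 1] by (simp add: enn2real_positive_iff)
qed

text \<open>Each half leaves a free parameter, the removed fraction \<open>\<theta>\<close> of the
  averaging bound and the width \<open>\<eta>\<close> by which the grid is extended; the constant
  becomes sharp only as they tend to 0.\<close>

lemma cp_lim_eq:
  "(\<lambda>n. enn2real (cube_polar TYPE('a) d (real d) n) / (real n * ln (real n))) \<longlonglongrightarrow> \<beta>"
proof -
  let ?a = "cube_polar TYPE('a) d (real d)"
  have fin: "?a n < top" for n by (intro cp_finite) simp
  have \<beta>: "0 < \<beta>" by simp
  show ?thesis
  proof (rule order_tendstoI)
    fix y assume y: "\<beta> < y"
    have "((\<lambda>\<theta>. \<beta> / (1 - \<theta>)) \<longlongrightarrow> \<beta> / (1 - 0)) (at_right 0)" by (intro tendsto_intros) auto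
    then have "\<forall>\<^sub>F \<theta> in at_right 0. \<beta> / (1 - \<theta>) < y" using y by (intro order_tendstoD(2)) auto
    moreover have "\<forall>\<^sub>F \<theta> in at_right (0::real). 0 < \<theta> \<and> \<theta> < 1" by (rule eventually_at_rightI[of _ 1]) auto
    ultimately have "\<forall>\<^sub>F \<theta> in at_right 0. \<beta> / (1 - \<theta>) < y \<and> 0 < \<theta> \<and> \<theta> < 1" by (rule eventually_conj)
    from eventually_happens'[OF _ this] obtain \<theta> where \<theta>: "0 < \<theta>" "\<theta> < 1" "\<beta> / (1 - \<theta>) < y"
      by auto
    define c1 where "c1 = real d * ln (real d) + ln (\<beta> / \<theta>)"
    have "(\<lambda>n. (1 + c1 / ln (real n)) * (\<beta> / (1 - \<theta>))) \<longlonglongrightarrow> (1 + 0) * (\<beta> / (1 - \<theta>))"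
    proof (intro tendsto_intros)
      show "(\<lambda>n. c1 / ln (real n)) \<longlonglongrightarrow> 0" by real_asymp
    qed
    then have "\<forall>\<^sub>F n in sequentially. (1 + c1 / ln (real n)) * (\<beta> / (1 - \<theta>)) < y"
      using \<theta> by (intro order_tendstoD(2)) auto
    moreover have "\<forall>\<^sub>F n in sequentially. \<theta> / (real n * \<beta>) \<le> 1"
    proof -
      have "(\<lambda>n. \<theta> / \<beta> / real n) \<longlonglongrightarrow> 0" by real_asymp
      then have "\<forall>\<^sub>F n in sequentially. \<theta> / \<beta> / real n < 1" by (rule order_tendstoD(2)) simp
      then show ?thesis by eventually_elim (simp add: mult.commute)
    qed
    moreover note eventually_ge_at_top[of 2]
    ultimately show "\<forall>\<^sub>F n in sequentially. enn2real (?a n) / (real n * ln (real n)) < y"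
    proof eventually_elim
      case (elim n)
      then have ln: "0 < ln (real n)" by simp
      have "enn2real (?a n) \<le> real n * (\<beta> * (real d * ln (real d) + ln (real n) + ln (\<beta> / \<theta>))) / (1 - \<theta>)"
        (is "_ \<le> ?r")
      \<comment> \<open>If the bound were negative, \<open>ennreal\<close> would turn it into 0,
        against the positivity of the polarization of the cube.\<close>
      proof (cases "0 \<le> ?r")
        case True
        then show ?thesis using cp_bound_eq[OF \<theta>(1,2), of n] elim by (intro enn2real_leI) auto
      next
        case False
        then have "ennreal ?r = 0" by (simp add: ennreal_neg)
        moreover have "0 < ?a n"
        proof -
          have "0 < ennreal (real d powr - real d)" using d1 by simp
          also have "\<dots> \<le> ?a 1" by (rule cp_1_pos[OF d d1]) simp
          also have "\<dots> \<le> ?a n" using elim by (intro cp_mono[OF d d1]) simp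
          finally show ?thesis .
        qed
        ultimately show ?thesis using cp_bound_eq[OF \<theta>(1,2), of n] elim by auto
      qed
      then have "enn2real (?a n) / (real n * ln (real n)) \<le> ?r / (real n * ln (real n))"
        using ln by (intro divide_right_mono) auto
      also have "?r / (real n * ln (real n)) = (1 + c1 / ln (real n)) * (\<beta> / (1 - \<theta>))"
        using ln elim \<theta> by (simp add: c1_def field_simps)
      finally show ?case using elim by simp
    qed
  next
    fix y assume y: "y < \<beta>"
    have "((\<lambda>\<eta>. \<beta> / (1 + 2 * \<eta>) ^ d) \<longlongrightarrow> \<beta> / (1 + 2 * 0) ^ d) (at_right 0)" by (intro tendsto_intros) auto
    then have "\<forall>\<^sub>F \<eta> in at_right 0. y < \<beta> / (1 + 2 * \<eta>) ^ d" using y by (intro order_tendstoD(1)) auto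
    moreover have "\<forall>\<^sub>F \<eta> in at_right (0::real). 0 < \<eta>" by (rule eventually_at_right_less)
    ultimately have "\<forall>\<^sub>F \<eta> in at_right 0. y < \<beta> / (1 + 2 * \<eta>) ^ d \<and> 0 < \<eta>" by (rule eventually_conj)
    from eventually_happens'[OF _ this] obtain \<eta> where \<eta>: "0 < \<eta>" "y < \<beta> / (1 + 2 * \<eta>) ^ d"
      by auto
    \<comment> \<open>With \<open>m \<le> k1 * (u n - 3)\<close> the extended grid has at most
      \<open>(1 + 2 * \<eta>) * m + 3 \<le> u n\<close> points in each direction, hence at most
      \<open>n\<close> in all; the 3 absorbs the ceiling on both sides and the additional grid
      point. Below, \<open>t n\<close> is a lower bound for the rounded \<open>m\<close>.\<close>
    define k1 where "k1 = 1 / (1 + 2 * \<eta>)"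
    define k2 where "k2 = \<eta> / (real d)\<^sup>2"
    have k: "0 < k1" "0 < k2" using \<eta> d1 by (auto simp: k1_def k2_def)
    define u where "u n = real n powr (1 / real d)" for n
    have u: "filterlim u at_top sequentially" unfolding u_def using d1 by real_asymp
    define t where "t n = k1 * (u n - 3) - 1" for n
    have lim1: "(\<lambda>n. ((k1 * (u n - 3) - 1) / u n) ^ d) \<longlonglongrightarrow> k1 ^ d"
    proof (rule tendsto_power)
      have "((\<lambda>x. (k1 * (x - 3) - 1) / x) \<longlongrightarrow> k1) at_top" by real_asymp
      then show "(\<lambda>n. (k1 * (u n - 3) - 1) / u n) \<longlonglongrightarrow> k1" by (rule filterlim_compose[OF _ u])
    qed
    have lim2: "(\<lambda>n. (ln (k2 * (k1 * (u n - 3) - 1)) - 1) / ln (u n)) \<longlonglongrightarrow> 1"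
    proof -
      have "((\<lambda>x. (ln (k2 * (k1 * (x - 3) - 1)) - 1) / ln x) \<longlongrightarrow> 1) at_top" using k by real_asymp
      then show ?thesis by (rule filterlim_compose[OF _ u])
    qed
    have "(\<lambda>n. (t n / u n) ^ d * \<beta> * ((ln (k2 * t n) - 1) / ln (u n))) \<longlonglongrightarrow> k1 ^ d * \<beta> * 1"
      unfolding t_def by (intro tendsto_intros lim1 lim2)
    then have "\<forall>\<^sub>F n in sequentially. y < (t n / u n) ^ d * \<beta> * ((ln (k2 * t n) - 1) / ln (u n))"
      using \<eta> by (intro order_tendstoD(1)) (auto simp: k1_def power_one_over divide_simps)
    \<comment> \<open>Three thresholds: a nonnegative logarithmic factor, a positive
      \<open>m\<close>, and cells small enough for the grid estimate.\<close>
    moreover have "\<forall>\<^sub>F n in sequentially. max (exp 1 / k2) (max 1 (real d * real d / \<eta>)) \<le> t n"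
    proof -
      have "filterlim (\<lambda>x. k1 * (x - 3) - 1) at_top at_top" using k by real_asymp
      then have "filterlim t at_top sequentially" unfolding t_def by (rule filterlim_compose[OF _ u])
      then show ?thesis unfolding filterlim_at_top by blast
    qed
    moreover note eventually_ge_at_top[of 2]
    ultimately show "\<forall>\<^sub>F n in sequentially. y < enn2real (?a n) / (real n * ln (real n))"
    proof eventually_elim
      case (elim n)
      have t1: "1 \<le> t n" "exp 1 / k2 \<le> t n" "real d * real d / \<eta> \<le> t n" using elim by auto
      define m where "m = nat \<lfloor>k1 * (u n - 3)\<rfloor>"
      have m: "real m \<le> k1 * (u n - 3)" "t n \<le> real m" using t1(1) unfolding m_def t_def by linarith+
      have m0: "0 < m" using m(2) t1(1) by linarith
      define M where "M = m + 2 * nat \<lceil>\<eta> * real m\<rceil> + 1"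
      have "real M \<le> u n"
      proof -
        have "real (nat \<lceil>\<eta> * real m\<rceil>) \<le> \<eta> * real m + 1" using \<eta> by (simp add: of_nat_nat)
        then have "real M \<le> (1 + 2 * \<eta>) * real m + 3" by (simp add: M_def algebra_simps)
        also have "(1 + 2 * \<eta>) * real m \<le> (1 + 2 * \<eta>) * (k1 * (u n - 3))" using m \<eta> by (intro mult_left_mono) auto
        also have "\<dots> = u n - 3" using \<eta> by (simp add: k1_def)
        finally show ?thesis by simp
      qed
      then have "real M ^ d \<le> u n ^ d" by (intro power_mono) auto
      also have "u n ^ d = real n" using elim d1 by (simp add: u_def powr_realpow[symmetric] powr_powr)
      finally have "M ^ d \<le> n" by (simp only: of_nat_power[symmetric] of_nat_le_iff)
      have un: "u n ^ d = real n" by fact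
      have lnu: "real d * ln (u n) = ln (real n)" using elim d1 by (simp add: u_def ln_powr)
      have small: "real d * (real d / real m) \<le> \<eta>" 
      proof -
        have "real d * real d / \<eta> \<le> real m" using t1(3) m by linarith
        then have "real d * real d \<le> \<eta> * real m" using \<eta> by (simp add: field_simps)
        then show ?thesis using m0 by (simp add: field_simps)
      qed
      have lb: "1 \<le> ln (k2 * t n)"
      proof -
        have "exp 1 \<le> k2 * t n" using t1(2) k by (simp add: field_simps)
        then show ?thesis using ln_ge_iff[of "k2 * t n" 1] k t1(1) by simp
      qed
      have "t n ^ d * (real d * \<beta> * (ln (k2 * t n) - 1)) \<le> real m ^ d * (real d * \<beta> * (ln (\<eta> * real m / (real d)\<^sup>2) - 1))"
      proof (intro mult_mono power_mono)
        have "ln (k2 * t n) \<le> ln (k2 * real m)" using k m t1 m0 by simp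
        then show "ln (k2 * t n) - 1 \<le> ln (\<eta> * real m / (real d)\<^sup>2) - 1" by (simp add: k2_def)
      qed (use m t1 lb in auto)
      also have "\<dots> \<le> enn2real (?a n)"
      proof -
        have "ennreal (real m ^ d * (real d * \<beta> * (ln (\<eta> * real m / (real d)\<^sup>2) - 1))) \<le> ?a n"
          using cp_lower_eq[OF \<eta>(1) m0 small] cp_mono[OF d d1 \<open>M ^ d \<le> n\<close>, of "real d"] unfolding M_def by (rule order_trans)
        then show ?thesis using fin[of n] by (rule le_enn2realI)
      qed
      finally have "t n ^ d * (real d * \<beta> * (ln (k2 * t n) - 1)) / (real n * ln (real n)) \<le> enn2real (?a n) / (real n * ln (real n))"
        using elim by (intro divide_right_mono) auto
      moreover have "t n ^ d * (real d * \<beta> * (ln (k2 * t n) - 1)) / (real n * ln (real n)) = (t n / u n) ^ d * \<beta> * ((ln (k2 * t n) - 1) / ln (u n))"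
        unfolding power_divide un lnu[symmetric] using d1 by simp
      ultimately show ?case using elim by linarith
    qed
  qed
qed

text \<open>For \<open>s > d\<close> the constant \<open>sigma_sd\<close> is an
  \<open>ennreal\<close> limit written with \<open>lim\<close>, which is informative only once
  convergence is known; the real limit is transferred to it here.\<close>

lemma cube_polar_asymptotics:
  assumes s: "real d \<le> s"
  obtains \<sigma> where "0 < \<sigma>" "sigma_sd s d TYPE('a) = ennreal \<sigma>"
    "(\<lambda>n. enn2real (cube_polar TYPE('a) d s n) / tau s d n) \<longlonglongrightarrow> \<sigma>"
proof (cases "s = real d")
  case True
  show ?thesis
  proof (rule that[of \<beta>])
    show "sigma_sd s d TYPE('a) = ennreal \<beta>" using True by (simp add: sigma_sd_def)
    show "(\<lambda>n. enn2real (cube_polar TYPE('a) d s n) / tau s d n) \<longlonglongrightarrow> \<beta>"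
      using cp_lim_eq True by (simp add: tau_def)
  qed simp
next
  case False
  then have s': "real d < s" using s by simp
  obtain \<sigma> where \<sigma>: "0 < \<sigma>" "(\<lambda>n. enn2real (cube_polar TYPE('a) d s n) / real n powr (s / real d)) \<longlonglongrightarrow> \<sigma>"
    using cp_lim_gt[OF s'] by auto
  have "(\<lambda>n. cube_polar TYPE('a) d s n / ennreal (real n powr (s / real d))) \<longlonglongrightarrow> ennreal \<sigma>"
  proof (rule Lim_transform_eventually)
    show "(\<lambda>n. ennreal (enn2real (cube_polar TYPE('a) d s n) / real n powr (s / real d))) \<longlonglongrightarrow> ennreal \<sigma>"
      by (intro tendsto_ennrealI \<sigma>)
    show "\<forall>\<^sub>F n in sequentially. ennreal (enn2real (cube_polar TYPE('a) d s n) / real n powr (s / real d)) = cube_polar TYPE('a) d s n / ennreal (real n powr (s / real d))"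
      using eventually_ge_at_top[of 1]
    proof eventually_elim
      case (elim n)
      then show ?case using cp_finite[OF s, of n] by (simp add: divide_ennreal[symmetric])
    qed
  qed
  then have "lim (\<lambda>n. cube_polar TYPE('a) d s n / ennreal (real n powr (s / real d))) = ennreal \<sigma>"
    by (rule limI)
  then have "sigma_sd s d TYPE('a) = ennreal \<sigma>" using False by (simp add: sigma_sd_def)
  then show ?thesis using \<sigma> False by (intro that[of \<sigma>]) (auto simp: tau_def)
qed

text \<open>The number \<open>n\<close> of points in a patch is unknown and may even stay bounded,
  so the asymptotics are made uniform in \<open>n \<le> N\<close>: large \<open>n\<close> use the
  limit and the comparison of \<open>tau s d n\<close> with \<open>tau s d N\<close>, small
  \<open>n\<close> disappear in the error term.\<close>

lemma cube_polar_uniform_upper: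
  assumes s: "real d \<le> s" and lim: "(\<lambda>n. enn2real (cube_polar TYPE('a) d s n) / tau s d n) \<longlonglongrightarrow> \<sigma>" and \<epsilon>: "0 < \<epsilon>"
  shows "\<forall>\<^sub>F N in sequentially. \<forall>n\<le>N. enn2real (cube_polar TYPE('a) d s n) \<le> (\<sigma> * (real n / real N) powr (s / real d) + \<epsilon>) * tau s d N"
proof -
  let ?a = "\<lambda>n. enn2real (cube_polar TYPE('a) d s n)"
  have mono: "?a m \<le> ?a n" if "m \<le> n" for m n
    by (rule enn2real_mono[OF cp_mono[OF d d1 that] cp_finite[OF s]])
  have "\<sigma> \<ge> 0" using lim by (rule LIMSEQ_le_const) (auto simp: tau_nonneg)
  have "\<forall>\<^sub>F n in sequentially. ?a n / tau s d n < \<sigma> + \<epsilon>" using \<epsilon> by (intro order_tendstoD(2)[OF lim]) auto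
  then obtain n0 where n0: "\<And>n. n0 \<le> n \<Longrightarrow> ?a n / tau s d n < \<sigma> + \<epsilon>" by (auto simp: eventually_sequentially)
  define n1 where "n1 = max n0 2"
  have "\<forall>\<^sub>F N in sequentially. ?a n1 / \<epsilon> \<le> tau s d N"
    using tau_at_top[OF d1 s] by (simp add: filterlim_at_top)
  then show ?thesis using eventually_ge_at_top[of 1]
  proof eventually_elim
    case (elim N)
    show ?case
    proof (intro allI impI)
      fix n assume n: "n \<le> N"
      show "?a n \<le> (\<sigma> * (real n / real N) powr (s / real d) + \<epsilon>) * tau s d N"
      proof (cases "n1 \<le> n")
        case True
        then have "0 < tau s d n" by (intro tau_pos d1) (auto simp: n1_def)
        then have "?a n \<le> (\<sigma> + \<epsilon>) * tau s d n" using n0[of n] True by (simp add: n1_def field_simps)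
        also have "\<dots> \<le> (\<sigma> + \<epsilon>) * ((real n / real N) powr (s / real d) * tau s d N)"
          using \<open>0 \<le> \<sigma>\<close> \<epsilon> by (intro mult_left_mono tau_le_fraction d1 s n) auto
        also have "\<dots> \<le> (\<sigma> * (real n / real N) powr (s / real d) + \<epsilon>) * tau s d N"
        proof -
          have "(real n / real N) powr (s / real d) \<le> 1" using n s elim by (intro powr_le1) auto
          then have "\<epsilon> * (real n / real N) powr (s / real d) \<le> \<epsilon> * 1" using \<epsilon> by (intro mult_left_mono) auto
          then have "(\<sigma> + \<epsilon>) * (real n / real N) powr (s / real d) \<le> \<sigma> * (real n / real N) powr (s / real d) + \<epsilon>"
            by (simp add: distrib_right)
          from mult_right_mono[OF this tau_nonneg[of s d N]] show ?thesis by (simp add: mult.assoc)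
        qed
        finally show ?thesis .
      next
        case False
        then have "?a n \<le> ?a n1" by (intro mono) simp
        also have "\<dots> \<le> \<epsilon> * tau s d N" using elim \<epsilon> by (simp add: field_simps)
        also have "\<dots> \<le> (\<sigma> * (real n / real N) powr (s / real d) + \<epsilon>) * tau s d N"
          using \<open>0 \<le> \<sigma>\<close> by (intro mult_right_mono tau_nonneg) auto
        finally show ?thesis .
      qed
    qed
  qed
qed

end

section \<open>Nearly isometric charts\<close>

definition bilipschitz :: "real \<Rightarrow> 'a::metric_space set \<Rightarrow> ('a \<Rightarrow> 'b::metric_space) \<Rightarrow> bool" where
  "bilipschitz L S h \<longleftrightarrow> (\<forall>u\<in>S. \<forall>v\<in>S. dist (h u) (h v) \<le> L * dist u v \<and> dist u v \<le> L * dist (h u) (h v))"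

lemma bilipschitz_subset: "bilipschitz L S h \<Longrightarrow> T \<subseteq> S \<Longrightarrow> bilipschitz L T h"
  unfolding bilipschitz_def by (meson subsetD)

lemma bilipschitz_inj_on: "bilipschitz L S h \<Longrightarrow> inj_on h S"
  unfolding bilipschitz_def inj_on_def by (metis dist_eq_0_iff dist_le_zero_iff mult_zero_right)

lemma bilipschitz_continuous_on: "bilipschitz L S h \<Longrightarrow> continuous_on S h"
proof (rule continuous_on_iff[THEN iffD2], intro ballI allI impI)
  fix x and e :: real assume b: "bilipschitz L S h" "x \<in> S" "0 < e"
  have "dist (h y) (h x) < e" if "y \<in> S" "dist y x < e / (\<bar>L\<bar> + 1)" for y
  proof -
    have "dist (h y) (h x) \<le> L * dist y x" using b that by (auto simp: bilipschitz_def)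
    also have "\<dots> \<le> (\<bar>L\<bar> + 1) * dist y x" by (intro mult_right_mono) auto
    also have "\<dots> < e" using that(2) by (simp add: field_simps)
    finally show ?thesis .
  qed
  then show "\<exists>d>0. \<forall>y\<in>S. dist y x < d \<longrightarrow> dist (h y) (h x) < e"
    using b(3) by (intro exI[of _ "e / (\<bar>L\<bar> + 1)"]) auto
qed

lemma bilipschitz_inv_into:
  assumes "bilipschitz L S h" shows "bilipschitz L (h ` S) (inv_into S h)"
  using assms bilipschitz_inj_on[OF assms] by (auto simp: bilipschitz_def)

lemma bilipschitz_openin_image:
  assumes h: "bilipschitz L S h" and W: "openin (top_of_set S) W"
  shows "openin (top_of_set (h ` S)) (h ` W)"
proof -
  have WS: "W \<subseteq> S" using W by (rule openin_imp_subset)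
  have inj: "inj_on h S" by (rule bilipschitz_inj_on[OF h])
  have "openin (top_of_set (h ` S)) (h ` S \<inter> inv_into S h -` W)"
    using W bilipschitz_continuous_on[OF bilipschitz_inv_into[OF h]]
    by (intro continuous_openin_preimage) (auto simp: inj)
  also have "h ` S \<inter> inv_into S h -` W = h ` W" using WS inj by auto
  finally show ?thesis .
qed

lemma hausdorff_outer_bilipschitz:
  assumes "bilipschitz L S h" "0 < L" "T \<subseteq> S"
  shows "hausdorff_outer d (h ` T) \<le> ennreal (L ^ d) * hausdorff_outer d T"
    and "hausdorff_outer d T \<le> ennreal (L ^ d) * hausdorff_outer d (h ` T)"
proof -
  have T: "bilipschitz L T h" by (rule bilipschitz_subset[OF assms(1,3)])
  show "hausdorff_outer d (h ` T) \<le> ennreal (L ^ d) * hausdorff_outer d T"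
    using T assms(2) by (intro hausdorff_outer_lipschitz) (auto simp: bilipschitz_def)
  have "hausdorff_outer d (inv_into T h ` (h ` T)) \<le> ennreal (L ^ d) * hausdorff_outer d (h ` T)"
    using bilipschitz_inv_into[OF T] assms(2) by (intro hausdorff_outer_lipschitz) (auto simp: bilipschitz_def)
  then show "hausdorff_outer d T \<le> ennreal (L ^ d) * hausdorff_outer d (h ` T)"
    using bilipschitz_inj_on[OF T] by simp
qed

section \<open>Charts and cube patches\<close>

definition chart :: "nat \<Rightarrow> 'a::euclidean_space set \<Rightarrow> real \<Rightarrow> ('a \<Rightarrow> 'a) \<times> 'a set \<Rightarrow> bool" where
  "chart d M L c \<longleftrightarrow> (case c of (h, V) \<Rightarrow> openin (top_of_set (coord_plane d)) V \<and> bounded V \<and>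
     openin (top_of_set M) (h ` V) \<and> bilipschitz L V h)"

text \<open>Openness relative to \<open>A\<close> keeps the remaining points of \<open>A\<close> at
  a positive distance from compact subsets of the open patch, and it makes what the open patches
  leave over compact.\<close>

definition cube_patch :: "nat \<Rightarrow> 'a::euclidean_space set \<Rightarrow> real \<Rightarrow> ('a \<Rightarrow> 'a) \<times> 'a \<times> real \<Rightarrow> bool" where
  "cube_patch d A L p \<longleftrightarrow> (case p of (h, a, r) \<Rightarrow> a \<in> coord_plane d \<and> 0 < r \<and> h ` closed_cube d a r \<subseteq> A \<and>
     openin (top_of_set A) (h ` open_cube d a r) \<and> bilipschitz L (closed_cube d a r) h)"

definition patch_open :: "nat \<Rightarrow> ('a \<Rightarrow> 'a) \<times> 'a \<times> real \<Rightarrow> 'a::euclidean_space set" where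
  "patch_open d p = (case p of (h, a, r) \<Rightarrow> h ` open_cube d a r)"

definition patch_closed :: "nat \<Rightarrow> ('a \<Rightarrow> 'a) \<times> 'a \<times> real \<Rightarrow> 'a::euclidean_space set" where
  "patch_closed d p = (case p of (h, a, r) \<Rightarrow> h ` closed_cube d a r)"

definition patch_family :: "nat \<Rightarrow> 'a::euclidean_space set \<Rightarrow> real \<Rightarrow> real \<Rightarrow> (('a \<Rightarrow> 'a) \<times> 'a \<times> real) set \<Rightarrow> bool" where
  "patch_family d A L \<delta> P \<longleftrightarrow> finite P \<and>
     (\<forall>p\<in>P. cube_patch d A L p \<and> (\<forall>x\<in>patch_closed d p. \<forall>y\<in>patch_closed d p. dist x y < \<delta>)) \<and>
     (\<forall>p\<in>P. \<forall>q\<in>P. p \<noteq> q \<longrightarrow> patch_open d p \<inter> patch_open d q = {})"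

lemma open_cube_subset_closed: "open_cube d a r \<subseteq> closed_cube d a r"
  by (rule order_trans[OF open_cube_subset half_open_cube_subset])

lemma patch_open_subset: "patch_open d p \<subseteq> patch_closed d p"
  using image_mono[OF order_trans[OF open_cube_subset half_open_cube_subset]]
  by (simp add: patch_open_def patch_closed_def split_beta)

context
  fixes d :: nat
  assumes d: "d \<le> DIM('a::euclidean_space)" and d1: "1 \<le> d"
begin


text \<open>The derivative \<open>T\<close> at \<open>v0\<close> is injective but need not be nearly
  isometric. An isometry \<open>J\<close> carries the image of \<open>T\<close> back to the
  coordinate plane, and \<open>S = J \<circ> T\<close> becomes the new parameter. Since
  \<open>norm (S u) = norm (T u)\<close>, in this parameter \<phi> deviates from an isometry only
  through the variation of its derivative, which is small near \<open>v0\<close>.\<close>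

lemma chart_exists:
  assumes M: "C1_submanifold d (M :: 'a set)" and x: "x \<in> M" and L: "1 < L"
  shows "\<exists>h V. chart d M L (h, V) \<and> x \<in> h ` V"
proof -
  let ?P = "\<lambda>U V \<phi> \<psi> (\<phi>' :: 'a \<Rightarrow> 'a \<Rightarrow>\<^sub>L 'a). open U \<and> x \<in> U \<and> openin (top_of_set (coord_plane d :: 'a set)) V \<and>
        homeomorphism V (M \<inter> U) \<phi> \<psi> \<and>
        (\<forall>v\<in>V. (\<phi> has_derivative blinfun_apply (\<phi>' v)) (at v within V) \<and> inj_on (blinfun_apply (\<phi>' v)) (coord_plane d :: 'a set)) \<and>
        continuous_on V \<phi>'"
  have "\<exists>U V \<phi> \<psi> \<phi>'. ?P U V \<phi> \<psi> \<phi>'"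
    using M x unfolding C1_submanifold_def by (rule bspec)
  then obtain U V \<phi> \<psi> \<phi>' where P: "?P U V \<phi> \<psi> \<phi>'" by (elim exE)
  then have U: "open U" "x \<in> U" and V: "openin (top_of_set (coord_plane d :: 'a set)) V" and hom: "homeomorphism V (M \<inter> U) \<phi> \<psi>"
    and cont: "continuous_on V \<phi>'" by simp_all
  have der: "(\<phi> has_derivative blinfun_apply (\<phi>' v)) (at v within V)" and inj: "inj_on (blinfun_apply (\<phi>' v)) (coord_plane d :: 'a set)" if "v \<in> V" for v
    using P that by simp_all
  define v0 where "v0 = \<psi> x"
  have v0: "v0 \<in> V" "\<phi> v0 = x"
    using hom x U by (auto simp: v0_def homeomorphism_def)
  have Vp: "V \<subseteq> (coord_plane d :: 'a set)" using V by (rule openin_imp_subset)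
  define T where "T = blinfun_apply (\<phi>' v0)"
  have linT: "linear T" and blT: "bounded_linear T"
    unfolding T_def by (simp_all add: blinfun.bounded_linear_right bounded_linear.linear)
  have injT: "inj_on T (coord_plane d :: 'a set)" unfolding T_def by (rule inj[OF v0(1)])
  have sp: "subspace (coord_plane d :: 'a set)" by (rule subspace_coord_plane)
  have "dim (T ` (coord_plane d :: 'a set)) = dim (coord_plane d :: 'a set)"
    using injT sp by (intro dim_image_eq linT) (simp add: span_eq_iff[THEN iffD2])
  then obtain J K where J: "linear J" "J ` (T ` (coord_plane d :: 'a set)) = (coord_plane d :: 'a set)" "\<And>y. y \<in> T ` (coord_plane d :: 'a set) \<Longrightarrow> norm (J y) = norm y"
    using isometries_subspaces[OF linear_subspace_image[OF linT sp] sp] by metis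
  define S where "S = J \<circ> T"
  have linS: "linear S" unfolding S_def by (intro linear_compose linT J)
  have Sim: "S ` (coord_plane d :: 'a set) = (coord_plane d :: 'a set)" using J(2) by (simp add: S_def image_comp)
  have normS: "norm (S u) = norm (T u)" if "u \<in> (coord_plane d :: 'a set)" for u using J(3) that by (simp add: S_def)
  have "T u = 0 \<longrightarrow> u = 0" if "u \<in> (coord_plane d :: 'a set)" for u
    using injT that subspace_0[OF sp] linear_0[OF linT] by (metis inj_onD)
  then obtain e where e: "0 < e" "\<And>u. u \<in> (coord_plane d :: 'a set) \<Longrightarrow> e * norm u \<le> norm (T u)"
    using injective_imp_isometric[OF closed_coord_plane sp blT] by metis
  have SeI: "e * dist u v \<le> dist (S u) (S v)" if "u \<in> (coord_plane d :: 'a set)" "v \<in> (coord_plane d :: 'a set)" for u v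
  proof -
    have "u - v \<in> (coord_plane d :: 'a set)" using that by (intro subspace_diff sp)
    then show ?thesis using e(2)[of "u - v"] normS[of "u - v"] linear_diff[OF linS] by (simp add: dist_norm)
  qed
  have injS: "inj_on S (coord_plane d :: 'a set)"
  proof (rule inj_onI)
    fix u v assume uv: "u \<in> (coord_plane d :: 'a set)" "v \<in> (coord_plane d :: 'a set)" "S u = S v"
    have "e * dist u v \<le> 0" using SeI[OF uv(1,2)] uv(3) by simp
    then show "u = v" using e(1) by (simp add: mult_le_0_iff)
  qed
  \<comment> \<open>Chosen so that a relative error \<open>\<delta>\<close> yields both bilipschitz
    bounds: \<open>1 - \<delta> = 1 / L\<close> and \<open>1 + \<delta> \<le> L\<close>.\<close>
  define \<delta> where "\<delta> = 1 - 1 / L"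
  have \<delta>: "0 < \<delta>" "1 + \<delta> \<le> L" "1 - \<delta> = 1 / L"
  proof -
    have "2 * L - 1 \<le> L * L" using zero_le_square[of "L - 1"] by (simp add: algebra_simps)
    then have "2 - 1 / L \<le> L" using L by (simp add: field_simps)
    then show "0 < \<delta>" "1 + \<delta> \<le> L" "1 - \<delta> = 1 / L" using L by (auto simp: \<delta>_def)
  qed
  obtain r1 where r1: "0 < r1" "\<And>v. v \<in> V \<Longrightarrow> dist v v0 < r1 \<Longrightarrow> dist (\<phi>' v) (\<phi>' v0) < e * \<delta>"
    using cont v0(1) mult_pos_pos[OF e(1) \<delta>(1)] unfolding continuous_on_iff by metis
  obtain r2 where r2: "0 < r2" "ball v0 r2 \<inter> (coord_plane d :: 'a set) \<subseteq> V"
    using V v0(1) unfolding openin_contains_ball by blast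
  define C where "C = ball v0 (min r1 r2) \<inter> (coord_plane d :: 'a set)"
  have C: "C \<subseteq> V" "C \<subseteq> (coord_plane d :: 'a set)" "convex C" "v0 \<in> C" "openin (top_of_set (coord_plane d :: 'a set)) C"
    using r1(1) r2 v0(1) Vp openin_open_Int[OF open_ball, of "coord_plane d" v0 "min r1 r2"]
    by (auto simp: C_def convex_Int subspace_imp_convex[OF sp] Int_commute)
  \<comment> \<open>Mean value inequality for \<open>\<phi> - T\<close> on the convex set
    \<open>C\<close>. As \<open>S\<close> expands distances by at least the factor \<open>e\<close>,
    the bound \<open>e * \<delta>\<close> amounts to a relative error \<open>\<delta>\<close> with
    respect to \<open>S\<close>.\<close>
  have near: "norm ((\<phi> u - T u) - (\<phi> v - T v)) \<le> e * \<delta> * norm (u - v)" if uv: "u \<in> C" "v \<in> C" for u v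
  proof (rule differentiable_bound[OF C(3) _ _ uv])
    fix y assume y: "y \<in> C"
    show "((\<lambda>u. \<phi> u - T u) has_derivative (\<lambda>u. blinfun_apply (\<phi>' y) u - T u)) (at y within C)"
      using y C(1) by (intro has_derivative_diff has_derivative_subset[OF der] bounded_linear_imp_has_derivative blT) auto
    have "onorm (\<lambda>u. blinfun_apply (\<phi>' y) u - T u) = norm (\<phi>' y - \<phi>' v0)"
      by (simp add: T_def norm_blinfun.rep_eq minus_blinfun.rep_eq)
    also have "\<dots> \<le> e * \<delta>"
      using r1(2)[of y] y C(1) by (auto simp: C_def dist_norm[symmetric] dist_commute less_imp_le)
    finally show "onorm (\<lambda>u. blinfun_apply (\<phi>' y) u - T u) \<le> e * \<delta>" .
  qed
  have bil: "dist (\<phi> u) (\<phi> v) \<le> L * dist (S u) (S v) \<and> dist (S u) (S v) \<le> L * dist (\<phi> u) (\<phi> v)" if uv: "u \<in> C" "v \<in> C" for u v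
  proof -
    have up: "u \<in> (coord_plane d :: 'a set)" "v \<in> (coord_plane d :: 'a set)" using uv C by auto
    have eq: "(\<phi> u - T u) - (\<phi> v - T v) = (\<phi> u - \<phi> v) - T (u - v)" by (simp add: linear_diff[OF linT])
    have Sd: "norm (T (u - v)) = dist (S u) (S v)"
      using normS[of "u - v"] subspace_diff[OF sp up] by (simp add: dist_norm linear_diff[OF linS])
    have "e * \<delta> * norm (u - v) = \<delta> * (e * dist u v)" by (simp add: dist_norm)
    also have "\<dots> \<le> \<delta> * dist (S u) (S v)" using \<delta> by (intro mult_left_mono SeI up) auto
    finally have n: "norm ((\<phi> u - \<phi> v) - T (u - v)) \<le> \<delta> * dist (S u) (S v)"
      using near[OF uv] unfolding eq by linarith
    have "dist (\<phi> u) (\<phi> v) \<le> (1 + \<delta>) * dist (S u) (S v)"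
      using n norm_triangle_sub[of "\<phi> u - \<phi> v" "T (u - v)"] Sd by (simp add: dist_norm algebra_simps)
    also have "\<dots> \<le> L * dist (S u) (S v)" using \<delta> by (intro mult_right_mono) auto
    finally have 1: "dist (\<phi> u) (\<phi> v) \<le> L * dist (S u) (S v)" .
    have "(1 - \<delta>) * dist (S u) (S v) \<le> dist (\<phi> u) (\<phi> v)"
      using n norm_triangle_sub[of "T (u - v)" "\<phi> u - \<phi> v"] Sd by (simp add: dist_norm algebra_simps norm_minus_commute)
    then have 2: "dist (S u) (S v) \<le> L * dist (\<phi> u) (\<phi> v)" unfolding \<delta> using L by (simp add: field_simps)
    show ?thesis using 1 2 by simp
  qed
  define g where "g = inv_into (coord_plane d :: 'a set) S"
  have g: "g (S u) = u" if "u \<in> (coord_plane d :: 'a set)" for u unfolding g_def by (rule inv_into_f_f[OF injS that])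
  have gp: "g y \<in> (coord_plane d :: 'a set)" "S (g y) = y" if "y \<in> (coord_plane d :: 'a set)" for y
    using that Sim unfolding g_def by (metis inv_into_into, metis f_inv_into_f)
  have "continuous_on (coord_plane d :: 'a set) g"
  proof (rule continuous_on_iff[THEN iffD2], intro ballI allI impI)
    fix y and \<epsilon> :: real assume y: "y \<in> (coord_plane d :: 'a set)" "0 < \<epsilon>"
    have "dist (g z) (g y) < \<epsilon>" if "z \<in> (coord_plane d :: 'a set)" "dist z y < e * \<epsilon>" for z
    proof -
      have "e * dist (g z) (g y) \<le> dist z y" using SeI[OF gp(1)[OF that(1)] gp(1)[OF y(1)]] gp(2) that y by simp
      also have "\<dots> < e * \<epsilon>" by fact
      finally show ?thesis using e(1) by simp
    qed
    then show "\<exists>\<delta>>0. \<forall>z\<in>(coord_plane d :: 'a set). dist z y < \<delta> \<longrightarrow> dist (g z) (g y) < \<epsilon>"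
      using e(1) y(2) by (intro exI[of _ "e * \<epsilon>"]) auto
  qed
  then have "openin (top_of_set (coord_plane d :: 'a set)) ((coord_plane d :: 'a set) \<inter> g -` C)"
    using gp(1) C(5) by (intro continuous_openin_preimage) auto
  moreover have SC: "(coord_plane d :: 'a set) \<inter> g -` C = S ` C"
  proof
    show "(coord_plane d :: 'a set) \<inter> g -` C \<subseteq> S ` C" using gp(2) by (auto intro!: image_eqI[of _ S "g _"])
    show "S ` C \<subseteq> (coord_plane d :: 'a set) \<inter> g -` C" using C(2) Sim g by auto
  qed
  ultimately have opn: "openin (top_of_set (coord_plane d :: 'a set)) (S ` C)" by simp
  have "bounded (S ` C)"
    by (intro bounded_linear_image linear_conv_bounded_linear[THEN iffD1] linS) (simp add: C_def bounded_Int)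
  moreover have im: "(\<phi> \<circ> g) ` (S ` C) = \<phi> ` C"
    using g C(2) by (auto simp: image_iff subset_eq) 
  moreover have "openin (top_of_set M) (\<phi> ` C)"
  proof -
    have "openin (top_of_set V) C" using C(1,5) Vp by (meson openin_subset_trans)
    then have "openin (top_of_set (M \<inter> U)) (\<phi> ` C)" by (rule homeomorphism_imp_open_map[OF hom])
    then show ?thesis using U(1) by (meson openin_open_Int openin_trans)
  qed
  moreover have "bilipschitz L (S ` C) (\<phi> \<circ> g)"
    unfolding bilipschitz_def
  proof (intro ballI)
    fix p q assume "p \<in> S ` C" "q \<in> S ` C"
    then obtain u v where uv: "u \<in> C" "v \<in> C" "p = S u" "q = S v" by auto
    then show "dist ((\<phi> \<circ> g) p) ((\<phi> \<circ> g) q) \<le> L * dist p q \<and> dist p q \<le> L * dist ((\<phi> \<circ> g) p) ((\<phi> \<circ> g) q)"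
      using bil[OF uv(1,2)] g C(2) by (simp add: subset_eq)
  qed
  ultimately have "chart d M L (\<phi> \<circ> g, S ` C)" using opn by (simp add: chart_def)
  moreover have "x \<in> (\<phi> \<circ> g) ` (S ` C)" unfolding im using C(4) v0(2) by auto
  ultimately show ?thesis by blast
qed

lemma hausdorff_cube_boundary:
  assumes "a \<in> (coord_plane d :: 'a set)" "0 < r" shows "hausdorff_outer d (closed_cube d a r - open_cube d a r) = 0"
proof -
  let ?H = "emeasure (hausdorff_measure d :: 'a measure)"
  have sub: "open_cube d a r \<subseteq> closed_cube d a r" by (rule open_cube_subset_closed)
  note meas = sets_cubes[OF d d1]
  have "?H (closed_cube d a r - open_cube d a r) = ?H (closed_cube d a r) - ?H (open_cube d a r)"
    using sub meas assms by (intro emeasure_Diff) (auto simp: emeasure_hausdorff_measure[OF d1] hausdorff_open_cube[OF d d1])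
  also have "\<dots> = 0"
    using meas assms by (simp add: emeasure_hausdorff_measure[OF d1] hausdorff_open_cube[OF d d1] hausdorff_closed_cube[OF d d1])
  finally show ?thesis using meas by (simp add: emeasure_hausdorff_measure[OF d1])
qed

lemma patch_boundary:
  assumes "cube_patch d (A :: 'a set) L p" "0 < L"
  shows "hausdorff_outer d (patch_closed d p - patch_open d p) = 0"
proof -
  obtain h a r where p: "p = (h, a, r)" by (cases p)
  have "hausdorff_outer d (h ` (closed_cube d a r - open_cube d a r)) \<le> ennreal (L ^ d) * hausdorff_outer d (closed_cube d a r - open_cube d a r)"
    using assms by (intro hausdorff_outer_bilipschitz[of L "closed_cube d a r"]) (auto simp: cube_patch_def p)
  also have "\<dots> = 0" using assms hausdorff_cube_boundary[of a r] by (simp add: cube_patch_def p)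
  finally have "hausdorff_outer d (h ` (closed_cube d a r - open_cube d a r)) = 0" by simp
  moreover have "hausdorff_outer d (h ` closed_cube d a r - h ` open_cube d a r) \<le> hausdorff_outer d (h ` (closed_cube d a r - open_cube d a r))"
    by (rule hausdorff_outer_mono) auto
  ultimately show ?thesis by (simp add: patch_open_def patch_closed_def p)
qed

lemma hausdorff_bounded_plane_finite:
  assumes "bounded V" "V \<subseteq> (coord_plane d :: 'a set)" shows "hausdorff_outer d V < top"
proof -
  obtain R where R: "0 < R" "\<forall>x\<in>V. norm x \<le> R" using assms(1) unfolding bounded_pos by blast
  have "hausdorff_outer d V \<le> hausdorff_outer d (cball 0 R \<inter> (coord_plane d :: 'a set))"
    using R assms(2) by (intro hausdorff_outer_mono) auto
  also have "\<dots> < top"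
    using R subspace_0[OF subspace_coord_plane] by (subst hausdorff_cball[OF d d1]) auto
  finally show ?thesis .
qed

lemma finite_chart_cover:
  assumes M: "C1_submanifold d (M :: 'a set)" and A: "compact A" "A \<subseteq> M" and L: "1 < L"
  shows "\<exists>\<C>. finite \<C> \<and> (\<forall>c\<in>\<C>. chart d M L c) \<and> A \<subseteq> (\<Union>(h, V)\<in>\<C>. h ` V)"
proof -
  have "\<forall>x\<in>A. \<exists>c. chart d M L c \<and> x \<in> fst c ` snd c" using chart_exists[OF M _ L] A(2) by fastforce
  then obtain c where c: "\<And>x. x \<in> A \<Longrightarrow> chart d M L (c x) \<and> x \<in> fst (c x) ` snd (c x)" by metis
  have "\<forall>x\<in>A. \<exists>W. open W \<and> fst (c x) ` snd (c x) = M \<inter> W"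
  proof
    fix x assume "x \<in> A"
    then have "openin (top_of_set M) (fst (c x) ` snd (c x))" using c[of x] by (simp add: chart_def split_beta)
    then show "\<exists>W. open W \<and> fst (c x) ` snd (c x) = M \<inter> W" by (auto simp: openin_open)
  qed
  then obtain W where W: "\<And>x. x \<in> A \<Longrightarrow> open (W x) \<and> fst (c x) ` snd (c x) = M \<inter> W x" by metis
  have "A \<subseteq> (\<Union>x\<in>A. W x)" using c W by blast
  then obtain F where F: "F \<subseteq> A" "finite F" "A \<subseteq> (\<Union>x\<in>F. W x)"
    using compactE_image[OF A(1), of A W] W by metis
  have "A \<subseteq> (\<Union>x\<in>F. fst (c x) ` snd (c x))"
  proof
    fix y assume y: "y \<in> A"
    then obtain x where "x \<in> F" "y \<in> W x" using F by auto
    moreover have "x \<in> A" using F(1) \<open>x \<in> F\<close> by auto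
    ultimately have "y \<in> fst (c x) ` snd (c x)" using W[of x] y A(2) by auto
    then show "y \<in> (\<Union>x\<in>F. fst (c x) ` snd (c x))" using \<open>x \<in> F\<close> by (rule UN_I[rotated])
  qed
  then show ?thesis using F c by (intro exI[of _ "c ` F"]) (auto simp: split_beta)
qed

lemma hausdorff_compact_finite:
  assumes M: "C1_submanifold d (M :: 'a set)" and A: "compact A" "A \<subseteq> M"
  shows "hausdorff_outer d A < top"
proof -
  obtain \<C> where C: "finite \<C>" "\<And>c. c \<in> \<C> \<Longrightarrow> chart d M 2 c" "A \<subseteq> (\<Union>(h, V)\<in>\<C>. h ` V)"
    using finite_chart_cover[OF M A, of 2] by auto
  have "hausdorff_outer d A \<le> hausdorff_outer d (\<Union>c\<in>\<C>. fst c ` snd c)"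
    using C(3) by (intro hausdorff_outer_mono) (auto simp: split_beta)
  also have "\<dots> \<le> (\<Sum>c\<in>\<C>. hausdorff_outer d (fst c ` snd c))" by (rule hausdorff_outer_finite_UN_le[OF d1 C(1)])
  also have "\<dots> < top"
  proof (rule ennreal_sum_less_top[OF C(1), THEN iffD2], intro ballI)
    fix c assume c: "c \<in> \<C>"
    obtain h V where hV: "c = (h, V)" by (cases c)
    have "chart d M 2 (h, V)" using C(2)[OF c] hV by simp
    then have V: "bounded V" "V \<subseteq> (coord_plane d :: 'a set)" "bilipschitz 2 V h"
      by (auto simp: chart_def dest: openin_imp_subset)
    have "hausdorff_outer d (h ` V) \<le> ennreal (2 ^ d) * hausdorff_outer d V"
      by (rule hausdorff_outer_bilipschitz(1)[OF V(3)]) auto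
    also have "\<dots> < top" using hausdorff_bounded_plane_finite[OF V(1,2)] by (simp add: ennreal_mult_less_top)
    finally show "hausdorff_outer d (fst c ` snd c) < top" by (simp add: hV)
  qed
  finally show ?thesis .
qed

text \<open>The part of the parameter domain over \<open>E\<close> is filled with closed dyadic
  cubes, so fine that their images have diameter below \<open>\<delta>\<close>. What they miss has
  measure below \<open>e / L ^ d\<close>, so its image has measure below \<open>e\<close>; the
  boundaries of the cubes contribute nothing.\<close>

lemma chart_cells:
  assumes c: "chart d (M :: 'a set) L (h, V)" and E: "openin (top_of_set M) E" "E \<subseteq> h ` V" "E \<subseteq> A" "A \<subseteq> M"
    and L: "1 < L" and \<delta>: "0 < \<delta>" and e: "0 < (e :: real)"
  shows "\<exists>P. patch_family d A L \<delta> P \<and> (\<forall>p\<in>P. patch_closed d p \<subseteq> E) \<and>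
     hausdorff_outer d (E - (\<Union>p\<in>P. patch_open d p)) < ennreal e"
proof -
  have V: "openin (top_of_set (coord_plane d :: 'a set)) V" "V \<subseteq> (coord_plane d :: 'a set)" "bounded V" "openin (top_of_set M) (h ` V)" "bilipschitz L V h"
    using c by (auto simp: chart_def dest: openin_imp_subset)
  have inj: "inj_on h V" by (rule bilipschitz_inj_on[OF V(5)])
  define V' where "V' = V \<inter> h -` E"
  have "openin (top_of_set V) V'"
    unfolding V'_def using V(4)[THEN openin_imp_subset] E
    by (intro continuous_openin_preimage[OF bilipschitz_continuous_on[OF V(5)]]) auto
  then have V'o: "openin (top_of_set (coord_plane d :: 'a set)) V'" using V(1) by (rule openin_trans)
  have hV': "h ` V' = E" using E(2) by (auto simp: V'_def)
  obtain U0 where U0: "open U0" "V' = (coord_plane d :: 'a set) \<inter> U0" using V'o by (auto simp: openin_open)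
  obtain R where R: "\<forall>x\<in>V. norm x < R" using V(3) by (metis bounded_pos_less)
  define U where "U = U0 \<inter> ball 0 R"
  have U: "open U" "bounded U" "U \<inter> (coord_plane d :: 'a set) = V'"
    using U0 R by (auto simp: U_def V'_def)
  have eL: "0 < e / L ^ d" using e L by simp
  have "\<forall>\<^sub>F k in sequentially. L * (real d * (1 / 2 ^ k)) < \<delta>"
  proof -
    have "(\<lambda>k. L * (real d * (1 / 2 ^ k))) \<longlonglongrightarrow> 0" by real_asymp
    then show ?thesis using \<delta> by (rule order_tendstoD(2))
  qed
  then have ev: "\<forall>\<^sub>F k in sequentially. L * (real d * (1 / 2 ^ k)) < \<delta> \<and>
      emeasure (hausdorff_measure d) (U \<inter> (coord_plane d :: 'a set) - (\<Union>z\<in>inner_cells d (2^k) U. grid_cell d (2^k) z)) < ennreal (e / L ^ d)"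
    by (rule eventually_conj[OF _ inner_cells_approx[OF d d1 U(1,2) eL]])
  obtain k where k: "L * (real d * (1 / 2 ^ k)) < \<delta>"
      "emeasure (hausdorff_measure d) (U \<inter> (coord_plane d :: 'a set) - (\<Union>z\<in>inner_cells d (2^k) U. grid_cell d (2^k) z)) < ennreal (e / L ^ d)"
    using eventually_happens'[OF sequentially_bot ev] by blast
  define m where "m = (2::nat) ^ k"
  have m: "0 < m" "real m = 2 ^ k" by (simp_all add: m_def)
  define Z where "Z = inner_cells d m U"
  have Zfin: "finite Z" unfolding Z_def by (rule inner_cells_finite[OF d d1 U(2) m(1)])
  have Zsub: "closed_cube d (grid_point d m z) (1 / real m) \<subseteq> V'" if "z \<in> Z" for z
  proof -
    have "closed_cube d (grid_point d m z) (1 / real m) \<subseteq> (coord_plane d :: 'a set)" by (auto simp: closed_cube_def)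
    then show ?thesis using that U(3) by (auto simp: Z_def inner_cells_def)
  qed
  define P where "P = (\<lambda>z. (h, grid_point d m z, 1 / real m)) ` Z"
  have V'V: "V' \<subseteq> V" by (auto simp: V'_def)
  have patch: "cube_patch d A L (h, grid_point d m z, 1 / real m)" if z: "z \<in> Z" for z
  proof -
    have cV: "closed_cube d (grid_point d m z) (1 / real m) \<subseteq> V" using Zsub[OF z] V'V by blast
    have oV: "open_cube d (grid_point d m z) (1 / real m) \<subseteq> V"
      by (rule order_trans[OF open_cube_subset_closed cV])
    have "openin (top_of_set V) (open_cube d (grid_point d m z) (1 / real m))"
      by (rule openin_subset_trans[OF openin_open_cube[OF d d1] oV V(2)])
    then have "openin (top_of_set (h ` V)) (h ` open_cube d (grid_point d m z) (1 / real m))"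
      by (rule bilipschitz_openin_image[OF V(5)])
    then have oM: "openin (top_of_set M) (h ` open_cube d (grid_point d m z) (1 / real m))"
      using V(4) by (rule openin_trans)
    have cA: "h ` closed_cube d (grid_point d m z) (1 / real m) \<subseteq> A"
      using Zsub[OF z] hV' E(3) by blast
    have oA: "h ` open_cube d (grid_point d m z) (1 / real m) \<subseteq> A"
      by (rule order_trans[OF image_mono[OF open_cube_subset_closed] cA])
    show ?thesis
      unfolding cube_patch_def
      using m cA openin_subset_trans[OF oM oA E(4)] bilipschitz_subset[OF V(5) cV] grid_point_in_plane[OF d d1]
      by simp
  qed
  have small: "dist (h u) (h v) < \<delta>"
    if z: "z \<in> Z" and uv: "u \<in> closed_cube d (grid_point d m z) (1 / real m)" "v \<in> closed_cube d (grid_point d m z) (1 / real m)" for z u v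
  proof -
    have "u \<in> V" "v \<in> V" using Zsub[OF z] V'V uv by auto
    then have "dist (h u) (h v) \<le> L * dist u v" using V(5) by (simp add: bilipschitz_def)
    also have "\<dots> \<le> L * (real d * (1 / real m))" using L closed_cube_dist[OF d d1 uv] by (intro mult_left_mono) auto
    also have "\<dots> < \<delta>" using k(1) m by simp
    finally show ?thesis .
  qed
  have disj: "h ` open_cube d (grid_point d m z) (1 / real m) \<inter> h ` open_cube d (grid_point d m z') (1 / real m) = {}"
    if z: "z \<in> Z" "z' \<in> Z" "z \<noteq> z'" for z z'
  proof -
    have "grid_cell d m z \<inter> grid_cell d m z' = ({} :: 'a set)"
      using disjoint_grid_cells[OF d d1 m(1)] z by (auto simp: disjoint_family_on_def Z_def inner_cells_def)
    then have 1: "open_cube d (grid_point d m z) (1 / real m) \<inter> open_cube d (grid_point d m z') (1 / real m) = ({} :: 'a set)"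
    proof -
      assume "grid_cell d m z \<inter> grid_cell d m z' = ({} :: 'a set)"
      then show ?thesis
        using open_cube_subset[of d "grid_point d m z :: 'a" "1 / real m"] open_cube_subset[of d "grid_point d m z' :: 'a" "1 / real m"] by blast
    qed
    have "open_cube d (grid_point d m z) (1 / real m) \<subseteq> V" if "z \<in> Z" for z
      by (rule order_trans[OF open_cube_subset_closed order_trans[OF Zsub[OF that] V'V]])
    then show ?thesis using 1 inj_on_image_Int[OF inj, of "open_cube d (grid_point d m z) (1 / real m)" "open_cube d (grid_point d m z') (1 / real m)"] z by simp
  qed
  have meas: "hausdorff_outer d (E - (\<Union>p\<in>P. patch_open d p)) < ennreal e"
  proof -
    let ?F = "\<Union>z\<in>Z. grid_cell d m z :: 'a set"
    let ?B = "\<Union>z\<in>Z. closed_cube d (grid_point d m z) (1 / real m) - open_cube d (grid_point d m z) (1 / real m) :: 'a set"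
    have "E - (\<Union>p\<in>P. patch_open d p) \<subseteq> h ` ((V' - ?F) \<union> (V' \<inter> ?B))"
    proof
      fix x assume x: "x \<in> E - (\<Union>p\<in>P. patch_open d p)"
      then obtain u where u: "u \<in> V'" "x = h u" using hV' by auto
      have "u \<notin> open_cube d (grid_point d m z) (1 / real m)" if "z \<in> Z" for z
        using x u that by (auto simp: P_def patch_open_def)
      moreover have "u \<in> closed_cube d (grid_point d m z) (1 / real m)" if "u \<in> grid_cell d m z" for z
        by (rule subsetD[OF half_open_cube_subset that])
      ultimately have "u \<in> (V' - ?F) \<union> (V' \<inter> ?B)" using u by blast
      then show "x \<in> h ` ((V' - ?F) \<union> (V' \<inter> ?B))" using u by blast
    qed
    then have "hausdorff_outer d (E - (\<Union>p\<in>P. patch_open d p)) \<le> hausdorff_outer d (h ` ((V' - ?F) \<union> (V' \<inter> ?B)))"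
      by (rule hausdorff_outer_mono)
    also have "\<dots> \<le> ennreal (L ^ d) * hausdorff_outer d ((V' - ?F) \<union> (V' \<inter> ?B))"
      using L V'V by (intro hausdorff_outer_bilipschitz(1)[OF V(5)]) auto
    also have "\<dots> \<le> ennreal (L ^ d) * (hausdorff_outer d (V' - ?F) + hausdorff_outer d ?B)"
      by (intro mult_left_mono order_trans[OF hausdorff_outer_Un_le[OF d1]] add_left_mono hausdorff_outer_mono) auto
    also have "hausdorff_outer d ?B = 0"
    proof -
      have "hausdorff_outer d ?B \<le> (\<Sum>z\<in>Z. hausdorff_outer d (closed_cube d (grid_point d m z) (1 / real m) - open_cube d (grid_point d m z) (1 / real m) :: 'a set))"
        by (rule hausdorff_outer_finite_UN_le[OF d1 Zfin])
      also have "\<dots> = 0" using m grid_point_in_plane[OF d d1] hausdorff_cube_boundary by (intro sum.neutral ballI) simp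
      finally show ?thesis by simp
    qed
    also have "ennreal (L ^ d) * (hausdorff_outer d (V' - ?F) + 0) < ennreal (L ^ d) * ennreal (e / L ^ d)"
    proof -
      have "V' - ?F \<in> sets borel"
      proof (intro sets.Diff sets.finite_UN Zfin)
        have "U \<inter> (coord_plane d :: 'a set) \<in> sets borel" using U(1) by auto
        then show "V' \<in> sets borel" using U(3) by simp
      qed (simp add: sets_cubes[OF d d1])
      then have "hausdorff_outer d (V' - ?F) < ennreal (e / L ^ d)"
        using k(2) unfolding U(3) by (simp add: emeasure_hausdorff_measure[OF d1] Z_def m_def)
      then show ?thesis using L by (simp add: ennreal_mult_strict_left_mono)
    qed
    also have "\<dots> = ennreal e" using L e by (simp add: ennreal_mult[symmetric])
    finally show ?thesis .
  qed
  have "patch_family d A L \<delta> P"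
    unfolding patch_family_def
  proof (intro conjI)
    show "finite P" using Zfin by (simp add: P_def)
    show "\<forall>p\<in>P. cube_patch d A L p \<and> (\<forall>x\<in>patch_closed d p. \<forall>y\<in>patch_closed d p. dist x y < \<delta>)"
    proof
      fix p assume "p \<in> P"
      then obtain z where z: "z \<in> Z" "p = (h, grid_point d m z, 1 / real m)" by (auto simp: P_def)
      show "cube_patch d A L p \<and> (\<forall>x\<in>patch_closed d p. \<forall>y\<in>patch_closed d p. dist x y < \<delta>)"
        using patch[OF z(1)] small[OF z(1)] by (auto simp: patch_closed_def z(2))
    qed
    show "\<forall>p\<in>P. \<forall>q\<in>P. p \<noteq> q \<longrightarrow> patch_open d p \<inter> patch_open d q = {}"
      using disj by (auto simp: P_def patch_open_def)
  qed
  moreover have "\<forall>p\<in>P. patch_closed d p \<subseteq> E"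
  proof
    fix p assume "p \<in> P"
    then obtain z where z: "z \<in> Z" "p = (h, grid_point d m z, 1 / real m)" by (auto simp: P_def)
    show "patch_closed d p \<subseteq> E" using Zsub[OF z(1)] hV' by (auto simp: patch_closed_def z(2))
  qed
  ultimately show ?thesis using meas by (intro exI[of _ P] conjI)
qed

lemma compact_patch_closed: "cube_patch d A L p \<Longrightarrow> compact (patch_closed d p :: 'a set)"
  using compact_closed_cube[OF d d1] bilipschitz_continuous_on
  by (auto simp: cube_patch_def patch_closed_def intro!: compact_continuous_image split: prod.splits)

text \<open>Charts overlap, so they are processed in turn: the new patches are placed in the chart
  minus the compact union \<open>K\<close> of the earlier closed patches, which is still relatively
  open. The part of \<open>K\<close> outside its open patches is null. Starting from the relative
  interior \<open>E\<close> is allowed because \<open>A - E\<close> lies in the null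
  frontier.\<close>

lemma patches_exist:
  assumes M: "C1_submanifold d (M :: 'a set)" and A: "compact A" "A \<subseteq> M"
    and null: "hausdorff_outer d ((top_of_set M) frontier_of A) = 0"
    and L: "1 < L" and \<delta>: "0 < \<delta>" and e: "0 < (e :: real)"
  shows "\<exists>P. patch_family d A L \<delta> P \<and> hausdorff_outer d (A - (\<Union>p\<in>P. patch_open d p)) < ennreal e"
proof -
  define E where "E = (top_of_set M) interior_of A"
  have E: "openin (top_of_set M) E" "E \<subseteq> A" by (simp_all add: E_def interior_of_subset)
  have AE: "A - E \<subseteq> (top_of_set M) frontier_of A"
    using closure_of_subset[of A "top_of_set M"] A(2) by (auto simp: frontier_of_def E_def)
  obtain \<C> where C: "finite \<C>" "\<forall>c\<in>\<C>. chart d M L c" "A \<subseteq> (\<Union>(h, V)\<in>\<C>. h ` V)"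
    using finite_chart_cover[OF M A L] by auto
  have "\<exists>P. patch_family d A L \<delta> P \<and>
     hausdorff_outer d (E \<inter> (\<Union>(h, V)\<in>\<C>. h ` V) - (\<Union>p\<in>P. patch_open d p)) < ennreal e"
    using C(1,2) e
  proof (induction arbitrary: e)
    case empty
    then show ?case by (intro exI[of _ "{}"]) (simp add: hausdorff_outer_empty[OF d1] patch_family_def)
  next
    case (insert c \<C>)
    obtain h V where c: "c = (h, V)" by (cases c)
    obtain P where PF: "patch_family d A L \<delta> P" and
       PH: "hausdorff_outer d (E \<inter> (\<Union>(h, V)\<in>\<C>. h ` V) - (\<Union>p\<in>P. patch_open d p)) < ennreal (e/2)"
      using insert.IH[of "e/2"] insert.prems by auto
    have P: "finite P" "\<And>p. p \<in> P \<Longrightarrow> cube_patch d A L p"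
       "\<And>p x y. p \<in> P \<Longrightarrow> x \<in> patch_closed d p \<Longrightarrow> y \<in> patch_closed d p \<Longrightarrow> dist x y < \<delta>"
       "\<And>p q. p \<in> P \<Longrightarrow> q \<in> P \<Longrightarrow> p \<noteq> q \<Longrightarrow> patch_open d p \<inter> patch_open d q = {}"
      using PF unfolding patch_family_def by simp_all
    define K where "K = (\<Union>p\<in>P. patch_closed d p)"
    have K: "compact K" unfolding K_def by (intro compact_UN compact_patch_closed[OF P(2)] P(1))
    define E' where "E' = E \<inter> h ` V - K"
    have ch: "chart d M L (h, V)" using insert.prems(1) c by simp
    have "openin (top_of_set M) (h ` V)" using ch by (simp add: chart_def)
    then have "openin (top_of_set M) (E \<inter> h ` V)" by (rule openin_Int[OF E(1)])
    then have E': "openin (top_of_set M) E'"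
    proof -
      assume o: "openin (top_of_set M) (E \<inter> h ` V)"
      have "E' = (E \<inter> h ` V) \<inter> - K" by (auto simp: E'_def)
      then show ?thesis using o compact_imp_closed[OF K] by (auto intro: openin_Int_open)
    qed
    obtain P' where PF': "patch_family d A L \<delta> P'" and sub': "\<forall>p\<in>P'. patch_closed d p \<subseteq> E'" and
       PH': "hausdorff_outer d (E' - (\<Union>p\<in>P'. patch_open d p)) < ennreal (e/2)"
    proof -
      have "E' \<subseteq> h ` V" "E' \<subseteq> A" using E(2) by (auto simp: E'_def)
      from chart_cells[OF ch E' this A(2) L \<delta>, of "e/2"] insert.prems(2) show ?thesis using that by auto
    qed
    have P': "finite P'" "\<And>p. p \<in> P' \<Longrightarrow> cube_patch d A L p" "\<And>p. p \<in> P' \<Longrightarrow> patch_closed d p \<subseteq> E'"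
       "\<And>p x y. p \<in> P' \<Longrightarrow> x \<in> patch_closed d p \<Longrightarrow> y \<in> patch_closed d p \<Longrightarrow> dist x y < \<delta>"
       "\<And>p q. p \<in> P' \<Longrightarrow> q \<in> P' \<Longrightarrow> p \<noteq> q \<Longrightarrow> patch_open d p \<inter> patch_open d q = {}"
      using PF' sub' unfolding patch_family_def by simp_all
    have KP: "hausdorff_outer d (K - (\<Union>p\<in>P. patch_open d p)) = 0"
    proof -
      have "hausdorff_outer d (K - (\<Union>p\<in>P. patch_open d p)) \<le> hausdorff_outer d (\<Union>p\<in>P. patch_closed d p - patch_open d p)"
        by (rule hausdorff_outer_mono) (auto simp: K_def)
      also have "\<dots> \<le> (\<Sum>p\<in>P. hausdorff_outer d (patch_closed d p - patch_open d p))"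
        by (rule hausdorff_outer_finite_UN_le[OF d1 P(1)])
      also have "\<dots> = 0" using patch_boundary[OF P(2)] L by (intro sum.neutral ballI) simp
      finally show ?thesis by simp
    qed
    have cross: "patch_open d p \<inter> patch_open d q = {}" if "p \<in> P" "q \<in> P'" for p q
    proof -
      have "patch_open d p \<subseteq> K" using that(1) patch_open_subset[of d p] by (auto simp: K_def)
      moreover have "patch_open d q \<subseteq> - K" using P'(3)[OF that(2)] patch_open_subset[of d q] by (auto simp: E'_def)
      ultimately show ?thesis by blast
    qed
    have disj: "patch_open d p \<inter> patch_open d q = {}" if "p \<in> P \<union> P'" "q \<in> P \<union> P'" "p \<noteq> q" for p q
      using that P(4)[of p q] P'(5)[of p q] cross[of p q] cross[of q p] by auto
    show ?case
    proof (intro exI[of _ "P \<union> P'"] conjI)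
      show "patch_family d A L \<delta> (P \<union> P')"
        unfolding patch_family_def
      proof (intro conjI)
        show "finite (P \<union> P')" using P(1) P'(1) by simp
        show "\<forall>p\<in>P \<union> P'. cube_patch d A L p \<and> (\<forall>x\<in>patch_closed d p. \<forall>y\<in>patch_closed d p. dist x y < \<delta>)"
        proof
          fix p assume "p \<in> P \<union> P'"
          then show "cube_patch d A L p \<and> (\<forall>x\<in>patch_closed d p. \<forall>y\<in>patch_closed d p. dist x y < \<delta>)"
          proof
            assume "p \<in> P" then show ?thesis using P(2,3) by simp
          next
            assume "p \<in> P'" then show ?thesis using P'(2,4) by simp
          qed
        qed
        show "\<forall>p\<in>P \<union> P'. \<forall>q\<in>P \<union> P'. p \<noteq> q \<longrightarrow> patch_open d p \<inter> patch_open d q = {}"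
          using disj by simp
      qed
    next
      let ?X = "E \<inter> (\<Union>(h, V)\<in>\<C>. h ` V) - (\<Union>p\<in>P. patch_open d p)"
      let ?Y = "E' - (\<Union>p\<in>P'. patch_open d p)"
      let ?Z = "K - (\<Union>p\<in>P. patch_open d p)"
      have "E \<inter> (\<Union>(h, V)\<in>insert c \<C>. h ` V) - (\<Union>p\<in>P \<union> P'. patch_open d p) \<subseteq> (?X \<union> ?Y) \<union> ?Z"
        by (auto simp: c E'_def)
      then have "hausdorff_outer d (E \<inter> (\<Union>(h, V)\<in>insert c \<C>. h ` V) - (\<Union>p\<in>P \<union> P'. patch_open d p))
         \<le> hausdorff_outer d ((?X \<union> ?Y) \<union> ?Z)" by (rule hausdorff_outer_mono)
      also have "\<dots> \<le> hausdorff_outer d ?X + hausdorff_outer d ?Y + hausdorff_outer d ?Z"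
        by (intro order_trans[OF hausdorff_outer_Un_le[OF d1]] add_right_mono hausdorff_outer_Un_le[OF d1])
      also have "\<dots> < ennreal (e/2) + ennreal (e/2)" using PH PH' KP by (simp add: add_strict_mono)
      also have "\<dots> = ennreal e" using insert.prems(2) by (simp add: ennreal_plus[symmetric] del: ennreal_plus)
      finally show "hausdorff_outer d (E \<inter> (\<Union>(h, V)\<in>insert c \<C>. h ` V) - (\<Union>p\<in>P \<union> P'. patch_open d p)) < ennreal e" .
    qed
  qed
  then obtain P where P: "patch_family d A L \<delta> P"
     "hausdorff_outer d (E \<inter> (\<Union>(h, V)\<in>\<C>. h ` V) - (\<Union>p\<in>P. patch_open d p)) < ennreal e" by blast
  have "A - (\<Union>p\<in>P. patch_open d p) \<subseteq> (E \<inter> (\<Union>(h, V)\<in>\<C>. h ` V) - (\<Union>p\<in>P. patch_open d p)) \<union> (top_of_set M) frontier_of A"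
    using AE C(3) by blast
  then have "hausdorff_outer d (A - (\<Union>p\<in>P. patch_open d p)) \<le> hausdorff_outer d (E \<inter> (\<Union>(h, V)\<in>\<C>. h ` V) - (\<Union>p\<in>P. patch_open d p)) + hausdorff_outer d ((top_of_set M) frontier_of A)"
    by (rule order_trans[OF hausdorff_outer_mono hausdorff_outer_Un_le[OF d1]])
  also have "\<dots> < ennreal e" using P(2) null by simp
  finally show ?thesis using P(1) by blast
qed

text \<open>The open neighbourhoods \<open>N n\<close> of \<open>C\<close> decrease to
  \<open>C\<close>, so one of them has plane measure below \<open>v\<close>. Sufficiently fine cells
  meeting \<open>C\<close> lie inside it, and being disjoint they have total volume below
  \<open>v\<close>. The form with all large \<open>k\<close> leaves room for further smallness
  conditions on the mesh.\<close>

lemma compact_grid_cover: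
  assumes C: "compact C" "C \<subseteq> (coord_plane d :: 'a set)" and v: "hausdorff_outer d C < ennreal v"
  shows "\<forall>\<^sub>F k in sequentially. \<exists>Z. finite Z \<and> C \<subseteq> (\<Union>z\<in>Z. closed_cube d (grid_point d (2^k) z) (1 / 2^k)) \<and> real (card Z) * (1 / 2^k) ^ d < v"
proof (cases "C = {}")
  case True
  have "0 < v" using v by (cases "0 < v") (auto simp: ennreal_neg not_less)
  then show ?thesis using True by (intro always_eventually allI exI[of _ "{}"]) simp
next
  case False
  let ?H = "emeasure (hausdorff_measure d :: 'a measure)"
  define N where "N n = {x. infdist x C < 1 / (real n + 1)}" for n
  have No: "open (N n)" for n unfolding N_def by (intro open_Collect_less continuous_intros)
  have Nb: "bounded (N n)" for n
  proof -
    obtain R where R: "\<forall>x\<in>C. norm x \<le> R" using compact_imp_bounded[OF C(1)] bounded_iff by metis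
    have "norm x \<le> R + 1" if x: "x \<in> N n" for x
    proof -
      have "1 / (real n + 1) \<le> 1" by simp
      moreover have "infdist x C < 1 / (real n + 1)" using x by (simp add: N_def)
      ultimately have "infdist x C < 1" by linarith
      moreover obtain y where y: "y \<in> C" "infdist x C = dist x y"
        using infdist_attains_inf[OF compact_imp_closed[OF C(1)] False, of x] by auto
      moreover have "norm y \<le> R" using R y(1) by blast
      ultimately show ?thesis using norm_triangle_sub[of x y] by (simp add: dist_norm)
    qed
    then show ?thesis by (auto simp: bounded_iff)
  qed
  have "(\<lambda>n. ?H (N n \<inter> (coord_plane d :: 'a set))) \<longlonglongrightarrow> ?H (\<Inter>n. N n \<inter> (coord_plane d :: 'a set))"
  proof (rule Lim_emeasure_decseq)
    show "decseq (\<lambda>n. N n \<inter> (coord_plane d :: 'a set))"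
    proof (rule decseq_SucI)
      fix n
      have "1 / (real (Suc n) + 1) \<le> 1 / (real n + 1)" by (simp add: frac_le)
      then show "N (Suc n) \<inter> (coord_plane d :: 'a set) \<subseteq> N n \<inter> (coord_plane d :: 'a set)" by (auto simp: N_def)
    qed
    show "range (\<lambda>n. N n \<inter> (coord_plane d :: 'a set)) \<subseteq> sets (hausdorff_measure d)" using No by auto
    show "?H (N n \<inter> (coord_plane d :: 'a set)) \<noteq> \<infinity>" for n
      using hausdorff_bounded_plane_finite[of "N n \<inter> (coord_plane d :: 'a set)"] Nb No by (auto simp: emeasure_hausdorff_measure[OF d1] bounded_Int)
  qed
  moreover have "(\<Inter>n. N n \<inter> (coord_plane d :: 'a set)) = C"
  proof
    show "C \<subseteq> (\<Inter>n. N n \<inter> (coord_plane d :: 'a set))" using C(2) by (auto simp: N_def add_nonneg_pos)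
    show "(\<Inter>n. N n \<inter> (coord_plane d :: 'a set)) \<subseteq> C"
    proof
      fix x assume x: "x \<in> (\<Inter>n. N n \<inter> (coord_plane d :: 'a set))"
      have "infdist x C \<le> 0"
      proof (rule ccontr)
        assume "\<not> infdist x C \<le> 0"
        then obtain n where "inverse (real (Suc n)) < infdist x C" using reals_Archimedean[of "infdist x C"] by (auto simp: not_le)
        moreover have "infdist x C < 1 / (real n + 1)" using x by (auto simp: N_def)
        ultimately show False by (simp add: inverse_eq_divide add.commute)
      qed
      then have "infdist x C = 0" using infdist_nonneg[of x C] by linarith
      then show "x \<in> C" using in_closed_iff_infdist_zero[OF compact_imp_closed[OF C(1)] False] by simp
    qed
  qed
  moreover have "?H C < ennreal v" using v borel_compact[OF C(1)] by (simp add: emeasure_hausdorff_measure[OF d1])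
  ultimately have "\<forall>\<^sub>F n in sequentially. ?H (N n \<inter> (coord_plane d :: 'a set)) < ennreal v" by (auto intro: order_tendstoD(2))
  then obtain n where n: "?H (N n \<inter> (coord_plane d :: 'a set)) < ennreal v" by (auto simp: eventually_sequentially)
  have "\<forall>\<^sub>F k in sequentially. real d * (1 / 2 ^ k) < 1 / (real n + 1)"
  proof -
    have "(\<lambda>k. real d * (1 / 2 ^ k)) \<longlonglongrightarrow> 0" by real_asymp
    then show ?thesis by (rule order_tendstoD(2)) simp
  qed
  then show ?thesis
  proof eventually_elim
    case (elim k)
    define m where "m = (2::nat) ^ k"
    have m: "0 < m" "real m = 2 ^ k" by (simp_all add: m_def)
    define Z where "Z = grid_index d m ` C"
    have sub: "closed_cube d (grid_point d m (grid_index d m x)) (1 / real m) \<subseteq> N n" if x: "x \<in> C" for x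
    proof
      fix y assume y: "y \<in> closed_cube d (grid_point d m (grid_index d m x)) (1 / real m)"
      have "x \<in> closed_cube d (grid_point d m (grid_index d m x)) (1 / real m)"
        using subsetD[OF half_open_cube_subset grid_cell_self[OF d d1 m(1)]] x C(2) by blast
      then have "dist y x \<le> real d * (1 / real m)" using y by (intro closed_cube_dist[OF d d1]) auto
      then show "y \<in> N n" using infdist_le[OF x, of y] elim m by (simp add: N_def)
    qed
    then have Zin: "Z \<subseteq> inner_cells d m (N n)"
      using grid_index_extensional[OF d d1] by (auto simp: Z_def inner_cells_def)
    have Zfin: "finite Z" using Zin inner_cells_finite[OF d d1 Nb m(1)] finite_subset by blast
    have Zext: "Z \<subseteq> extensional (coord_dirs d :: 'a set)" using grid_index_extensional[OF d d1] by (auto simp: Z_def)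
    have "C \<subseteq> (\<Union>z\<in>Z. closed_cube d (grid_point d m z) (1 / real m))"
    proof
      fix x assume x: "x \<in> C"
      then have "x \<in> closed_cube d (grid_point d m (grid_index d m x)) (1 / real m)"
        using subsetD[OF half_open_cube_subset grid_cell_self[OF d d1 m(1)]] C(2) by blast
      then show "x \<in> (\<Union>z\<in>Z. closed_cube d (grid_point d m z) (1 / real m))"
        using x by (auto simp: Z_def)
    qed
    moreover have "ennreal (real (card Z) * (1 / real m) ^ d) < ennreal v"
    proof -
      have "ennreal (real (card Z) * (1 / real m) ^ d) = ?H (\<Union>z\<in>Z. grid_cell d m z)"
        using emeasure_inner_cells(1)[OF d d1 m(1) Zfin Zext] by (simp add: hausdorff_unit_cube[OF d d1])
      also have "\<dots> \<le> ?H (N n \<inter> (coord_plane d :: 'a set))"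
      proof (rule emeasure_mono)
        show "(\<Union>z\<in>Z. grid_cell d m z) \<subseteq> N n \<inter> (coord_plane d :: 'a set)"
        proof
          fix y assume "y \<in> (\<Union>z\<in>Z. grid_cell d m z)"
          then obtain z where z: "z \<in> Z" "y \<in> grid_cell d m z" by auto
          then have "y \<in> N n" using Zin subsetD[OF half_open_cube_subset z(2)] by (auto simp: inner_cells_def)
          then show "y \<in> N n \<inter> (coord_plane d :: 'a set)" using z(2) by (auto simp: half_open_cube_def)
        qed
      qed (use No in auto)
      also have "\<dots> < ennreal v" by fact
      finally show ?thesis .
    qed
    ultimately show ?case using Zfin m by (intro exI[of _ Z]) (auto simp: m_def ennreal_less_iff)
  qed
qed

end

section \<open>The lower bound\<close>

lemma pos_if_less_ennreal: "a < ennreal v \<Longrightarrow> 0 < v"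
  by (rule ccontr) (simp add: ennreal_neg not_less)

text \<open>\<sigma> enters only as the limit for the flat cube: both bounds compare
  \<open>A\<close> with the cube and treat \<open>s > d\<close> and \<open>s = d\<close>
  alike.\<close>

locale riesz_setting =
  fixes d :: nat and M A :: "'a::euclidean_space set" and w :: "'a \<Rightarrow> 'a \<Rightarrow> real" and s \<sigma> :: real
  assumes d: "d \<le> DIM('a)" and d1: "1 \<le> d"
    and manifold: "C1_submanifold d M" and A_subset: "A \<subseteq> M" and compact_A: "compact A" and A_nonempty: "A \<noteq> {}"
    and null_frontier: "hausdorff_outer d ((top_of_set M) frontier_of A) = 0"
    and w_continuous: "continuous_on (A \<times> A) (\<lambda>(x, y). w x y)"
    and w_pos: "\<And>x. x \<in> A \<Longrightarrow> 0 < w x x"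
    and s: "real d \<le> s" and \<sigma>_pos: "0 < \<sigma>"
    and \<sigma>_lim: "(\<lambda>n. enn2real (cube_polar TYPE('a) d s n) / tau s d n) \<longlonglongrightarrow> \<sigma>"
begin

abbreviation "\<gamma> \<equiv> s / real d"
abbreviation "g \<equiv> \<lambda>x. w x x powr (- real d / s)"
abbreviation "H \<equiv> hausdorff_measure d :: 'a measure"

lemma s_pos: "0 < s" using s d1 by simp

lemma \<gamma>_ge: "1 \<le> \<gamma>" using s d1 by simp

lemma A_borel [measurable, simp]: "A \<in> sets borel"
  by (rule borel_compact[OF compact_A])

lemma w_diag_continuous: "continuous_on A (\<lambda>x. w x x)"
proof -
  have "continuous_on A ((\<lambda>(x, y). w x y) \<circ> (\<lambda>x. (x, x)))"
    by (intro continuous_on_compose continuous_intros continuous_on_subset[OF w_continuous]) auto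
  then show ?thesis by (simp add: comp_def)
qed

lemma w_diag_lower: "\<exists>w0>0. \<forall>x\<in>A. w0 \<le> w x x"
proof -
  obtain x where "x \<in> A" "\<And>y. y \<in> A \<Longrightarrow> w x x \<le> w y y"
    using continuous_attains_inf[OF compact_A A_nonempty w_diag_continuous] by blast
  then show ?thesis using w_pos by blast
qed

lemma w_bounded: "\<exists>W>0. \<forall>x\<in>A. \<forall>y\<in>A. w x y \<le> W"
proof -
  have "compact ((\<lambda>(x, y). w x y) ` (A \<times> A))"
    by (intro compact_continuous_image w_continuous compact_Times compact_A)
  then obtain B where "0 < B" "\<forall>z\<in>(\<lambda>(x, y). w x y) ` (A \<times> A). norm z \<le> B"
    using compact_imp_bounded bounded_pos by metis
  then show ?thesis by (intro exI[of _ B]) (auto simp: abs_le_iff)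
qed

text \<open>The potential involves \<open>w\<close> at pairs of different points, so
  \<open>w x y\<close> itself is compared with \<open>w c c\<close>. The diagonal values are bounded
  away from 0, which turns the absolute error of uniform continuity into a relative one.\<close>

lemma w_nearly_constant:
  assumes \<kappa>: "1 < \<kappa>"
  shows "\<exists>\<delta>>0. \<forall>c\<in>A. \<forall>x\<in>A. \<forall>y\<in>A. dist x c < \<delta> \<longrightarrow> dist y c < \<delta> \<longrightarrow> w c c / \<kappa> \<le> w x y \<and> w x y \<le> \<kappa> * w c c"
proof -
  obtain w0 where w0: "0 < w0" "\<And>x. x \<in> A \<Longrightarrow> w0 \<le> w x x" using w_diag_lower by blast
  \<comment> \<open>One tolerance for both sides:
    \<open>w c c - w c c * q = w c c / \<kappa>\<close>, and
    \<open>q \<le> \<kappa> - 1\<close>.\<close>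
  define q where "q = 1 - 1 / \<kappa>"
  have q: "0 < q" "q \<le> \<kappa> - 1"
  proof -
    have "2 * \<kappa> - 1 \<le> \<kappa> * \<kappa>" using zero_le_square[of "\<kappa> - 1"] by (simp add: algebra_simps)
    then have "2 - 1 / \<kappa> \<le> \<kappa>" using \<kappa> by (simp add: field_simps)
    then show "0 < q" "q \<le> \<kappa> - 1" using \<kappa> by (auto simp: q_def)
  qed
  have "uniformly_continuous_on (A \<times> A) (\<lambda>(x, y). w x y)"
    by (intro compact_uniformly_continuous w_continuous compact_Times compact_A)
  then obtain \<delta> where \<delta>: "0 < \<delta>" "\<And>p p'. p \<in> A \<times> A \<Longrightarrow> p' \<in> A \<times> A \<Longrightarrow> dist p' p < \<delta> \<Longrightarrow>
      dist ((\<lambda>(x, y). w x y) p') ((\<lambda>(x, y). w x y) p) < w0 * q"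
    using mult_pos_pos[OF w0(1) q(1)] unfolding uniformly_continuous_on_def by metis
  have "w c c / \<kappa> \<le> w x y \<and> w x y \<le> \<kappa> * w c c"
    if "c \<in> A" "x \<in> A" "y \<in> A" "dist x c < \<delta> / 2" "dist y c < \<delta> / 2" for c x y
  proof -
    have "dist (x, y) (c, c) \<le> dist x c + dist y c"
      unfolding dist_Pair_Pair by (intro sqrt_sum_squares_le_sum) auto
    then have "\<bar>w x y - w c c\<bar> < w0 * q"
      using \<delta>(2)[of "(c, c)" "(x, y)"] that by (simp add: dist_real_def)
    moreover have "w0 * q \<le> w c c * q" using w0(2)[OF that(1)] q by (intro mult_right_mono) auto
    ultimately have "\<bar>w x y - w c c\<bar> \<le> w c c * q" by linarith
    moreover have "w c c * q \<le> w c c * (\<kappa> - 1)" using w_pos[OF that(1)] q by (intro mult_left_mono) auto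
    moreover have "w c c * q = w c c - w c c / \<kappa>" by (simp add: q_def algebra_simps)
    ultimately show ?thesis by (simp add: algebra_simps abs_le_iff)
  qed
  then show ?thesis using \<delta>(1) by (intro exI[of _ "\<delta> / 2"]) auto
qed

text \<open>\<open>vol_ok K v\<close>: asymptotically, \<open>n\<close> points of \<open>A\<close> serve \<open>K\<close> as well as they would serve a flat cube of volume \<open>v\<close>
  in the unweighted problem.\<close>

definition vol_ok :: "'a set \<Rightarrow> real \<Rightarrow> bool" where
  "vol_ok K v \<longleftrightarrow> (\<forall>c < \<sigma> * v powr (- \<gamma>). \<forall>\<^sub>F n in sequentially.
     \<exists>\<omega>\<in>configs A n. \<forall>y\<in>K. ennreal (c * tau s d n) \<le> riesz_pot w s y \<omega>)"

section \<open>Calculus of served volumes\<close>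

lemma vol_okD:
  assumes "vol_ok K v" "c < \<sigma> * v powr (- \<gamma>)"
  shows "\<forall>\<^sub>F n in sequentially. \<exists>\<omega>\<in>configs A n. \<forall>y\<in>K. ennreal (c * tau s d n) \<le> riesz_pot w s y \<omega>"
  using assms unfolding vol_ok_def by blast

lemma vol_ok_mono:
  assumes ok: "vol_ok K v" and K: "K' \<subseteq> K" and v: "0 < v" "v \<le> v'" shows "vol_ok K' v'"
  unfolding vol_ok_def
proof (intro allI impI)
  fix c assume "c < \<sigma> * v' powr (- \<gamma>)"
  also have "\<dots> \<le> \<sigma> * v powr (- \<gamma>)"
    using v \<sigma>_pos \<gamma>_ge by (intro mult_left_mono powr_mono2') auto
  finally show "\<forall>\<^sub>F n in sequentially. \<exists>\<omega>\<in>configs A n. \<forall>y\<in>K'. ennreal (c * tau s d n) \<le> riesz_pot w s y \<omega>"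
  proof -
    assume "c < \<sigma> * v powr (- \<gamma>)"
    from vol_okD[OF ok this] show ?thesis
      by (rule eventually_mono) (use K in blast)
  qed
qed

lemma vol_ok_empty: "vol_ok {} v"
  unfolding vol_ok_def using configs_nonempty[OF A_nonempty] by (auto intro!: always_eventually)

text \<open>Near-optimal configurations of the cube are carried into \<open>A\<close> by
  \<open>h\<close>, while \<open>\<psi>\<close> reads the points to be served as points of the cube.
  The potential is at least \<open>wi * (L * r) powr - s\<close> times the one in the unit cube, and
  the stated volume is this factor raised to the power \<open>- d / s\<close>.\<close>

lemma vol_ok_map:
  assumes a: "(a :: 'a) \<in> coord_plane d" and r: "0 < r" and L: "0 < L" and wi: "0 < wi"
    and \<psi>: "\<And>y. y \<in> K \<Longrightarrow> \<psi> y \<in> closed_cube d a r"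
    and h: "\<And>x. x \<in> closed_cube d a r \<Longrightarrow> h x \<in> A"
    and dist: "\<And>x y. x \<in> closed_cube d a r \<Longrightarrow> y \<in> K \<Longrightarrow> dist y (h x) \<le> L * dist (\<psi> y) x"
    and wi_le: "\<And>x y. x \<in> closed_cube d a r \<Longrightarrow> y \<in> K \<Longrightarrow> wi \<le> w y (h x)"
  shows "vol_ok K (L ^ d * wi powr (- real d / s) * r ^ d)"
  unfolding vol_ok_def
proof (intro allI impI)
  fix c assume c: "c < \<sigma> * (L ^ d * wi powr (- real d / s) * r ^ d) powr (- \<gamma>)"
  have e1: "(L ^ d) powr (- \<gamma>) = L powr - s" "(r ^ d) powr (- \<gamma>) = r powr - s"
    using L r d1 by (simp_all add: powr_realpow[symmetric] powr_powr)
  have e2: "(wi powr (- real d / s)) powr (- \<gamma>) = wi"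
    using wi s_pos d1 by (simp add: powr_powr)
  have "(L ^ d * wi powr (- real d / s) * r ^ d) powr (- \<gamma>) = wi * (L * r) powr - s"
    using L r wi s_pos d1 by (simp add: powr_mult e1 powr_powr mult_ac)
  then have "c < \<sigma> * (wi * (L * r) powr - s)" using c by simp
  then have c': "c / (wi * (L * r) powr - s) < \<sigma>" using wi L r by (simp add: pos_divide_less_eq)
  have im: "(\<lambda>x. a + r *\<^sub>R x) ` unit_cube d = closed_cube d a r"
    unfolding unit_cube_eq by (rule affine_cube(2)[OF d d1 a r])
  have "\<forall>\<^sub>F n in sequentially. c / (wi * (L * r) powr - s) < enn2real (cube_polar TYPE('a) d s n) / tau s d n"
    by (rule order_tendstoD(1)[OF \<sigma>_lim c'])
  then show "\<forall>\<^sub>F n in sequentially. \<exists>\<omega>\<in>configs A n. \<forall>y\<in>K. ennreal (c * tau s d n) \<le> riesz_pot w s y \<omega>"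
    using eventually_ge_at_top[of 2]
  proof eventually_elim
    case (elim n)
    have \<tau>: "0 < tau s d n" using elim by (intro tau_pos d1)
    let ?c = "c / (wi * (L * r) powr - s)"
    have fin: "cube_polar TYPE('a) d s n < top" by (rule cp_finite[OF d d1 s])
    have "?c * tau s d n < enn2real (cube_polar TYPE('a) d s n)" using elim \<tau> by (simp add: field_simps)
    moreover have "0 < cube_polar TYPE('a) d s n"
    proof -
      have "0 < ennreal (real d powr - s)" using d1 by simp
      also have "\<dots> \<le> cube_polar TYPE('a) d s 1" using s_pos by (intro cp_1_pos[OF d d1]) simp
      also have "\<dots> \<le> cube_polar TYPE('a) d s n" using elim by (intro cp_mono[OF d d1]) simp
      finally show ?thesis .
    qed
    ultimately have "ennreal (?c * tau s d n) < cube_polar TYPE('a) d s n"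
      using fin by (cases "cube_polar TYPE('a) d s n") (auto simp: ennreal_less_iff ennreal_lessI)
    from less_polar_maxD[OF this] obtain \<omega> where \<omega>: "\<omega> \<in> configs (unit_cube d :: 'a set) n"
        "\<And>u. u \<in> (unit_cube d :: 'a set) \<Longrightarrow> ennreal (?c * tau s d n) \<le> riesz s u \<omega>" by blast
    define f where "f x = h (a + r *\<^sub>R x)" for x
    have fx: "a + r *\<^sub>R x \<in> closed_cube d a r" if "x \<in># \<omega>" for x
      using im that \<omega>(1) by (auto simp: configs_def)
    have \<omega>': "image_mset f \<omega> \<in> configs A n" using \<omega>(1) fx h by (auto simp: configs_def f_def)
    have "ennreal (c * tau s d n) \<le> riesz_pot w s y (image_mset f \<omega>)" if y: "y \<in> K" for y
    proof -
      have "\<psi> y \<in> (\<lambda>x. a + r *\<^sub>R x) ` unit_cube d" unfolding im by (rule \<psi>[OF y])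
      then obtain u where u: "u \<in> unit_cube d" "\<psi> y = a + r *\<^sub>R u" by auto
      have "dist y (f x) \<le> (L * r) * dist u x" if "x \<in># \<omega>" for x
      proof -
        have "dist y (f x) \<le> L * dist (a + r *\<^sub>R u) (a + r *\<^sub>R x)"
          using dist[OF fx[OF that] y] u(2) by (simp add: f_def)
        also have "dist (a + r *\<^sub>R u) (a + r *\<^sub>R x) = r * dist u x"
          using r by (simp add: dist_norm scaleR_diff_right[symmetric])
        finally show ?thesis by (simp add: mult.assoc)
      qed
      then have R: "ennreal ((L * r) powr - s) * riesz s u \<omega> \<le> riesz s y (image_mset f \<omega>)"
        using L r s_pos by (intro riesz_image_mset) auto
      have eq: "c * tau s d n = wi * ((L * r) powr - s * (?c * tau s d n))" using wi L r by simp
      have wi0: "0 \<le> wi" using wi by simp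
      have "ennreal (c * tau s d n) = ennreal (wi * ((L * r) powr - s * (?c * tau s d n)))" by (rule arg_cong[OF eq])
      also have "\<dots> = ennreal wi * (ennreal ((L * r) powr - s) * ennreal (?c * tau s d n))"
        by (simp only: ennreal_mult'[OF wi0] ennreal_mult'[OF powr_ge_zero])
      finally have "ennreal (c * tau s d n) = ennreal wi * (ennreal ((L * r) powr - s) * ennreal (?c * tau s d n))" .
      also have "\<dots> \<le> ennreal wi * riesz s y (image_mset f \<omega>)"
        by (intro mult_left_mono order_trans[OF mult_left_mono[OF \<omega>(2)[OF u(1)]] R]) auto
      also have "\<dots> = (\<Sum>x\<in>#\<omega>. ennreal wi * riesz_kernel s y (f x))"
        by (simp add: riesz_eq sum_mset_distrib_left image_mset.compositionality comp_def)
      also have "\<dots> \<le> (\<Sum>x\<in>#\<omega>. ennreal (w y (f x)) * riesz_kernel s y (f x))"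
        using wi_le[OF fx y] by (intro sum_mset_mono_ennreal mult_right_mono ennreal_leI) (auto simp: f_def)
      also have "\<dots> = riesz_pot w s y (image_mset f \<omega>)"
        by (simp add: riesz_pot_eq image_mset.compositionality comp_def)
      finally show ?thesis .
    qed
    then show ?case using \<omega>' by blast
  qed
qed

text \<open>The points are split in the ratio of \<open>v1\<close> to \<open>v2\<close>. A set of
  volume \<open>v\<close> then gets the fraction \<open>\<theta> = v / (v1 + v2)\<close>, and
  \<open>v powr - \<gamma> * \<theta> powr \<gamma>\<close> is
  \<open>(v1 + v2) powr - \<gamma>\<close> in both cases. Each point to be served relies on the
  share of its own set only.\<close>

lemma vol_ok_Un:
  assumes ok1: "vol_ok K1 v1" and ok2: "vol_ok K2 v2" and v1: "0 < v1" and v2: "0 < v2"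
  shows "vol_ok (K1 \<union> K2) (v1 + v2)"
  unfolding vol_ok_def
proof (intro allI impI)
  fix c assume c: "c < \<sigma> * (v1 + v2) powr (- \<gamma>)"
  define h1 where "h1 N = nat \<lfloor>v1 / (v1 + v2) * real N\<rfloor>" for N :: nat
  define h2 where "h2 N = N - h1 N" for N
  have h1_le: "h1 N \<le> N" for N
  proof -
    have "v1 / (v1 + v2) * real N \<le> 1 * real N" using v1 v2 by (intro mult_right_mono) auto
    then show ?thesis unfolding h1_def by linarith
  qed
  have l1: "(\<lambda>N. real (h1 N) / real N) \<longlonglongrightarrow> v1 / (v1 + v2)"
  proof (rule real_tendsto_sandwich)
    have b: "v1 / (v1 + v2) * real N - 1 \<le> real (h1 N) \<and> real (h1 N) \<le> v1 / (v1 + v2) * real N" for N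
    proof -
      have "0 \<le> v1 / (v1 + v2) * real N" using v1 v2 by simp
      then show ?thesis unfolding h1_def by linarith
    qed
    show "\<forall>\<^sub>F N in sequentially. (v1 / (v1 + v2) * real N - 1) / real N \<le> real (h1 N) / real N"
      using b by (intro always_eventually allI divide_right_mono) auto
    show "\<forall>\<^sub>F N in sequentially. real (h1 N) / real N \<le> (v1 / (v1 + v2) * real N) / real N"
      using b by (intro always_eventually allI divide_right_mono) auto
    show "(\<lambda>N. (v1 / (v1 + v2) * real N - 1) / real N) \<longlonglongrightarrow> v1 / (v1 + v2)" by real_asymp
    show "(\<lambda>N. (v1 / (v1 + v2) * real N) / real N) \<longlonglongrightarrow> v1 / (v1 + v2)" by real_asymp
  qed
  have l2: "(\<lambda>N. real (h2 N) / real N) \<longlonglongrightarrow> v2 / (v1 + v2)"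
  proof (rule Lim_transform_eventually)
    have "(\<lambda>N. 1 - real (h1 N) / real N) \<longlonglongrightarrow> 1 - v1 / (v1 + v2)" by (intro tendsto_intros l1)
    also have "1 - v1 / (v1 + v2) = v2 / (v1 + v2)" using v1 v2 by (simp add: field_simps)
    finally show "(\<lambda>N. 1 - real (h1 N) / real N) \<longlonglongrightarrow> v2 / (v1 + v2)" .
    show "\<forall>\<^sub>F N in sequentially. 1 - real (h1 N) / real N = real (h2 N) / real N"
      using eventually_ge_at_top[of 1]
      by eventually_elim (simp add: h2_def of_nat_diff[OF h1_le] diff_divide_distrib)
  qed
  have part: "\<forall>\<^sub>F N in sequentially. \<exists>\<omega>\<in>configs A (h N). \<forall>y\<in>K. ennreal (c * tau s d N) \<le> riesz_pot w s y \<omega>"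
    if ok: "vol_ok K v" and v: "0 < v" and lim: "(\<lambda>N. real (h N) / real N) \<longlonglongrightarrow> v / (v1 + v2)" for K v and h :: "nat \<Rightarrow> nat"
  proof -
    let ?\<theta> = "v / (v1 + v2)"
    have \<theta>: "0 < ?\<theta>" using v v1 v2 by simp
    have "(v1 + v2) powr (- \<gamma>) = v powr (- \<gamma>) * ?\<theta> powr \<gamma>"
      using v v1 v2 by (simp add: powr_divide powr_minus field_simps)
    moreover have X: "0 < ?\<theta> powr \<gamma>" by (rule powr_gt_zero[THEN iffD2]) (use \<theta> in linarith)
    ultimately have "c / ?\<theta> powr \<gamma> < \<sigma> * v powr (- \<gamma>)" using c by (simp only: pos_divide_less_eq[OF X] mult.assoc)
    \<comment> \<open>The room between the two levels is used up by the convergence of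
      \<open>tau s d (h N) / tau s d N\<close>.\<close>
    then obtain c' where c': "c / ?\<theta> powr \<gamma> < c'" "c' < \<sigma> * v powr (- \<gamma>)" using dense by blast
    have "filterlim h at_top sequentially"
    proof -
      have "filterlim (\<lambda>N. real (h N) / real N * real N) at_top sequentially"
        by (rule filterlim_tendsto_pos_mult_at_top[OF lim \<theta> filterlim_real_sequentially])
      then have "filterlim (\<lambda>N. real (h N)) at_top sequentially"
      proof (rule filterlim_cong[THEN iffD1, OF refl refl, rotated])
        show "\<forall>\<^sub>F N in sequentially. real (h N) / real N * real N = real (h N)"
          using eventually_gt_at_top[of 0] by eventually_elim simp
      qed
      then show ?thesis by (rule filterlim_sequentially_iff_filterlim_real[THEN iffD2])
    qed
    then have "\<forall>\<^sub>F N in sequentially. \<exists>\<omega>\<in>configs A (h N). \<forall>y\<in>K. ennreal (c' * tau s d (h N)) \<le> riesz_pot w s y \<omega>"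
      by (rule eventually_compose_filterlim[OF vol_okD[OF ok c'(2)]])
    moreover have "\<forall>\<^sub>F N in sequentially. c * tau s d N \<le> c' * tau s d (h N)"
    proof -
      have "(\<lambda>N. c' * (tau s d (h N) / tau s d N)) \<longlonglongrightarrow> c' * ?\<theta> powr \<gamma>"
        by (intro tendsto_mult tendsto_const tau_ratio_tendsto d1 s lim \<theta>)
      moreover have "c < c' * ?\<theta> powr \<gamma>" using c'(1) by (simp only: pos_divide_less_eq[OF X])
      ultimately have "\<forall>\<^sub>F N in sequentially. c < c' * (tau s d (h N) / tau s d N)" by (rule order_tendstoD(1))
      then show ?thesis using eventually_ge_at_top[of 2]
      proof eventually_elim
        case (elim N)
        have "0 < tau s d N" using elim by (intro tau_pos d1)
        then show ?case using elim by (simp add: field_simps)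
      qed
    qed
    ultimately show ?thesis
    proof eventually_elim
      case (elim N)
      then obtain \<omega> where \<omega>: "\<omega> \<in> configs A (h N)" "\<And>y. y \<in> K \<Longrightarrow> ennreal (c' * tau s d (h N)) \<le> riesz_pot w s y \<omega>" by blast
      have "ennreal (c * tau s d N) \<le> ennreal (c' * tau s d (h N))" using elim(2) by (rule ennreal_leI)
      then show ?case using \<omega> order_trans by blast
    qed
  qed
  show "\<forall>\<^sub>F N in sequentially. \<exists>\<omega>\<in>configs A N. \<forall>y\<in>K1 \<union> K2. ennreal (c * tau s d N) \<le> riesz_pot w s y \<omega>"
    using part[OF ok1 v1 l1] part[OF ok2 v2 l2]
  proof eventually_elim
    case (elim N)
    obtain \<omega>1 where 1: "\<omega>1 \<in> configs A (h1 N)" "\<And>y. y \<in> K1 \<Longrightarrow> ennreal (c * tau s d N) \<le> riesz_pot w s y \<omega>1" using elim(1) by blast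
    obtain \<omega>2 where 2: "\<omega>2 \<in> configs A (h2 N)" "\<And>y. y \<in> K2 \<Longrightarrow> ennreal (c * tau s d N) \<le> riesz_pot w s y \<omega>2" using elim(2) by blast
    have "h1 N + h2 N = N" using h1_le by (simp add: h2_def)
    then have "\<omega>1 + \<omega>2 \<in> configs A N" using configs_add[OF 1(1) 2(1)] by simp
    moreover have "ennreal (c * tau s d N) \<le> riesz_pot w s y (\<omega>1 + \<omega>2)" if "y \<in> K1 \<union> K2" for y
    proof -
      from that have "ennreal (c * tau s d N) \<le> riesz_pot w s y \<omega>1 \<or> ennreal (c * tau s d N) \<le> riesz_pot w s y \<omega>2" using 1(2) 2(2) by blast
      then show ?thesis by (auto intro: add_increasing add_increasing2)
    qed
    ultimately show ?case by blast
  qed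
qed

text \<open>The extra \<open>\<eta>\<close> plays the part of a positive volume for the empty union,
  from which the induction starts.\<close>

lemma vol_ok_finite_UN:
  assumes "finite I" "\<And>i. i \<in> I \<Longrightarrow> vol_ok (K i) (v i)" "\<And>i. i \<in> I \<Longrightarrow> 0 < v i" "0 < \<eta>"
  shows "vol_ok (\<Union>i\<in>I. K i) ((\<Sum>i\<in>I. v i) + \<eta>)"
  using assms(1-3)
proof (induction I)
  case empty
  then show ?case by (simp add: vol_ok_empty)
next
  case (insert i I)
  have "0 \<le> (\<Sum>i\<in>I. v i)" using insert by (intro sum_nonneg) (auto intro: less_imp_le)
  then have "vol_ok (K i \<union> (\<Union>i\<in>I. K i)) (v i + ((\<Sum>i\<in>I. v i) + \<eta>))"
    using insert assms(4) by (intro vol_ok_Un) auto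
  then show ?case using insert by (simp add: add.assoc)
qed

text \<open>Chosen once for \<open>A\<close>, these compact pieces make the crude estimate uniform
  over all compact subsets of \<open>A\<close>.\<close>

lemma compact_chart_pieces:
  "\<exists>J :: (('a \<Rightarrow> 'a) \<times> 'a set \<times> 'a set) set. finite J \<and> A \<subseteq> (\<Union>(h, V, B)\<in>J. B) \<and>
     (\<forall>(h, V, B)\<in>J. compact B \<and> B \<subseteq> h ` V \<and> V \<subseteq> coord_plane d \<and> bilipschitz 2 V h)"
proof -
  let ?ok = "\<lambda>x (j :: ('a \<Rightarrow> 'a) \<times> 'a set \<times> real). 0 < snd (snd j) \<and> A \<inter> cball x (snd (snd j)) \<subseteq> fst j ` fst (snd j) \<and>
    fst (snd j) \<subseteq> coord_plane d \<and> bilipschitz 2 (fst (snd j)) (fst j)"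
  have "\<forall>x\<in>A. \<exists>j. ?ok x j"
  proof
    fix x assume x: "x \<in> A"
    obtain h V where hV: "chart d M 2 (h, V)" "x \<in> h ` V"
      using chart_exists[OF d d1 manifold, of x 2] x A_subset by auto
    then have "openin (top_of_set M) (h ` V)" by (simp add: chart_def)
    then obtain \<rho> where \<rho>: "0 < \<rho>" "cball x \<rho> \<inter> M \<subseteq> h ` V" using hV(2) unfolding openin_contains_cball by blast
    have "V \<subseteq> coord_plane d" "bilipschitz 2 V h" using hV(1) by (auto simp: chart_def dest: openin_imp_subset)
    moreover have "A \<inter> cball x \<rho> \<subseteq> h ` V" using \<rho>(2) A_subset by blast
    ultimately have "?ok x (h, V, \<rho>)" using \<rho>(1) by simp
    then show "\<exists>j. ?ok x j" by (rule exI)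
  qed
  from bchoice[OF this] obtain j where j: "\<forall>x\<in>A. ?ok x (j x)" ..
  define \<rho> where "\<rho> x = snd (snd (j x))" for x
  define F where "F x = (fst (j x), fst (snd (j x)), A \<inter> cball x (\<rho> x))" for x
  have j': "0 < \<rho> x" "A \<inter> cball x (\<rho> x) \<subseteq> fst (j x) ` fst (snd (j x))" "fst (snd (j x)) \<subseteq> coord_plane d"
      "bilipschitz 2 (fst (snd (j x))) (fst (j x))" if "x \<in> A" for x
    using bspec[OF j that] unfolding \<rho>_def by simp_all
  have cover: "A \<subseteq> (\<Union>x\<in>A. ball x (\<rho> x))"
  proof
    fix x assume "x \<in> A"
    then show "x \<in> (\<Union>x\<in>A. ball x (\<rho> x))" using j'(1)[of x] by (intro UN_I[of x]) auto
  qed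
  obtain X where X: "X \<subseteq> A" "finite X" "A \<subseteq> (\<Union>x\<in>X. ball x (\<rho> x))"
    by (rule compactE_image[OF compact_A open_ball cover])
  have "A \<subseteq> (\<Union>x\<in>X. A \<inter> cball x (\<rho> x))"
  proof
    fix y assume y: "y \<in> A"
    then obtain x where "x \<in> X" "y \<in> ball x (\<rho> x)" using X(3) by auto
    then show "y \<in> (\<Union>x\<in>X. A \<inter> cball x (\<rho> x))" using y by (intro UN_I[of x]) auto
  qed
  then have "A \<subseteq> (\<Union>(h, V, B)\<in>F ` X. B)" by (simp add: F_def)
  moreover have "\<forall>(h, V, B)\<in>F ` X. compact B \<and> B \<subseteq> h ` V \<and> V \<subseteq> coord_plane d \<and> bilipschitz 2 V h"
  proof (intro ballI)
    fix t assume "t \<in> F ` X"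
    then obtain x where x: "x \<in> A" "t = F x" using X(1) by auto
    have "compact (A \<inter> cball x (\<rho> x))" by (intro compact_Int_closed compact_A) simp
    then show "case t of (h, V, B) \<Rightarrow> compact B \<and> B \<subseteq> h ` V \<and> V \<subseteq> coord_plane d \<and> bilipschitz 2 V h"
      using j'(2-4)[OF x(1)] by (simp add: x(2) F_def)
  qed
  ultimately show ?thesis using X(2) by (intro exI[of _ "F ` X"]) simp
qed

text \<open>An arbitrary compact \<open>R\<close> need not contain images of cubes, so points meant
  for a grid cube are replaced by nearest points of the part \<open>S \<inter> ?Q z\<close> of the
  pulled-back set. This at most doubles the distance to any point of that part, and the chart
  doubles it again, hence \<open>4 ^ d\<close>. Pulling back multiplies the measure by at most
  \<open>2 ^ d\<close>, hence \<open>8 ^ d\<close>. Near-constancy with ratio 2 keeps the weight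
  above \<open>w0 / 2\<close>.\<close>

lemma vol_ok_in_chart:
  fixes h :: "'a \<Rightarrow> 'a"
  assumes w0: "0 < w0" "\<And>x. x \<in> A \<Longrightarrow> w0 \<le> w x x"
    and V: "V \<subseteq> coord_plane d" "bilipschitz 2 V h" and R: "compact R" "R \<subseteq> A" "R \<subseteq> h ` V"
    and v: "hausdorff_outer d R < ennreal v"
  shows "vol_ok R (8 ^ d * (w0 / 2) powr (- real d / s) * v + v)"
proof -
  let ?\<psi> = "inv_into V h"
  have v0: "0 < v" by (rule pos_if_less_ennreal[OF v])
  have inj: "inj_on h V" by (rule bilipschitz_inj_on[OF V(2)])
  define S where "S = ?\<psi> ` R"
  have hS: "h ` S = R" using R(3) by (auto simp: S_def image_comp f_inv_into_f subset_eq image_iff) 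
  have SV: "S \<subseteq> V" using R(3) by (auto simp: S_def inv_into_into)
  have bi: "bilipschitz 2 (h ` V) ?\<psi>" by (rule bilipschitz_inv_into[OF V(2)])
  have cS: "compact S" unfolding S_def
    by (intro compact_continuous_image R(1) bilipschitz_continuous_on[OF bilipschitz_subset[OF bi R(3)]])
  have "hausdorff_outer d S \<le> ennreal (2 ^ d) * hausdorff_outer d R"
    unfolding S_def by (rule hausdorff_outer_bilipschitz(1)[OF bi _ R(3)]) simp
  also have "\<dots> < ennreal (2 ^ d) * ennreal v" using v by (intro ennreal_mult_strict_left_mono) auto
  also have "\<dots> = ennreal (2 ^ d * v)" using v0 by (simp add: ennreal_mult)
  finally have Sv: "hausdorff_outer d S < ennreal (2 ^ d * v)" .
  obtain \<delta> where \<delta>: "0 < \<delta>" "\<And>c x y. c \<in> A \<Longrightarrow> x \<in> A \<Longrightarrow> y \<in> A \<Longrightarrow> dist x c < \<delta> \<Longrightarrow> dist y c < \<delta> \<Longrightarrow> w c c / 2 \<le> w x y"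
    using w_nearly_constant[of 2] by auto
  have "\<forall>\<^sub>F k in sequentially. 2 * (real d * (1 / 2 ^ k)) < \<delta>"
  proof -
    have "(\<lambda>k. 2 * (real d * (1 / 2 ^ k))) \<longlonglongrightarrow> 0" by real_asymp
    then show ?thesis using \<delta>(1) by (rule order_tendstoD(2))
  qed
  from eventually_happens'[OF sequentially_bot eventually_conj[OF this compact_grid_cover[OF d d1 cS order_trans[OF SV V(1)] Sv]]]
  obtain k Z where k: "2 * (real d * (1 / 2 ^ k)) < \<delta>" and Z: "finite Z"
      "S \<subseteq> (\<Union>z\<in>Z. closed_cube d (grid_point d (2^k) z) (1 / 2^k))" "real (card Z) * (1 / 2^k) ^ d < 2 ^ d * v" by blast
  let ?Q = "\<lambda>z. closed_cube d (grid_point d (2^k) z) (1 / 2^k) :: 'a set"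
  let ?v = "4 ^ d * (w0 / 2) powr (- real d / s) * (1 / 2^k) ^ d"
  have piece: "vol_ok (h ` (S \<inter> ?Q z)) ?v" for z
  proof (cases "S \<inter> ?Q z = {}")
    case True
    then show ?thesis by (simp add: vol_ok_empty)
  next
    case False
    let ?C = "S \<inter> ?Q z"
    have cC: "closed ?C" by (rule closed_Int[OF compact_imp_closed[OF cS] closed_closed_cube])
    have in_C: "closest_point ?C x \<in> ?C" for x by (rule closest_point_in_set[OF cC False])
    have \<psi>h: "?\<psi> (h u) = u" if "u \<in> ?C" for u using that SV inj by (intro inv_into_f_f) auto
    show ?thesis
    proof (rule vol_ok_map[where \<psi> = ?\<psi> and h = "h \<circ> closest_point ?C"])
      fix y assume "y \<in> h ` ?C"
      then show "?\<psi> y \<in> ?Q z" using \<psi>h by auto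
    next
      fix x
      show "(h \<circ> closest_point ?C) x \<in> A" using in_C[of x] hS R(2) by auto
    next
      fix x y assume y: "y \<in> h ` ?C"
      then obtain u where u: "u \<in> ?C" "y = h u" by auto
      have uV: "u \<in> V" "closest_point ?C x \<in> V" using u(1) in_C[of x] SV by auto
      have "dist u (closest_point ?C x) \<le> dist u x + dist x (closest_point ?C x)" by (rule dist_triangle)
      also have "dist x (closest_point ?C x) \<le> dist x u" by (rule closest_point_le[OF cC u(1)])
      finally have "dist u (closest_point ?C x) \<le> 2 * dist u x" by (simp add: dist_commute)
      moreover have "dist (h u) (h (closest_point ?C x)) \<le> 2 * dist u (closest_point ?C x)"
        using V(2) uV by (simp add: bilipschitz_def)
      ultimately show "dist y ((h \<circ> closest_point ?C) x) \<le> 4 * dist (?\<psi> y) x"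
        using u \<psi>h by simp
      have "dist u (closest_point ?C x) \<le> real d * (1 / 2^k)"
        using u(1) in_C[of x] by (intro closed_cube_dist[OF d d1]) auto
      then have "dist (h u) (h (closest_point ?C x)) < \<delta>"
        using k \<open>dist (h u) (h (closest_point ?C x)) \<le> 2 * dist u (closest_point ?C x)\<close> by linarith
      moreover have "h u \<in> A" "h (closest_point ?C x) \<in> A" using u in_C[of x] hS R(2) by auto
      ultimately have "w (h u) (h u) / 2 \<le> w (h u) (h (closest_point ?C x))"
        using \<delta> by (intro \<delta>(2)) (auto simp: dist_commute)
      then show "w0 / 2 \<le> w y ((h \<circ> closest_point ?C) x)"
        using w0(2)[OF \<open>h u \<in> A\<close>] u by simp
    qed (use w0 grid_point_in_plane[OF d d1] in auto)
  qed
  have "vol_ok (\<Union>z\<in>Z. h ` (S \<inter> ?Q z)) ((\<Sum>z\<in>Z. ?v) + v)"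
    using piece w0 v0 by (intro vol_ok_finite_UN Z(1)) auto
  then show ?thesis
  proof (rule vol_ok_mono)
    show "R \<subseteq> (\<Union>z\<in>Z. h ` (S \<inter> ?Q z))"
    proof
      fix y assume "y \<in> R"
      then obtain u where u: "u \<in> S" "y = h u" using hS by auto
      then obtain z where "z \<in> Z" "u \<in> ?Q z" using Z(2) by auto
      then show "y \<in> (\<Union>z\<in>Z. h ` (S \<inter> ?Q z))" using u by (intro UN_I[of z]) auto
    qed
    show "0 < (\<Sum>z\<in>Z. ?v) + v" using v0 w0 by (intro add_nonneg_pos sum_nonneg) auto
    have "(\<Sum>z\<in>Z. ?v) = 4 ^ d * (w0 / 2) powr (- real d / s) * (real (card Z) * (1 / 2^k) ^ d)" by simp
    also have "\<dots> \<le> 4 ^ d * (w0 / 2) powr (- real d / s) * (2 ^ d * v)" using Z(3) by (intro mult_left_mono) auto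
    also have "\<dots> = 8 ^ d * (w0 / 2) powr (- real d / s) * v"
      using power_mult_distrib[of "4 :: real" 2 d] by simp
    finally show "(\<Sum>z\<in>Z. ?v) + v \<le> 8 ^ d * (w0 / 2) powr (- real d / s) * v + v" by simp
  qed
qed

text \<open>The constant does not depend on \<open>R\<close>, so a remainder of small measure costs
  only a small volume although each of its points has to be served.\<close>

lemma vol_ok_crude: "\<exists>C>0. \<forall>R v. compact R \<longrightarrow> R \<subseteq> A \<longrightarrow> hausdorff_outer d R < ennreal v \<longrightarrow> vol_ok R (C * v)"
proof -
  obtain w0 where w0: "0 < w0" "\<And>x. x \<in> A \<Longrightarrow> w0 \<le> w x x" using w_diag_lower by blast
  from compact_chart_pieces obtain J :: "(('a \<Rightarrow> 'a) \<times> 'a set \<times> 'a set) set" where J': "finite J \<and> A \<subseteq> (\<Union>(h, V, B)\<in>J. B) \<and>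
     (\<forall>(h, V, B)\<in>J. compact B \<and> B \<subseteq> h ` V \<and> V \<subseteq> coord_plane d \<and> bilipschitz 2 V h)" ..
  note J = conjunct1[OF J'] conjunct1[OF conjunct2[OF J']] conjunct2[OF conjunct2[OF J']]
  define c where "c = 8 ^ d * (w0 / 2) powr (- real d / s) + 1"
  have c: "0 < c" unfolding c_def by (intro add_nonneg_pos) auto
  have "vol_ok R ((real (card J) * c + 1) * v)" if R: "compact R" "R \<subseteq> A" "hausdorff_outer d R < ennreal v" for R v
  proof -
    have v0: "0 < v" by (rule pos_if_less_ennreal[OF R(3)])
    have ok: "vol_ok (R \<inter> snd (snd j)) (c * v)" if "j \<in> J" for j
    proof -
      obtain h V B where j: "j = (h, V, B)" by (cases j)
      have B: "compact B" "B \<subseteq> h ` V" "V \<subseteq> coord_plane d" "bilipschitz 2 V h" using bspec[OF J(3) that] unfolding j by simp_all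
      have Rv: "hausdorff_outer d (R \<inter> B) < ennreal v" by (rule order_le_less_trans[OF hausdorff_outer_mono[OF Int_lower1] R(3)])
      have "vol_ok (R \<inter> B) (8 ^ d * (w0 / 2) powr (- real d / s) * v + v)"
        by (rule vol_ok_in_chart[OF w0(1) _ B(3,4) compact_Int[OF R(1) B(1)] le_infI1[OF R(2)] le_infI2[OF B(2)] Rv]) (rule w0(2))
      then show ?thesis by (simp add: c_def j algebra_simps)
    qed
    have "vol_ok (\<Union>j\<in>J. R \<inter> snd (snd j)) ((\<Sum>j\<in>J. c * v) + v)"
      using ok c v0 by (intro vol_ok_finite_UN J(1)) auto
    moreover have "R \<subseteq> (\<Union>j\<in>J. R \<inter> snd (snd j))"
    proof
      fix x assume x: "x \<in> R"
      then have "x \<in> (\<Union>(h, V, B)\<in>J. B)" by (intro subsetD[OF J(2)] subsetD[OF R(2)])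
      then obtain j where "j \<in> J" "x \<in> snd (snd j)" by (auto simp: split_beta)
      then show "x \<in> (\<Union>j\<in>J. R \<inter> snd (snd j))" using x by (intro UN_I[of j]) auto
    qed
    moreover have "0 < (\<Sum>j\<in>J. c * v) + v" using c v0 by (intro add_nonneg_pos sum_nonneg) auto
    ultimately have "vol_ok R ((\<Sum>j\<in>J. c * v) + v)" by (rule vol_ok_mono) (rule order_refl)
    then show ?thesis by (simp add: algebra_simps)
  qed
  moreover have "0 < real (card J) * c + 1" by (intro add_nonneg_pos mult_nonneg_nonneg less_imp_le[OF c]) simp_all
  ultimately show ?thesis by (intro exI[of _ "real (card J) * c + 1"] conjI allI impI)
qed

section \<open>The weighted measure of the set and the sharp lower bound\<close>

definition \<mu> :: real where "\<mu> = enn2real (Hsw d s w A A)"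

lemma Hsw_A: "Hsw d s w A A = (\<integral>\<^sup>+x. ennreal (g x) * indicator A x \<partial>H)"
  by (simp add: Hsw_def)

lemma hausdorff_A_finite: "emeasure H A < top"
  using hausdorff_compact_finite[OF d d1 manifold compact_A A_subset] by (simp add: emeasure_hausdorff_measure[OF d1])

lemma g_bounded: "\<exists>G>0. \<forall>x\<in>A. g x \<le> G"
proof -
  obtain w0 where w0: "0 < w0" "\<And>x. x \<in> A \<Longrightarrow> w0 \<le> w x x" using w_diag_lower by blast
  have "g x \<le> w0 powr (- real d / s)" if "x \<in> A" for x
    using powr_mono2'[of "- real d / s" w0 "w x x"] w0(1) w0(2)[OF that] s_pos d1 by simp
  then show ?thesis using w0(1) by (intro exI[of _ "w0 powr (- real d / s)"]) auto
qed

lemma Hsw_finite: "Hsw d s w A A < top"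
proof -
  obtain G where G: "0 < G" "\<And>x. x \<in> A \<Longrightarrow> g x \<le> G" using g_bounded by blast
  have "Hsw d s w A A \<le> (\<integral>\<^sup>+x. ennreal G * indicator A x \<partial>H)"
    unfolding Hsw_A using G(2) by (intro nn_integral_mono) (auto simp: indicator_def intro!: ennreal_leI)
  also have "\<dots> = ennreal G * emeasure H A" by (simp add: nn_integral_cmult_indicator)
  also have "\<dots> < top" using hausdorff_A_finite by (simp add: ennreal_mult_less_top)
  finally show ?thesis .
qed

lemma Hsw_eq_\<mu>: "Hsw d s w A A = ennreal \<mu>"
  using Hsw_finite by (simp add: \<mu>_def)

lemma \<mu>_nonneg: "0 \<le> \<mu>" by (simp add: \<mu>_def)

lemma patch_open_borel:
  assumes "cube_patch d A L p" shows "patch_open d p \<in> sets borel"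
proof -
  have "openin (top_of_set A) (patch_open d p)" using assms by (auto simp: cube_patch_def patch_open_def)
  then obtain T where "open T" "patch_open d p = A \<inter> T" by (auto simp: openin_open)
  then show ?thesis by simp
qed

lemma patch_measure:
  assumes p: "cube_patch d A L (h, a, r)" and L: "0 < L"
  shows "ennreal (r ^ d / L ^ d) \<le> emeasure H (patch_open d (h, a, r))"
    and "emeasure H (patch_open d (h, a, r)) \<le> ennreal (L ^ d * r ^ d)"
proof -
  have a: "a \<in> coord_plane d" "0 < r" "bilipschitz L (closed_cube d a r) h" using p by (auto simp: cube_patch_def)
  have e: "emeasure H (patch_open d (h, a, r)) = hausdorff_outer d (h ` open_cube d a r)"
    using patch_open_borel[OF p] by (simp add: emeasure_hausdorff_measure[OF d1] patch_open_def)
  note b = hausdorff_outer_bilipschitz[OF a(3) L open_cube_subset_closed, where d = d, unfolded hausdorff_open_cube[OF d d1 a(1,2)]]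
  show "emeasure H (patch_open d (h, a, r)) \<le> ennreal (L ^ d * r ^ d)"
    unfolding e using b(1) L a(2) by (simp add: ennreal_mult)
  have "ennreal (r ^ d / L ^ d) = ennreal (1 / L ^ d) * ennreal (r ^ d)" using L a(2) by (simp add: ennreal_mult[symmetric])
  also have "\<dots> \<le> ennreal (1 / L ^ d) * (ennreal (L ^ d) * hausdorff_outer d (h ` open_cube d a r))"
    by (intro mult_left_mono b(2)) simp
  also have "\<dots> = hausdorff_outer d (h ` open_cube d a r)" using L by (simp add: mult.assoc[symmetric] ennreal_mult[symmetric])
  finally show "ennreal (r ^ d / L ^ d) \<le> emeasure H (patch_open d (h, a, r))" unfolding e .
qed

text \<open>As \<open>d / s \<le> 1\<close>, the power turns a factor \<open>\<kappa>\<close> into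
  at most \<open>\<kappa>\<close>.\<close>

lemma g_nearly_constant:
  assumes "1 < \<kappa>" "c \<in> A" "x \<in> A" "w c c / \<kappa> \<le> w x x" "w x x \<le> \<kappa> * w c c"
  shows "g c / \<kappa> \<le> g x" and "g x \<le> \<kappa> * g c"
proof -
  have e: "real d / s \<le> 1" "0 < real d / s" using s s_pos d1 by auto
  have \<kappa>: "\<kappa> powr (real d / s) \<le> \<kappa>" using powr_mono[OF e(1), of \<kappa>] assms(1) by simp
  have \<kappa>': "1 / \<kappa> \<le> \<kappa> powr (- real d / s)"
    using \<kappa> assms(1) by (simp add: powr_minus_divide frac_le)
  have "g c / \<kappa> \<le> \<kappa> powr (- real d / s) * g c"
    using mult_right_mono[OF \<kappa>', of "g c"] by simp
  also have "\<dots> = (\<kappa> * w c c) powr (- real d / s)" using assms(1) w_pos[OF assms(2)] by (simp add: powr_mult)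
  also have "\<dots> \<le> g x" using e assms w_pos[OF assms(3)] by (intro powr_mono2') auto
  finally show "g c / \<kappa> \<le> g x" .
  have "g x \<le> (w c c / \<kappa>) powr (- real d / s)" using e assms w_pos[OF assms(2)] by (intro powr_mono2') auto
  also have "\<dots> = \<kappa> powr (real d / s) * g c"
    using assms(1) w_pos[OF assms(2)] by (simp add: powr_divide powr_minus_divide)
  also have "\<dots> \<le> \<kappa> * g c" using \<kappa> by (intro mult_right_mono) auto
  finally show "g x \<le> \<kappa> * g c" .
qed

text \<open>The closed patches are served at volumes close to their weighted measures and the
  compact remainder by the crude estimate; the total stays below any \<open>v\<close> above
  \<mu>.\<close>

lemma vol_ok_A:
  assumes v: "\<mu> < v" shows "vol_ok A v"
proof -
  obtain C where C: "0 < C" "\<And>R v. compact R \<Longrightarrow> R \<subseteq> A \<Longrightarrow> hausdorff_outer d R < ennreal v \<Longrightarrow> vol_ok R (C * v)"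
    using vol_ok_crude by blast
  \<comment> \<open>The exponent counts losses: \<open>d\<close> from transporting configurations,
    \<open>d\<close> from the measure of a patch, and one each from the weight in the potential and
    from the density in the integral.\<close>
  have "((\<lambda>\<kappa>. \<kappa> ^ (2 * d + 2) * \<mu>) \<longlongrightarrow> 1 ^ (2 * d + 2) * \<mu>) (at_right 1)" by (intro tendsto_intros)
  then have "\<forall>\<^sub>F \<kappa> in at_right 1. \<kappa> ^ (2 * d + 2) * \<mu> < v" using v by (intro order_tendstoD(2)) auto
  from eventually_happens'[OF _ eventually_conj[OF this eventually_at_right_less]]
  obtain \<kappa> where \<kappa>: "\<kappa> ^ (2 * d + 2) * \<mu> < v" "1 < \<kappa>" by auto
  define \<eta> where "\<eta> = (v - \<kappa> ^ (2 * d + 2) * \<mu>) / 2"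
  have \<eta>: "0 < \<eta>" using \<kappa> by (simp add: \<eta>_def)
  obtain \<delta> where \<delta>: "0 < \<delta>" "\<And>c x y. c \<in> A \<Longrightarrow> x \<in> A \<Longrightarrow> y \<in> A \<Longrightarrow> dist x c < \<delta> \<Longrightarrow> dist y c < \<delta> \<Longrightarrow> w c c / \<kappa> \<le> w x y \<and> w x y \<le> \<kappa> * w c c"
    using w_nearly_constant[OF \<kappa>(2)] by blast
  have "0 < \<eta> / C" using \<eta> C by simp
  from patches_exist[OF d d1 manifold compact_A A_subset null_frontier \<kappa>(2) \<delta>(1) this]
  obtain P where P: "patch_family d A \<kappa> \<delta> P" "hausdorff_outer d (A - (\<Union>p\<in>P. patch_open d p)) < ennreal (\<eta> / C)" by blast
  have fin: "finite P" and patch: "\<And>p. p \<in> P \<Longrightarrow> cube_patch d A \<kappa> p"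
    and small: "\<And>p x y. p \<in> P \<Longrightarrow> x \<in> patch_closed d p \<Longrightarrow> y \<in> patch_closed d p \<Longrightarrow> dist x y < \<delta>"
    and disj: "\<And>p q. p \<in> P \<Longrightarrow> q \<in> P \<Longrightarrow> p \<noteq> q \<Longrightarrow> patch_open d p \<inter> patch_open d q = {}"
    using P(1) unfolding patch_family_def by simp_all
  define cen where "cen p = fst p (fst (snd p))" for p :: "('a \<Rightarrow> 'a) \<times> 'a \<times> real"
  define rad where "rad p = snd (snd p)" for p :: "('a \<Rightarrow> 'a) \<times> 'a \<times> real"
  define vp where "vp p = \<kappa> ^ d * (w (cen p) (cen p) / \<kappa>) powr (- real d / s) * rad p ^ d" for p
  have pp: "cen p \<in> patch_closed d p" "cen p \<in> A" "0 < rad p" "patch_closed d p \<subseteq> A" if "p \<in> P" for p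
  proof -
    obtain h a r where p: "p = (h, a, r)" by (cases p)
    have "a \<in> coord_plane d" "0 < r" "h ` closed_cube d a r \<subseteq> A" using patch[OF that] by (auto simp: cube_patch_def p)
    moreover from this have "a \<in> closed_cube d a r" by (simp add: closed_cube_def)
    ultimately show "cen p \<in> patch_closed d p" "cen p \<in> A" "0 < rad p" "patch_closed d p \<subseteq> A"
      by (auto simp: cen_def rad_def patch_closed_def p)
  qed
  have wp: "w (cen p) (cen p) / \<kappa> \<le> w x y \<and> w x y \<le> \<kappa> * w (cen p) (cen p)"
    if "p \<in> P" "x \<in> patch_closed d p" "y \<in> patch_closed d p" for p x y
    using \<delta>(2)[of "cen p" x y] pp[OF that(1)] small[OF that(1)] that by blast
  have okp: "vol_ok (patch_closed d p) (vp p)" if pP: "p \<in> P" for p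
  proof -
    obtain h a r where p: "p = (h, a, r)" by (cases p)
    have a: "a \<in> coord_plane d" "0 < r" "h ` closed_cube d a r \<subseteq> A" "bilipschitz \<kappa> (closed_cube d a r) h"
      using patch[OF pP] by (auto simp: cube_patch_def p)
    have inj: "inj_on h (closed_cube d a r)" by (rule bilipschitz_inj_on[OF a(4)])
    have "vol_ok (h ` closed_cube d a r) (\<kappa> ^ d * (w (cen p) (cen p) / \<kappa>) powr (- real d / s) * r ^ d)"
    proof (rule vol_ok_map[where \<psi> = "inv_into (closed_cube d a r) h" and h = h])
      fix x y assume x: "x \<in> closed_cube d a r" and y: "y \<in> h ` closed_cube d a r"
      then obtain u where u: "u \<in> closed_cube d a r" "y = h u" by auto
      show "dist y (h x) \<le> \<kappa> * dist (inv_into (closed_cube d a r) h y) x"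
        using a(4) u x inj by (simp add: bilipschitz_def)
      show "w (cen p) (cen p) / \<kappa> \<le> w y (h x)"
        using wp[OF pP, of y "h x"] x y by (auto simp: patch_closed_def p)
    qed (use a \<kappa>(2) w_pos[OF pp(2)[OF pP]] in \<open>auto simp: inv_into_into\<close>)
    then show ?thesis by (simp add: vp_def patch_closed_def p rad_def)
  qed
  have vp_pos: "0 < vp p" if "p \<in> P" for p
  proof -
    have "0 < w (cen p) (cen p) / \<kappa>" using w_pos[OF pp(2)[OF that]] \<kappa>(2) by simp
    then have "w (cen p) (cen p) / \<kappa> \<noteq> 0" by linarith
    then show ?thesis unfolding vp_def using \<kappa>(2) pp(3)[OF that]
      by (intro mult_pos_pos zero_less_power powr_gt_zero[THEN iffD2]) auto
  qed
  have vp_le: "vp p \<le> \<kappa> ^ (2 * d + 2) * ((g (cen p) / \<kappa>) * (rad p ^ d / \<kappa> ^ d))" if "p \<in> P" for p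
  proof -
    have wc: "0 < w (cen p) (cen p)" using w_pos pp(2)[OF that] .
    have "\<kappa> powr (real d / s) \<le> \<kappa> powr 1" using s s_pos \<kappa>(2) by (intro powr_mono) auto
    then have "(w (cen p) (cen p) / \<kappa>) powr (- real d / s) \<le> \<kappa> * g (cen p)"
      using wc \<kappa>(2) by (simp add: powr_divide powr_minus_divide divide_right_mono)
    then have "vp p \<le> \<kappa> ^ d * (\<kappa> * g (cen p)) * rad p ^ d"
      unfolding vp_def using \<kappa>(2) pp(3)[OF that] by (intro mult_right_mono mult_left_mono) auto
    also have "\<dots> = \<kappa> ^ (2 * d + 2) * ((g (cen p) / \<kappa>) * (rad p ^ d / \<kappa> ^ d))"
    proof -
      have "\<kappa> ^ (2 * d + 2) = \<kappa> ^ d * \<kappa> ^ d * \<kappa> * \<kappa>" by (simp add: power_add mult_2)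
      then show ?thesis using \<kappa>(2) by (simp add: field_simps)
    qed
    finally show ?thesis .
  qed
  \<comment> \<open>The open patches are disjoint subsets of \<open>A\<close>, and on each of them
    the density is at least \<open>g (cen p) / \<kappa>\<close>; so this is a lower sum for the
    integral \<mu>.\<close>
  have sum_le: "(\<Sum>p\<in>P. (g (cen p) / \<kappa>) * (rad p ^ d / \<kappa> ^ d)) \<le> \<mu>"
  proof -
    have "ennreal (\<Sum>p\<in>P. (g (cen p) / \<kappa>) * (rad p ^ d / \<kappa> ^ d)) = (\<Sum>p\<in>P. ennreal ((g (cen p) / \<kappa>) * (rad p ^ d / \<kappa> ^ d)))"
    proof (rule sum_ennreal[symmetric])
      fix p assume "p \<in> P"
      then have "0 < rad p" by (rule pp(3))
      then show "0 \<le> (g (cen p) / \<kappa>) * (rad p ^ d / \<kappa> ^ d)" using \<kappa>(2) by simp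
    qed
    also have "\<dots> \<le> (\<Sum>p\<in>P. ennreal (g (cen p) / \<kappa>) * emeasure H (patch_open d p))"
    proof (rule sum_mono)
      fix p assume pP: "p \<in> P"
      obtain h a r where p: "p = (h, a, r)" by (cases p)
      have "ennreal (rad p ^ d / \<kappa> ^ d) \<le> emeasure H (patch_open d p)"
        using patch_measure(1)[of \<kappa> h a r] patch[OF pP] \<kappa>(2) by (simp add: p rad_def)
      then show "ennreal ((g (cen p) / \<kappa>) * (rad p ^ d / \<kappa> ^ d)) \<le> ennreal (g (cen p) / \<kappa>) * emeasure H (patch_open d p)"
        using \<kappa>(2) pp(3)[OF pP] by (subst ennreal_mult) (auto intro!: mult_left_mono)
    qed
    also have "\<dots> = (\<Sum>p\<in>P. \<integral>\<^sup>+x. ennreal (g (cen p) / \<kappa>) * indicator (patch_open d p) x \<partial>H)"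
      using patch_open_borel[OF patch] by (intro sum.cong refl nn_integral_cmult_indicator[symmetric]) auto
    also have "\<dots> = (\<integral>\<^sup>+x. (\<Sum>p\<in>P. ennreal (g (cen p) / \<kappa>) * indicator (patch_open d p) x) \<partial>H)"
      using patch_open_borel[OF patch] by (intro nn_integral_sum[symmetric]) (auto intro!: borel_measurable_times_ennreal borel_measurable_indicator)
    also have "\<dots> \<le> (\<integral>\<^sup>+x. ennreal (g x) * indicator A x \<partial>H)"
    proof (rule nn_integral_mono)
      fix x
      show "(\<Sum>p\<in>P. ennreal (g (cen p) / \<kappa>) * indicator (patch_open d p) x) \<le> ennreal (g x) * indicator A x"
      proof (cases "\<exists>p\<in>P. x \<in> patch_open d p")
        case True
        then obtain p where p: "p \<in> P" "x \<in> patch_open d p" by blast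
        have xc: "x \<in> patch_closed d p" using p patch_open_subset[of d p] by auto
        have xA: "x \<in> A" using xc pp(4)[OF p(1)] by auto
        have "(\<Sum>q\<in>P. ennreal (g (cen q) / \<kappa>) * indicator (patch_open d q) x) = (\<Sum>q\<in>{p}. ennreal (g (cen q) / \<kappa>) * indicator (patch_open d q) x)"
          using disj[OF p(1)] p fin by (intro sum.mono_neutral_right) (auto simp: indicator_def)
        also have "\<dots> \<le> ennreal (g x)"
          using p g_nearly_constant(1)[OF \<kappa>(2) pp(2)[OF p(1)] xA] wp[OF p(1) xc xc] by (auto intro!: ennreal_leI)
        finally show ?thesis using xA by simp
      next
        case False
        then have "(\<Sum>p\<in>P. ennreal (g (cen p) / \<kappa>) * indicator (patch_open d p) x) = 0" by (intro sum.neutral) auto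
        then show ?thesis by simp
      qed
    qed
    also have "\<dots> = ennreal \<mu>" using Hsw_A Hsw_eq_\<mu> by simp
    finally show ?thesis using \<mu>_nonneg by simp
  qed
  define R where "R = A - (\<Union>p\<in>P. patch_open d p)"
  \<comment> \<open>The patches are relatively open in \<open>A\<close>, so the remainder is
    compact, as the crude estimate demands.\<close>
  have "compact R"
  proof -
    have "openin (top_of_set A) (\<Union>p\<in>P. patch_open d p)"
      using patch by (intro openin_Union) (auto simp: cube_patch_def patch_open_def)
    then have "closedin (top_of_set A) R" unfolding R_def by (metis closedin_diff closedin_topspace topspace_euclidean_subtopology)
    then show ?thesis using compact_A closedin_compact by blast
  qed
  then have okR: "vol_ok R \<eta>" using C(2)[of R "\<eta> / C"] P(2) C(1) by (simp add: R_def)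
  have okP: "vol_ok (\<Union>p\<in>P. patch_closed d p) ((\<Sum>p\<in>P. vp p) + \<eta>)"
    by (intro vol_ok_finite_UN fin okp vp_pos \<eta>)
  have sp: "0 < (\<Sum>p\<in>P. vp p) + \<eta>" using vp_pos \<eta> by (intro add_nonneg_pos sum_nonneg) (auto intro: less_imp_le)
  have "vol_ok ((\<Union>p\<in>P. patch_closed d p) \<union> R) ((\<Sum>p\<in>P. vp p) + \<eta> + \<eta>)"
    by (rule vol_ok_Un[OF okP okR sp \<eta>])
  then show ?thesis
  proof (rule vol_ok_mono)
    show "A \<subseteq> (\<Union>p\<in>P. patch_closed d p) \<union> R"
    proof
      fix x assume "x \<in> A"
      show "x \<in> (\<Union>p\<in>P. patch_closed d p) \<union> R"
      proof (cases "x \<in> R")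
        case False
        then have "x \<in> (\<Union>p\<in>P. patch_open d p)" using \<open>x \<in> A\<close> unfolding R_def by (simp only: Diff_iff not_not simp_thms)
        then obtain p where p: "p \<in> P" "x \<in> patch_open d p" by (rule UN_E)
        have "x \<in> patch_closed d p" by (rule subsetD[OF patch_open_subset p(2)])
        then show ?thesis by (intro UnI1 UN_I[OF p(1)])
      qed (rule UnI2)
    qed
    show "0 < (\<Sum>p\<in>P. vp p) + \<eta> + \<eta>" using sp \<eta> by simp
    have "(\<Sum>p\<in>P. vp p) \<le> \<kappa> ^ (2 * d + 2) * (\<Sum>p\<in>P. (g (cen p) / \<kappa>) * (rad p ^ d / \<kappa> ^ d))"
      unfolding sum_distrib_left by (intro sum_mono vp_le)
    also have "\<dots> \<le> \<kappa> ^ (2 * d + 2) * \<mu>" using sum_le \<kappa>(2) by (intro mult_left_mono) auto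
    finally show "(\<Sum>p\<in>P. vp p) + \<eta> + \<eta> \<le> v" by (simp add: \<eta>_def)
  qed
qed

end

section \<open>The upper bound\<close>

text \<open>Provides a compact core, concentric with the open cube; seen from its image, the points
  of \<open>A\<close> outside the patch are at a positive distance.\<close>

lemma shrunk_cube:
  assumes d: "d \<le> DIM('a::euclidean_space)" and d1: "1 \<le> d" and a: "(a :: 'a) \<in> coord_plane d" and r: "0 < r" and \<kappa>: "1 < \<kappa>"
  shows "\<exists>a' :: 'a. a' \<in> coord_plane d \<and> closed_cube d a' (r / \<kappa>) \<subseteq> open_cube d a r"
proof -
  define \<rho> where "\<rho> = (r - r / \<kappa>) / 2"
  have \<rho>: "0 < \<rho>" using r \<kappa> by (simp add: \<rho>_def field_simps)
  let ?a' = "a + coord_embed d (\<lambda>_. \<rho>) :: 'a"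
  have plane: "?a' \<in> coord_plane d"
    by (rule subspace_add[OF subspace_coord_plane a coord_embed_in_plane[OF d d1]])
  have "x \<in> open_cube d a r" if x: "x \<in> closed_cube d ?a' (r / \<kappa>)" for x :: 'a
  proof -
    have "a \<bullet> b < x \<bullet> b \<and> x \<bullet> b < a \<bullet> b + r" if b: "b \<in> coord_dirs d" for b
    proof -
      have "?a' \<bullet> b = a \<bullet> b + \<rho>" using b coord_dirs(1)[OF d] by (auto simp: inner_add_left inner_coord_embed[OF d])
      moreover have "?a' \<bullet> b \<le> x \<bullet> b \<and> x \<bullet> b \<le> ?a' \<bullet> b + r / \<kappa>" using x b unfolding closed_cube_def by blast
      moreover have "\<rho> + r / \<kappa> = r - \<rho>" by (simp add: \<rho>_def field_simps)
      ultimately show ?thesis using \<rho> by linarith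
    qed
    moreover have "x \<in> coord_plane d" using x by (simp add: closed_cube_def)
    ultimately show ?thesis by (simp add: open_cube_def)
  qed
  then show ?thesis using plane by (intro exI[of _ ?a']) (simp add: subset_eq)
qed

text \<open>Lets an error \<open>e powr \<gamma>\<close> be absorbed into
  \<open>(x + e) powr \<gamma>\<close> before the power is inverted.\<close>

lemma powr_superadditive:
  fixes x y \<gamma> :: real
  assumes "0 \<le> x" "0 \<le> y" "1 \<le> \<gamma>" shows "x powr \<gamma> + y powr \<gamma> \<le> (x + y) powr \<gamma>"
proof -
  have split: "z powr \<gamma> = z * z powr (\<gamma> - 1)" if "0 \<le> z" for z :: real
    using that by (cases "z = 0") (simp_all add: powr_mult_base)
  have "x powr \<gamma> + y powr \<gamma> = x * x powr (\<gamma> - 1) + y * y powr (\<gamma> - 1)" using split assms by simp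
  also have "\<dots> \<le> x * (x + y) powr (\<gamma> - 1) + y * (x + y) powr (\<gamma> - 1)"
    using assms by (intro add_mono mult_left_mono powr_mono2) auto
  also have "\<dots> = (x + y) powr \<gamma>" using split[of "x + y"] assms by (simp add: algebra_simps)
  finally show ?thesis .
qed

text \<open>Uniform continuity of the logarithm of \<open>f\<close> is already the multiplicative
  statement.\<close>

lemma positive_nearly_constant:
  fixes f :: "'a::metric_space \<Rightarrow> real"
  assumes K: "compact K" and f: "continuous_on K f" "\<And>x. x \<in> K \<Longrightarrow> 0 < f x" and \<kappa>: "1 < \<kappa>"
  shows "\<exists>\<delta>>0. \<forall>x\<in>K. \<forall>y\<in>K. dist x y < \<delta> \<longrightarrow> f x \<le> \<kappa> * f y"
proof -
  have "continuous_on K (\<lambda>x. ln (f x))"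
    by (rule continuous_on_ln[OF f(1)]) (use f(2) in \<open>simp add: less_imp_neq[symmetric]\<close>)
  then have "uniformly_continuous_on K (\<lambda>x. ln (f x))" by (rule compact_uniformly_continuous[OF _ K])
  moreover have "0 < ln \<kappa>" using \<kappa> by simp
  ultimately obtain \<delta> where \<delta>: "0 < \<delta>" "\<And>x y. x \<in> K \<Longrightarrow> y \<in> K \<Longrightarrow> dist y x < \<delta> \<Longrightarrow> dist (ln (f y)) (ln (f x)) < ln \<kappa>"
    unfolding uniformly_continuous_on_def by metis
  have "f x \<le> \<kappa> * f y" if "x \<in> K" "y \<in> K" "dist x y < \<delta>" for x y
  proof -
    have "ln (f x) < ln \<kappa> + ln (f y)" using \<delta>(2)[of y x] that by (simp add: dist_real_def abs_less_iff)
    also have "\<dots> = ln (\<kappa> * f y)" using \<kappa> f(2)[OF that(2)] by (simp add: ln_mult)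
    finally show ?thesis using \<kappa> f(2) that by simp
  qed
  then show ?thesis using \<delta>(1) by blast
qed

lemma disjoint_sum_indicator_le:
  fixes F :: "'i \<Rightarrow> real"
  assumes P: "finite P" "\<And>p q. p \<in> P \<Longrightarrow> q \<in> P \<Longrightarrow> p \<noteq> q \<Longrightarrow> G p \<inter> G q = {}"
    and F: "\<And>p. p \<in> P \<Longrightarrow> x \<in> G p \<Longrightarrow> F p \<le> c" and c: "0 \<le> c"
  shows "(\<Sum>p\<in>P. F p * indicator (G p) x) \<le> c"
proof (cases "\<exists>p\<in>P. x \<in> G p")
  case True
  then obtain p where p: "p \<in> P" "x \<in> G p" by blast
  have "(\<Sum>q\<in>P. F q * indicator (G q) x) = (\<Sum>q\<in>{p}. F q * indicator (G q) x)"
  proof (rule sum.mono_neutral_right[OF P(1)])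
    show "\<forall>q\<in>P - {p}. F q * indicator (G q) x = 0"
    proof
      fix q assume q: "q \<in> P - {p}"
      then have "x \<notin> G q" using P(2)[OF p(1), of q] p(2) by blast
      then show "F q * indicator (G q) x = 0" by simp
    qed
  qed (use p in simp)
  then show ?thesis using F[OF p] p by simp
next
  case False
  then have "(\<Sum>p\<in>P. F p * indicator (G p) x) = 0" by (intro sum.neutral) auto
  then show ?thesis using c by simp
qed

text \<open>Exchanging the sum over sets with the sum over points turns a pointwise bound into a
  bound for the counts.\<close>

lemma sum_size_filter_le:
  fixes F :: "'i \<Rightarrow> real"
  assumes "\<And>x. x \<in># \<omega> \<Longrightarrow> (\<Sum>p\<in>P. F p * indicator (G p) x) \<le> f x"
  shows "(\<Sum>p\<in>P. F p * real (size (filter_mset (\<lambda>x. x \<in> G p) \<omega>))) \<le> (\<Sum>x\<in>#\<omega>. f x)"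
  using assms
proof (induction \<omega>)
  case (add x \<omega>)
  have "(\<Sum>p\<in>P. F p * real (size (filter_mset (\<lambda>x. x \<in> G p) (add_mset x \<omega>)))) =
    (\<Sum>p\<in>P. F p * indicator (G p) x + F p * real (size (filter_mset (\<lambda>x. x \<in> G p) \<omega>)))"
    by (intro sum.cong refl) (simp add: indicator_def algebra_simps)
  also have "\<dots> = (\<Sum>p\<in>P. F p * indicator (G p) x) + (\<Sum>p\<in>P. F p * real (size (filter_mset (\<lambda>x. x \<in> G p) \<omega>)))"
    by (rule sum.distrib)
  also have "\<dots> \<le> f x + (\<Sum>x\<in>#\<omega>. f x)"
    by (intro add_mono add.IH add.prems) simp_all
  finally show ?case by simp
qed simp

lemma sum_mset_affine: "(\<Sum>x\<in>#M. a * f x + C) = a * (\<Sum>x\<in>#M. f x) + C * real (size M)" for a C :: real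
proof (induction M)
  case (add x M)
  have "real (size (add_mset x M)) = 1 + real (size M)" by simp
  then have "C * real (size (add_mset x M)) = C + C * real (size M)" by (simp only: distrib_left mult_1_right)
  then show ?case using add.IH by (simp only: image_mset_add_mset sum_mset.add_mset distrib_left)
qed simp

lemma scaled_le: "x \<le> e \<Longrightarrow> k * x = z \<Longrightarrow> 0 \<le> k \<Longrightarrow> k = k' \<Longrightarrow> z \<le> k' * e" for x e :: real
  using mult_left_mono[of x e k] by simp

context riesz_setting
begin

text \<open>Seen from the image of the core cube \<open>?Q'\<close>, each point outside the patch
  contributes at most \<open>W * \<rho> powr - s\<close>, which gives a \<open>C\<close> independent
  of the configuration. The points inside are pulled back to \<open>?Q\<close> and their potential
  is bounded through projection onto \<open>?Q'\<close>. The exponent \<open>2 * s + 1\<close>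
  collects \<open>s\<close> from the chart, \<open>s\<close> from shrinking the cube and 1 from the
  weight.\<close>

lemma patch_upper:
  assumes p: "cube_patch d A \<kappa> (h, a, r)" and \<kappa>: "1 < \<kappa>" and c: "c \<in> A"
    and wc: "\<forall>x\<in>h ` closed_cube d a r. \<forall>y\<in>h ` closed_cube d a r. w x y \<le> \<kappa> * w c c"
  shows "\<exists>C\<ge>0. \<forall>\<omega> t. set_mset \<omega> \<subseteq> A \<longrightarrow> (\<forall>y\<in>A. ennreal t \<le> riesz_pot w s y \<omega>) \<longrightarrow>
    t \<le> \<kappa> powr (2 * s + 1) * w c c * r powr - s * enn2real (cube_polar TYPE('a) d s (size (filter_mset (\<lambda>x. x \<in> patch_open d (h, a, r)) \<omega>)))
        + C * real (size \<omega>)"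
proof -
  let ?Q = "closed_cube d a r" and ?G = "patch_open d (h, a, r)"
  have a: "a \<in> coord_plane d" "0 < r" "h ` ?Q \<subseteq> A" "bilipschitz \<kappa> ?Q h" "openin (top_of_set A) ?G"
    using p by (simp_all add: cube_patch_def patch_open_def)
  have GQ: "?G \<subseteq> h ` ?Q" using patch_open_subset[of d "(h, a, r)"] by (simp add: patch_closed_def)
  have inj: "inj_on h ?Q" by (rule bilipschitz_inj_on[OF a(4)])
  obtain W where W: "0 < W" "\<And>x y. x \<in> A \<Longrightarrow> y \<in> A \<Longrightarrow> w x y \<le> W" using w_bounded by blast
  obtain a' :: 'a where a': "a' \<in> coord_plane d" "closed_cube d a' (r / \<kappa>) \<subseteq> open_cube d a r"
    using shrunk_cube[OF d d1 a(1,2) \<kappa>] by (elim exE conjE)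
  let ?Q' = "closed_cube d a' (r / \<kappa>)"
  have Q': "?Q' \<subseteq> ?Q" by (rule order_trans[OF a'(2) open_cube_subset_closed])
  have KG: "h ` ?Q' \<subseteq> ?G" unfolding patch_open_def using image_mono[OF a'(2)] by simp
  have cK: "compact (h ` ?Q')"
    by (intro compact_continuous_image compact_closed_cube[OF d d1] bilipschitz_continuous_on[OF bilipschitz_subset[OF a(4) Q']])
  have "closedin (top_of_set A) (A - ?G)" using a(5) by (metis closedin_diff closedin_topspace topspace_euclidean_subtopology)
  then have far: "closed (A - ?G)" using compact_imp_closed[OF compact_A] by (rule closedin_closed_trans)
  have disj: "h ` ?Q' \<inter> (A - ?G) = {}" using KG by blast
  obtain \<rho> where \<rho>': "0 < \<rho> \<and> (\<forall>x\<in>h ` ?Q'. \<forall>y\<in>A - ?G. \<rho> \<le> dist x y)"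
    using separate_compact_closed[OF cK far disj] ..
  note \<rho> = conjunct1[OF \<rho>'] bspec[OF bspec[OF conjunct2[OF \<rho>']]]
  define C where "C = W * \<rho> powr - s"
  have C: "0 \<le> C" using W(1) by (simp add: C_def)
  \<comment> \<open>Factor by which the potential of the points in the patch may exceed the
    unweighted potential of their pulled-back points.\<close>
  define B where "B = \<kappa> * w c c * \<kappa> powr s"
  have B: "0 < B" using \<kappa> w_pos[OF c] by (simp add: B_def)
  have main: "t \<le> \<kappa> powr (2 * s + 1) * w c c * r powr - s * enn2real (cube_polar TYPE('a) d s (size (filter_mset (\<lambda>x. x \<in> ?G) \<omega>)))
        + C * real (size \<omega>)"
    if \<omega>: "set_mset \<omega> \<subseteq> A" and t: "\<And>y. y \<in> A \<Longrightarrow> ennreal t \<le> riesz_pot w s y \<omega>" for \<omega> t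
  proof -
    let ?\<omega>1 = "filter_mset (\<lambda>x. x \<in> ?G) \<omega>" and ?\<omega>2 = "filter_mset (\<lambda>x. x \<notin> ?G) \<omega>"
    define \<psi> where "\<psi> = inv_into ?Q h"
    let ?\<omega>' = "image_mset \<psi> ?\<omega>1"
    have pot: "ennreal ((t - C * real (size \<omega>)) / B) \<le> riesz s u ?\<omega>'" if u: "u \<in> ?Q'" for u
    proof -
      have uQ: "u \<in> ?Q" using u Q' by (rule subsetD[rotated])
      have huA: "h u \<in> A" using uQ a(3) by blast
      have far: "riesz_pot w s (h u) ?\<omega>2 \<le> ennreal (C * real (size \<omega>))"
      proof -
        have "riesz_pot w s (h u) ?\<omega>2 \<le> (\<Sum>x\<in>#?\<omega>2. ennreal C)"
          unfolding riesz_pot_eq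
        proof (rule sum_mset_mono_ennreal)
          fix x assume "x \<in># ?\<omega>2"
          then have x: "x \<in> A - ?G" using \<omega> by auto
          have "ennreal (w (h u) x) \<le> ennreal W" using W(2)[OF huA, of x] x by (intro ennreal_leI) simp
          moreover have "riesz_kernel s (h u) x \<le> ennreal (\<rho> powr - s)"
            using \<rho>(2)[OF imageI[OF u] x] \<rho>(1) s_pos by (intro riesz_kernel_le) auto
          ultimately have "ennreal (w (h u) x) * riesz_kernel s (h u) x \<le> ennreal W * ennreal (\<rho> powr - s)"
            by (intro mult_mono) auto
          also have "\<dots> = ennreal C" using W(1) by (simp add: C_def ennreal_mult)
          finally show "ennreal (w (h u) x) * riesz_kernel s (h u) x \<le> ennreal C" .
        qed
        also have "\<dots> = of_nat (size ?\<omega>2) * ennreal C" by (simp add: image_mset_const_eq sum_mset_constant)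
        also have "\<dots> \<le> of_nat (size \<omega>) * ennreal C"
          by (intro mult_right_mono) (simp_all add: size_filter_mset_lesseq)
        also have "\<dots> = ennreal (C * real (size \<omega>))"
          using C by (simp add: ennreal_mult ennreal_of_nat_eq_real_of_nat mult.commute)
        finally show ?thesis .
      qed
      have near: "riesz_pot w s (h u) ?\<omega>1 \<le> ennreal B * riesz s u ?\<omega>'"
      proof -
        have "riesz_pot w s (h u) ?\<omega>1 \<le> (\<Sum>x\<in>#?\<omega>1. ennreal B * riesz_kernel s u (\<psi> x))"
          unfolding riesz_pot_eq
        proof (rule sum_mset_mono_ennreal)
          fix x assume "x \<in># ?\<omega>1"
          then have x: "x \<in> h ` ?Q" using GQ by auto
          then obtain v where v: "v \<in> ?Q" "x = h v" by blast
          have \<psi>: "\<psi> x = v" using v inj by (simp add: \<psi>_def)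
          have 1: "ennreal (w (h u) x) \<le> ennreal (\<kappa> * w c c)" by (intro ennreal_leI bspec[OF bspec[OF wc]] x imageI uQ)
          have "dist u v \<le> \<kappa> * dist (h u) x" using a(4) uQ v by (simp add: bilipschitz_def)
          then have "ennreal (\<kappa> powr - s) * riesz_kernel s (h u) x \<le> riesz_kernel s u v"
            using \<kappa> s_pos by (intro riesz_kernel_dist_le) auto
          then have "ennreal (\<kappa> powr s) * (ennreal (\<kappa> powr - s) * riesz_kernel s (h u) x) \<le> ennreal (\<kappa> powr s) * riesz_kernel s u v"
            by (intro mult_left_mono) auto
          moreover have "ennreal (\<kappa> powr s) * (ennreal (\<kappa> powr - s) * riesz_kernel s (h u) x) = riesz_kernel s (h u) x"
            using \<kappa> by (simp add: mult.assoc[symmetric] ennreal_mult[symmetric] powr_add[symmetric])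
          ultimately have 2: "riesz_kernel s (h u) x \<le> ennreal (\<kappa> powr s) * riesz_kernel s u v" by simp
          have "ennreal (w (h u) x) * riesz_kernel s (h u) x \<le> ennreal (\<kappa> * w c c) * (ennreal (\<kappa> powr s) * riesz_kernel s u v)"
            by (intro mult_mono 1 2) auto
          also have "\<dots> = ennreal B * riesz_kernel s u (\<psi> x)"
            using \<kappa> w_pos[OF c] by (simp add: B_def \<psi> mult.assoc[symmetric] ennreal_mult)
          finally show "ennreal (w (h u) x) * riesz_kernel s (h u) x \<le> ennreal B * riesz_kernel s u (\<psi> x)" .
        qed
        also have "\<dots> = ennreal B * riesz s u ?\<omega>'"
          by (simp add: riesz_eq sum_mset_distrib_left image_mset.compositionality comp_def)
        finally show ?thesis .
      qed
      have "ennreal t \<le> riesz_pot w s (h u) (?\<omega>1 + ?\<omega>2)" using t[OF huA] by simp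
      also have "\<dots> \<le> ennreal B * riesz s u ?\<omega>' + ennreal (C * real (size \<omega>))"
        unfolding riesz_pot_union by (rule add_mono[OF near far])
      \<comment> \<open>Truncated subtraction agrees with \<open>ennreal\<close> sending negative
        reals to 0, so the sign of the difference is immaterial.\<close>
      finally have "ennreal t - ennreal (C * real (size \<omega>)) \<le> ennreal B * riesz s u ?\<omega>'"
        by (simp add: ennreal_minus_le_iff add.commute)
      then have "ennreal (t - C * real (size \<omega>)) \<le> ennreal B * riesz s u ?\<omega>'" using C by (simp add: ennreal_minus)
      then have "ennreal (1 / B) * ennreal (t - C * real (size \<omega>)) \<le> ennreal (1 / B) * (ennreal B * riesz s u ?\<omega>')"
        by (intro mult_left_mono) auto
      moreover have "ennreal (1 / B) * (ennreal B * riesz s u ?\<omega>') = riesz s u ?\<omega>'"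
        using B by (simp add: mult.assoc[symmetric] ennreal_mult[symmetric])
      moreover have "ennreal (1 / B) * ennreal (t - C * real (size \<omega>)) = ennreal ((t - C * real (size \<omega>)) / B)"
        using B by (simp add: ennreal_mult'[symmetric])
      ultimately show ?thesis by simp
    qed
    let ?cp = "cube_polar TYPE('a) d s (size ?\<omega>1)"
    have "ennreal ((r / \<kappa>) powr s) * ennreal ((t - C * real (size \<omega>)) / B) \<le> ennreal ((r / \<kappa>) powr s) * polar ?Q' (\<lambda>_ _. 1) s ?\<omega>'"
      by (intro mult_left_mono polar_greatest pot) auto
    also have "\<dots> \<le> cube_polar TYPE('a) d s (size ?\<omega>')"
      using a(2) \<kappa> s_pos by (intro polar_closed_cube_le[OF d d1 a'(1)]) auto
    finally have "ennreal ((r / \<kappa>) powr s * ((t - C * real (size \<omega>)) / B)) \<le> ?cp"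
      unfolding ennreal_mult'[OF powr_ge_zero, symmetric] size_image_mset .
    then have le: "(r / \<kappa>) powr s * ((t - C * real (size \<omega>)) / B) \<le> enn2real ?cp" by (rule le_enn2realI[OF _ cp_finite[OF d d1 s]])
    have e1: "B * (\<kappa> powr s * r powr - s) * ((r / \<kappa>) powr s * (z / B)) = z" for z
    proof -
      have "(r / \<kappa>) powr s * (\<kappa> powr s * r powr - s) = 1" using a(2) \<kappa> by (simp add: powr_divide powr_minus)
      moreover have "B * (\<kappa> powr s * r powr - s) * ((r / \<kappa>) powr s * (z / B)) = (B * (z / B)) * ((r / \<kappa>) powr s * (\<kappa> powr s * r powr - s))"
        by (simp only: mult_ac)
      ultimately show ?thesis using B by simp
    qed
    have e2: "B * (\<kappa> powr s * r powr - s) = \<kappa> powr (2 * s + 1) * w c c * r powr - s"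
    proof -
      have "2 * s + 1 = s + s + 1" by simp
      moreover have "\<kappa> powr 1 = \<kappa>" using \<kappa> by simp
      ultimately have "\<kappa> powr (2 * s + 1) = \<kappa> powr s * \<kappa> powr s * \<kappa>" by (simp only: powr_add)
      then show ?thesis by (simp only: B_def mult_ac)
    qed
    have "t - C * real (size \<omega>) \<le> \<kappa> powr (2 * s + 1) * w c c * r powr - s * enn2real ?cp"
    proof (rule scaled_le[OF le e1])
      show "0 \<le> B * (\<kappa> powr s * r powr - s)" using B by simp
    qed (rule e2)
    then show ?thesis by (simp only: diff_le_eq)
  qed
  show ?thesis using C main by (intro exI[of _ C]) simp
qed

text \<open>The upper estimate read backwards: a level \<open>q * tau s d N\<close> can be reached
  only if the patch holds at least the stated fraction of the points. The power
  \<open>d / s = 1 / \<gamma>\<close> inverts the dependence of the cube's polarization on the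
  number of points.\<close>

lemma patch_mass:
  assumes p: "cube_patch d A \<kappa> (h, a, r)" and \<kappa>: "1 < \<kappa>" and c: "c \<in> A"
    and wc: "\<forall>x\<in>h ` closed_cube d a r. \<forall>y\<in>h ` closed_cube d a r. w x y \<le> \<kappa> * w c c" and e: "0 < e"
  shows "\<forall>\<^sub>F N in sequentially. \<forall>\<omega>\<in>configs A N. \<forall>q\<ge>0. (\<forall>y\<in>A. ennreal (q * tau s d N) \<le> riesz_pot w s y \<omega>) \<longrightarrow>
    (q / \<sigma>) powr (real d / s) * (g c * r ^ d / \<kappa> ^ (2 * d + 1)) \<le> real (size (filter_mset (\<lambda>x. x \<in> patch_open d (h, a, r)) \<omega>)) / real N + e"
proof -
  obtain C where C: "0 \<le> C" "\<forall>\<omega> t. set_mset \<omega> \<subseteq> A \<longrightarrow> (\<forall>y\<in>A. ennreal t \<le> riesz_pot w s y \<omega>) \<longrightarrow>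
    t \<le> \<kappa> powr (2 * s + 1) * w c c * r powr - s * enn2real (cube_polar TYPE('a) d s (size (filter_mset (\<lambda>x. x \<in> patch_open d (h, a, r)) \<omega>)))
        + C * real (size \<omega>)"
    using patch_upper[OF p \<kappa> c wc] by (elim exE conjE) (rule that)
  define b where "b = \<kappa> powr (2 * s + 1) * w c c * r powr - s"
  have r: "0 < r" using p by (simp add: cube_patch_def)
  have b: "0 < b" using \<kappa> w_pos[OF c] r by (simp add: b_def)
  \<comment> \<open>Half of \<open>\<sigma> * e powr \<gamma>\<close>, because the far points and
    the uniform cube estimate each cost one \<open>\<epsilon>\<close>; superadditivity turns their
    sum into the additive \<open>e\<close> of the conclusion.\<close>
  define \<epsilon> where "\<epsilon> = \<sigma> * e powr \<gamma> / 2"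
  have \<epsilon>: "0 < \<epsilon>" using \<sigma>_pos e by (simp add: \<epsilon>_def)
  have "(\<lambda>N. C * (real N / tau s d N)) \<longlonglongrightarrow> C * 0" by (intro tendsto_mult tendsto_const tau_superlinear d1 s)
  then have "\<forall>\<^sub>F N in sequentially. C * (real N / tau s d N) < b * \<epsilon>" using b \<epsilon> by (intro order_tendstoD(2)) auto
  then show ?thesis using cube_polar_uniform_upper[OF d d1 s \<sigma>_lim \<epsilon>] eventually_ge_at_top[of 2]
  proof eventually_elim
    case (elim N)
    have \<tau>: "0 < tau s d N" by (rule tau_pos[OF d1 elim(3)])
    show ?case
    proof (intro ballI allI impI)
      fix \<omega> q assume \<omega>: "\<omega> \<in> configs A N" and q: "0 \<le> q" "\<forall>y\<in>A. ennreal (q * tau s d N) \<le> riesz_pot w s y \<omega>"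
      let ?n = "size (filter_mset (\<lambda>x. x \<in> patch_open d (h, a, r)) \<omega>)"
      define x where "x = real ?n / real N"
      have x: "0 \<le> x" by (simp add: x_def)
      have N: "size \<omega> = N" "set_mset \<omega> \<subseteq> A" using \<omega> by (simp_all add: configs_def)
      have nN: "?n \<le> N" using size_filter_mset_lesseq[of _ \<omega>] N(1) by simp
      have "q * tau s d N \<le> b * enn2real (cube_polar TYPE('a) d s ?n) + C * real N"
        using C(2) N q(2) unfolding b_def by blast
      also have "\<dots> \<le> b * ((\<sigma> * x powr \<gamma> + \<epsilon>) * tau s d N) + b * \<epsilon> * tau s d N"
      proof (rule add_mono)
        show "b * enn2real (cube_polar TYPE('a) d s ?n) \<le> b * ((\<sigma> * x powr \<gamma> + \<epsilon>) * tau s d N)"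
          using elim(2) nN b unfolding x_def by (intro mult_left_mono) auto
        show "C * real N \<le> b * \<epsilon> * tau s d N" using elim(1) \<tau> by (simp add: field_simps)
      qed
      also have "\<dots> = (b * \<sigma> * (x powr \<gamma> + e powr \<gamma>)) * tau s d N" by (simp add: \<epsilon>_def algebra_simps)
      finally have "q \<le> b * \<sigma> * (x powr \<gamma> + e powr \<gamma>)" using \<tau> by simp
      also have "\<dots> \<le> b * \<sigma> * (x + e) powr \<gamma>"
        using b \<sigma>_pos x e \<gamma>_ge by (intro mult_left_mono powr_superadditive) auto
      finally have "q / \<sigma> \<le> b * (x + e) powr \<gamma>" using \<sigma>_pos by (simp add: field_simps)
      then have "(q / \<sigma>) powr (real d / s) \<le> (b * (x + e) powr \<gamma>) powr (real d / s)"
        using q \<sigma>_pos s_pos by (intro powr_mono2) auto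
      also have "\<dots> = b powr (real d / s) * (x + e)"
        using b x e s_pos d1 by (simp add: powr_mult powr_powr)
      finally have main: "(q / \<sigma>) powr (real d / s) * b powr (- real d / s) \<le> x + e"
        using b by (simp add: powr_minus field_simps)
      have "g c * r ^ d / \<kappa> ^ (2 * d + 1) \<le> b powr (- real d / s)"
      proof -
        have rr: "r powr (- s * (- real d / s)) = r ^ d" using r s_pos by (simp add: powr_realpow)
        have "b powr (- real d / s) = \<kappa> powr ((2 * s + 1) * (- real d / s)) * g c * r ^ d"
          using \<kappa> w_pos[OF c] r by (simp only: b_def powr_mult rr powr_powr)
        \<comment> \<open>The exponent on the right is \<open>- 2 * d - d / s\<close>, and
          \<open>d / s \<le> 1\<close>.\<close>
        moreover have "1 / \<kappa> ^ (2 * d + 1) \<le> \<kappa> powr ((2 * s + 1) * (- real d / s))"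
        proof -
          have "\<kappa> powr real (2 * d + 1) = \<kappa> ^ (2 * d + 1)" using \<kappa> by (intro powr_realpow) simp
          then have "1 / \<kappa> ^ (2 * d + 1) = \<kappa> powr (- real (2 * d + 1))" by (simp only: powr_minus_divide)
          also have "- real (2 * d + 1) = - (2 * real d + 1)" by simp
          also have "\<kappa> powr (- (2 * real d + 1)) \<le> \<kappa> powr ((2 * s + 1) * (- real d / s))"
          proof (rule powr_mono)
            have "(2 * s + 1) * (- real d / s) = - (2 * real d) - real d / s" using s_pos by (simp add: field_simps)
            moreover have "real d / s \<le> 1" using s s_pos by simp
            ultimately show "- (2 * real d + 1) \<le> (2 * s + 1) * (- real d / s)" by linarith
          qed (use \<kappa> in simp)
          finally show ?thesis .
        qed
        then have "1 / \<kappa> ^ (2 * d + 1) * (g c * r ^ d) \<le> \<kappa> powr ((2 * s + 1) * (- real d / s)) * (g c * r ^ d)"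
          using r by (intro mult_right_mono) auto
        ultimately show ?thesis by (simp add: mult.assoc)
      qed
      then have "(q / \<sigma>) powr (real d / s) * (g c * r ^ d / \<kappa> ^ (2 * d + 1)) \<le> (q / \<sigma>) powr (real d / s) * b powr (- real d / s)"
        by (rule mult_left_mono) simp
      then show "(q / \<sigma>) powr (real d / s) * (g c * r ^ d / \<kappa> ^ (2 * d + 1)) \<le> real ?n / real N + e"
        using main unfolding x_def by (rule order_trans)
    qed
  qed
qed

section \<open>Integration against the weighted measure\<close>

definition I :: "('a \<Rightarrow> real) \<Rightarrow> real" where
  "I f = (LINT x:A|H. g x * f x)"

lemma g_continuous: "continuous_on A g"
  using w_pos by (intro continuous_on_powr w_diag_continuous continuous_on_const) (simp add: less_imp_neq[symmetric])

lemma g_pos: "x \<in> A \<Longrightarrow> 0 < g x"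
  using w_pos[of x] by simp

lemma integrable_g:
  assumes f: "continuous_on A f" shows "integrable H (\<lambda>x. indicator A x *\<^sub>R (g x * f x))"
proof -
  have c: "continuous_on A (\<lambda>x. g x * f x)" by (intro continuous_on_mult g_continuous f)
  have "compact ((\<lambda>x. g x * f x) ` A)" by (rule compact_continuous_image[OF c compact_A])
  then obtain B where B: "\<forall>y\<in>(\<lambda>x. g x * f x) ` A. norm y \<le> B" using compact_imp_bounded bounded_pos by metis
  have m: "(\<lambda>x. indicator A x *\<^sub>R (g x * f x)) \<in> borel_measurable H"
    using borel_measurable_continuous_on_indicator[OF A_borel c]
    by (simp add: measurable_cong_sets[OF sets_hausdorff_measure refl])
  show ?thesis
  proof (rule integrableI_bounded_set[where A = A and B = B])
    show "A \<in> sets H" by (simp add: sets_hausdorff_measure)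
    show "emeasure H A < \<infinity>" using hausdorff_A_finite by simp
    show "AE x in H. x \<in> A \<longrightarrow> norm (indicator A x *\<^sub>R (g x * f x)) \<le> B" using B by (intro AE_I2) auto
    show "AE x in H. x \<notin> A \<longrightarrow> indicator A x *\<^sub>R (g x * f x) = 0" by (intro AE_I2) simp
  qed (rule m)
qed

lemma I_one: "I (\<lambda>_. 1) = \<mu>"
proof -
  have "I (\<lambda>_. 1) = enn2real (\<integral>\<^sup>+x. ennreal (indicator A x *\<^sub>R (g x * 1)) \<partial>H)"
    unfolding I_def set_lebesgue_integral_def
    by (rule integral_eq_nn_integral[OF borel_measurable_integrable[OF integrable_g]]) (auto intro!: AE_I2 simp: indicator_def)
  also have "(\<integral>\<^sup>+x. ennreal (indicator A x *\<^sub>R (g x * 1)) \<partial>H) = Hsw d s w A A"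
    unfolding Hsw_A by (intro nn_integral_cong) (simp add: indicator_def)
  finally show ?thesis by (simp add: \<mu>_def)
qed

lemma I_linear:
  assumes "continuous_on A f" shows "I (\<lambda>x. a * f x + C) = a * I f + C * \<mu>"
proof -
  have e: "(\<lambda>x. indicator A x *\<^sub>R (g x * (a * f x + C))) =
    (\<lambda>x. a * (indicator A x *\<^sub>R (g x * f x)) + C * (indicator A x *\<^sub>R (g x * 1)))"
    by (simp add: fun_eq_iff algebra_simps)
  have "I (\<lambda>x. a * f x + C) = a * I f + C * I (\<lambda>_. 1)"
    unfolding I_def set_lebesgue_integral_def e
    by (subst Bochner_Integration.integral_add) (use integrable_g[OF assms] integrable_g[of "\<lambda>_. 1"] in simp_all)
  then show ?thesis by (simp add: I_one)
qed

text \<open>Each patch holds at least a fraction of the points proportional to its weighted measure;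
  weighting these fractions with lower bounds of \<open>f\<close> and summing gives a lower sum for
  the integral. Positivity of \<open>f\<close> allows the points outside the patches to be dropped.
  Constant \<open>f\<close> will bound the polarization, general \<open>f\<close> will determine the
  limit distribution.\<close>

lemma upper_main:
  assumes f_cont: "continuous_on A f" and f_pos: "\<forall>x\<in>A. 0 < f x" and \<eta>: "0 < \<eta>"
  shows "\<forall>\<^sub>F N in sequentially. \<forall>\<omega>\<in>configs A N. \<forall>q\<ge>0. (\<forall>y\<in>A. ennreal (q * tau s d N) \<le> riesz_pot w s y \<omega>) \<longrightarrow>
    (q / \<sigma>) powr (real d / s) * (I f - \<eta>) - \<eta> \<le> (\<Sum>x\<in>#\<omega>. f x) / real N"
proof -
  note f = f_cont bspec[OF f_pos]
  have "continuous_on A (\<lambda>x. g x * f x)" by (intro continuous_on_mult g_continuous f)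
  from continuous_attains_sup[OF compact_A A_nonempty this]
  obtain x0 where x0: "x0 \<in> A" "\<And>x. x \<in> A \<Longrightarrow> g x * f x \<le> g x0 * f x0" by blast
  define F where "F = g x0 * f x0"
  have F: "0 < F" "\<And>x. x \<in> A \<Longrightarrow> g x * f x \<le> F" using g_pos[OF x0(1)] f(2)[OF x0(1)] x0(2) by (simp_all add: F_def)
  \<comment> \<open>The exponent is \<open>d + 3\<close> from comparing the integral with the sum
    \<open>S\<close> (\<open>d\<close> for the measures of patches, 1 for the density, 2 for
    \<open>f\<close>) plus \<open>2 * d + 1\<close> from the mass estimate.\<close>
  have "((\<lambda>\<kappa>. (I f - \<eta> / 2) / \<kappa> ^ (3 * d + 4)) \<longlongrightarrow> (I f - \<eta> / 2) / 1 ^ (3 * d + 4)) (at_right 1)" by (intro tendsto_intros) simp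
  then have "\<forall>\<^sub>F \<kappa> in at_right 1. I f - \<eta> < (I f - \<eta> / 2) / \<kappa> ^ (3 * d + 4)" using \<eta> by (intro order_tendstoD(1)) auto
  from eventually_happens'[OF _ eventually_conj[OF this eventually_at_right_less]]
  obtain \<kappa> where \<kappa>: "I f - \<eta> < (I f - \<eta> / 2) / \<kappa> ^ (3 * d + 4)" "1 < \<kappa>" by auto
  obtain \<delta>1 where \<delta>1: "0 < \<delta>1" "\<forall>c\<in>A. \<forall>x\<in>A. \<forall>y\<in>A. dist x c < \<delta>1 \<longrightarrow> dist y c < \<delta>1 \<longrightarrow> w c c / \<kappa> \<le> w x y \<and> w x y \<le> \<kappa> * w c c"
    using w_nearly_constant[OF \<kappa>(2)] by blast
  obtain \<delta>2 where \<delta>2: "0 < \<delta>2" "\<forall>x\<in>A. \<forall>y\<in>A. dist x y < \<delta>2 \<longrightarrow> f x \<le> \<kappa> * f y"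
    using positive_nearly_constant[OF compact_A f \<kappa>(2)] by blast
  \<comment> \<open>\<open>F\<close> bounds the integrand, so a remainder of measure at most
    \<open>e\<close> contributes at most \<open>\<eta> / 2\<close> to the integral.\<close>
  define e where "e = \<eta> / (2 * F)"
  have e: "0 < e" "F * e = \<eta> / 2" using \<eta> F by (simp_all add: e_def)
  have "0 < min \<delta>1 \<delta>2" using \<delta>1 \<delta>2 by simp
  from patches_exist[OF d d1 manifold compact_A A_subset null_frontier \<kappa>(2) this e(1)]
  obtain P where P: "patch_family d A \<kappa> (min \<delta>1 \<delta>2) P" "hausdorff_outer d (A - (\<Union>p\<in>P. patch_open d p)) < ennreal e" by blast
  have fin: "finite P" and patch: "\<And>p. p \<in> P \<Longrightarrow> cube_patch d A \<kappa> p"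
    and small: "\<And>p x y. p \<in> P \<Longrightarrow> x \<in> patch_closed d p \<Longrightarrow> y \<in> patch_closed d p \<Longrightarrow> dist x y < min \<delta>1 \<delta>2"
    and disj: "\<And>p q. p \<in> P \<Longrightarrow> q \<in> P \<Longrightarrow> p \<noteq> q \<Longrightarrow> patch_open d p \<inter> patch_open d q = {}"
    using P(1) unfolding patch_family_def by simp_all
  define cen where "cen p = fst p (fst (snd p))" for p :: "('a \<Rightarrow> 'a) \<times> 'a \<times> real"
  define rad where "rad p = snd (snd p)" for p :: "('a \<Rightarrow> 'a) \<times> 'a \<times> real"
  let ?G = "patch_open d :: ('a \<Rightarrow> 'a) \<times> 'a \<times> real \<Rightarrow> 'a set"
  have pp: "cen p \<in> patch_closed d p" "cen p \<in> A" "0 < rad p" "patch_closed d p \<subseteq> A" if "p \<in> P" for p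
  proof -
    obtain h a r where p: "p = (h, a, r)" by (cases p)
    have "a \<in> coord_plane d" "0 < r" "h ` closed_cube d a r \<subseteq> A" using patch[OF that] by (auto simp: cube_patch_def p)
    moreover from this have "a \<in> closed_cube d a r" by (simp add: closed_cube_def)
    ultimately show "cen p \<in> patch_closed d p" "cen p \<in> A" "0 < rad p" "patch_closed d p \<subseteq> A"
      by (auto simp: cen_def rad_def patch_closed_def p)
  qed
  have wp: "w (cen p) (cen p) / \<kappa> \<le> w x y \<and> w x y \<le> \<kappa> * w (cen p) (cen p)"
    if p: "p \<in> P" and x: "x \<in> patch_closed d p" and y: "y \<in> patch_closed d p" for p x y
  proof -
    have "dist x (cen p) < \<delta>1" "dist y (cen p) < \<delta>1" using small[OF p x pp(1)[OF p]] small[OF p y pp(1)[OF p]] by simp_all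
    then show ?thesis using \<delta>1(2) pp(2)[OF p] subsetD[OF pp(4)[OF p] x] subsetD[OF pp(4)[OF p] y] by blast
  qed
  define fp where "fp p = f (cen p) / \<kappa>" for p
  have fp_pos: "0 < fp p" if "p \<in> P" for p using f(2)[OF pp(2)[OF that]] \<kappa>(2) by (simp add: fp_def)
  have fb: "fp p \<le> f x \<and> f x \<le> \<kappa> ^ 2 * fp p" if p: "p \<in> P" and x: "x \<in> patch_closed d p" for p x
  proof -
    have "dist (cen p) x < \<delta>2" "dist x (cen p) < \<delta>2" using small[OF p x pp(1)[OF p]] by (simp_all add: dist_commute)
    then have "f (cen p) \<le> \<kappa> * f x" "f x \<le> \<kappa> * f (cen p)"
      using \<delta>2(2) pp(2)[OF p] subsetD[OF pp(4)[OF p] x] by simp_all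
    then show ?thesis using \<kappa>(2) by (simp add: fp_def field_simps power2_eq_square)
  qed
  define S where "S = (\<Sum>p\<in>P. fp p * (g (cen p) * rad p ^ d))"
  have open_closed: "x \<in> patch_closed d p" if "x \<in> ?G p" for x p by (rule subsetD[OF patch_open_subset that])
  define R where "R = A - (\<Union>p\<in>P. ?G p)"
  have Gb: "?G p \<in> sets H" if "p \<in> P" for p
    using patch_open_borel[OF patch[OF that]] by (simp add: sets_hausdorff_measure)
  have Rb: "R \<in> sets H"
    unfolding R_def using Gb fin by (intro sets.Diff sets.finite_UN) (auto simp: sets_hausdorff_measure)
  have mR: "measure H R \<le> e"
  proof -
    have "emeasure H R \<le> ennreal e" using P(2) Rb
      by (simp add: emeasure_hausdorff_measure[OF d1] sets_hausdorff_measure R_def less_imp_le)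
    then show ?thesis using e(1) unfolding measure_def by (intro enn2real_leI) auto
  qed
  have fR: "emeasure H R < \<infinity>"
    using emeasure_mono[of R A H] hausdorff_A_finite by (auto simp: R_def sets_hausdorff_measure)
  have mG: "measure H (?G p) \<le> \<kappa> ^ d * rad p ^ d" "emeasure H (?G p) < \<infinity>" if p: "p \<in> P" for p
  proof -
    obtain h a r where hp: "p = (h, a, r)" by (cases p)
    have "0 < \<kappa>" using \<kappa>(2) by simp
    then have b: "emeasure H (?G p) \<le> ennreal (\<kappa> ^ d * rad p ^ d)"
      using patch_measure(2)[of \<kappa> h a r] patch[OF p] by (simp add: hp rad_def)
    then show "measure H (?G p) \<le> \<kappa> ^ d * rad p ^ d"
      using pp(3)[OF p] \<kappa>(2) unfolding measure_def by (intro enn2real_leI) auto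
    show "emeasure H (?G p) < \<infinity>" using b by (rule order_le_less_trans) simp
  qed
  let ?B = "\<lambda>p. \<kappa> ^ 3 * (fp p * g (cen p))"
  have B0: "0 \<le> ?B p" if "p \<in> P" for p using fp_pos[OF that] \<kappa>(2) by simp
  \<comment> \<open>Each point of \<open>A\<close> lies in an open patch, where the integrand is at
    most \<open>?B p\<close>, or in the remainder, where it is at most \<open>F\<close>.\<close>
  have "I f \<le> (LINT x|H. (\<Sum>p\<in>P. ?B p * indicator (?G p) x) + F * indicator R x)"
    unfolding I_def set_lebesgue_integral_def
  proof (rule integral_mono)
    show "integrable H (\<lambda>x. indicator A x *\<^sub>R (g x * f x))" by (rule integrable_g[OF f(1)])
    show "integrable H (\<lambda>x. (\<Sum>p\<in>P. ?B p * indicator (?G p) x) + F * indicator R x)"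
      using Gb Rb mG(2) fR by (intro Bochner_Integration.integrable_add Bochner_Integration.integrable_sum integrable_mult_right integrable_real_indicator) auto
    fix x
    have S0: "0 \<le> (\<Sum>p\<in>P. ?B p * indicator (?G p) x)" using B0 by (intro sum_nonneg) simp
    show "indicator A x *\<^sub>R (g x * f x) \<le> (\<Sum>p\<in>P. ?B p * indicator (?G p) x) + F * indicator R x"
    proof (cases "x \<in> A")
      case xA: True
      show ?thesis
      proof (cases "x \<in> R")
        case True
        then show ?thesis using F(2)[OF xA] xA S0 by simp
      next
        case False
        then have "x \<in> (\<Union>p\<in>P. ?G p)" using xA unfolding R_def by (simp only: Diff_iff not_not simp_thms)
        then obtain p where p: "p \<in> P" "x \<in> ?G p" by (rule UN_E)
        note xc = open_closed[OF p(2)]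
        have "g x \<le> \<kappa> * g (cen p)"
          using g_nearly_constant(2)[OF \<kappa>(2) pp(2)[OF p(1)] xA] wp[OF p(1) xc xc] by simp
        then have "g x * f x \<le> (\<kappa> * g (cen p)) * (\<kappa> ^ 2 * fp p)"
          using fb[OF p(1) xc] f(2)[OF xA] \<kappa>(2) by (intro mult_mono) auto
        also have "\<dots> = ?B p * indicator (?G p) x" using p by (simp add: power2_eq_square power3_eq_cube)
        also have "\<dots> \<le> (\<Sum>p\<in>P. ?B p * indicator (?G p) x)"
          using B0 by (intro member_le_sum fin p(1)) auto
        finally show ?thesis using xA False by simp
      qed
    next
      case False
      then show ?thesis using S0 F(1) by simp
    qed
  qed
  also have "\<dots> = (\<Sum>p\<in>P. ?B p * measure H (?G p)) + F * measure H R"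
    using Gb Rb mG(2) fR
    by (subst Bochner_Integration.integral_add) (auto intro!: Bochner_Integration.integrable_sum integrable_mult_right integrable_real_indicator simp: Bochner_Integration.integral_sum)
  also have "\<dots> \<le> (\<Sum>p\<in>P. ?B p * (\<kappa> ^ d * rad p ^ d)) + F * e"
    using B0 mG(1) mR F(1) by (intro add_mono sum_mono mult_left_mono) auto
  also have "(\<Sum>p\<in>P. ?B p * (\<kappa> ^ d * rad p ^ d)) = \<kappa> ^ (d + 3) * S"
    unfolding S_def sum_distrib_left by (intro sum.cong refl) (simp add: power_add mult_ac)
  finally have "I f - \<eta> / 2 \<le> \<kappa> ^ (d + 3) * S" using e(2) by simp
  then have "(I f - \<eta> / 2) / \<kappa> ^ (3 * d + 4) \<le> \<kappa> ^ (d + 3) * S / \<kappa> ^ (3 * d + 4)"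
    using \<kappa>(2) by (intro divide_right_mono) auto
  also have "\<dots> = S / \<kappa> ^ (2 * d + 1)"
  proof -
    have "3 * d + 4 = (d + 3) + (2 * d + 1)" by simp
    then have "\<kappa> ^ (3 * d + 4) = \<kappa> ^ (d + 3) * \<kappa> ^ (2 * d + 1)" by (simp only: power_add)
    then show ?thesis using \<kappa>(2) by simp
  qed
  finally have S: "I f - \<eta> \<le> S / \<kappa> ^ (2 * d + 1)" using \<kappa>(1) by simp
  \<comment> \<open>Scaled so that the errors of all patches, weighted with \<open>fp\<close>, stay
    below \<open>\<eta>\<close>.\<close>
  define \<epsilon> where "\<epsilon> = \<eta> / ((\<Sum>p\<in>P. fp p) + 1)"
  have Sf: "0 \<le> (\<Sum>p\<in>P. fp p)" using fp_pos by (intro sum_nonneg) (auto intro: less_imp_le)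
  have \<epsilon>: "0 < \<epsilon>" "(\<Sum>p\<in>P. fp p) * \<epsilon> \<le> \<eta>" using \<eta> Sf by (simp_all add: \<epsilon>_def field_simps)
  have ev: "\<forall>\<^sub>F N in sequentially. \<forall>\<omega>\<in>configs A N. \<forall>q\<ge>0. (\<forall>y\<in>A. ennreal (q * tau s d N) \<le> riesz_pot w s y \<omega>) \<longrightarrow>
    (q / \<sigma>) powr (real d / s) * (g (cen p) * rad p ^ d / \<kappa> ^ (2 * d + 1)) \<le> real (size (filter_mset (\<lambda>x. x \<in> ?G p) \<omega>)) / real N + \<epsilon>"
    if p: "p \<in> P" for p
  proof -
    obtain h a r where hp: "p = (h, a, r)" by (cases p)
    have "\<forall>x\<in>h ` closed_cube d a r. \<forall>y\<in>h ` closed_cube d a r. w x y \<le> \<kappa> * w (cen p) (cen p)"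
      using wp[OF p] by (simp add: hp patch_closed_def)
    from patch_mass[OF patch[OF p, unfolded hp] \<kappa>(2) pp(2)[OF p] this \<epsilon>(1)] show ?thesis by (simp add: hp rad_def)
  qed
  have "\<forall>\<^sub>F N in sequentially. \<forall>p\<in>P. \<forall>\<omega>\<in>configs A N. \<forall>q\<ge>0. (\<forall>y\<in>A. ennreal (q * tau s d N) \<le> riesz_pot w s y \<omega>) \<longrightarrow>
    (q / \<sigma>) powr (real d / s) * (g (cen p) * rad p ^ d / \<kappa> ^ (2 * d + 1)) \<le> real (size (filter_mset (\<lambda>x. x \<in> ?G p) \<omega>)) / real N + \<epsilon>"
    by (rule eventually_ball_finite[OF fin]) (use ev in blast)
  then show ?thesis
  proof eventually_elim
    case (elim N)
    show ?case
    proof (intro ballI allI impI)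
      fix \<omega> q assume \<omega>: "\<omega> \<in> configs A N" and q: "0 \<le> q" "\<forall>y\<in>A. ennreal (q * tau s d N) \<le> riesz_pot w s y \<omega>"
      let ?n = "\<lambda>p. real (size (filter_mset (\<lambda>x. x \<in> ?G p) \<omega>))" and ?q = "(q / \<sigma>) powr (real d / s)"
      have m: "?q * (g (cen p) * rad p ^ d / \<kappa> ^ (2 * d + 1)) \<le> ?n p / real N + \<epsilon>" if "p \<in> P" for p
        using elim that \<omega> q by blast
      have "?q * (I f - \<eta>) \<le> ?q * (S / \<kappa> ^ (2 * d + 1))" by (intro mult_left_mono S) simp
      also have "\<dots> = (\<Sum>p\<in>P. fp p * (?q * (g (cen p) * rad p ^ d / \<kappa> ^ (2 * d + 1))))"
        unfolding S_def sum_divide_distrib sum_distrib_left by (intro sum.cong refl) (simp add: mult_ac)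
      also have "\<dots> \<le> (\<Sum>p\<in>P. fp p * (?n p / real N + \<epsilon>))"
        using m fp_pos by (intro sum_mono mult_left_mono) (auto intro: less_imp_le)
      also have "\<dots> = (\<Sum>p\<in>P. fp p * ?n p) / real N + (\<Sum>p\<in>P. fp p) * \<epsilon>"
        by (simp add: distrib_left sum.distrib sum_divide_distrib sum_distrib_right)
      also have "\<dots> \<le> (\<Sum>x\<in>#\<omega>. f x) / real N + \<eta>"
      proof (intro add_mono divide_right_mono \<epsilon>(2))
        show "(\<Sum>p\<in>P. fp p * ?n p) \<le> (\<Sum>x\<in>#\<omega>. f x)"
        proof (rule sum_size_filter_le)
          fix x assume "x \<in># \<omega>"
          then have x: "x \<in> A" using \<omega> by (auto simp: configs_def)
          show "(\<Sum>p\<in>P. fp p * indicator (?G p) x) \<le> f x"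
          proof (rule disjoint_sum_indicator_le[OF fin disj])
            fix p assume "p \<in> P" "x \<in> ?G p"
            then show "fp p \<le> f x" using fb[OF _ open_closed] by blast
          qed (use f(2)[OF x] in simp_all)
        qed
      qed simp
      finally show "?q * (I f - \<eta>) - \<eta> \<le> (\<Sum>x\<in>#\<omega>. f x) / real N" by simp
    qed
  qed
qed

section \<open>The limit and the weak-star convergence\<close>

lemma powr_dual: "0 < x \<Longrightarrow> (x powr - \<gamma>) powr (real d / s) = 1 / x"
proof -
  assume x: "0 < x"
  have "- \<gamma> * (real d / s) = - 1" using s_pos d1 by simp
  then show ?thesis unfolding powr_powr using x by (simp only: powr_minus_divide powr_one less_imp_le)
qed

text \<open>For \<open>f\<close> constantly 1 the average over the points is exactly 1, while a
  level \<open>B\<close> above the limit would force it to exceed 1.\<close>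

lemma polar_max_upper:
  assumes \<mu>: "0 < \<mu>" and B: "\<sigma> * \<mu> powr - \<gamma> < B"
  shows "\<forall>\<^sub>F N in sequentially. polar_max A w s N \<le> ennreal (B * tau s d N)"
proof -
  have "0 < \<sigma> * \<mu> powr - \<gamma>" using \<sigma>_pos \<mu> by simp
  then have B0: "0 < B" using B by simp
  define x where "x = (B / \<sigma>) powr (real d / s)"
  have "1 / \<mu> = (\<mu> powr - \<gamma>) powr (real d / s)" by (rule powr_dual[OF \<mu>, symmetric])
  also have "\<dots> < x"
    unfolding x_def using B \<sigma>_pos s_pos d1 by (intro powr_less_mono2) (simp_all add: field_simps)
  finally have x: "1 < x * \<mu>" using \<mu> by (simp add: field_simps)
  have x0: "0 \<le> x" by (simp add: x_def)
  \<comment> \<open>Uses half of the slack in \<open>1 < x * \<mu>\<close>, namely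
    \<open>\<eta> * (x + 1) = (x * \<mu> - 1) / 2\<close>.\<close>
  define \<eta> where "\<eta> = (x * \<mu> - 1) / (2 * (x + 1))"
  have \<eta>: "0 < \<eta>" using x x0 by (simp add: \<eta>_def)
  have "z / (2 * y) * y = z / 2" if "0 < y" for y z :: real using that by simp
  then have "\<eta> * (x + 1) = (x * \<mu> - 1) / 2" unfolding \<eta>_def using x0 by (metis add_nonneg_pos zero_less_one)
  then have big: "1 < x * (\<mu> - \<eta>) - \<eta>" using x by (simp add: algebra_simps)
  have "\<forall>\<^sub>F N in sequentially. \<forall>\<omega>\<in>configs A N. \<forall>q\<ge>0. (\<forall>y\<in>A. ennreal (q * tau s d N) \<le> riesz_pot w s y \<omega>) \<longrightarrow>
    (q / \<sigma>) powr (real d / s) * (\<mu> - \<eta>) - \<eta> \<le> (\<Sum>x\<in>#\<omega>. 1) / real N"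
    using upper_main[OF continuous_on_const _ \<eta>, of 1] unfolding I_one by simp
  then show ?thesis using eventually_ge_at_top[of 1]
  proof eventually_elim
    case (elim N)
    show ?case
    proof (rule ccontr)
      assume "\<not> ?case"
      then have "ennreal (B * tau s d N) < polar_max A w s N" by simp
      from less_polar_maxD[OF this] obtain \<omega> where \<omega>: "\<omega> \<in> configs A N" "\<forall>y\<in>A. ennreal (B * tau s d N) \<le> riesz_pot w s y \<omega>" by blast
      have "x * (\<mu> - \<eta>) - \<eta> \<le> (\<Sum>x\<in>#\<omega>. 1) / real N"
        using elim(1) \<omega> less_imp_le[OF B0] unfolding x_def by blast
      also have "\<dots> = 1" using \<omega>(1) elim(2) by (simp add: configs_def)
      finally show False using big by simp
    qed
  qed
qed

lemma polar_max_lower: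
  assumes "\<mu> < v" "b < \<sigma> * v powr - \<gamma>"
  shows "\<forall>\<^sub>F N in sequentially. ennreal (b * tau s d N) \<le> polar_max A w s N"
  using vol_okD[OF vol_ok_A[OF assms(1)] assms(2)]
proof eventually_elim
  case (elim N)
  then obtain \<omega> where \<omega>: "\<omega> \<in> configs A N" "\<And>y. y \<in> A \<Longrightarrow> ennreal (b * tau s d N) \<le> riesz_pot w s y \<omega>" by blast
  show ?case by (rule order_trans[OF polar_greatest[OF \<omega>(2)] polar_le_max[OF \<omega>(1)]])
qed

lemma polar_max_lower_pos:
  assumes \<mu>: "0 < \<mu>" and b: "b < \<sigma> * \<mu> powr - \<gamma>"
  shows "\<forall>\<^sub>F N in sequentially. ennreal (b * tau s d N) \<le> polar_max A w s N"
proof -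
  have "((\<lambda>v. \<sigma> * v powr - \<gamma>) \<longlongrightarrow> \<sigma> * \<mu> powr - \<gamma>) (at_right \<mu>)" using \<mu> by (intro tendsto_intros) auto
  then have "\<forall>\<^sub>F v in at_right \<mu>. b < \<sigma> * v powr - \<gamma>" using b by (rule order_tendstoD(1))
  from eventually_happens'[OF _ eventually_conj[OF this eventually_at_right_less]]
  obtain v where "b < \<sigma> * v powr - \<gamma>" "\<mu> < v" by auto
  then show ?thesis by (intro polar_max_lower)
qed

text \<open>If \<mu> vanishes, \<open>A\<close> can be served at every positive volume, so every
  level is reached eventually; \<open>?v\<close> is the volume that belongs to the level
  \<open>\<bar>b\<bar> + 1\<close>.\<close>

lemma polar_max_lower_zero:
  assumes \<mu>: "\<mu> = 0" shows "\<forall>\<^sub>F N in sequentially. ennreal (b * tau s d N) \<le> polar_max A w s N"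
proof (rule polar_max_lower)
  let ?v = "((\<bar>b\<bar> + 1) / \<sigma>) powr (- 1 / \<gamma>)"
  have p: "0 < (\<bar>b\<bar> + 1) / \<sigma>" using \<sigma>_pos by simp
  then have "(\<bar>b\<bar> + 1) / \<sigma> \<noteq> 0" by (rule less_imp_neq[symmetric])
  then show "\<mu> < ?v" unfolding \<mu> by (simp only: powr_gt_zero not_False_eq_True)
  have "- 1 / \<gamma> * - \<gamma> = 1" using s_pos d1 by simp
  then have "?v powr - \<gamma> = (\<bar>b\<bar> + 1) / \<sigma>" using p by (simp only: powr_powr powr_one)
  then show "b < \<sigma> * ?v powr - \<gamma>" using \<sigma>_pos by simp
qed

lemma polar_max_limit:
  "(\<lambda>N. polar_max A w s N / ennreal (tau s d N)) \<longlonglongrightarrow> ennreal \<sigma> / ennpow (Hsw d s w A A) \<gamma>"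
proof -
  have ge: "\<forall>\<^sub>F N in sequentially. ennreal b \<le> polar_max A w s N / ennreal (tau s d N)"
    if "\<forall>\<^sub>F N in sequentially. ennreal (b * tau s d N) \<le> polar_max A w s N" for b
    using that eventually_ge_at_top[of 2]
  proof eventually_elim
    case (elim N)
    have \<tau>: "0 < tau s d N" by (rule tau_pos[OF d1 elim(2)])
    have "ennreal b * ennreal (tau s d N) = ennreal (b * tau s d N)" using \<tau> by (simp add: ennreal_mult'')
    then show ?case using elim(1) by (simp add: ennreal_le_divide_iff_mult_le[OF \<tau>])
  qed
  show ?thesis
  proof (cases "\<mu> = 0")
    case True
    \<comment> \<open>A positive \<open>ennreal\<close> divided by 0 is infinite, which is the
      intended limit when the measure vanishes.\<close>
    then have "ennreal \<sigma> / ennpow (Hsw d s w A A) \<gamma> = top"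
      using \<sigma>_pos by (simp add: Hsw_eq_\<mu> ennpow_def ennreal_divide_zero)
    moreover have "(\<lambda>N. polar_max A w s N / ennreal (tau s d N)) \<longlonglongrightarrow> top"
    proof (rule order_tendstoI)
      fix a :: ennreal assume "a < top"
      then obtain r where r: "a = ennreal r" "0 \<le> r" by (cases a) auto
      show "\<forall>\<^sub>F N in sequentially. a < polar_max A w s N / ennreal (tau s d N)"
        using ge[OF polar_max_lower_zero[OF True, of "r + 1"]]
      proof eventually_elim
        case (elim N)
        have "a < ennreal (r + 1)" using r by (simp add: ennreal_less_iff)
        then show ?case using elim by (rule order_less_le_trans)
      qed
    qed simp
    ultimately show ?thesis by simp
  next
    case False
    then have \<mu>: "0 < \<mu>" using \<mu>_nonneg by simp
    define L where "L = \<sigma> * \<mu> powr - \<gamma>"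
    have L: "0 < L" using \<sigma>_pos \<mu> by (simp add: L_def)
    have "ennreal \<sigma> / ennpow (Hsw d s w A A) \<gamma> = ennreal (\<sigma> / \<mu> powr \<gamma>)"
      using \<sigma>_pos \<mu> by (simp add: Hsw_eq_\<mu> ennpow_def divide_ennreal)
    also have "\<sigma> / \<mu> powr \<gamma> = L" by (simp add: L_def powr_minus_divide)
    finally have lim: "ennreal \<sigma> / ennpow (Hsw d s w A A) \<gamma> = ennreal L" .
    show ?thesis unfolding lim
    proof (rule order_tendstoI)
      fix a assume a: "a < ennreal L"
      then obtain r where r: "a = ennreal r" "0 \<le> r" by (cases a) auto
      then have "r < L" using a by (simp add: ennreal_less_iff)
      then obtain b where b: "r < b" "b < L" using dense by blast
      show "\<forall>\<^sub>F N in sequentially. a < polar_max A w s N / ennreal (tau s d N)"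
        using ge[OF polar_max_lower_pos[OF \<mu> b(2)[unfolded L_def]]]
      proof eventually_elim
        case (elim N)
        have "a < ennreal b" using r b by (simp add: ennreal_less_iff)
        then show ?case using elim by (rule order_less_le_trans)
      qed
    next
      fix a assume a: "ennreal L < a"
      then obtain a' where a': "ennreal L < a'" "a' < a" using dense by blast
      then obtain B where B: "a' = ennreal B" "0 \<le> B" by (cases a') auto
      then have "L < B" using a' L by (simp add: ennreal_less_iff)
      from polar_max_upper[OF \<mu> this[unfolded L_def]]
      show "\<forall>\<^sub>F N in sequentially. polar_max A w s N / ennreal (tau s d N) < a"
        using eventually_ge_at_top[of 2]
      proof eventually_elim
        case (elim N)
        have \<tau>: "0 < tau s d N" by (rule tau_pos[OF d1 elim(2)])
        have "polar_max A w s N / ennreal (tau s d N) \<le> ennreal (B * tau s d N) / ennreal (tau s d N)"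
          by (rule divide_right_mono_ennreal[OF elim(1)])
        also have "\<dots> = a'" using \<tau> B by (simp add: divide_ennreal)
        finally show ?case using a'(2) by (rule order_le_less_trans)
      qed
    qed
  qed
qed

section \<open>Asymptotically optimal sequences\<close>

context
  fixes \<omega> :: "nat \<Rightarrow> 'a multiset"
  assumes opt: "asympt_optimal A w s \<omega>" and \<mu>_pos: "0 < \<mu>"
begin

lemma optimal_configs: "1 \<le> N \<Longrightarrow> \<omega> N \<in> configs A N"
  using opt by (simp add: asympt_optimal_def)

text \<open>An intermediate level \<open>b'\<close> leaves the factor \<open>b / b' < 1\<close>,
  which the quotient in the definition of asymptotic optimality eventually exceeds. The upper bound
  for \<open>polar_max\<close> makes it finite, so that the quotient can be cleared.\<close>

lemma optimal_polar:
  assumes b: "0 \<le> b" "b < \<sigma> * \<mu> powr - \<gamma>"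
  shows "\<forall>\<^sub>F N in sequentially. \<forall>y\<in>A. ennreal (b * tau s d N) \<le> riesz_pot w s y (\<omega> N)"
proof -
  obtain b' where b': "b < b'" "b' < \<sigma> * \<mu> powr - \<gamma>" using dense[OF b(2)] by blast
  have "(\<lambda>N. polar A w s (\<omega> N) / polar_max A w s N) \<longlonglongrightarrow> 1" using opt by (simp add: asympt_optimal_def)
  moreover have "ennreal (b / b') < 1" using b b' by (subst ennreal_1[symmetric], subst ennreal_less_iff) simp_all
  ultimately have ratio: "\<forall>\<^sub>F N in sequentially. ennreal (b / b') < polar A w s (\<omega> N) / polar_max A w s N"
    by (rule order_tendstoD(1))
  have "\<sigma> * \<mu> powr - \<gamma> < \<sigma> * \<mu> powr - \<gamma> + 1" by simp
  from ratio polar_max_lower_pos[OF \<mu>_pos b'(2)] polar_max_upper[OF \<mu>_pos this] eventually_ge_at_top[of 2]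
  show ?thesis
  proof eventually_elim
    case (elim N)
    have \<tau>: "0 < tau s d N" by (rule tau_pos[OF d1 elim(4)])
    obtain c where c: "polar_max A w s N = ennreal c" "0 \<le> c"
      using elim(3) by (cases "polar_max A w s N") (auto simp: top_unique)
    have "0 < b' * tau s d N" using b b' \<tau> by simp
    moreover have bc: "b' * tau s d N \<le> c" using elim(2) c by simp
    ultimately have c0: "0 < c" by linarith
    have "b / b' * (b' * tau s d N) \<le> b / b' * c" using b b' by (intro mult_left_mono bc) simp
    then have "ennreal (b * tau s d N) \<le> ennreal (b / b' * c)" using b b' by (intro ennreal_leI) simp
    also have "\<dots> = ennreal (b / b') * ennreal c" using c0 by (rule ennreal_mult''[OF less_imp_le])
    also have "\<dots> \<le> polar A w s (\<omega> N)"
      using elim(1) unfolding c(1) by (intro ennreal_le_divide_iff_mult_le[OF c0, THEN iffD1]) simp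
    finally have "ennreal (b * tau s d N) \<le> polar A w s (\<omega> N)" .
    then show ?case using polar_le[of _ A w s "\<omega> N"] order_trans by blast
  qed
qed

text \<open>At the limiting level \<open>\<sigma> * \<mu> powr - \<gamma>\<close> the factor of the
  integral would be exactly \<open>1 / \<mu>\<close>; one small \<eta> controls both the distance to
  this level and the errors of the estimate.\<close>

lemma optimal_average_lower:
  assumes f: "continuous_on A f" "\<forall>x\<in>A. 0 < f x" and a: "a < I f / \<mu>"
  shows "\<forall>\<^sub>F N in sequentially. a < (\<Sum>x\<in>#\<omega> N. f x) / real N"
proof -
  let ?\<phi> = "\<lambda>\<eta>. (\<mu> powr - \<gamma> * (1 - \<eta>)) powr (real d / s) * (I f - \<eta>) - \<eta>"
  have "(?\<phi> \<longlongrightarrow> ?\<phi> 0) (at_right 0)" using \<mu>_pos by (intro tendsto_intros) auto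
  moreover have "?\<phi> 0 = I f / \<mu>" using powr_dual[OF \<mu>_pos] by simp
  ultimately have "\<forall>\<^sub>F \<eta> in at_right 0. a < ?\<phi> \<eta>" using a by (intro order_tendstoD(1)) auto
  moreover have "\<forall>\<^sub>F \<eta> :: real in at_right 0. 0 < \<eta> \<and> \<eta> < 1" by (rule eventually_at_rightI[of 0 1]) auto
  ultimately have "\<forall>\<^sub>F \<eta> in at_right 0. a < ?\<phi> \<eta> \<and> 0 < \<eta> \<and> \<eta> < 1" by (rule eventually_conj)
  from eventually_happens'[OF _ this] obtain \<eta> where \<eta>: "a < ?\<phi> \<eta>" "0 < \<eta>" "\<eta> < 1" by auto
  define b where "b = \<sigma> * (\<mu> powr - \<gamma> * (1 - \<eta>))"
  have b: "0 \<le> b" "b < \<sigma> * \<mu> powr - \<gamma>" using \<eta> \<sigma>_pos \<mu>_pos by (simp_all add: b_def)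
  from optimal_polar[OF b] upper_main[OF f \<eta>(2)] eventually_ge_at_top[of 1]
  show ?thesis
  proof eventually_elim
    case (elim N)
    have "b / \<sigma> = \<mu> powr - \<gamma> * (1 - \<eta>)" using \<sigma>_pos by (simp add: b_def)
    moreover have "(b / \<sigma>) powr (real d / s) * (I f - \<eta>) - \<eta> \<le> (\<Sum>x\<in>#\<omega> N. f x) / real N"
      using elim(1,2) optimal_configs[OF elim(3)] b(1) by blast
    ultimately have "?\<phi> \<eta> \<le> (\<Sum>x\<in>#\<omega> N. f x) / real N" by (simp only:)
    with \<eta>(1) show ?case by (rule order_less_le_trans)
  qed
qed

text \<open>The lower bound for \<open>f + C\<close> and for \<open>- f + C\<close>, both positive
  on \<open>A\<close>, gives the two halves of the limit; adding the constant shifts both sides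
  equally because \<open>I (\<lambda>_. 1) = \<mu>\<close>.\<close>

lemma optimal_average_limit:
  assumes f: "continuous_on A f" shows "(\<lambda>N. (\<Sum>x\<in>#\<omega> N. f x) / real N) \<longlonglongrightarrow> I f / \<mu>"
proof -
  have "compact (f ` A)" by (rule compact_continuous_image[OF f compact_A])
  then obtain B where B: "\<forall>y\<in>f ` A. norm y \<le> B" using compact_imp_bounded bounded_pos by metis
  define C where "C = B + 1"
  have C: "\<bar>f x\<bar> < C" if "x \<in> A" for x using B that by (force simp: C_def)
  have av: "\<forall>\<^sub>F N in sequentially. e < c * ((\<Sum>x\<in>#\<omega> N. f x) / real N)" if c: "\<bar>c\<bar> = 1" "e < c * (I f / \<mu>)" for c e
  proof -
    have pos: "\<forall>x\<in>A. 0 < c * f x + C"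
    proof
      fix x assume "x \<in> A"
      have "\<bar>c * f x\<bar> < C" using C[OF \<open>x \<in> A\<close>] c(1) by (simp add: abs_mult)
      then show "0 < c * f x + C" by linarith
    qed
    have cont: "continuous_on A (\<lambda>x. c * f x + C)" by (intro continuous_intros f)
    have "e + C < I (\<lambda>x. c * f x + C) / \<mu>" using c(2) \<mu>_pos by (simp add: I_linear[OF f] add_divide_distrib)
    from optimal_average_lower[OF cont pos this] eventually_ge_at_top[of 1]
    show ?thesis
    proof eventually_elim
      case (elim N)
      have "size (\<omega> N) = N" using optimal_configs[OF elim(2)] by (simp add: configs_def)
      then have "(\<Sum>x\<in>#\<omega> N. c * f x + C) / real N = c * ((\<Sum>x\<in>#\<omega> N. f x) / real N) + C"
        using elim(2) by (simp add: sum_mset_affine add_divide_distrib)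
      then show ?case using elim(1) by simp
    qed
  qed
  show ?thesis
  proof (rule order_tendstoI)
    fix e assume "e < I f / \<mu>"
    then show "\<forall>\<^sub>F N in sequentially. e < (\<Sum>x\<in>#\<omega> N. f x) / real N" using av[of 1 e] by simp
  next
    fix e assume "I f / \<mu> < e"
    then show "\<forall>\<^sub>F N in sequentially. (\<Sum>x\<in>#\<omega> N. f x) / real N < e" using av[of "-1" "-e"] by simp
  qed
qed

end

lemma \<mu>_pos_if_emeasure_pos:
  assumes "0 < emeasure H A" shows "0 < \<mu>"
proof -
  obtain x0 where x0: "x0 \<in> A" "\<And>x. x \<in> A \<Longrightarrow> g x0 \<le> g x"
    using continuous_attains_inf[OF compact_A A_nonempty g_continuous] by blast
  have "0 < ennreal (g x0) * emeasure H A" using assms g_pos[OF x0(1)] by (simp add: ennreal_zero_less_mult_iff)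
  also have "\<dots> = (\<integral>\<^sup>+x. ennreal (g x0) * indicator A x \<partial>H)"
    by (rule nn_integral_cmult_indicator[symmetric]) (simp add: sets_hausdorff_measure)
  also have "\<dots> \<le> ennreal \<mu>"
    unfolding Hsw_eq_\<mu>[symmetric] Hsw_A using x0(2) by (intro nn_integral_mono) (auto simp: indicator_def intro!: ennreal_leI)
  finally show ?thesis by simp
qed

end

text \<open>Weak-star convergence is tested on the functions continuous on the compact
  \<open>A\<close>, which carries all the points and the limit measure; the average of
  \<open>f\<close> over \<open>\<omega> N\<close> is the integral against the normalized counting
  measure.\<close>

theorem theorem2:
  fixes A M :: "'a::euclidean_space set" and w :: "'a \<Rightarrow> 'a \<Rightarrow> real" and d :: nat
  assumes "1 \<le> d" and "d \<le> DIM('a)"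
    and "C1_submanifold d M" and "A \<subseteq> M" and "compact A" and "A \<noteq> {}"
    and "emeasure (hausdorff_measure d) ((top_of_set M) frontier_of A) = 0"
    and "continuous_on (A \<times> A) (\<lambda>(x, y). w x y)"
    and "\<forall>x\<in>A. \<forall>y\<in>A. 0 \<le> w x y" and "\<forall>x\<in>A. 0 < w x x"
  shows "(\<forall>s. real d \<le> s \<longrightarrow>
            ((\<lambda>N. polar_max A w s N / ennreal (tau s d N)) \<longlonglongrightarrow>
              sigma_sd s d TYPE('a) / ennpow (Hsw d s w A A) (s / real d)))
       \<and> (0 < emeasure (hausdorff_measure d) A \<longrightarrow>
          (\<forall>s \<omega>. real d \<le> s \<longrightarrow> asympt_optimal A w s \<omega> \<longrightarrow>
             (\<forall>f :: 'a \<Rightarrow> real. continuous_on A f \<longrightarrow>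
                ((\<lambda>N. (\<Sum>x\<in>#\<omega> N. f x) / real N) \<longlonglongrightarrow>
                  (LINT x:A|hausdorff_measure d. w x x powr (- real d / s) * f x)
                    / enn2real (Hsw d s w A A)))))"
proof -
  \<comment> \<open>The hypothesis on the frontier is stated with \<open>emeasure\<close>, which is
    0 on every non-measurable set; the frontier has to be Borel before its outer measure is known to
    vanish.\<close>
  have "A \<inter> M = A" using assms(4) by (rule inf_absorb1)
  then have "(top_of_set M) frontier_of A = A \<inter> closure (M - A)"
    using assms(4) compact_imp_closed[OF assms(5)]
    by (auto simp: frontier_of_closures closure_of_subtopology Int_absorb1 Int_Diff inf_commute)
  then have "(top_of_set M) frontier_of A \<in> sets borel"
    using borel_compact[OF assms(5)] by simp
  then have frontier: "hausdorff_outer d ((top_of_set M) frontier_of A) = 0"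
    using assms(7) by (simp add: emeasure_hausdorff_measure[OF assms(1)])
  have setting: "\<exists>\<sigma>. sigma_sd s d TYPE('a) = ennreal \<sigma> \<and> riesz_setting d M A w s \<sigma>" if s: "real d \<le> s" for s
  proof -
    obtain \<sigma> where \<sigma>: "0 < \<sigma>" "sigma_sd s d TYPE('a) = ennreal \<sigma>"
      "(\<lambda>n. enn2real (cube_polar TYPE('a) d s n) / tau s d n) \<longlonglongrightarrow> \<sigma>"
      by (rule cube_polar_asymptotics[OF assms(2,1) s])
    have "riesz_setting d M A w s \<sigma>"
      using assms(1-6,8-10) frontier s \<sigma>(1,3) by (intro riesz_setting.intro) simp_all
    then show ?thesis using \<sigma>(2) by (intro exI[of _ \<sigma>] conjI)
  qed
  show ?thesis
  proof (intro conjI allI impI)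
    fix s assume "real d \<le> s"
    from setting[OF this] obtain \<sigma> where \<sigma>: "sigma_sd s d TYPE('a) = ennreal \<sigma>" and "riesz_setting d M A w s \<sigma>" by (elim exE conjE)
    then interpret riesz_setting d M A w s \<sigma> by simp
    show "(\<lambda>N. polar_max A w s N / ennreal (tau s d N)) \<longlonglongrightarrow> sigma_sd s d TYPE('a) / ennpow (Hsw d s w A A) (s / real d)"
      unfolding \<sigma> by (rule polar_max_limit)
  next
    fix s \<omega> and f :: "'a \<Rightarrow> real"
    assume A: "0 < emeasure (hausdorff_measure d) A" and s: "real d \<le> s" and opt: "asympt_optimal A w s \<omega>" and f: "continuous_on A f"
    from setting[OF s] obtain \<sigma> where "riesz_setting d M A w s \<sigma>" by (elim exE conjE)
    then interpret riesz_setting d M A w s \<sigma> .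
    show "(\<lambda>N. (\<Sum>x\<in>#\<omega> N. f x) / real N) \<longlonglongrightarrow>
      (LINT x:A|hausdorff_measure d. w x x powr (- real d / s) * f x) / enn2real (Hsw d s w A A)"
      using optimal_average_limit[OF opt \<mu>_pos_if_emeasure_pos[OF A] f] unfolding I_def \<mu>_def .
  qed
qed

end
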